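(* Let $\mathfrak S=\Sigma_{0,m}$ have genus $0$ and negative Euler characteristic. Assume $\vec w\in(\mathbb C\setminus\{2,-2\})^m$ and $\tau\in\mathcal X^{\vec w}(\mathfrak S)$ is the character of an irreducible representation. Then $\tau$ is a smooth point of $\mathcal X^{\vec w}(\mathfrak S)$.
   Context: $\Sigma_{0,m}$ is the 2-sphere with $m$ punctures $v_1,\dots,v_m$; $\mathfrak d_i$ is a small loop around $v_i$. $\mathcal X(\mathfrak S)=\mathrm{MaxSpec}\big(\mathbb C[\mathrm{Hom}(\pi_1(\mathfrak S),SL_2(\mathbb C))]^{SL_2(\mathbb C)}\big)$ is the $SL_2(\mathbb C)$-character variety, with points the characters $[\rho]$ of representations $\rho:\pi_1(\mathfrak S)\to SL_2(\mathbb C)$. For $\vec w=(w_1,\dots,w_m)\in\mathbb C^m$, the sliced character variety is $\mathcal X^{\vec w}(\mathfrak S)=\{[\rho]\in\mathcal X(\mathfrak S)\mid\mathrm{tr}(\rho(\mathfrak d_i))=w_i,\ i=1,\dots,m\}$, an affine variety. *)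

theory Defs
  imports
    "HOL-Analysis.Analysis"
    "HOL-Library.Extended_Nat"
    "HOL-Algebra.Embedded_Algebras"
    "HOL-Algebra.Generated_Rings"
    "HOL-Algebra.Ideal_Product"
    "HOL-Algebra.QuotRing"
begin

section \<open>The fundamental group\<close>

definition loops_at :: "'a::topological_space set \<Rightarrow> 'a \<Rightarrow> (real \<Rightarrow> 'a) set" where
  "loops_at S x = {p. path p \<and> path_image p \<subseteq> S \<and> pathstart p = x \<and> pathfinish p = x}"

definition path_class :: "'a::topological_space set \<Rightarrow> (real \<Rightarrow> 'a) \<Rightarrow> (real \<Rightarrow> 'a) set" where
  "path_class S p = {q. homotopic_paths S p q}"

text \<open>In the product, all the classes in the union coincide (for \<open>x \<in> S\<close> and loop classes \<open>P\<close>, \<open>Q\<close>).\<close>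

definition fundamental_group ::
    "'a::real_normed_vector set \<Rightarrow> 'a \<Rightarrow> (real \<Rightarrow> 'a) set monoid" where
  "fundamental_group S x =
    \<lparr>carrier = path_class S ` loops_at S x,
     mult = (\<lambda>P Q. \<Union>p\<in>P. \<Union>q\<in>Q. path_class S (p +++ q)),
     one = path_class S (linepath x x)\<rparr>"


section \<open>Punctured spheres\<close>

definition euler_characteristic :: "nat \<Rightarrow> nat \<Rightarrow> int" where
  "euler_characteristic genus punctures = 2 - 2 * int genus - int punctures"

definition punctured_sphere :: "nat \<Rightarrow> (nat \<Rightarrow> real^3) \<Rightarrow> (real^3) set" where
  "punctured_sphere m v = sphere 0 1 - v ` {..<m}"

text \<open>
  A small loop around \<open>v i\<close> is a parametrised round circle of angular radius \<open>\<theta>\<close> about \<open>v i\<close>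
  such that the closed spherical cap it bounds contains no other puncture. Both
  orientations are admitted: the orientation does not matter for the sliced character variety,
  because a matrix in \<open>SL\<^sub>2\<close> and its inverse have the same trace.
\<close>

definition small_loop :: "nat \<Rightarrow> (nat \<Rightarrow> real^3) \<Rightarrow> nat \<Rightarrow> (real \<Rightarrow> real^3) \<Rightarrow> bool" where
  "small_loop m v i \<delta> \<longleftrightarrow>
    (\<exists>a b \<theta>. norm a = 1 \<and> norm b = 1 \<and> a \<bullet> b = 0 \<and> a \<bullet> v i = 0 \<and> b \<bullet> v i = 0 \<and>
       0 < \<theta> \<and> \<theta> < pi \<and> (\<forall>j<m. j \<noteq> i \<longrightarrow> v j \<bullet> v i < cos \<theta>) \<and>
       \<delta> = (\<lambda>t. cos \<theta> *\<^sub>R v i + sin \<theta> *\<^sub>R (cos (2 * pi * t) *\<^sub>R a + sin (2 * pi * t) *\<^sub>R b)))"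

text \<open>
  The free loop around \<open>v i\<close> determines an element of the fundamental group up to conjugation
  and inversion; this is the set of all these elements.
\<close>

definition peripheral :: "nat \<Rightarrow> (nat \<Rightarrow> real^3) \<Rightarrow> real^3 \<Rightarrow> nat \<Rightarrow> (real \<Rightarrow> real^3) set set" where
  "peripheral m v x i =
    {path_class (punctured_sphere m v) p | p \<delta>.
       p \<in> loops_at (punctured_sphere m v) x \<and> small_loop m v i \<delta> \<and>
       homotopic_loops (punctured_sphere m v) p \<delta>}"


section \<open>Representations and the character variety\<close>

definition SL2 :: "(complex^2^2) monoid" where
  "SL2 = \<lparr>carrier = {A. det A = 1}, mult = (**), one = mat 1\<rparr>"

definition rep_space :: "'g monoid \<Rightarrow> ('g \<Rightarrow> complex^2^2) set" where
  "rep_space G = hom G SL2 \<inter> extensional (carrier G)"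

definition irreducible_rep :: "'g monoid \<Rightarrow> ('g \<Rightarrow> complex^2^2) \<Rightarrow> bool" where
  "irreducible_rep G \<rho> \<longleftrightarrow>
    (\<forall>W. vec.subspace W \<and> (\<forall>g\<in>carrier G. \<forall>x\<in>W. \<rho> g *v x \<in> W) \<longrightarrow> W = {0} \<or> W = UNIV)"

definition conjugate_rep ::
    "'g monoid \<Rightarrow> complex^2^2 \<Rightarrow> ('g \<Rightarrow> complex^2^2) \<Rightarrow> ('g \<Rightarrow> complex^2^2)" where
  "conjugate_rep G P \<rho> = (\<lambda>g\<in>carrier G. P ** \<rho> g ** matrix_inv P)"

definition function_ring :: "'x set \<Rightarrow> ('x \<Rightarrow> complex) ring" where
  "function_ring X =
    \<lparr>carrier = X \<rightarrow>\<^sub>E UNIV,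
     mult = (\<lambda>f g. \<lambda>x\<in>X. f x * g x),
     one = (\<lambda>x\<in>X. 1),
     zero = (\<lambda>x\<in>X. 0),
     add = (\<lambda>f g. \<lambda>x\<in>X. f x + g x)\<rparr>"

definition constant_functions :: "'x set \<Rightarrow> ('x \<Rightarrow> complex) set" where
  "constant_functions X = range (\<lambda>c. \<lambda>x\<in>X. c)"

text \<open>
  The regular functions on \<open>Hom(G, SL\<^sub>2)\<close> form the \<open>\<complex>\<close>-algebra of functions generated by the matrix
  entries of all \<open>\<rho> g\<close>. If \<open>G\<close> is generated by \<open>g\<^sub>1, \<dots>, g\<^sub>n\<close>, this is the coordinate ring of
  the closed subset \<open>Hom(G, SL\<^sub>2) \<subseteq> SL\<^sub>2\<^sup>n\<close>.
\<close>

definition regular_functions :: "'g monoid \<Rightarrow> (('g \<Rightarrow> complex^2^2) \<Rightarrow> complex) set" where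
  "regular_functions G =
    generate_ring (function_ring (rep_space G))
      (constant_functions (rep_space G) \<union>
       {(\<lambda>\<rho>\<in>rep_space G. \<rho> g $ i $ j) | g i j. g \<in> carrier G})"

definition invariant_ring :: "'g monoid \<Rightarrow> (('g \<Rightarrow> complex^2^2) \<Rightarrow> complex) ring" where
  "invariant_ring G =
    (function_ring (rep_space G))
      \<lparr>carrier := {f \<in> regular_functions G.
         \<forall>P\<in>carrier SL2. \<forall>\<rho>\<in>rep_space G. f (conjugate_rep G P \<rho>) = f \<rho>}\<rparr>"

definition max_spec :: "('a, 'b) ring_scheme \<Rightarrow> 'a set set" where
  "max_spec R = {I. maximalideal I R}"

definition character_variety :: "'g monoid \<Rightarrow> (('g \<Rightarrow> complex^2^2) \<Rightarrow> complex) set set" where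
  "character_variety G = max_spec (invariant_ring G)"

text \<open>The character \<open>[\<rho>]\<close> as a point of the maximal spectrum.\<close>

definition character ::
    "'g monoid \<Rightarrow> ('g \<Rightarrow> complex^2^2) \<Rightarrow> (('g \<Rightarrow> complex^2^2) \<Rightarrow> complex) set" where
  "character G \<rho> = {f \<in> carrier (invariant_ring G). f \<rho> = 0}"

definition sliced_character_variety ::
    "nat \<Rightarrow> (nat \<Rightarrow> real^3) \<Rightarrow> real^3 \<Rightarrow> (nat \<Rightarrow> complex) \<Rightarrow>
     (((real \<Rightarrow> real^3) set \<Rightarrow> complex^2^2) \<Rightarrow> complex) set set" where
  "sliced_character_variety m v x w =
    (let G = fundamental_group (punctured_sphere m v) x in
     {\<tau> \<in> character_variety G.
        \<exists>\<rho>\<in>rep_space G. \<tau> = character G \<rho> \<and>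
          (\<forall>i<m. \<forall>d\<in>peripheral m v x i. trace (\<rho> d) = w i)})"


section \<open>Smooth points of affine varieties\<close>

text \<open>
  An affine variety is given by a closed set \<open>Y\<close> of points of the maximal spectrum of a commutative
  ring \<open>R\<close> containing the ground field \<open>K\<close>; it carries its reduced structure.
\<close>

definition vanishing_ideal :: "('a, 'b) ring_scheme \<Rightarrow> 'a set set \<Rightarrow> 'a set" where
  "vanishing_ideal R Y = {f \<in> carrier R. \<forall>I\<in>Y. f \<in> I}"

definition coordinate_ring :: "('a, 'b) ring_scheme \<Rightarrow> 'a set set \<Rightarrow> 'a set ring" where
  "coordinate_ring R Y = R Quot vanishing_ideal R Y"

text \<open>
  The dimension of the variety at the point \<open>M\<close>: chains of prime ideals of \<open>A\<close> contained in \<open>M\<close> are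
  chains of irreducible closed subsets through the point, and also chains of prime ideals of the
  local ring at the point.
\<close>

definition local_dimension :: "('a, 'b) ring_scheme \<Rightarrow> 'a set \<Rightarrow> enat" where
  "local_dimension A M =
    (SUP Ps \<in> {Ps. Ps \<noteq> [] \<and> sorted_wrt (\<subset>) Ps \<and> (\<forall>P\<in>set Ps. primeideal P A \<and> P \<subseteq> M)}.
       enat (length Ps - 1))"

text \<open>
  The Zariski cotangent space \<open>M/M\<^sup>2\<close> at \<open>M\<close> has dimension \<open>n\<close> over \<open>K\<close>, both being regarded as
  subsets of the ring \<open>A/M\<^sup>2\<close>.
\<close>

definition has_cotangent_dimension :: "('a, 'b) ring_scheme \<Rightarrow> 'a set \<Rightarrow> 'a set \<Rightarrow> nat \<Rightarrow> bool" where
  "has_cotangent_dimension A K M n \<longleftrightarrow>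
    (let J = ideal_prod A M M
     in ring.dimension (A Quot J) n (a_r_coset A J ` K) (a_r_coset A J ` M))"

definition smooth_point :: "('a, 'b) ring_scheme \<Rightarrow> 'a set \<Rightarrow> 'a set set \<Rightarrow> 'a set \<Rightarrow> bool" where
  "smooth_point R K Y p \<longleftrightarrow>
    p \<in> Y \<and>
    (let quotient_map = a_r_coset R (vanishing_ideal R Y);
         A = coordinate_ring R Y;
         M = quotient_map ` p
     in \<exists>n. has_cotangent_dimension A (quotient_map ` K) M n \<and> local_dimension A M = enat n)"

end

theory Submission
  imports Defs "HOL-Complex_Analysis.Complex_Analysis" "HOL-Library.Function_Algebras"
begin


text \<open>
Why the statement holds. Choose an axis so that the punctures lie on different half meridians,
numbered by longitude, and let \<open>n = m - 1\<close>. The fundamental group is free on the classes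
\<open>d 0, \<dots>, d (n - 1)\<close> of loops around all punctures but the last, and the product of these classes is
inverse to the class \<open>d n\<close> of a loop around the last one. A representation is therefore an
arbitrary tuple of matrices \<open>A\<^sub>k = \<rho> (d k)\<close> in \<open>SL\<^sub>2\<close>, and the slice prescribes the traces of all \<open>A\<^sub>k\<close> and
of the product \<open>A\<^sub>0 \<cdots> A\<^sub>n\<^sub>-\<^sub>1\<close>.

Local coordinates. As no weight is \<open>2\<close> or \<open>-2\<close>, an irreducible tuple can be conjugated so that \<open>A\<^sub>0\<close>
is diagonal with distinct eigenvalues and some \<open>A\<^sub>i\<close> has upper right entry \<open>1\<close>. This removes the
conjugation action, and the normalised matrices are rational functions of traces of words
(\<open>normal\<close>), hence of invariants. For \<open>k \<noteq> 0, i\<close> the matrices of determinant \<open>1\<close> and prescribed trace form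
a smooth surface with two coordinates, and the normalised \<open>A\<^sub>i\<close> has one coordinate. In these
coordinates the slice is the hypersurface \<open>F = 0\<close>, where \<open>F\<close> is, up to a factor without zeros near
the point, the trace of the product minus its prescribed value.

The hypersurface is nonsingular (\<open>noncritical\<close>). If the derivative of \<open>F\<close> vanished, each \<open>A\<^sub>k\<close> would commute
with the product \<open>A\<^sub>0 \<cdots> A\<^sub>n\<^sub>-\<^sub>1\<close> (\<open>critical_commute\<close>). That product has trace different from \<open>2\<close> and \<open>-2\<close>, so it has an
eigenline, and this line would be invariant under all \<open>A\<^sub>k\<close>, against irreducibility.

From a nonvanishing derivative to smoothness. If \<open>F\<close> has a nonzero partial derivative with respect to one of
the \<open>N\<close> coordinates, both dimensions in the definition of a smooth point equal \<open>N - 1\<close>. The cotangent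
space is spanned by the other coordinates because the Taylor expansion of \<open>F\<close> expresses the solved one
(\<open>coordinates_span\<close>), and they are independent because the holomorphic implicit function theorem supplies curves
along the coordinate axes (\<open>coordinates_independent\<close>). Functions that vanish on coordinate slices of the
graph give a chain of primes of the required length (\<open>germ_chain\<close>); no chain is longer since primes pull back to
primes of a polynomial algebra that contain \<open>F \<noteq> 0\<close> (\<open>chain_upper_bound\<close>).

Topology. Cutting the sphere along the meridian arcs from the punctures to the south pole, or to
the north pole, leaves two simply connected open sets \<open>U\<close> and \<open>V\<close>. They cover the punctured sphere, and
they meet in \<open>m\<close> sectors. Subdividing loops shows that the loops which pass from \<open>U\<close> to \<open>V\<close> in one sector and back in
the base sector generate (\<open>carrier_eq_H\<close>). Freeness only needs enough representations, and these are
holonomies of the flat bundles glued over \<open>U \<inter> V\<close> by locally constant matrices (\<open>representation_exists\<close>).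
\<close>

(* Below, the dollar sign denotes matrix entries only. *)
no_notation fps_nth (infixl "$" 75)

section \<open>Polynomial functions\<close>

inductive_set polyfun :: "'i set \<Rightarrow> (('i \<Rightarrow> complex) \<Rightarrow> complex) set" for I :: "'i set" where
  const: "(\<lambda>y. c) \<in> polyfun I"
| var: "i \<in> I ==> (\<lambda>y. y i) \<in> polyfun I"
| add: "f \<in> polyfun I ==> g \<in> polyfun I ==> (\<lambda>y. f y + g y) \<in> polyfun I"
| mult: "f \<in> polyfun I ==> g \<in> polyfun I ==> (\<lambda>y. f y * g y) \<in> polyfun I"

lemma polyfun_cmult: "f \<in> polyfun I ==> (\<lambda>y. c * f y) \<in> polyfun I"
  using polyfun.mult[OF polyfun.const[of c]] by blast

lemma polyfun_uminus: "f \<in> polyfun I ==> (\<lambda>y. - f y) \<in> polyfun I"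
  using polyfun_cmult[of f I "-1"] by simp

lemma polyfun_diff: "f \<in> polyfun I ==> g \<in> polyfun I ==> (\<lambda>y. f y - g y) \<in> polyfun I"
  using polyfun.add[of f I "\<lambda>y. - g y"] polyfun_uminus[of g I] by simp

lemma polyfun_power: "f \<in> polyfun I ==> (\<lambda>y. f y ^ n) \<in> polyfun I"
  by (induction n) (auto intro: polyfun.intros)

lemma polyfun_sum: "(\<And>a. a \<in> S ==> f a \<in> polyfun I) ==> (\<lambda>y. \<Sum>a\<in>S. f a y) \<in> polyfun I"
  by (induction S rule: infinite_finite_induct) (auto intro: polyfun.intros)

lemma polyfun_prod: "(\<And>a. a \<in> S ==> f a \<in> polyfun I) ==> (\<lambda>y. \<Prod>a\<in>S. f a y) \<in> polyfun I"
  by (induction S rule: infinite_finite_induct) (auto intro: polyfun.intros)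

lemmas polyfun_intros = polyfun.intros polyfun_cmult polyfun_uminus polyfun_diff polyfun_power
  polyfun_sum polyfun_prod

lemma polyfun_cong: "f \<in> polyfun I ==> (\<And>i. i \<in> I ==> y i = z i) ==> f y = f z"
  by (induction rule: polyfun.induct) auto

lemma polyfun_holomorphic:
  assumes "f \<in> polyfun I" and "\<And>i. i \<in> I ==> (\<lambda>z. g z i) holomorphic_on S"
  shows "(\<lambda>z. f (g z)) holomorphic_on S"
  using assms by (induction rule: polyfun.induct) (auto intro!: holomorphic_intros)


definition pmon :: "'i set \<Rightarrow> ('i \<Rightarrow> nat) \<Rightarrow> ('i \<Rightarrow> complex) \<Rightarrow> complex" where
  "pmon I e y = (\<Prod>i\<in>I. y i ^ e i)"

text \<open>Bounding each exponent, not the total degree, makes the exponents a product set; all that matters is that its size is a polynomial in \<open>d\<close> of degree \<open>card I\<close>.\<close>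
definition expo :: "'i set \<Rightarrow> nat \<Rightarrow> ('i \<Rightarrow> nat) set" where
  "expo I d = (I \<rightarrow>\<^sub>E {..d})"

definition polydeg :: "'i set \<Rightarrow> nat \<Rightarrow> (('i \<Rightarrow> complex) \<Rightarrow> complex) set" where
  "polydeg I d = range (\<lambda>c y. \<Sum>e\<in>expo I d. c e * pmon I e y)"

lemma finite_expo: "finite I ==> finite (expo I d)"
  unfolding expo_def by (auto intro: finite_PiE)

lemma polydegI:
  assumes "finite S" "finite I" "\<And>a y. a \<in> S ==> g a \<in> expo I d" "\<And>y. f y = (\<Sum>a\<in>S. c a * pmon I (g a) y)"
  shows "f \<in> polydeg I d"
proof -
  have "f y = (\<Sum>e\<in>expo I d. (\<Sum>a | a \<in> S \<and> g a = e. c a) * pmon I e y)" for y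
  proof -
    have "f y = (\<Sum>e\<in>expo I d. \<Sum>a | a \<in> S \<and> g a = e. c a * pmon I (g a) y)"
      unfolding assms(4) using assms(1,3) finite_expo[OF assms(2)]
      by (intro sum.group[symmetric]) auto
    also have "\<dots> = (\<Sum>e\<in>expo I d. (\<Sum>a | a \<in> S \<and> g a = e. c a) * pmon I e y)"
      by (intro sum.cong refl) (simp add: sum_distrib_right)
    finally show ?thesis .
  qed
  then show ?thesis unfolding polydeg_def
    by (intro range_eqI[where x="\<lambda>e. \<Sum>a | a \<in> S \<and> g a = e. c a"] ext)
qed

lemma polydeg_mono:
  assumes I: "finite I" and f: "f \<in> polydeg I d" and le: "d \<le> d'" shows "f \<in> polydeg I d'"
proof -
  from f obtain c where c: "f = (\<lambda>y. \<Sum>e\<in>expo I d. c e * pmon I e y)" unfolding polydeg_def by blast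
  have sub: "expo I d \<subseteq> expo I d'"
    unfolding expo_def using le by (intro PiE_mono) auto
  show ?thesis
    by (rule polydegI[where S="expo I d" and g="\<lambda>e. e" and c=c]) (use I c sub in \<open>auto simp: finite_expo\<close>)
qed

lemma polydeg_add:
  assumes I: "finite I" and f: "f \<in> polydeg I d" and g: "g \<in> polydeg I d"
  shows "(\<lambda>y. f y + g y) \<in> polydeg I d"
proof -
  from f obtain c where c: "f = (\<lambda>y. \<Sum>e\<in>expo I d. c e * pmon I e y)" unfolding polydeg_def by blast
  from g obtain c' where c': "g = (\<lambda>y. \<Sum>e\<in>expo I d. c' e * pmon I e y)" unfolding polydeg_def by blast
  have "(\<lambda>y. f y + g y) = (\<lambda>y. \<Sum>e\<in>expo I d. (c e + c' e) * pmon I e y)"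
    unfolding c c' by (simp add: sum.distrib distrib_right)
  then show ?thesis unfolding polydeg_def
    by (rule range_eqI[where x="\<lambda>e. c e + c' e"])
qed

lemma polydeg_mult:
  assumes I: "finite I" and f: "f \<in> polydeg I d" and g: "g \<in> polydeg I d'"
  shows "(\<lambda>y. f y * g y) \<in> polydeg I (d + d')"
proof -
  from f obtain c where c: "f = (\<lambda>y. \<Sum>e\<in>expo I d. c e * pmon I e y)" unfolding polydeg_def by blast
  from g obtain c' where c': "g = (\<lambda>y. \<Sum>e\<in>expo I d'. c' e * pmon I e y)" unfolding polydeg_def by blast
  let ?g = "\<lambda>(e, e'). restrict (\<lambda>i. e i + e' i) I"
  show ?thesis
  proof (rule polydegI[where S="expo I d \<times> expo I d'" and g="?g" and c="\<lambda>(e,e'). c e * c' e'"])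
    show "?g a \<in> expo I (d + d')" if "a \<in> expo I d \<times> expo I d'" for a
      using that unfolding expo_def by (fastforce simp: PiE_iff intro: add_mono)
    show "f y * g y = (\<Sum>a\<in>expo I d \<times> expo I d'. (case a of (e, e') \<Rightarrow> c e * c' e') * pmon I (?g a) y)" for y
      unfolding c c' sum_product sum.cartesian_product
      by (intro sum.cong refl) (auto simp: pmon_def power_add prod.distrib)
  qed (use I in \<open>auto simp: finite_expo\<close>)
qed

lemma polydeg_const: "finite I ==> (\<lambda>y. c) \<in> polydeg I d"
  by (rule polydegI[where S="{()}" and c="\<lambda>_. c" and g="\<lambda>_. \<lambda>i\<in>I. 0"]) (auto simp: expo_def pmon_def)

lemma polydeg_power: "finite I ==> f \<in> polydeg I d ==> (\<lambda>y. f y ^ n) \<in> polydeg I (n * d)"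
  by (induction n) (auto intro: polydeg_const polydeg_mult)

lemma polyfun_polydeg:
  assumes "finite I" "f \<in> polyfun I" shows "\<exists>d. f \<in> polydeg I d"
  using assms(2)
proof (induction rule: polyfun.induct)
  case (const c)
  then show ?case using polydeg_const assms by blast
next
  case (var i)
  have *: "(\<Prod>k\<in>I. y k ^ (if k = i then 1 else 0)) = y i" for y :: "'a \<Rightarrow> complex"
  proof -
    have "(\<Prod>k\<in>I. y k ^ (if k = i then 1 else 0)) = (\<Prod>k\<in>I. if k = i then y k else 1)"
      by (intro prod.cong) auto
    then show ?thesis using var assms by simp
  qed
  have "(\<lambda>y. y i) \<in> polydeg I 1"
    by (rule polydegI[where S="{()}" and c="\<lambda>_. 1" and g="\<lambda>_. \<lambda>k\<in>I. if k = i then 1 else 0"])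
      (use var assms in \<open>auto simp: expo_def pmon_def *\<close>)
  then show ?case by blast
next
  case (add f g)
  then obtain d d' where "f \<in> polydeg I d" "g \<in> polydeg I d'" by blast
  then have "f \<in> polydeg I (max d d')" "g \<in> polydeg I (max d d')"
    using polydeg_mono[OF assms(1)] by auto
  then show ?case using polydeg_add[OF assms(1)] by blast
next
  case (mult f g)
  then show ?case using polydeg_mult[OF assms(1)] by blast
qed

fun lmon :: "('y \<Rightarrow> complex) list \<Rightarrow> nat list \<Rightarrow> 'y \<Rightarrow> complex" where
  "lmon (f # fs) (a # e) y = f y ^ a * lmon fs e y"
| "lmon _ _ y = 1"

definition lexpo :: "nat \<Rightarrow> nat \<Rightarrow> nat list set" where
  "lexpo r D = {e. set e \<subseteq> {..D} \<and> length e = r}"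

lemma card_lexpo: "card (lexpo r D) = (D + 1) ^ r"
  unfolding lexpo_def by (subst card_lists_length_eq) auto

lemma finite_lexpo: "finite (lexpo r D)"
  unfolding lexpo_def by (rule finite_lists_length_eq) auto

lemma lmon_polydeg:
  assumes I: "finite I"
  shows "set fs \<subseteq> polydeg I d ==> e \<in> lexpo (length fs) D ==> lmon fs e \<in> polydeg I (length fs * (D * d))"
proof (induction fs arbitrary: e)
  case Nil
  then show ?case by (simp add: polydeg_const[OF I] lexpo_def)
next
  case (Cons f fs)
  then obtain a e' where e: "e = a # e'" "a \<le> D" "e' \<in> lexpo (length fs) D"
    by (cases e) (auto simp: lexpo_def)
  have 1: "(\<lambda>y. f y ^ a) \<in> polydeg I (D * d)"
    using polydeg_mono[OF I polydeg_power[OF I, of f d a]] Cons.prems e by auto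
  have "lmon (f # fs) e = (\<lambda>y. f y ^ a * lmon fs e' y)" unfolding e by auto
  then show ?case using polydeg_mult[OF I 1 Cons.IH] Cons.prems e by simp
qed

lemma sum_fun_apply: "(\<Sum>a\<in>S. f a) y = (\<Sum>a\<in>S. f a y :: complex)"
  by (induction S rule: infinite_finite_induct) auto

text \<open>
More than \<open>card I\<close> polynomials in \<open>card I\<close> variables are algebraically dependent, by counting: the \<open>(D + 1) ^ r\<close>
monomials of exponents at most \<open>D\<close> in \<open>r\<close> polynomials lie in a space whose dimension grows only like \<open>D ^ card I\<close>.
\<close>
lemma algebraically_dependent:
  assumes I: "finite I" and fs: "set fs \<subseteq> polyfun I" and len: "length fs > card I"
  shows "\<exists>D c. (\<exists>e\<in>lexpo (length fs) D. c e \<noteq> 0) \<and> (\<forall>y. (\<Sum>e\<in>lexpo (length fs) D. c e * lmon fs e y) = 0)"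
proof -
  interpret V: vector_space "\<lambda>(c::complex) f (y::'a \<Rightarrow> complex). c * f y"
    by unfold_locales (auto simp: fun_eq_iff algebra_simps)
  define r where "r = length fs"
  have "\<exists>d. set fs \<subseteq> polydeg I d"
    using fs
  proof (induction fs)
    case (Cons f fs)
    then obtain d where d: "set fs \<subseteq> polydeg I d" by auto
    obtain d' where d': "f \<in> polydeg I d'" using polyfun_polydeg[OF I] Cons.prems by auto
    have "set (f # fs) \<subseteq> polydeg I (max d d')"
      using polydeg_mono[OF I] d d' by auto
    then show ?case by blast
  qed auto
  then obtain d0 where "set fs \<subseteq> polydeg I d0" by blast
  then have d: "set fs \<subseteq> polydeg I (Suc d0)" using polydeg_mono[OF I, of _ d0 "Suc d0"] by auto
  define d where "d = Suc d0"
  define D where "D = (r * d) ^ card I"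
  have r0: "r > 0" using len r_def by auto
  have big: "card (expo I (r * (D * d))) < card (lexpo r D)"
  proof -
    have "card (expo I (r * (D * d))) = (r * (D * d) + 1) ^ card I"
      unfolding expo_def by (subst card_PiE) (auto simp: I)
    also have "\<dots> \<le> ((r * d) * (D + 1)) ^ card I"
      using r0 by (intro power_mono) (auto simp: d_def algebra_simps)
    also have "\<dots> = D * (D + 1) ^ card I" by (simp only: power_mult_distrib[of "r * d"] D_def[symmetric])
    also have "\<dots> < (D + 1) ^ Suc (card I)" by simp
    also have "\<dots> \<le> (D + 1) ^ r" using len r_def by (intro power_increasing) auto
    finally show ?thesis by (simp add: card_lexpo)
  qed
  let ?S = "lmon fs ` lexpo r D"
  let ?T = "pmon I ` expo I (r * (D * d))"
  have span: "?S \<subseteq> V.span ?T"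
  proof
    fix f assume "f \<in> ?S"
    then have "f \<in> polydeg I (r * (D * d))"
      using lmon_polydeg[OF I d] r_def d_def by auto
    then obtain c where "f = (\<lambda>y. \<Sum>e\<in>expo I (r * (D * d)). c e * pmon I e y)"
      unfolding polydeg_def by blast
    then have f: "f = (\<Sum>e\<in>expo I (r * (D * d)). (\<lambda>y. c e * pmon I e y))"
      by (simp add: fun_eq_iff sum_fun_apply)
    show "f \<in> V.span ?T"
      unfolding f by (intro V.span_sum V.span_scale V.span_base) auto
  qed
  show ?thesis
  proof (cases "inj_on (lmon fs) (lexpo r D)")
    case True
    have "V.dependent ?S"
    proof (rule ccontr)
      assume "\<not> V.dependent ?S"
      from V.independent_span_bound[OF _ this span]
      have "card ?S \<le> card ?T" by (simp add: finite_expo I)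
      also have "\<dots> \<le> card (expo I (r * (D * d)))" by (simp add: card_image_le finite_expo I)
      finally show False using big card_image[OF True] by simp
    qed
    then obtain u v where uv: "v \<in> ?S" "u v \<noteq> 0" "(\<Sum>v\<in>?S. (\<lambda>y. u v * v y)) = (\<lambda>y. 0)"
      unfolding V.dependent_finite[OF finite_imageI[OF finite_lexpo]] by (auto simp: zero_fun_def)
    define c where "c = (\<lambda>e. u (lmon fs e))"
    have "(\<Sum>e\<in>lexpo r D. c e * lmon fs e y) = 0" for y
    proof -
      have "(\<Sum>v\<in>?S. u v * v y) = 0" using fun_cong[OF uv(3), of y]
        by (simp add: sum_fun_apply)
      then show ?thesis unfolding c_def by (subst (asm) sum.reindex[OF True]) simp
    qed
    moreover from uv obtain e where "e \<in> lexpo r D" "c e \<noteq> 0" unfolding c_def by auto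
    ultimately show ?thesis unfolding r_def by blast
  next
    case False
    then obtain e e' where e: "e \<in> lexpo r D" "e' \<in> lexpo r D" "e \<noteq> e'" "lmon fs e = lmon fs e'"
      unfolding inj_on_def by blast
    define c where "c = (\<lambda>a. if a = e then 1 else if a = e' then -1 else 0 :: complex)"
    have "(\<Sum>a\<in>lexpo r D. c a * lmon fs a y) = 0" for y
    proof -
      have "(\<Sum>a\<in>lexpo r D. c a * lmon fs a y) = (\<Sum>a\<in>{e, e'}. c a * lmon fs a y)"
        using e by (intro sum.mono_neutral_right) (auto simp: finite_lexpo c_def)
      then show ?thesis using e by (simp add: c_def)
    qed
    moreover have "c e \<noteq> 0" by (simp add: c_def)
    ultimately show ?thesis using e(1) unfolding r_def by blast
  qed
qed

section \<open>Chains of prime ideals\<close>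

locale function_algebra =
  fixes A :: "('q \<Rightarrow> complex) set"
  assumes const: "(\<lambda>q. c) \<in> A"
    and add: "f \<in> A ==> g \<in> A ==> (\<lambda>q. f q + g q) \<in> A"
    and mult: "f \<in> A ==> g \<in> A ==> (\<lambda>q. f q * g q) \<in> A"
begin

lemma cmult: "f \<in> A ==> (\<lambda>q. c * f q) \<in> A"
  using mult[OF const[of c]] by blast

lemma diff: "f \<in> A ==> g \<in> A ==> (\<lambda>q. f q - g q) \<in> A"
  using add[of f "\<lambda>q. - 1 * g q"] cmult[of g "- 1"] by simp

lemma power: "f \<in> A ==> (\<lambda>q. f q ^ n) \<in> A"
  by (induction n) (auto intro: const mult)

lemma sum: "(\<And>a. a \<in> S ==> f a \<in> A) ==> (\<lambda>q. \<Sum>a\<in>S. f a q) \<in> A"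
  by (induction S rule: infinite_finite_induct) (auto intro: const add)

lemma lmon: "set fs \<subseteq> A ==> lmon fs e \<in> A"
proof (induction fs arbitrary: e)
  case (Cons f fs)
  have "lmon (f # fs) e \<in> A"
    if "e = a # e'" for a e'
  proof -
    have "lmon (f # fs) e = (\<lambda>q. f q ^ a * lmon fs e' q)" using that by auto
    then show ?thesis using mult[OF power, of f "lmon fs e'" a] Cons by simp
  qed
  moreover have "lmon (f # fs) [] = (\<lambda>q. 1)" by auto
  ultimately show ?case using const[of 1] by (cases e) (simp_all del: lmon.simps)
next
  case Nil
  have "lmon [] e = (\<lambda>q::'q. 1)" by auto
  then show ?case using const[of 1] by simp
qed

end

lemma function_algebra_polyfun: "function_algebra (polyfun I)"
  by unfold_locales (auto intro: polyfun.intros)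

text \<open>Prime ideals of an algebra of functions as plain sets of functions, so that no ring record is needed in the analytic part.\<close>
definition prime_in :: "('q \<Rightarrow> complex) set \<Rightarrow> ('q \<Rightarrow> complex) set \<Rightarrow> bool" where
  "prime_in A P \<longleftrightarrow> P \<subseteq> A \<and> (\<lambda>q. 0) \<in> P \<and> (\<lambda>q. 1) \<notin> P \<and>
     (\<forall>f\<in>P. \<forall>g\<in>P. (\<lambda>q. f q + g q) \<in> P) \<and>
     (\<forall>f\<in>A. \<forall>g\<in>P. (\<lambda>q. f q * g q) \<in> P) \<and>
     (\<forall>f\<in>A. \<forall>g\<in>A. (\<lambda>q. f q * g q) \<in> P --> f \<in> P \<or> g \<in> P)"

lemma prime_inD:
  assumes "prime_in A P"
  shows "P \<subseteq> A" "(\<lambda>q. 0) \<in> P" "(\<lambda>q. 1) \<notin> P"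
    "\<And>f g. f \<in> P ==> g \<in> P ==> (\<lambda>q. f q + g q) \<in> P"
    "\<And>f g. f \<in> A ==> g \<in> P ==> (\<lambda>q. f q * g q) \<in> P"
    "\<And>f g. f \<in> A ==> g \<in> A ==> (\<lambda>q. f q * g q) \<in> P ==> f \<in> P \<or> g \<in> P"
  using assms unfolding prime_in_def by auto

lemma lexpo_Suc: "lexpo (Suc r) D = (\<lambda>(a, e). a # e) ` ({..D} \<times> lexpo r D)"
  unfolding lexpo_def by (auto simp: image_iff length_Suc_conv)

lemma sum_lexpo_Suc: "(\<Sum>e\<in>lexpo (Suc r) D. h e) = (\<Sum>a\<le>D. \<Sum>e\<in>lexpo r D. h (a # e) :: complex)"
proof -
  have inj: "inj_on (\<lambda>(a, e). a # e) ({..D} \<times> lexpo r D)" by (auto simp: inj_on_def)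
  show ?thesis unfolding lexpo_Suc
    by (subst sum.reindex[OF inj]) (simp add: sum.cartesian_product case_prod_beta)
qed

text \<open>
A strict chain of primes yields functions that are algebraically independent modulo its smallest member: choose one
function in each member outside the previous one. In a relation modulo the smaller prime, the part without the new function lies in the
larger prime and vanishes by induction; then one factor of that function can be cancelled.
\<close>
lemma (in function_algebra) prime_chain_independent:
  assumes "sorted_wrt (\<subset>) (Q # Qs)" "\<forall>P\<in>set (Q # Qs). prime_in A P"
  shows "\<exists>fs. length fs = length Qs \<and> set fs \<subseteq> A \<and>
     (\<forall>D c. (\<lambda>y. \<Sum>e\<in>lexpo (length fs) D. c e * lmon fs e y) \<in> Q --> (\<forall>e\<in>lexpo (length fs) D. c e = 0))"
  using assms
proof (induction Qs arbitrary: Q)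
  case Nil
  have "c [] = 0" if "(\<lambda>y. c []) \<in> Q" for c :: "nat list \<Rightarrow> complex"
  proof (rule ccontr)
    assume "c [] \<noteq> 0"
    moreover have "prime_in A Q" using Nil by auto
    ultimately show False
      using prime_inD(3)[of A Q] prime_inD(5)[of A Q, OF _ const[of "1 / c []"] that] by simp
  qed
  moreover have "lexpo 0 D = {[]}" for D unfolding lexpo_def by auto
  ultimately show ?case by (intro exI[of _ "[]"]) auto
next
  case (Cons Q' Qs)
  have "\<exists>fs. length fs = length Qs \<and> set fs \<subseteq> A \<and>
     (\<forall>D c. (\<lambda>y. \<Sum>e\<in>lexpo (length fs) D. c e * lmon fs e y) \<in> Q' --> (\<forall>e\<in>lexpo (length fs) D. c e = 0))"
    by (rule Cons.IH) (use Cons.prems in auto)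
  then obtain fs where len: "length fs = length Qs" and fsA: "set fs \<subseteq> A"
    and ind: "\<And>D c e. (\<lambda>y. \<Sum>e\<in>lexpo (length fs) D. c e * lmon fs e y) \<in> Q' ==> e \<in> lexpo (length fs) D ==> c e = 0"
    by blast
  have P: "prime_in A Q" "prime_in A Q'" "Q \<subset> Q'" using Cons.prems by auto
  then obtain f where f: "f \<in> Q'" "f \<notin> Q" by auto
  then have fA: "f \<in> A" using prime_inD(1)[OF P(2)] by auto
  let ?r = "length fs"
  define g where "g = (\<lambda>D c y. \<Sum>e\<in>lexpo ?r D. c e * lmon fs e y)"
  have gA: "g D c \<in> A" for D c unfolding g_def by (intro sum cmult lmon fsA)
  have key: "(\<lambda>y. \<Sum>a\<le>D'. f y ^ a * g D (h a) y) \<in> Q ==> a \<le> D' ==> e \<in> lexpo ?r D ==> h a e = 0" for D' D h a e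
  proof (induction D' arbitrary: h a)
    case 0
    then have "g D (h 0) \<in> Q'" using P(3) by auto
    then show ?case using ind[where D=D and c="h 0" and e=e] 0 unfolding g_def by auto
  next
    case (Suc D')
    let ?t = "\<lambda>y. \<Sum>a\<le>D'. f y ^ a * g D (h (Suc a)) y"
    have tA: "?t \<in> A" by (intro sum mult power fA gA)
    have eq: "(\<Sum>a\<le>Suc D'. f y ^ a * g D (h a) y) = g D (h 0) y + f y * ?t y" for y
      by (subst sum.atMost_Suc_shift) (simp add: sum_distrib_left mult.assoc)
    have in': "(\<lambda>y. g D (h 0) y + f y * ?t y) \<in> Q'" using Suc.prems(1) P(3) unfolding eq by auto
    have "(\<lambda>y. ?t y * f y) \<in> Q'" using prime_inD(5)[OF P(2) tA f(1)] .
    from prime_inD(5)[OF P(2) const[of "-1"] this]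
    have "(\<lambda>y. -1 * (?t y * f y)) \<in> Q'" .
    from prime_inD(4)[OF P(2) in' this]
    have "g D (h 0) \<in> Q'" by (simp add: mult.commute)
    then have h0: "h 0 e = 0" if "e \<in> lexpo ?r D" for e using ind[where D=D and c="h 0" and e=e] that unfolding g_def by auto
    then have "g D (h 0) = (\<lambda>y. 0)" unfolding g_def by (intro ext sum.neutral) auto
    then have "(\<lambda>y. f y * ?t y) \<in> Q" using Suc.prems(1) unfolding eq by simp
    then have tQ: "?t \<in> Q" using prime_inD(6)[OF P(1) fA tA] f by auto
    show ?case
    proof (cases a)
      case 0 then show ?thesis using h0 Suc.prems by auto
    next
      case (Suc a')
      then show ?thesis using Suc.IH[of "\<lambda>a. h (Suc a)", OF tQ, of a'] Suc.prems by auto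
    qed
  qed
  have "c e = 0" if c: "(\<lambda>y. \<Sum>e\<in>lexpo (Suc ?r) D. c e * lmon (f # fs) e y) \<in> Q" and e: "e \<in> lexpo (Suc ?r) D" for c D e
  proof -
    obtain a e' where ae: "e = a # e'" "a \<le> D" "e' \<in> lexpo ?r D" using e unfolding lexpo_Suc by auto
    have "(\<Sum>e\<in>lexpo (Suc ?r) D. c e * lmon (f # fs) e y) = (\<Sum>a\<le>D. f y ^ a * g D (\<lambda>e. c (a # e)) y)" for y
      unfolding sum_lexpo_Suc g_def by (simp add: sum_distrib_left algebra_simps)
    with c have "(\<lambda>y. \<Sum>a\<le>D. f y ^ a * g D (\<lambda>e. c (a # e)) y) \<in> Q" by simp
    from key[OF this ae(2,3)] show ?thesis by (simp add: ae)
  qed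
  then show ?case using len fsA fA
    by (intro exI[of _ "f # fs"]) (auto simp del: lmon.simps)
qed

lemma holomorphic_product_zero:
  assumes S: "open S" "connected S" and f: "f holomorphic_on S" and g: "g holomorphic_on S"
    and fg: "\<And>z. z \<in> S ==> f z * g z = 0" and a: "a \<in> S" "f a \<noteq> 0" and z: "z \<in> S"
  shows "g z = 0"
proof -
  have "continuous_on S f" using f by (rule holomorphic_on_imp_continuous_on)
  then have "open (S \<inter> f -` (- {0}))"
    using S(1) by (intro continuous_open_preimage) auto
  moreover have "g w = 0" if "w \<in> S \<inter> f -` (- {0})" for w
    using fg[of w] that by auto
  moreover have "a \<in> S \<inter> f -` (- {0})" using a by auto
  ultimately show ?thesis
    using analytic_continuation_open[of "S \<inter> f -` (- {0})" S g "\<lambda>_. 0"] S g z by auto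
qed

text \<open>The polynomial functions form an integral domain because a product of holomorphic functions of one variable vanishes only if a factor does (restrict to a line).\<close>
lemma polyfun_prime_zero: "prime_in (polyfun I) {\<lambda>y. 0}"
proof -
  have "f = (\<lambda>y. 0) \<or> g = (\<lambda>y. 0)" if f: "f \<in> polyfun I" and g: "g \<in> polyfun I" and fg: "(\<lambda>y. f y * g y) = (\<lambda>y. 0)" for f g
  proof (rule ccontr)
    assume "\<not> ?thesis"
    then obtain y0 y1 where y: "f y0 \<noteq> 0" "g y1 \<noteq> 0" by (auto simp: fun_eq_iff)
    define l where "l = (\<lambda>z i. y0 i + z * (y1 i - y0 i))"
    have l01: "l 0 = y0" "l 1 = y1" by (auto simp: l_def)
    have hl: "(\<lambda>z. l z i) holomorphic_on UNIV" for i unfolding l_def by (intro holomorphic_intros)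
    have "g (l 1) = 0"
      by (rule holomorphic_product_zero[where S=UNIV and a=0 and f="\<lambda>z. f (l z)"])
        (use y fg in \<open>auto simp: l01 fun_eq_iff intro!: polyfun_holomorphic[OF f hl] polyfun_holomorphic[OF g hl]\<close>)
    then show False using y l01 by auto
  qed
  then show ?thesis unfolding prime_in_def by (auto intro: polyfun.intros simp: fun_eq_iff)
qed

lemma polyfun_chain_bound:
  assumes "finite I" "sorted_wrt (\<subset>) ({\<lambda>y. 0} # Qs)" "\<forall>P\<in>set Qs. prime_in (polyfun I) P"
  shows "length Qs \<le> card I"
proof (rule ccontr)
  assume "\<not> ?thesis"
  interpret function_algebra "polyfun I" by (rule function_algebra_polyfun)
  from prime_chain_independent[OF assms(2)] assms(3) polyfun_prime_zero[of I]
  obtain fs where fs: "length fs = length Qs" "set fs \<subseteq> polyfun I"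
    "\<And>D c e. (\<lambda>y. \<Sum>e\<in>lexpo (length fs) D. c e * lmon fs e y) = (\<lambda>y. 0) ==> e \<in> lexpo (length fs) D ==> c e = 0"
    by auto
  from algebraically_dependent[OF assms(1) fs(2)] fs(1) \<open>\<not> ?thesis\<close>
  obtain D c e where "e \<in> lexpo (length fs) D" "c e \<noteq> 0" "\<forall>y. (\<Sum>e\<in>lexpo (length fs) D. c e * lmon fs e y) = 0"
    by auto
  with fs(3)[where D=D and c=c and e=e] show False by auto
qed

section \<open>Algebras that are locally the functions on a hypersurface\<close>

text \<open>
The situation near a point \<open>p\<close> of an affine variety with algebra of functions \<open>A\<close>. On the basic open set \<open>s \<noteq> 0\<close> there are
regular coordinates \<open>x i\<close> (their denominators are powers of \<open>s\<close>), every function in \<open>A\<close> is a fraction in the coordinates whose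
denominator does not vanish at \<open>p\<close>, and the image of the coordinates is near \<open>0\<close> exactly the zero set of \<open>F\<close>, whose partial derivative
\<open>c\<close> in direction \<open>j\<close> is not zero. The points \<open>q\<close> range over a whole type; a variety that is a proper subset is
represented by sending the other elements of the type to \<open>p\<close>.
\<close>
locale local_hypersurface = function_algebra A
  for A :: "('q \<Rightarrow> complex) set" +
  fixes p :: 'q and I :: "'i set" and x :: "'i \<Rightarrow> 'q \<Rightarrow> complex" and s :: "'q \<Rightarrow> complex"
    and F :: "('i \<Rightarrow> complex) \<Rightarrow> complex" and j :: 'i and c :: complex
  assumes finI: "finite I" and jI: "j \<in> I"
    and sA: "s \<in> A" and sp: "s p \<noteq> 0"
    and sx: "i \<in> I ==> (\<lambda>q. s q * x i q) \<in> A" and xp: "i \<in> I ==> x i p = 0"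
    and loc: "f \<in> A ==> \<exists>G\<in>polyfun I. \<exists>H\<in>polyfun I. H (\<lambda>i. 0) \<noteq> 0 \<and>
                 (\<forall>q. s q \<noteq> 0 --> H (\<lambda>i. x i q) * f q = G (\<lambda>i. x i q))"
    and FI: "F \<in> polyfun I" and Fx: "s q \<noteq> 0 ==> F (\<lambda>i. x i q) = 0"
    and dF: "((\<lambda>\<xi>. F ((\<lambda>i. 0)(j := \<xi>))) has_field_derivative c) (at 0)" and c0: "c \<noteq> 0"
    and points: "\<exists>\<epsilon>>0. \<forall>y. (\<forall>i\<in>I. norm (y i) < \<epsilon>) --> F y = 0 --> (\<exists>q. s q \<noteq> 0 \<and> (\<forall>i\<in>I. x i q = y i))"
begin

abbreviation xs :: "'q \<Rightarrow> 'i \<Rightarrow> complex" where "xs q \<equiv> (\<lambda>i. x i q)"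

definition M where "M = {f \<in> A. f p = 0}"

lemma poly_xs_p: "G \<in> polyfun I ==> G (xs p) = G (\<lambda>i. 0)"
  by (rule polyfun_cong[of G I "xs p" "\<lambda>i. 0"]) (auto simp: xp)

lemma clear_denominators:
  assumes "G \<in> polyfun I" shows "\<exists>k\<ge>1. \<forall>k'\<ge>k. (\<lambda>q. s q ^ k' * G (xs q)) \<in> A"
  using assms
proof (induction rule: polyfun.induct)
  case (const c)
  then show ?case
    using function_algebra.mult[OF function_algebra_axioms power[OF sA] function_algebra.const[OF function_algebra_axioms]]
    by (intro exI[of _ 1]) auto
next
  case (var i)
  have "(\<lambda>q. s q ^ k' * x i q) \<in> A" if "k' \<ge> 1" for k'
  proof -
    have "(\<lambda>q. s q ^ (k' - 1) * (s q * x i q)) \<in> A"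
      by (intro mult power sA sx var)
    moreover have "s q ^ k' * x i q = s q ^ (k' - 1) * (s q * x i q)" for q
      using that by (cases k') auto
    ultimately show ?thesis by (simp only:)
  qed
  then show ?case by blast
next
  case (add f g)
  then obtain k l where kl: "k \<ge> 1" "l \<ge> 1" "\<forall>k'\<ge>k. (\<lambda>q. s q ^ k' * f (xs q)) \<in> A" "\<forall>k'\<ge>l. (\<lambda>q. s q ^ k' * g (xs q)) \<in> A"
    by blast
  have "(\<lambda>q. s q ^ k' * (f (xs q) + g (xs q))) \<in> A" if "k' \<ge> max k l" for k'
    using function_algebra.add[OF function_algebra_axioms kl(3)[rule_format, of k'] kl(4)[rule_format, of k']] that by (simp add: distrib_left)
  then show ?case using kl by (intro exI[of _ "max k l"]) auto
next
  case (mult f g)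
  then obtain k l where kl: "k \<ge> 1" "l \<ge> 1" "\<forall>k'\<ge>k. (\<lambda>q. s q ^ k' * f (xs q)) \<in> A" "\<forall>k'\<ge>l. (\<lambda>q. s q ^ k' * g (xs q)) \<in> A"
    by blast
  have "(\<lambda>q. s q ^ k' * (f (xs q) * g (xs q))) \<in> A" if "k' \<ge> k + l" for k'
  proof -
    have "(\<lambda>q. (s q ^ k * f (xs q)) * (s q ^ (k' - k) * g (xs q))) \<in> A"
      by (rule function_algebra.mult[OF function_algebra_axioms]) (use kl that in auto)
    moreover have "(s q ^ k * f (xs q)) * (s q ^ (k' - k) * g (xs q)) = s q ^ k' * (f (xs q) * g (xs q))" for q
    proof -
      have "s q ^ k' = s q ^ k * s q ^ (k' - k)" using that by (simp flip: power_add)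
      then show ?thesis by simp
    qed
    ultimately show ?thesis by simp
  qed
  then show ?case using kl by (intro exI[of _ "k + l"]) auto
qed

text \<open>The contraction of \<open>P\<close> to the polynomial algebra along the coordinates; powers of \<open>s\<close> clear the denominators.\<close>
definition pull :: "('q \<Rightarrow> complex) set \<Rightarrow> (('i \<Rightarrow> complex) \<Rightarrow> complex) set" where
  "pull P = {G \<in> polyfun I. \<exists>k\<ge>1. (\<lambda>q. s q ^ k * G (xs q)) \<in> P}"

context
  fixes P assumes P: "prime_in A P" and PM: "P \<subseteq> M"
begin

lemma s_power_not_in: "(\<lambda>q. s q ^ k) \<notin> P"
  using PM sp unfolding M_def by auto

lemma pull_more:
  assumes "(\<lambda>q. s q ^ k * G (xs q)) \<in> P" "k' \<ge> k" shows "(\<lambda>q. s q ^ k' * G (xs q)) \<in> P"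
proof -
  have "(\<lambda>q. s q ^ (k' - k) * (s q ^ k * G (xs q))) \<in> P"
    by (rule prime_inD(5)[OF P power[OF sA] assms(1)])
  moreover have "s q ^ (k' - k) * (s q ^ k * G (xs q)) = s q ^ k' * G (xs q)" for q
    using assms(2) by (simp flip: power_add mult.assoc)
  ultimately show ?thesis by simp
qed

lemma pull_prime: "prime_in (polyfun I) (pull P)"
  unfolding prime_in_def
proof (intro conjI ballI impI)
  show "pull P \<subseteq> polyfun I" unfolding pull_def by auto
  show "(\<lambda>q. 0) \<in> pull P" unfolding pull_def using prime_inD(2)[OF P] by (auto intro: polyfun.intros)
  show "(\<lambda>q. 1) \<notin> pull P" unfolding pull_def using s_power_not_in by auto
next
  fix f g assume "f \<in> pull P" "g \<in> pull P"
  then obtain k l where kl: "f \<in> polyfun I" "g \<in> polyfun I" "k \<ge> 1" "l \<ge> 1" "(\<lambda>q. s q ^ k * f (xs q)) \<in> P" "(\<lambda>q. s q ^ l * g (xs q)) \<in> P"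
    unfolding pull_def by auto
  have "(\<lambda>q. s q ^ (k + l) * f (xs q)  + s q ^ (k + l) * g (xs q)) \<in> P"
    by (intro prime_inD(4)[OF P] pull_more[OF kl(5)] pull_more[OF kl(6)]) auto
  then show "(\<lambda>q. f q + g q) \<in> pull P" unfolding pull_def using kl
    by (auto intro!: polyfun.intros exI[of _ "k + l"] simp: distrib_left)
next
  fix f g assume f: "f \<in> polyfun I" and "g \<in> pull P"
  then obtain l where l: "g \<in> polyfun I" "l \<ge> 1" "(\<lambda>q. s q ^ l * g (xs q)) \<in> P"
    unfolding pull_def by auto
  obtain k where k: "k \<ge> 1" "(\<lambda>q. s q ^ k * f (xs q)) \<in> A" using clear_denominators[OF f] by auto
  have "(\<lambda>q. (s q ^ k * f (xs q)) * (s q ^ l * g (xs q))) \<in> P"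
    by (rule prime_inD(5)[OF P k(2) l(3)])
  then have "(\<lambda>q. s q ^ (k + l) * (f (xs q) * g (xs q))) \<in> P" by (simp add: power_add mult_ac)
  then show "(\<lambda>q. f q * g q) \<in> pull P" unfolding pull_def using f l k
    by (auto intro!: polyfun.intros exI[of _ "k + l"])
next
  fix f g assume f: "f \<in> polyfun I" and g: "g \<in> polyfun I" and "(\<lambda>q. f q * g q) \<in> pull P"
  then obtain n where n: "(\<lambda>q. s q ^ n * (f (xs q) * g (xs q))) \<in> P" unfolding pull_def by auto
  obtain k where k: "k \<ge> 1" "(\<lambda>q. s q ^ k * f (xs q)) \<in> A" using clear_denominators[OF f] by auto
  obtain l where l: "l \<ge> 1" "(\<lambda>q. s q ^ l * g (xs q)) \<in> A" using clear_denominators[OF g] by auto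
  have "(\<lambda>q. s q ^ (k + l) * (s q ^ n * (f (xs q) * g (xs q)))) \<in> P"
    by (rule prime_inD(5)[OF P power[OF sA] n])
  then have "(\<lambda>q. s q ^ n * ((s q ^ k * f (xs q)) * (s q ^ l * g (xs q)))) \<in> P"
    by (simp add: power_add mult_ac)
  from prime_inD(6)[OF P power[OF sA] mult[OF k(2) l(2)] this] s_power_not_in
  have "(\<lambda>q. (s q ^ k * f (xs q)) * (s q ^ l * g (xs q))) \<in> P" by blast
  from prime_inD(6)[OF P k(2) l(2) this] show "f \<in> pull P \<or> g \<in> pull P"
    unfolding pull_def using f g k l by blast
qed

lemma F_in_pull: "F \<in> pull P"
proof -
  have "(\<lambda>q. s q ^ 1 * F (xs q)) = (\<lambda>q. 0)" using Fx by (auto simp: fun_eq_iff)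
  then have "(\<lambda>q. s q ^ 1 * F (xs q)) \<in> P" using prime_inD(2)[OF P] by simp
  then show ?thesis unfolding pull_def using FI by blast
qed

end

text \<open>If \<open>f\<close> lies in \<open>Q\<close> but not in \<open>P\<close>, the numerator of \<open>f\<close> in the coordinates separates the contractions, since denominators and powers of \<open>s\<close> are outside both primes.\<close>
lemma pull_strict:
  assumes P: "prime_in A P" "P \<subseteq> M" and P': "prime_in A P'" "P' \<subseteq> M" and sub: "P \<subset> P'"
  shows "pull P \<subset> pull P'"
proof -
  obtain f where f: "f \<in> P'" "f \<notin> P" using sub by auto
  then have fA: "f \<in> A" using prime_inD(1)[OF P'(1)] by auto
  from loc[OF this] obtain G H where GH: "G \<in> polyfun I" "H \<in> polyfun I" "H (\<lambda>i. 0) \<noteq> 0"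
     "\<And>q. s q \<noteq> 0 ==> H (xs q) * f q = G (xs q)" by blast
  obtain k where k: "k \<ge> 1" "\<And>k'. k' \<ge> k ==> (\<lambda>q. s q ^ k' * H (xs q)) \<in> A" using clear_denominators[OF GH(2)] by auto
  have eq: "s q ^ k' * G (xs q) = (s q ^ k' * H (xs q)) * f q" if "k' \<ge> 1" for q k'
    using GH(4)[of q] that by (cases "s q = 0") auto
  have "(\<lambda>q. s q ^ k * G (xs q)) \<in> P'"
    using prime_inD(5)[OF P'(1) k(2)[OF order_refl] f(1)] unfolding eq[OF k(1)] .
  then have "G \<in> pull P'" unfolding pull_def using GH(1) k(1) by blast
  moreover have "G \<notin> pull P"
  proof
    assume "G \<in> pull P"
    then obtain l where l: "l \<ge> 1" "(\<lambda>q. s q ^ l * G (xs q)) \<in> P" unfolding pull_def by auto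
    from pull_more[OF P l(2), of "k + l"]
    have "(\<lambda>q. (s q ^ (k + l) * H (xs q)) * f q) \<in> P" using eq[of "k + l"] k(1) by simp
    with prime_inD(6)[OF P(1) k(2)[of "k + l"] fA] f have "(\<lambda>q. (s q ^ (k + l) * H (xs q))) \<in> P"
      by auto
    then have "s p ^ (k + l) * H (xs p) = 0" using P(2) unfolding M_def by auto
    then show False using sp GH(3) poly_xs_p[OF GH(2)] by auto
  qed
  moreover have "pull P \<subseteq> pull P'" using sub unfolding pull_def by auto
  ultimately show ?thesis by auto
qed

lemma F_nonzero: "F \<noteq> (\<lambda>y. 0)"
proof
  assume "F = (\<lambda>y. 0)"
  then have "((\<lambda>\<xi>::complex. 0) has_field_derivative c) (at 0)" using dF by simp
  moreover have "((\<lambda>\<xi>::complex. 0) has_field_derivative 0) (at 0)" by simp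
  ultimately show False using c0 DERIV_unique by blast
qed

text \<open>All contracted primes contain \<open>F\<close>, so the zero ideal can be put in front of the contracted chain, and the bound for polynomials applies to the longer chain.\<close>
theorem chain_upper_bound:
  assumes sorted: "sorted_wrt (\<subset>) Ps" and pr: "\<forall>P\<in>set Ps. prime_in A P \<and> P \<subseteq> M"
  shows "length Ps \<le> card I"
proof -
  have "sorted_wrt (\<lambda>P Q. pull P \<subset> pull Q) Ps"
  proof (rule sorted_wrt_mono_rel[OF _ sorted])
    fix P Q assume "P \<in> set Ps" "Q \<in> set Ps" "P \<subset> Q"
    then show "pull P \<subset> pull Q" using pr pull_strict[of P Q] by blast
  qed
  then have "sorted_wrt (\<subset>) (map pull Ps)" unfolding sorted_wrt_map .
  moreover have "{\<lambda>y. 0} \<subset> Q" if Q: "Q \<in> set (map pull Ps)" for Q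
  proof -
    obtain P where P: "P \<in> set Ps" "Q = pull P" using Q by auto
    show ?thesis using prime_inD(2)[OF pull_prime[of P]] F_in_pull[of P] F_nonzero P pr by auto
  qed
  ultimately have "length (map pull Ps) \<le> card I"
    using pull_prime pr by (intro polyfun_chain_bound[OF finI]) auto
  then show ?thesis by simp
qed

end

section \<open>The holomorphic implicit function\<close>

lemma polyfun_tendsto:
  assumes "G \<in> polyfun I" and "\<And>i. i \<in> I ==> ((\<lambda>n. u n i) \<longlongrightarrow> a i) N"
  shows "((\<lambda>n. G (u n)) \<longlongrightarrow> G a) N"
  using assms by (induction rule: polyfun.induct) (auto intro: tendsto_intros)

text \<open>The neighbourhoods of \<open>0\<close> with respect to the finitely many coordinates in \<open>I\<close>; functions on \<open>I\<close> are total functions here, and their values outside \<open>I\<close> are ignored.\<close>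
definition box_filter :: "'i set \<Rightarrow> ('i \<Rightarrow> complex) filter" where
  "box_filter I = filtercomap (\<lambda>y. \<Sum>i\<in>I. norm (y i)) (nhds 0)"

lemma eventually_box_filter:
  assumes "finite I"
  shows "eventually P (box_filter I) \<longleftrightarrow> (\<exists>\<delta>>0. \<forall>y. (\<forall>i\<in>I. norm (y i) < \<delta>) --> P y)"
proof
  assume "eventually P (box_filter I)"
  then obtain Q where Q: "eventually Q (nhds 0)" "\<And>y. Q (\<Sum>i\<in>I. norm (y i)) ==> P y"
    unfolding box_filter_def eventually_filtercomap by auto
  then obtain d where d: "d > 0" "\<And>r. dist r 0 < d ==> Q (r::real)" unfolding eventually_nhds_metric by auto
  have "P y" if y: "\<forall>i\<in>I. norm (y i) < d / (card I + 1)" for y :: "'a \<Rightarrow> complex"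
  proof -
    have "(\<Sum>i\<in>I. norm (y i)) \<le> (\<Sum>i\<in>I. d / (card I + 1))"
      using y by (intro sum_mono) (auto intro: less_imp_le)
    also have "\<dots> < d" using d by (simp add: field_simps)
    finally have "(\<Sum>i\<in>I. norm (y i)) < d" .
    moreover have "(\<Sum>i\<in>I. norm (y i)) \<ge> 0" by (intro sum_nonneg) auto
    ultimately show ?thesis using Q(2) d(2) by (auto simp: dist_norm)
  qed
  then show "\<exists>\<delta>>0. \<forall>y. (\<forall>i\<in>I. norm (y i) < \<delta>) --> P y"
    using d by (intro exI[of _ "d / (card I + 1)"]) auto
next
  assume "\<exists>\<delta>>0. \<forall>y. (\<forall>i\<in>I. norm (y i) < \<delta>) --> P y"
  then obtain d where d: "d > 0" "\<And>y. (\<forall>i\<in>I. norm (y i) < d) ==> P y" by blast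
  show "eventually P (box_filter I)"
    unfolding box_filter_def eventually_filtercomap
  proof (intro exI conjI allI impI)
    show "eventually (\<lambda>r::real. r < d) (nhds 0)" using d(1) by (intro eventually_nhds_in_open[of "{..<d}", simplified]) auto
    fix y :: "'a \<Rightarrow> complex" assume "(\<Sum>i\<in>I. norm (y i)) < d"
    moreover have "norm (y i) \<le> (\<Sum>i\<in>I. norm (y i))" if "i \<in> I" for i
      using that assms by (intro member_le_sum) auto
    ultimately show "P y" by (intro d(2)) force
  qed
qed

lemma tendsto_box_filter: "finite I ==> i \<in> I ==> ((\<lambda>y. y i) \<longlongrightarrow> 0) (box_filter I)"
  unfolding tendsto_iff by (subst eventually_box_filter) auto

lemma polyfun_difference_quotient:
  fixes F :: "('i \<Rightarrow> complex) \<Rightarrow> complex" and u :: "'n \<Rightarrow> 'i \<Rightarrow> complex"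
  assumes "F \<in> polyfun I" and u: "\<And>i. i \<in> I ==> ((\<lambda>n. u n i) \<longlongrightarrow> 0) N" "(a \<longlongrightarrow> 0) N" "(b \<longlongrightarrow> 0) N"
    and d: "((\<lambda>\<xi>. F ((\<lambda>i. 0)(j := \<xi>))) has_field_derivative d) (at 0)"
  shows "\<exists>D. (\<forall>n. F ((u n)(j := a n)) - F ((u n)(j := b n)) = (a n - b n) * D n) \<and> (D \<longlongrightarrow> d) N"
proof -
  have "\<exists>D d'. (\<forall>n. F ((u n)(j := a n)) - F ((u n)(j := b n)) = (a n - b n) * D n) \<and> (D \<longlongrightarrow> d') N
     \<and> ((\<lambda>\<xi>. F ((\<lambda>i. 0)(j := \<xi>))) has_field_derivative d') (at 0)"
    using assms(1)
  proof (induction rule: polyfun.induct)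
    case (const c)
    show ?case by (intro exI[of _ "\<lambda>_. 0"] exI[of _ 0]) auto
  next
    case (var i)
    show ?case
    proof (intro exI conjI allI)
      show "((u n)(j := a n)) i - ((u n)(j := b n)) i = (a n - b n) * of_bool (i = j)" for n by auto
      show "((\<lambda>n. of_bool (i = j)) \<longlongrightarrow> of_bool (i = j)) N" by auto
      show "((\<lambda>\<xi>. ((\<lambda>i. 0)(j := \<xi>)) i) has_field_derivative of_bool (i = j)) (at 0)"
        by (cases "i = j") auto
    qed
  next
    case (add f g)
    then obtain D d D' d' where *: "\<forall>n. f ((u n)(j := a n)) - f ((u n)(j := b n)) = (a n - b n) * D n" "(D \<longlongrightarrow> d) N"
      "((\<lambda>\<xi>. f ((\<lambda>i. 0)(j := \<xi>))) has_field_derivative d) (at 0)"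
      "\<forall>n. g ((u n)(j := a n)) - g ((u n)(j := b n)) = (a n - b n) * D' n" "(D' \<longlongrightarrow> d') N"
      "((\<lambda>\<xi>. g ((\<lambda>i. 0)(j := \<xi>))) has_field_derivative d') (at 0)"
      by (elim exE conjE) blast
    show ?case
    proof (intro exI[of _ "\<lambda>n. D n + D' n"] exI[of _ "d + d'"] conjI allI)
      show "f ((u n)(j := a n)) + g ((u n)(j := a n)) - (f ((u n)(j := b n)) + g ((u n)(j := b n))) = (a n - b n) * (D n + D' n)" for n
        using *(1)[rule_format, of n] *(4)[rule_format, of n] by (metis add_diff_add distrib_left)
    qed (rule tendsto_add[OF *(2,5)], rule DERIV_add[OF *(3,6)])
  next
    case (mult f g)
    then obtain D d D' d' where *: "\<forall>n. f ((u n)(j := a n)) - f ((u n)(j := b n)) = (a n - b n) * D n" "(D \<longlongrightarrow> d) N"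
      "((\<lambda>\<xi>. f ((\<lambda>i. 0)(j := \<xi>))) has_field_derivative d) (at 0)"
      "\<forall>n. g ((u n)(j := a n)) - g ((u n)(j := b n)) = (a n - b n) * D' n" "(D' \<longlongrightarrow> d') N"
      "((\<lambda>\<xi>. g ((\<lambda>i. 0)(j := \<xi>))) has_field_derivative d') (at 0)"
      by (elim exE conjE) blast
    have lim: "((\<lambda>n. G ((u n)(j := v n))) \<longlongrightarrow> G (\<lambda>i. 0)) N" if "G \<in> polyfun I" "(v \<longlongrightarrow> 0) N" for G v
    proof (rule polyfun_tendsto[OF that(1)])
      show "((\<lambda>n. ((u n)(j := v n)) i) \<longlongrightarrow> 0) N" if "i \<in> I" for i
        using u(1)[OF that] \<open>(v \<longlongrightarrow> 0) N\<close> by (cases "i = j") auto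
    qed
    show ?case
    proof (intro exI[of _ "\<lambda>n. D n * g ((u n)(j := a n)) + f ((u n)(j := b n)) * D' n"] exI[of _ "d * g (\<lambda>i. 0) + f (\<lambda>i. 0) * d'"] conjI allI)
      fix n
      have "f ((u n)(j := a n)) * g ((u n)(j := a n)) - f ((u n)(j := b n)) * g ((u n)(j := b n)) =
        (f ((u n)(j := a n)) - f ((u n)(j := b n))) * g ((u n)(j := a n)) + f ((u n)(j := b n)) * (g ((u n)(j := a n)) - g ((u n)(j := b n)))"
        by (simp add: algebra_simps)
      then show "f ((u n)(j := a n)) * g ((u n)(j := a n)) - f ((u n)(j := b n)) * g ((u n)(j := b n)) =
        (a n - b n) * (D n * g ((u n)(j := a n)) + f ((u n)(j := b n)) * D' n)"
        using *(1,4) by (simp add: algebra_simps)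
    next
      show "((\<lambda>n. D n * g ((u n)(j := a n)) + f ((u n)(j := b n)) * D' n) \<longlongrightarrow> d * g (\<lambda>i. 0) + f (\<lambda>i. 0) * d') N"
        by (intro tendsto_intros * lim mult.hyps u)
      show "((\<lambda>\<xi>. f ((\<lambda>i. 0)(j := \<xi>)) * g ((\<lambda>i. 0)(j := \<xi>))) has_field_derivative d * g (\<lambda>i. 0) + f (\<lambda>i. 0) * d') (at 0)"

      proof -
        have "(\<lambda>i. 0)(j := 0) = (\<lambda>i. 0::complex)" by auto
        then show ?thesis using DERIV_mult[OF *(3,6)] by (simp only: mult.commute)
      qed
    qed
  qed
  then obtain D d' where "\<forall>n. F ((u n)(j := a n)) - F ((u n)(j := b n)) = (a n - b n) * D n" "(D \<longlongrightarrow> d') N"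
     "((\<lambda>\<xi>. F ((\<lambda>i. 0)(j := \<xi>))) has_field_derivative d') (at 0)" by (elim exE conjE) blast
  moreover have "d' = d" using DERIV_unique[OF calculation(3) d] .
  ultimately show ?thesis by blast
qed

context local_hypersurface
begin

abbreviation N where "N \<equiv> box_filter I"

lemma F0: "F (\<lambda>i. 0) = 0"
  using poly_xs_p[OF FI] Fx[of p] sp by simp

lemma jF_tendsto: "((\<lambda>y. F (y(j := 0))) \<longlongrightarrow> 0) N"
proof -
  have "((\<lambda>y. F (y(j := 0))) \<longlongrightarrow> F (\<lambda>i. 0)) N"
  proof (rule polyfun_tendsto[OF FI])
    show "((\<lambda>y. (y(j := 0)) i) \<longlongrightarrow> 0) N" if "i \<in> I" for i
      using that by (cases "i = j") (simp_all add: tendsto_box_filter[OF finI])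
  qed
  then show ?thesis using F0 by simp
qed

text \<open>By continuity of the difference quotient, \<open>F\<close> is in the variable \<open>j\<close> as close to multiplication by \<open>c\<close> as a contraction argument needs.\<close>
lemma increment_bound:
  obtains r where "r > 0"
   "\<And>y a b. (\<forall>i\<in>I. norm (y i) \<le> r) ==> norm a \<le> r ==> norm b \<le> r ==>
      norm (F (y(j := a)) - F (y(j := b)) - c * (a - b)) \<le> norm c / 2 * norm (a - b)"
proof -
  define S where "S = (\<lambda>(y :: 'i \<Rightarrow> complex, a :: complex, b :: complex). (\<Sum>i\<in>I. norm (y i)) + norm a + norm b)"
  define N3 where "N3 = filtercomap S (nhds 0)"
  have lim: "(v \<longlongrightarrow> 0) N3" if v: "\<And>n. norm (v n) \<le> S n" for v :: "('i \<Rightarrow> complex) \<times> complex \<times> complex \<Rightarrow> complex"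
    by (rule Lim_null_comparison[where g=S])
       (use v in \<open>auto simp: N3_def intro: filterlim_filtercomap\<close>)
  have le: "norm (y i) \<le> (\<Sum>i\<in>I. norm (y i))" if "i \<in> I" for i and y :: "'i \<Rightarrow> complex"
    using that finI by (intro member_le_sum) auto
  have nn: "(\<Sum>i\<in>I. norm (y i)) \<ge> 0" for y :: "'i \<Rightarrow> complex" by (intro sum_nonneg) auto
  have "\<exists>D. (\<forall>n. F ((fst n)(j := fst (snd n))) - F ((fst n)(j := snd (snd n))) = (fst (snd n) - snd (snd n)) * D n) \<and> (D \<longlongrightarrow> c) N3"
  proof (rule polyfun_difference_quotient[OF FI _ _ _ dF])
    show "((\<lambda>n. fst n i) \<longlongrightarrow> 0) N3" if "i \<in> I" for i
    proof (rule lim)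
      fix n :: "('i \<Rightarrow> complex) \<times> complex \<times> complex"
      obtain y a b where n: "n = (y, a, b)" by (cases n) auto
      show "norm (fst n i) \<le> S n" using le[OF that, of y] norm_ge_zero[of a] norm_ge_zero[of b] unfolding n S_def prod.case fst_conv by linarith
    qed
    show "((\<lambda>n. fst (snd n)) \<longlongrightarrow> 0) N3" "((\<lambda>n. snd (snd n)) \<longlongrightarrow> 0) N3"
      by (rule lim; use nn in \<open>auto simp: S_def\<close>)+
  qed
  then obtain D where D: "\<And>n. F ((fst n)(j := fst (snd n))) - F ((fst n)(j := snd (snd n))) = (fst (snd n) - snd (snd n)) * D n" "(D \<longlongrightarrow> c) N3"
    by blast
  have "eventually (\<lambda>n. dist (D n) c < norm c / 2) N3" using D(2) c0 by (intro tendstoD) auto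
  then obtain Q where Q: "eventually Q (nhds (0::real))" "\<And>n. Q (S n) ==> dist (D n) c < norm c / 2"
    unfolding N3_def eventually_filtercomap by auto
  then obtain d where d: "d > 0" "\<And>r. dist r 0 < d ==> Q r" unfolding eventually_nhds_metric by auto
  define r where "r = d / (card I + 3)"
  have r: "r > 0" using d unfolding r_def by auto
  show thesis
  proof (rule that[OF r])
    fix y :: "'i \<Rightarrow> complex" and a b :: complex assume y: "\<forall>i\<in>I. norm (y i) \<le> r" "norm a \<le> r" "norm (b::complex) \<le> r"
    have "(\<Sum>i\<in>I. norm (y i)) \<le> (\<Sum>i\<in>I. r)" using y by (intro sum_mono) auto
    then have "S (y, a, b) \<le> (card I + 2) * r" using y by (simp add: S_def algebra_simps)
    also have "\<dots> < (card I + 3) * r" using r by simp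
    also have "\<dots> = d" by (simp add: r_def)
    finally have "S (y, a, b) < d" .
    moreover have "S (y, a, b) \<ge> 0" using nn by (auto simp: S_def)
    ultimately have "dist (D (y, a, b)) c < norm c / 2" using Q(2) d(2) by (auto simp: dist_norm)
    moreover have "F (y(j := a)) - F (y(j := b)) - c * (a - b) = (D (y, a, b) - c) * (a - b)"
      using D(1)[of "(y, a, b)"] by (simp add: algebra_simps)
    moreover have "norm (D (y, a, b) - c) * norm (a - b) \<le> norm c / 2 * norm (a - b)"
      using calculation(1) by (intro mult_right_mono) (auto simp: dist_norm)
    ultimately show "norm (F (y(j := a)) - F (y(j := b)) - c * (a - b)) \<le> norm c / 2 * norm (a - b)"
      by (simp add: norm_mult)
  qed
qed

text \<open>
The holomorphy clause is stated for compositions with curves \<open>g\<close> in one complex variable, because only one-variable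
complex analysis is used: restrictions of \<open>h\<close> to lines suffice below.
\<close>
definition implicit_solution where
  "implicit_solution \<rho> h \<longleftrightarrow> \<rho> > 0 \<and> (\<forall>y. (\<forall>i\<in>I. norm (y i) < \<rho>) -->
        F (y(j := h y)) = 0 \<and> norm (h y) \<le> 2 / norm c * norm (F (y(j := 0))) \<and>
        (\<exists>q. s q \<noteq> 0 \<and> (\<forall>i\<in>I. x i q = (y(j := h y)) i))) \<and>
     (\<forall>g S. open S --> (\<forall>i\<in>I. (\<lambda>z. g z i) holomorphic_on S) --> (\<forall>z\<in>S. \<forall>i\<in>I. norm (g z i) < \<rho>) --> (\<lambda>z. h (g z)) holomorphic_on S)"

text \<open>
For small \<open>y\<close> the map \<open>a \<mapsto> a - F (y(j := a)) / c\<close> is a contraction of a disc by \<open>increment_bound\<close>. Its fixed point is \<open>h y\<close>;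
as a locally uniform limit of iterates it depends holomorphically on \<open>y\<close> along curves.
\<close>
lemma implicit_function: "\<exists>\<rho> h. implicit_solution \<rho> h"
proof -
  obtain r where r: "r > 0"
   "\<And>y a b. (\<forall>i\<in>I. norm (y i) \<le> r) ==> norm a \<le> r ==> norm b \<le> r ==>
      norm (F (y(j := a)) - F (y(j := b)) - c * (a - b)) \<le> norm c / 2 * norm (a - b)"
    using increment_bound by metis
  obtain \<epsilon> where \<epsilon>: "\<epsilon> > 0" "\<And>y. (\<forall>i\<in>I. norm (y i) < \<epsilon>) ==> F y = 0 ==> (\<exists>q. s q \<noteq> 0 \<and> (\<forall>i\<in>I. x i q = y i))"
    using points by auto
  define \<eta> where "\<eta> = norm c / 2 * min (r / 2) (\<epsilon> / 2)"
  have \<eta>0: "\<eta> > 0" using c0 r \<epsilon> unfolding \<eta>_def by auto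
  have "eventually (\<lambda>y. dist (F (y(j := 0))) 0 < \<eta>) N" using jF_tendsto \<eta>0 by (rule tendstoD)
  then obtain \<delta> where \<delta>: "\<delta> > 0" "\<And>y. (\<forall>i\<in>I. norm (y i) < \<delta>) ==> norm (F (y(j := 0))) < \<eta>"
    unfolding eventually_box_filter[OF finI] by auto
  define \<rho> where "\<rho> = min (min r \<delta>) \<epsilon>"
  define T where "T = (\<lambda>(y :: 'i \<Rightarrow> complex) a. a - F (y(j := a)) / c)"
  define B where "B = {y :: 'i \<Rightarrow> complex. \<forall>i\<in>I. norm (y i) < \<rho>}"
  have T: "norm (T y a - T y b) \<le> 1/2 * norm (a - b)" if "y \<in> B" "norm a \<le> r" "norm b \<le> r" for y a b
  proof -
    have "T y a - T y b = - (F (y(j := a)) - F (y(j := b)) - c * (a - b)) / c"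
      unfolding T_def using c0 by (simp add: field_simps)
    then have "norm (T y a - T y b) = norm (F (y(j := a)) - F (y(j := b)) - c * (a - b)) / norm c"
      by (simp add: norm_divide norm_minus_commute)
    also have "\<dots> \<le> (norm c / 2 * norm (a - b)) / norm c"
      using that by (intro divide_right_mono r(2)) (auto simp: B_def \<rho>_def less_imp_le)
    also have "\<dots> = 1/2 * norm (a - b)" using c0 by simp
    finally show ?thesis .
  qed
  have T0: "norm (T y 0) = norm (F (y(j := 0))) / norm c" for y
    unfolding T_def by (simp add: norm_divide)
  have T0': "norm (T y 0) \<le> r / 2" if "y \<in> B" for y
  proof -
    have "norm (F (y(j := 0))) < \<eta>" using \<delta>(2)[of y] that by (auto simp: B_def \<rho>_def)
    also have "\<eta> \<le> norm c * (r / 2)"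
    proof -
      have "norm c / 2 * min (r / 2) (\<epsilon> / 2) \<le> norm c / 2 * (r / 2)" by (intro mult_left_mono) auto
      also have "\<dots> \<le> norm c * (r / 2)" using r(1) by (intro mult_right_mono) auto
      finally show ?thesis unfolding \<eta>_def .
    qed
    finally show ?thesis unfolding T0 using c0 by (simp add: field_simps)
  qed
  have Tr: "norm (T y a) \<le> r" if "y \<in> B" "norm a \<le> r" for y a
    using norm_triangle_ineq[of "T y a - T y 0" "T y 0"] T[OF that(1,2), of 0] T0'[OF that(1)] that(2) r(1) by simp
  have ex: "\<exists>!a\<in>cball 0 r. T y a = a" if "y \<in> B" for y
    by (rule Banach_fix[where c="1/2"]) (use r(1) T[OF that] Tr[OF that] in \<open>auto simp: dist_norm complete_eq_closed\<close>)
  define h where "h = (\<lambda>y. THE a. a \<in> cball 0 r \<and> T y a = a)"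
  have h: "norm (h y) \<le> r" "T y (h y) = h y" if "y \<in> B" for y
    using theI'[OF ex[OF that]] unfolding h_def by auto
  have hF: "F (y(j := h y)) = 0" if "y \<in> B" for y
    using h(2)[OF that] c0 unfolding T_def by simp
  have hb: "norm (h y) \<le> 2 / norm c * norm (F (y(j := 0)))" if "y \<in> B" for y
    using norm_triangle_ineq[of "T y (h y) - T y 0" "T y 0"] T[OF that h(1)[OF that], of 0] r(1) h(2)[OF that] T0[of y] by simp
  have hq: "\<exists>q. s q \<noteq> 0 \<and> (\<forall>i\<in>I. x i q = (y(j := h y)) i)" if "y \<in> B" for y
  proof (rule \<epsilon>(2))
    have "norm (F (y(j := 0))) < \<eta>" using \<delta>(2)[of y] that by (auto simp: B_def \<rho>_def)
    then have "2 / norm c * norm (F (y(j := 0))) < 2 / norm c * \<eta>" using c0 by (intro mult_strict_left_mono) auto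
    also have "\<dots> < \<epsilon>" unfolding \<eta>_def using c0 \<epsilon>(1) by (simp add: min_def)
    finally have "norm (h y) < \<epsilon>" using hb[OF that] by simp
    then show "\<forall>i\<in>I. norm ((y(j := h y)) i) < \<epsilon>" using that by (auto simp: B_def \<rho>_def)
    show "F (y(j := h y)) = 0" by (rule hF[OF that])
  qed
  define it where "it = (\<lambda>n y. (T y ^^ n) 0)"
  have it: "norm (it n y) \<le> r \<and> norm (it n y - h y) \<le> (1/2)^n * r" if "y \<in> B" for n y
  proof (induction n)
    case 0 then show ?case using h(1)[OF that] r(1) by (simp add: it_def)
  next
    case (Suc n)
    have "norm (T y (it n y) - T y (h y)) \<le> 1/2 * norm (it n y - h y)" using T[OF that] Suc h(1)[OF that] by auto
    also have "\<dots> \<le> (1/2)^Suc n * r" using Suc by simp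
    finally show ?case using Tr[OF that] Suc h(2)[OF that] by (simp add: it_def)
  qed
  have hol: "(\<lambda>z. h (g z)) holomorphic_on S" if S: "open S" and g: "\<And>i. i \<in> I ==> (\<lambda>z. g z i) holomorphic_on S"
     and gB: "\<And>z. z \<in> S ==> g z \<in> B" for g S
  proof (rule holomorphic_uniform_sequence[OF S])
    show "(\<lambda>z. it n (g z)) holomorphic_on S" for n
    proof (induction n)
      case 0 then show ?case by (simp add: it_def)
    next
      case (Suc n)
      have "(\<lambda>z. F ((g z)(j := it n (g z)))) holomorphic_on S"

      proof (rule polyfun_holomorphic[OF FI])
        show "(\<lambda>z. ((g z)(j := it n (g z))) i) holomorphic_on S" if "i \<in> I" for i
          using g[OF that] Suc by (cases "i = j") auto
      qed
      then have "(\<lambda>z. T (g z) (it n (g z))) holomorphic_on S"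
        unfolding T_def using Suc c0 by (intro holomorphic_intros) auto
      then show ?case by (simp add: it_def)
    qed
    have ul: "uniform_limit S (\<lambda>n z. it n (g z)) (\<lambda>z. h (g z)) sequentially"
    proof (rule uniform_limitI)
      fix e :: real assume "e > 0"
      have "(\<lambda>n. (1/2)^n * r) \<longlonglongrightarrow> 0" by (intro tendsto_mult_left_zero LIMSEQ_power_zero) auto
      from order_tendstoD(2)[OF this \<open>e > 0\<close>]
      show "\<forall>\<^sub>F n in sequentially. \<forall>z\<in>S. dist (it n (g z)) (h (g z)) < e"
      proof eventually_elim
        case (elim n)
        show ?case
        proof
          fix z assume "z \<in> S"
          then have "dist (it n (g z)) (h (g z)) \<le> (1/2)^n * r" using it[OF gB, of z n] by (simp add: dist_norm)
          then show "dist (it n (g z)) (h (g z)) < e" using elim by simp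
        qed
      qed
    qed
    fix z assume "z \<in> S"
    then obtain d where "d > 0" "cball z d \<subseteq> S" using S open_contains_cball by blast
    then show "\<exists>d>0. cball z d \<subseteq> S \<and> uniform_limit (cball z d) (\<lambda>n z. it n (g z)) (\<lambda>z. h (g z)) sequentially"
      using uniform_limit_on_subset[OF ul] by blast
  qed
  have "\<rho> > 0" using r \<delta> \<epsilon> by (auto simp: \<rho>_def)
  then show ?thesis
    using hF hb hq hol unfolding B_def implicit_solution_def by (intro exI[of _ \<rho>] exI[of _ h]) auto
qed

end

section \<open>Prime ideals and curves on the graph\<close>

context local_hypersurface
begin

text \<open>The square of the ideal \<open>M\<close>; as \<open>M\<close> is closed under multiplication by \<open>A\<close>, sums of products suffice.\<close>
inductive_set M2 :: "('q \<Rightarrow> complex) set" where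
  prod: "f \<in> M ==> g \<in> M ==> (\<lambda>q. f q * g q) \<in> M2"
| sum: "f \<in> M2 ==> g \<in> M2 ==> (\<lambda>q. f q + g q) \<in> M2"

end

text \<open>A choice of points \<open>pt y\<close> of the variety above the graph of an implicit function \<open>h\<close>.\<close>
locale hypersurface_section = local_hypersurface A p I x s F j c
  for A :: "('q \<Rightarrow> complex) set" and p and I :: "'i set" and x s F j c +
  fixes \<rho> :: real and h :: "('i \<Rightarrow> complex) \<Rightarrow> complex" and pt :: "('i \<Rightarrow> complex) \<Rightarrow> 'q"
  assumes \<rho>: "\<rho> > 0"
    and hb: "\<And>y. (\<forall>i\<in>I. norm (y i) < \<rho>) ==> norm (h y) \<le> 2 / norm c * norm (F (y(j := 0)))"
    and pts: "\<And>y. (\<forall>i\<in>I. norm (y i) < \<rho>) ==> s (pt y) \<noteq> 0 \<and> (\<forall>i\<in>I. x i (pt y) = (y(j := h y)) i)"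
    and hol: "\<And>g S. open S ==> (\<And>i. i \<in> I ==> (\<lambda>z. g z i) holomorphic_on S) ==>
        (\<And>z i. z \<in> S ==> i \<in> I ==> norm (g z i) < \<rho>) ==> (\<lambda>z. h (g z)) holomorphic_on S"
begin

abbreviation hat where "hat y \<equiv> y(j := h y)"

lemma eventually_small: "eventually (\<lambda>y. \<forall>i\<in>I. norm (y i) < \<rho>) N"
  unfolding eventually_box_filter[OF finI] using \<rho> by auto

lemma h_tendsto: "(h \<longlongrightarrow> 0) N"
proof (rule Lim_null_comparison)
  show "eventually (\<lambda>y. norm (h y) \<le> 2 / norm c * norm (F (y(j := 0)))) N"
    using eventually_small by eventually_elim (rule hb)
  have "((\<lambda>y. 2 / norm c * norm (F (y(j := 0)))) \<longlongrightarrow> 2 / norm c * norm (0::complex)) N"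
    by (intro tendsto_intros jF_tendsto)
  then show "((\<lambda>y. 2 / norm c * norm (F (y(j := 0)))) \<longlongrightarrow> 0) N" by simp
qed

lemma hat_tendsto:
  assumes "G \<in> polyfun I" shows "((\<lambda>y. G (hat y)) \<longlongrightarrow> G (\<lambda>i. 0)) N"
proof (rule polyfun_tendsto[OF assms])
  show "((\<lambda>y. (hat y) i) \<longlongrightarrow> 0) N" if "i \<in> I" for i
    using that h_tendsto by (cases "i = j") (simp_all add: tendsto_box_filter[OF finI])
qed

lemma poly_pt: "G \<in> polyfun I ==> (\<forall>i\<in>I. norm (y i) < \<rho>) ==> G (xs (pt y)) = G (hat y)"
  using pts[of y] by (intro polyfun_cong[of G I "xs (pt y)" "hat y"]) auto

text \<open>The fraction \<open>G / H\<close> describes \<open>f\<close> along the section \<open>pt\<close>. The value at \<open>p\<close> is listed separately because \<open>pt (\<lambda>i. 0)\<close> need not be \<open>p\<close>.\<close>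
definition represents where
  "represents G H f \<longleftrightarrow> G \<in> polyfun I \<and> H \<in> polyfun I \<and> H (\<lambda>i. 0) \<noteq> 0 \<and> H (\<lambda>i. 0) * f p = G (\<lambda>i. 0) \<and>
    (\<forall>y. (\<forall>i\<in>I. norm (y i) < \<rho>) --> H (hat y) * f (pt y) = G (hat y))"

lemma representsD:
  assumes "represents G H f"
  shows "G \<in> polyfun I" "H \<in> polyfun I" "H (\<lambda>i. 0) \<noteq> 0" "H (\<lambda>i. 0) * f p = G (\<lambda>i. 0)"
    "\<And>y. (\<forall>i\<in>I. norm (y i) < \<rho>) ==> H (hat y) * f (pt y) = G (hat y)"
    "eventually (\<lambda>y. H (hat y) \<noteq> 0) N"
proof -
  show *: "G \<in> polyfun I" "H \<in> polyfun I" "H (\<lambda>i. 0) \<noteq> 0" "H (\<lambda>i. 0) * f p = G (\<lambda>i. 0)"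
    "\<And>y. (\<forall>i\<in>I. norm (y i) < \<rho>) ==> H (hat y) * f (pt y) = G (hat y)"
    using assms unfolding represents_def by blast+
  show "eventually (\<lambda>y. H (hat y) \<noteq> 0) N"
    using tendsto_imp_eventually_ne[OF hat_tendsto[OF *(2)] *(3)] .
qed

lemma local_fraction:
  assumes "f \<in> A"
  shows "\<exists>G H. represents G H f"
proof -
  from loc[OF assms] obtain G H where GH: "G \<in> polyfun I" "H \<in> polyfun I" "H (\<lambda>i. 0) \<noteq> 0"
    "\<And>q. s q \<noteq> 0 ==> H (xs q) * f q = G (xs q)" by blast
  have "H (\<lambda>i. 0) * f p = G (\<lambda>i. 0)" using GH(4)[OF sp] unfolding poly_xs_p[OF GH(1)] poly_xs_p[OF GH(2)] .
  moreover have "H (hat y) * f (pt y) = G (hat y)" if "\<forall>i\<in>I. norm (y i) < \<rho>" for y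
    using GH(4)[of "pt y"] pts[OF that] unfolding poly_pt[OF GH(1) that] poly_pt[OF GH(2) that] by blast
  ultimately have "represents G H f" unfolding represents_def using GH(1-3) by blast
  then show ?thesis by blast
qed

text \<open>The functions whose restriction to the graph vanishes on the coordinate subspace \<open>y i = 0\<close>, \<open>i \<in> J\<close>, near the origin.\<close>
definition germ :: "'i set \<Rightarrow> ('q \<Rightarrow> complex) set" where
  "germ J = {f \<in> A. eventually (\<lambda>y. (\<forall>i\<in>J. y i = 0) --> f (pt y) = 0) N}"

text \<open>The germs of holomorphic functions on a coordinate subspace form a domain. This reduces to one variable: on the complex line through a point where the first factor is not zero and one where the second is not, the product would vanish identically.\<close>
lemma germ_poly_product:
  assumes G: "G \<in> polyfun I" "G' \<in> polyfun I"
    and prod: "eventually (\<lambda>y. (\<forall>i\<in>J. y i = 0) --> G (hat y) * G' (hat y) = 0) N"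
  shows "eventually (\<lambda>y. (\<forall>i\<in>J. y i = 0) --> G (hat y) = 0) N \<or>
         eventually (\<lambda>y. (\<forall>i\<in>J. y i = 0) --> G' (hat y) = 0) N"
proof -
  obtain \<delta>0 where \<delta>0: "\<delta>0 > 0" "\<And>y. (\<forall>i\<in>I. norm (y i) < \<delta>0) ==> (\<forall>i\<in>J. y i = 0) ==> G (hat y) * G' (hat y) = 0"
    using prod unfolding eventually_box_filter[OF finI] by blast
  define \<delta> where "\<delta> = min \<delta>0 \<rho>"
  have \<delta>: "\<delta> > 0" using \<delta>0 \<rho> by (auto simp: \<delta>_def)
  have "(\<forall>y. (\<forall>i\<in>I. norm (y i) < \<delta>) --> (\<forall>i\<in>J. y i = 0) --> G (hat y) = 0) \<or>
    (\<forall>y. (\<forall>i\<in>I. norm (y i) < \<delta>) --> (\<forall>i\<in>J. y i = 0) --> G' (hat y) = 0)"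
  proof (rule ccontr)
    assume "\<not> ?thesis"
    then obtain y0 y1 where y0: "\<forall>i\<in>I. norm (y0 i) < \<delta>" "\<forall>i\<in>J. y0 i = 0" "G (hat y0) \<noteq> 0"
      and y1: "\<forall>i\<in>I. norm (y1 i) < \<delta>" "\<forall>i\<in>J. y1 i = 0" "G' (hat y1) \<noteq> 0" by blast
    define l where "l = (\<lambda>z i. y0 i + z * (y1 i - y0 i))"
    have l01: "l 0 = y0" "l 1 = y1" by (auto simp: l_def)
    have hl: "(\<lambda>z. l z i) holomorphic_on UNIV" for i unfolding l_def by (intro holomorphic_intros)
    define S where "S = (\<Inter>i\<in>I. {z. norm (l z i) < \<delta>})"
    have opS: "open S" unfolding S_def
    proof (intro open_INT finI ballI)
      fix i
      have "continuous_on UNIV (\<lambda>z. norm (l z i))"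
        by (intro continuous_intros holomorphic_on_imp_continuous_on[OF hl])
      then show "open {z. norm (l z i) < \<delta>}" by (intro open_Collect_less continuous_on_const)
    qed
    have "convex S" unfolding S_def
    proof (intro convex_INT)
      fix i
      show "convex {z. norm (l z i) < \<delta>}"
      proof (rule convexI)
        fix a b u v assume ab: "a \<in> {z. norm (l z i) < \<delta>}" "b \<in> {z. norm (l z i) < \<delta>}" and uv: "0 \<le> u" "0 \<le> v" "u + v = (1::real)"
        have "l (u *\<^sub>R a + v *\<^sub>R b) i = u *\<^sub>R l a i + v *\<^sub>R l b i"
        proof -
          have "y0 i = (of_real u + of_real v) * y0 i" using uv by (simp flip: of_real_add)
          then show ?thesis unfolding l_def scaleR_conv_of_real by (simp add: algebra_simps)
        qed
        moreover have "u *\<^sub>R l a i + v *\<^sub>R l b i \<in> ball 0 \<delta>"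
          by (rule convexD[OF convex_ball]) (use ab uv in auto)
        ultimately show "u *\<^sub>R a + v *\<^sub>R b \<in> {z. norm (l z i) < \<delta>}" by simp
      qed
    qed
    then have cS: "connected S" by (rule convex_connected)
    have hh: "(\<lambda>z. h (l z)) holomorphic_on S"
      by (rule hol[OF opS]) (use hl in \<open>auto intro: holomorphic_on_subset simp: S_def \<delta>_def\<close>)
    have hhat: "(\<lambda>z. (hat (l z)) i) holomorphic_on S" for i
      using hh holomorphic_on_subset[OF hl[of i]] by (cases "i = j") auto
    have zero: "l z i = 0" if "i \<in> J" for z i using y0 y1 that by (auto simp: l_def)
    have "G' (hat (l 1)) = 0"
    proof (rule holomorphic_product_zero[OF opS cS, where f="\<lambda>z. G (hat (l z))" and g="\<lambda>z. G' (hat (l z))" and a=0 and z=1])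
      show "(\<lambda>z. G (hat (l z))) holomorphic_on S" "(\<lambda>z. G' (hat (l z))) holomorphic_on S"
        by (rule polyfun_holomorphic[OF G(1)] polyfun_holomorphic[OF G(2)]; rule hhat)+
      show "G (hat (l z)) * G' (hat (l z)) = 0" if "z \<in> S" for z
        by (rule \<delta>0(2)) (use that zero in \<open>auto simp: S_def \<delta>_def\<close>)
      show "0 \<in> S" "1 \<in> S" using y0 y1 unfolding S_def by (auto simp: l01)
      show "G (hat (l 0)) \<noteq> 0" using y0 l01 by simp
    qed
    then show False using y1 l01 by simp
  qed
  then show ?thesis unfolding eventually_box_filter[OF finI] using \<delta> by blast
qed

lemma germ_prime: "prime_in A (germ J)"
  unfolding prime_in_def
proof (intro conjI ballI impI)
  show "germ J \<subseteq> A" unfolding germ_def by auto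
  show "(\<lambda>q. 0) \<in> germ J" unfolding germ_def using const by auto
  show "(\<lambda>q. 1) \<notin> germ J"
  proof
    assume "(\<lambda>q. 1) \<in> germ J"
    then obtain \<delta> where "\<delta> > 0" "\<And>y :: 'i \<Rightarrow> complex. (\<forall>i\<in>I. norm (y i) < \<delta>) ==> \<not> (\<forall>i\<in>J. y i = 0)"
      unfolding germ_def eventually_box_filter[OF finI] by auto
    from this(2)[of "\<lambda>_. 0"] this(1) show False by auto
  qed
next
  fix f g assume "f \<in> germ J" "g \<in> germ J"
  then have fg: "f \<in> A" "g \<in> A" "eventually (\<lambda>y. (\<forall>i\<in>J. y i = 0) --> f (pt y) = 0) N" "eventually (\<lambda>y. (\<forall>i\<in>J. y i = 0) --> g (pt y) = 0) N"
    unfolding germ_def by auto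
  from fg(3,4) have "eventually (\<lambda>y. (\<forall>i\<in>J. y i = 0) --> f (pt y) + g (pt y) = 0) N" by eventually_elim auto
  then show "(\<lambda>q. f q + g q) \<in> germ J" unfolding germ_def using fg add[OF fg(1,2)] by simp
next
  fix f g assume "f \<in> A" "g \<in> germ J"
  then have fg: "f \<in> A" "g \<in> A" "eventually (\<lambda>y. (\<forall>i\<in>J. y i = 0) --> g (pt y) = 0) N"
    unfolding germ_def by auto
  from fg(3) have "eventually (\<lambda>y. (\<forall>i\<in>J. y i = 0) --> f (pt y) * g (pt y) = 0) N" by eventually_elim auto
  then show "(\<lambda>q. f q * g q) \<in> germ J" unfolding germ_def using fg mult[OF fg(1,2)] by simp
next
  fix f g assume f: "f \<in> A" and g: "g \<in> A" and fg: "(\<lambda>q. f q * g q) \<in> germ J"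
  obtain G H where "represents G H f" using local_fraction[OF f] by blast
  note GH = representsD[OF this]
  obtain G' H' where "represents G' H' g" using local_fraction[OF g] by blast
  note GH' = representsD[OF this]
  have "eventually (\<lambda>y. (\<forall>i\<in>J. y i = 0) --> f (pt y) * g (pt y) = 0) N" using fg unfolding germ_def by auto
  then have "eventually (\<lambda>y. (\<forall>i\<in>J. y i = 0) --> G (hat y) * G' (hat y) = 0) N"
    using eventually_small
  proof eventually_elim
    case (elim y)
    then show ?case using GH(5)[of y] GH'(5)[of y] by auto
  qed
  from germ_poly_product[OF GH(1) GH'(1) this]
  show "f \<in> germ J \<or> g \<in> germ J"
  proof
    assume "eventually (\<lambda>y. (\<forall>i\<in>J. y i = 0) --> G (hat y) = 0) N"
    then have "eventually (\<lambda>y. (\<forall>i\<in>J. y i = 0) --> f (pt y) = 0) N"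
      using GH(6) eventually_small
    proof eventually_elim
      case (elim y)
      then show ?case using GH(5)[of y] by auto
    qed
    then show ?thesis unfolding germ_def using f by auto
  next
    assume "eventually (\<lambda>y. (\<forall>i\<in>J. y i = 0) --> G' (hat y) = 0) N"
    then have "eventually (\<lambda>y. (\<forall>i\<in>J. y i = 0) --> g (pt y) = 0) N"
      using GH'(6) eventually_small
    proof eventually_elim
      case (elim y)
      then show ?case using GH'(5)[of y] by auto
    qed
    then show ?thesis unfolding germ_def using g by auto
  qed
qed

lemma h_zero: "h (\<lambda>i. 0) = 0"
proof -
  have "(\<lambda>i. 0 :: complex)(j := 0) = (\<lambda>i. 0)" by auto
  then show ?thesis using hb[of "\<lambda>i. 0"] \<rho> F0 by simp
qed

lemma germ_M: "germ J \<subseteq> M"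
proof
  fix f assume "f \<in> germ J"
  then have f: "f \<in> A" "eventually (\<lambda>y. (\<forall>i\<in>J. y i = 0) --> f (pt y) = 0) N" unfolding germ_def by auto
  then have f0: "f (pt (\<lambda>i. 0)) = 0" unfolding eventually_box_filter[OF finI] by auto
    obtain G H where "represents G H f" using local_fraction[OF f(1)] by blast
  note GH = representsD[OF this]
  have "hat (\<lambda>i. 0) = (\<lambda>i. 0)" using h_zero by auto
  then have "G (\<lambda>i. 0) = 0" using GH(5)[of "\<lambda>i. 0"] f0 \<rho> by simp
  then show "f \<in> M" unfolding M_def using GH(3,4) f(1) by auto
qed

text \<open>The coordinate \<open>x i\<close> separates the two ideals.\<close>
lemma germ_strict:
  assumes i: "i \<in> I" "i \<noteq> j" "i \<notin> J" shows "germ J \<subset> germ (insert i J)"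
proof (rule psubsetI)
  show "germ J \<subseteq> germ (insert i J)" unfolding germ_def by (auto elim: eventually_mono)
  have "(\<lambda>q. s q * x i q) \<in> germ (insert i J)"
  proof -
    have "eventually (\<lambda>y. (\<forall>k\<in>insert i J. y k = 0) --> s (pt y) * x i (pt y) = 0) N"
      using eventually_small
    proof eventually_elim
      case (elim y) then show ?case using pts[of y] i by auto
    qed
    then show ?thesis unfolding germ_def using sx[OF i(1)] by simp
  qed
  moreover have "(\<lambda>q. s q * x i q) \<notin> germ J"
  proof
    assume "(\<lambda>q. s q * x i q) \<in> germ J"
    then have "eventually (\<lambda>y. (\<forall>k\<in>J. y k = 0) --> s (pt y) * x i (pt y) = 0) N" unfolding germ_def by auto
    then obtain \<delta> where \<delta>: "\<delta> > 0" "\<And>y. (\<forall>i\<in>I. norm (y i) < \<delta>) ==> (\<forall>k\<in>J. y k = 0) ==> s (pt y) * x i (pt y) = 0"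
      unfolding eventually_box_filter[OF finI] by blast
    define t where "t = min \<delta> \<rho> / 2"
    have t: "0 < t" "t < \<delta>" "t < \<rho>" using \<delta> \<rho> by (auto simp: t_def)
    define y where "y = (\<lambda>k. if k = i then complex_of_real t else 0)"
    have y: "norm (y k) < \<delta>" "norm (y k) < \<rho>" for k unfolding y_def using t by auto
    have "s (pt y) * x i (pt y) = 0" using \<delta>(2)[of y] y i by (auto simp: y_def)
    then show False using pts[of y] y i t by (auto simp: y_def)
  qed
  ultimately show "germ J \<noteq> germ (insert i J)" by auto
qed

text \<open>Adding the coordinates different from \<open>j\<close> one at a time to the vanishing conditions gives a chain of \<open>card I\<close> primes.\<close>
lemma germ_chain:
  "finite K ==> K \<subseteq> I - {j} ==> J \<inter> K = {} ==> \<exists>Ps. length Ps = Suc (card K) \<and> sorted_wrt (\<subset>) Ps \<and>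
     (\<forall>P\<in>set Ps. prime_in A P \<and> P \<subseteq> M \<and> germ J \<subseteq> P)"
proof (induction K arbitrary: J rule: finite_induct)
  case empty
  then show ?case using germ_prime germ_M by (intro exI[of _ "[germ J]"]) auto
next
  case (insert i K)
  have "\<exists>Ps. length Ps = Suc (card K) \<and> sorted_wrt (\<subset>) Ps \<and>
     (\<forall>P\<in>set Ps. prime_in A P \<and> P \<subseteq> M \<and> germ (insert i J) \<subseteq> P)"
    by (rule insert.IH) (use insert in auto)
  then obtain Ps where Ps: "length Ps = Suc (card K)" "sorted_wrt (\<subset>) Ps"
    "\<And>P. P\<in>set Ps ==> prime_in A P \<and> P \<subseteq> M \<and> germ (insert i J) \<subseteq> P" by blast
  have st: "germ J \<subset> germ (insert i J)" by (rule germ_strict) (use insert in auto)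
  show ?case
  proof (intro exI[of _ "germ J # Ps"] conjI ballI)
    show "length (germ J # Ps) = Suc (card (insert i K))" using Ps insert by simp
    show "sorted_wrt (\<subset>) (germ J # Ps)" using Ps(2,3) st by auto
    fix P assume "P \<in> set (germ J # Ps)"
    then consider "P = germ J" | "P \<in> set Ps" by auto
    then have "prime_in A P \<and> P \<subseteq> M \<and> germ J \<subseteq> P"
    proof cases
      case 1 then show ?thesis using germ_prime[of J] germ_M[of J] by auto
    next
      case 2 then show ?thesis using Ps(3)[OF 2] st by blast
    qed
    then show "prime_in A P" "P \<subseteq> M" "germ J \<subseteq> P" by auto
  qed
qed

definition curve :: "'i \<Rightarrow> complex \<Rightarrow> 'i \<Rightarrow> complex" where
  "curve i t = (\<lambda>k. if k = i then t else 0)"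

lemma curve_filterlim: "filterlim (curve i) N (at 0)"
  unfolding filterlim_def le_filter_def eventually_filtermap eventually_box_filter[OF finI]
proof (intro allI impI, elim exE conjE)
  fix P \<delta> assume \<delta>: "\<delta> > 0" "\<forall>y. (\<forall>i\<in>I. norm (y i) < \<delta>) --> P (y :: 'i \<Rightarrow> complex)"
  have "eventually (\<lambda>t. dist t (0::complex) < \<delta>) (at 0)" using \<delta>(1) by (auto simp: eventually_at intro!: exI[of _ \<delta>])
  then show "eventually (\<lambda>t. P (curve i t)) (at 0)"
    by eventually_elim (use \<delta> in \<open>auto simp: curve_def\<close>)
qed

lemma curve_value:
  assumes f: "f \<in> A" shows "((\<lambda>t. f (pt (curve i t))) \<longlongrightarrow> f p) (at 0)"
proof -
  obtain G H where "represents G H f" using local_fraction[OF f] by blast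
  note GH = representsD[OF this]
  have "((\<lambda>y. G (hat y) / H (hat y)) \<longlongrightarrow> G (\<lambda>i. 0) / H (\<lambda>i. 0)) N"
    by (intro tendsto_divide hat_tendsto GH)
  moreover have "eventually (\<lambda>y. G (hat y) / H (hat y) = f (pt y)) N"
    using GH(6) eventually_small
  proof eventually_elim
    case (elim y) then show ?case using GH(5)[of y] by (simp add: field_simps)
  qed
  ultimately have "((\<lambda>y. f (pt y)) \<longlongrightarrow> G (\<lambda>i. 0) / H (\<lambda>i. 0)) N"
    by (rule Lim_transform_eventually)
  moreover have "G (\<lambda>i. 0) / H (\<lambda>i. 0) = f p" using GH(3,4) by (simp add: field_simps)
  ultimately show ?thesis using filterlim_compose[OF _ curve_filterlim] by auto
qed

text \<open>Along an axis, \<open>f\<close> is a quotient of functions that are holomorphic in the parameter.\<close>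
lemma curve_derivative:
  assumes f: "f \<in> M" shows "\<exists>d. ((\<lambda>t. f (pt (curve i t)) / t) \<longlongrightarrow> d) (at 0)"
proof -
  have fA: "f \<in> A" and fp: "f p = 0" using f unfolding M_def by auto
  obtain G H where "represents G H f" using local_fraction[OF fA] by blast
  note GH = representsD[OF this]
  have cur: "(\<lambda>t. curve i t k) holomorphic_on S" for k S unfolding curve_def by (cases "k = i") auto
  have "(\<lambda>t. h (curve i t)) holomorphic_on ball 0 \<rho>"
    by (rule hol) (use cur \<rho> in \<open>auto simp: curve_def\<close>)
  then have "(\<lambda>t. (hat (curve i t)) k) holomorphic_on ball 0 \<rho>" for k
    using cur by (cases "k = j") auto
  then have "(\<lambda>t. G (hat (curve i t))) holomorphic_on ball 0 \<rho>"
    by (intro polyfun_holomorphic[OF GH(1)])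
  then obtain d where d: "((\<lambda>t. G (hat (curve i t))) has_field_derivative d) (at 0)"
    using holomorphic_on_imp_differentiable_at[of _ "ball 0 \<rho>" 0] \<rho> by (auto simp: field_differentiable_def)
  have c0: "curve i 0 = (\<lambda>_. 0)" by (auto simp: curve_def)
  have "hat (\<lambda>_. 0) = (\<lambda>_. 0)" using h_zero by auto
  then have "G (hat (curve i 0)) = 0" using GH(4) fp c0 by simp
  then have l1: "((\<lambda>t. G (hat (curve i t)) / t) \<longlongrightarrow> d) (at 0)"
    using d unfolding has_field_derivative_iff by simp
  have l2: "((\<lambda>t. H (hat (curve i t))) \<longlongrightarrow> H (\<lambda>_. 0)) (at 0)"
    using filterlim_compose[OF hat_tendsto[OF GH(2)] curve_filterlim] .
  have "((\<lambda>t. (G (hat (curve i t)) / t) / H (hat (curve i t))) \<longlongrightarrow> d / H (\<lambda>_. 0)) (at 0)"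
    by (intro tendsto_divide l1 l2 GH(3))
  moreover have "eventually (\<lambda>t. (G (hat (curve i t)) / t) / H (hat (curve i t)) = f (pt (curve i t)) / t) (at 0)"
  proof -
    have "eventually (\<lambda>y. \<forall>t. (G (hat y) / t) / H (hat y) = f (pt y) / t) N"
      using GH(6) eventually_small
    proof eventually_elim
      case (elim y)
      then have "G (hat y) = H (hat y) * f (pt y)" using GH(5)[of y] by simp
      then show ?case using elim(1) by simp
    qed
    from eventually_compose_filterlim[OF this curve_filterlim[of i]]
    show ?thesis by (rule eventually_mono) blast
  qed
  ultimately have "((\<lambda>t. f (pt (curve i t)) / t) \<longlongrightarrow> d / H (\<lambda>_. 0)) (at 0)"
    by (rule Lim_transform_eventually)
  then show ?thesis by blast
qed

text \<open>A product of two functions that vanish at the point has derivative zero along every curve through it.\<close>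
lemma M2_curve: "f \<in> M2 ==> ((\<lambda>t. f (pt (curve i t)) / t) \<longlongrightarrow> 0) (at 0)"
proof (induction rule: M2.induct)
  case (prod f g)
  obtain d where "((\<lambda>t. f (pt (curve i t)) / t) \<longlongrightarrow> d) (at 0)" using curve_derivative[OF prod(1)] by blast
  moreover have "((\<lambda>t. g (pt (curve i t))) \<longlongrightarrow> 0) (at 0)" using curve_value[of g i] prod(2) unfolding M_def by auto
  ultimately have "((\<lambda>t. f (pt (curve i t)) / t * g (pt (curve i t))) \<longlongrightarrow> d * 0) (at 0)" by (intro tendsto_mult)
  then show ?case by simp
next
  case (sum f g)
  from tendsto_add[OF sum.IH] show ?case by (simp add: add_divide_distrib)
qed

text \<open>Differentiate the relation along the curve in direction \<open>i\<close>: elements of \<open>M2\<close> have derivative zero, and of the coordinates only \<open>x i\<close> contributes.\<close>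
lemma coordinates_independent:
  assumes a: "(\<lambda>q. \<Sum>k\<in>I - {j}. a k * (s q * x k q)) \<in> M2" and i: "i \<in> I" "i \<noteq> j"
  shows "a i = 0"
proof -
  have ne: "eventually (\<lambda>t. t \<noteq> (0::complex)) (at 0)" by (simp add: eventually_at_filter)
  have "((\<lambda>t. (\<Sum>k\<in>I - {j}. a k * (s (pt (curve i t)) * x k (pt (curve i t)))) / t) \<longlongrightarrow> 0) (at 0)"
    using M2_curve[OF a, of i] by simp
  moreover have "eventually (\<lambda>t. (\<Sum>k\<in>I - {j}. a k * (s (pt (curve i t)) * x k (pt (curve i t)))) / t = a i * s (pt (curve i t))) (at 0)"
    using eventually_compose_filterlim[OF eventually_small curve_filterlim[of i]] ne
  proof eventually_elim
    case (elim t)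
    have "(\<Sum>k\<in>I - {j}. a k * (s (pt (curve i t)) * x k (pt (curve i t)))) = (\<Sum>k\<in>I - {j}. if k = i then a i * s (pt (curve i t)) * t else 0)"
      using pts[OF elim(1)] by (intro sum.cong) (auto simp: curve_def)
    also have "\<dots> = a i * s (pt (curve i t)) * t" using i finI by simp
    finally show ?case using elim(2) by simp
  qed
  ultimately have "((\<lambda>t. a i * s (pt (curve i t))) \<longlongrightarrow> 0) (at 0)"
    by (rule Lim_transform_eventually)
  moreover have "((\<lambda>t. a i * s (pt (curve i t))) \<longlongrightarrow> a i * s p) (at 0)"
    by (intro tendsto_intros curve_value sA)
  ultimately have "a i * s p = 0" using tendsto_unique[OF at_neq_bot] by blast
  then show ?thesis using sp by simp
qed

end

section \<open>Taylor expansion and the cotangent space\<close>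

context local_hypersurface
begin


lemma M2_A_mult:
  assumes "f \<in> A" "g \<in> M2" shows "(\<lambda>q. f q * g q) \<in> M2"
  using assms(2)
proof (induction rule: M2.induct)
  case (prod g h)
  have "(\<lambda>q. f q * g q) \<in> M" using prod(1) mult[OF assms(1), of g] unfolding M_def by simp
  from M2.prod[OF this, of h] prod show ?case by (simp add: mult.assoc)
next
  case (sum g h)
  then show ?case using M2.sum[of "\<lambda>q. f q * g q" "\<lambda>q. f q * h q"] by (simp add: distrib_left)
qed

lemma M2_cmult: "g \<in> M2 ==> (\<lambda>q. a * g q) \<in> M2"
  using M2_A_mult[OF const[of a]] .

lemma M2_zero: "(\<lambda>q. 0) \<in> M2"
  using M2.prod[of "\<lambda>q. 0" "\<lambda>q. 0"] const[of 0] unfolding M_def by simp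

lemma M2_diff: "f \<in> M2 ==> g \<in> M2 ==> (\<lambda>q. f q - g q) \<in> M2"
  using M2.sum[of f "\<lambda>q. - 1 * g q"] M2_cmult[of g "- 1"] by simp

lemma M2_sum: "(\<And>a. a \<in> S ==> f a \<in> M2) ==> (\<lambda>q. \<Sum>a\<in>S. f a q) \<in> M2"
  by (induction S rule: infinite_finite_induct) (auto intro: M2_zero M2.sum)

lemma s_power_M2:
  assumes "f \<in> M" shows "(\<lambda>q. s q ^ k * f q - s p ^ k * f q) \<in> M2"
proof -
  have "(\<lambda>q. s q ^ k - s p ^ k) \<in> M" unfolding M_def using diff[OF power[OF sA] const] by simp
  from M2.prod[OF this assms] show ?thesis by (simp add: algebra_simps)
qed

text \<open>If the \<open>l i\<close> are the partial derivatives of \<open>G\<close> at \<open>0\<close>, this is its expansion to first order; multiplication by \<open>s ^ k\<close> makes the expansion an identity in \<open>A\<close>.\<close>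
definition taylor where
  "taylor G l k \<longleftrightarrow> (\<lambda>q. s q ^ k * (G (xs q) - G (\<lambda>i. 0)) - (\<Sum>i\<in>I. l i * (s q ^ k * x i q))) \<in> M2"

lemma taylor_expansion:
  assumes "G \<in> polyfun I"
  shows "\<exists>l K. (\<forall>k\<ge>K. taylor G l k) \<and> ((\<lambda>\<xi>. G ((\<lambda>i. 0)(j := \<xi>))) has_field_derivative l j) (at 0)"
  using assms
proof (induction rule: polyfun.induct)
  case (const a)
  show ?case by (intro exI[of _ "\<lambda>_. 0"] exI[of _ 0]) (auto simp: taylor_def M2_zero)
next
  case (var i)
  show ?case
  proof (intro exI[of _ "\<lambda>k. of_bool (k = i)"] exI[of _ 0] conjI allI impI)
    fix k :: nat
    have "(\<Sum>m\<in>I. of_bool (m = i) * (s q ^ k * x m q)) = s q ^ k * x i q" for q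
    proof -
      have "(\<Sum>m\<in>I. of_bool (m = i) * (s q ^ k * x m q)) = (\<Sum>m\<in>I. if m = i then s q ^ k * x i q else 0)"
        by (intro sum.cong) auto
      then show ?thesis using var finI by simp
    qed
    then show "taylor (\<lambda>y. y i) (\<lambda>k. of_bool (k = i)) k" unfolding taylor_def using M2_zero by simp
    show "((\<lambda>\<xi>. ((\<lambda>i. 0)(j := \<xi>)) i) has_field_derivative of_bool (j = i)) (at 0)"
      by (cases "i = j") auto
  qed
next
  case (add f g)
  obtain l K where l: "\<And>k. k \<ge> K ==> taylor f l k" "((\<lambda>\<xi>. f ((\<lambda>i. 0)(j := \<xi>))) has_field_derivative l j) (at 0)"
    using add.IH(1) by blast
  obtain l' K' where l': "\<And>k. k \<ge> K' ==> taylor g l' k" "((\<lambda>\<xi>. g ((\<lambda>i. 0)(j := \<xi>))) has_field_derivative l' j) (at 0)"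
    using add.IH(2) by blast
  show ?case
  proof (intro exI[of _ "\<lambda>i. l i + l' i"] exI[of _ "max K K'"] conjI allI impI)
    fix k assume "k \<ge> max K K'"
    then have "taylor f l k" "taylor g l' k" using l l' by auto
    from M2.sum[OF this[unfolded taylor_def]]
    show "taylor (\<lambda>y. f y + g y) (\<lambda>i. l i + l' i) k"
      unfolding taylor_def by (simp add: algebra_simps sum.distrib)
  qed (rule DERIV_add[OF l(2) l'(2)])
next
  case (mult f g)
  obtain l K where l: "\<And>k. k \<ge> K ==> taylor f l k" "((\<lambda>\<xi>. f ((\<lambda>i. 0)(j := \<xi>))) has_field_derivative l j) (at 0)"
    using mult.IH(1) by blast
  obtain l' K' where l': "\<And>k. k \<ge> K' ==> taylor g l' k" "((\<lambda>\<xi>. g ((\<lambda>i. 0)(j := \<xi>))) has_field_derivative l' j) (at 0)"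
    using mult.IH(2) by blast
  define f0 g0 where "f0 = f (\<lambda>i. 0)" and "g0 = g (\<lambda>i. 0)"
  have "(\<lambda>y. f y - f0) \<in> polyfun I" by (intro polyfun_intros mult.hyps)
  from clear_denominators[OF this] obtain n where n: "(\<lambda>q. s q ^ n * (f (xs q) - f0)) \<in> A" by blast
  have "(\<lambda>y. g y - g0) \<in> polyfun I" by (intro polyfun_intros mult.hyps)
  from clear_denominators[OF this] obtain n' where n': "\<And>k. k \<ge> n' ==> (\<lambda>q. s q ^ k * (g (xs q) - g0)) \<in> A" by blast
  have xp0: "f (xs p) = f0" "g (xs p) = g0" unfolding f0_def g0_def by (intro poly_xs_p mult.hyps)+
  show ?case
  proof (intro exI[of _ "\<lambda>i. l i * g0 + f0 * l' i"] exI[of _ "max (n + n') (max K K')"] conjI allI impI)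
    fix k assume k: "k \<ge> max (n + n') (max K K')"
    have "(\<lambda>q. s q ^ n * (f (xs q) - f0)) \<in> M" "(\<lambda>q. s q ^ (k - n) * (g (xs q) - g0)) \<in> M"
      unfolding M_def using n n'[of "k - n"] k xp0 by auto
    from M2.prod[OF this]
    have "(\<lambda>q. (s q ^ n * (f (xs q) - f0)) * (s q ^ (k - n) * (g (xs q) - g0))) \<in> M2" .
    moreover have "(s q ^ n * (f (xs q) - f0)) * (s q ^ (k - n) * (g (xs q) - g0)) = s q ^ k * ((f (xs q) - f0) * (g (xs q) - g0))" for q
    proof -
      have "s q ^ k = s q ^ n * s q ^ (k - n)" using k by (simp flip: power_add)
      then show ?thesis by simp
    qed
    ultimately have 1: "(\<lambda>q. s q ^ k * ((f (xs q) - f0) * (g (xs q) - g0))) \<in> M2" by simp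
    have 2: "(\<lambda>q. g0 * (s q ^ k * (f (xs q) - f0) - (\<Sum>i\<in>I. l i * (s q ^ k * x i q)))) \<in> M2"
      using M2_cmult[OF l(1)[unfolded taylor_def]] k unfolding f0_def by auto
    have 3: "(\<lambda>q. f0 * (s q ^ k * (g (xs q) - g0) - (\<Sum>i\<in>I. l' i * (s q ^ k * x i q)))) \<in> M2"
      using M2_cmult[OF l'(1)[unfolded taylor_def]] k unfolding g0_def by auto
    have "s q ^ k * (f (xs q) * g (xs q) - f0 * g0) - (\<Sum>i\<in>I. (l i * g0 + f0 * l' i) * (s q ^ k * x i q)) =
      s q ^ k * ((f (xs q) - f0) * (g (xs q) - g0)) + g0 * (s q ^ k * (f (xs q) - f0) - (\<Sum>i\<in>I. l i * (s q ^ k * x i q)))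
      + f0 * (s q ^ k * (g (xs q) - g0) - (\<Sum>i\<in>I. l' i * (s q ^ k * x i q)))" for q
    proof -
      have "(\<Sum>i\<in>I. (l i * g0 + f0 * l' i) * (s q ^ k * x i q)) =
         g0 * (\<Sum>i\<in>I. l i * (s q ^ k * x i q)) + f0 * (\<Sum>i\<in>I. l' i * (s q ^ k * x i q))"
        by (simp add: sum_distrib_left sum.distrib[symmetric] algebra_simps)
      then show ?thesis by (simp add: algebra_simps)
    qed
    with M2.sum[OF M2.sum[OF 1 2] 3] show "taylor (\<lambda>y. f y * g y) (\<lambda>i. l i * g0 + f0 * l' i) k"
      unfolding taylor_def f0_def[symmetric] g0_def[symmetric] by simp
  next
    have "(\<lambda>i. 0)(j := 0) = (\<lambda>i. 0::complex)" by auto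
    then show "((\<lambda>\<xi>. f ((\<lambda>i. 0)(j := \<xi>)) * g ((\<lambda>i. 0)(j := \<xi>))) has_field_derivative l j * g0 + f0 * l' j) (at 0)"
      using DERIV_mult[OF l(2) l'(2)] unfolding f0_def g0_def by (simp only: mult.commute)
  qed
qed

lemma sx_M: "i \<in> I ==> (\<lambda>q. s q * x i q) \<in> M"
  unfolding M_def using sx xp by auto

lemma taylor_linear:
  assumes "taylor G l k" "k \<ge> 1"
  shows "(\<lambda>q. s q ^ k * (G (xs q) - G (\<lambda>i. 0)) - (\<Sum>i\<in>I. l i * s p ^ (k - 1) * (s q * x i q))) \<in> M2"
proof -
  have "(\<lambda>q. \<Sum>i\<in>I. l i * (s q ^ (k - 1) * (s q * x i q) - s p ^ (k - 1) * (s q * x i q))) \<in> M2"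
    by (intro M2_sum M2_cmult s_power_M2 sx_M)
  from M2.sum[OF assms(1)[unfolded taylor_def] this]
  have "(\<lambda>q. s q ^ k * (G (xs q) - G (\<lambda>i. 0)) - (\<Sum>i\<in>I. l i * (s q ^ k * x i q)) +
     (\<Sum>i\<in>I. l i * (s q ^ (k - 1) * (s q * x i q) - s p ^ (k - 1) * (s q * x i q)))) \<in> M2" .
  moreover have "(\<Sum>i\<in>I. l i * (s q ^ (k - 1) * (s q * x i q) - s p ^ (k - 1) * (s q * x i q))) =
     (\<Sum>i\<in>I. l i * (s q ^ k * x i q)) - (\<Sum>i\<in>I. l i * s p ^ (k - 1) * (s q * x i q))" for q
  proof -
    have "s q ^ k = s q ^ (k - 1) * s q" using assms(2) by (cases k) auto
    then show ?thesis by (simp add: sum_subtractf[symmetric] algebra_simps)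
  qed
  ultimately show ?thesis by simp
qed

text \<open>Expanding the numerator of \<open>f\<close> writes \<open>f\<close> modulo \<open>M2\<close> as a combination of all coordinates. Expanding \<open>F\<close>, which vanishes on the variety, gives a relation with coefficient \<open>c \<noteq> 0\<close> at the coordinate \<open>j\<close>, which is therefore redundant.\<close>
lemma coordinates_span:
  assumes f: "f \<in> M"
  shows "\<exists>a. (\<lambda>q. f q - (\<Sum>i\<in>I - {j}. a i * (s q * x i q))) \<in> M2"
proof -
  have fA: "f \<in> A" and fp: "f p = 0" using f unfolding M_def by auto
  from loc[OF fA] obtain G H where GH: "G \<in> polyfun I" "H \<in> polyfun I" "H (\<lambda>i. 0) \<noteq> 0"
    "\<And>q. s q \<noteq> 0 ==> H (xs q) * f q = G (xs q)" by blast
  have G0: "G (\<lambda>i. 0) = 0" using GH(4)[OF sp] fp unfolding poly_xs_p[OF GH(1)] by simp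
  obtain l K where l: "\<And>k. k \<ge> K ==> taylor G l k" using taylor_expansion[OF GH(1)] by blast
  obtain lF KF where lF: "\<And>k. k \<ge> KF ==> taylor F lF k"
    "((\<lambda>\<xi>. F ((\<lambda>i. 0)(j := \<xi>))) has_field_derivative lF j) (at 0)" using taylor_expansion[OF FI] by blast
  have lFj: "lF j = c" using DERIV_unique[OF lF(2) dF] .
  obtain n where n: "\<And>k. k \<ge> n ==> (\<lambda>q. s q ^ k * H (xs q)) \<in> A" using clear_denominators[OF GH(2)] by blast
  define k where "k = Suc (n + K + KF)"
  define b where "b = (\<lambda>i q. s q * x i q)"
  define \<sigma> where "\<sigma> = s p ^ (k - 1)"
  have \<sigma>: "\<sigma> \<noteq> 0" using sp by (simp add: \<sigma>_def)
  have "(\<lambda>q. s q ^ k * (F (xs q) - F (\<lambda>i. 0)) - (\<Sum>i\<in>I. lF i * \<sigma> * b i q)) \<in> M2"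
    unfolding \<sigma>_def b_def by (rule taylor_linear[OF lF(1)]) (auto simp: k_def)
  moreover have "s q ^ k * (F (xs q) - F (\<lambda>i. 0)) = 0" for q using Fx[of q] F0 by (cases "s q = 0") (auto simp: k_def)
  ultimately have FM: "(\<lambda>q. - (\<Sum>i\<in>I. lF i * \<sigma> * b i q)) \<in> M2" by simp
  have GM: "(\<lambda>q. s q ^ k * (G (xs q) - G (\<lambda>i. 0)) - (\<Sum>i\<in>I. l i * \<sigma> * b i q)) \<in> M2"
    unfolding \<sigma>_def b_def by (rule taylor_linear[OF l(1)]) (auto simp: k_def)
  define u where "u = (\<lambda>q. s q ^ k * H (xs q))"
  have uA: "u \<in> A" unfolding u_def by (rule n) (auto simp: k_def)
  have up: "u p \<noteq> 0" unfolding u_def poly_xs_p[OF GH(2)] using GH(3) sp by simp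
  have Gu: "s q ^ k * (G (xs q) - G (\<lambda>i. 0)) = u q * f q" for q
    unfolding u_def G0 using GH(4)[of q] by (cases "s q = 0") (auto simp: k_def)
  have "(\<lambda>q. u q - u p) \<in> M" unfolding M_def using diff[OF uA const] by simp
  from M2.prod[OF this f] have uM: "(\<lambda>q. (u q - u p) * f q) \<in> M2" .
  have comb: "(\<lambda>q. (1 / u p) * ((u q * f q - (\<Sum>i\<in>I. l i * \<sigma> * b i q)) - (u q - u p) * f q - (l j / c) * (- (\<Sum>i\<in>I. lF i * \<sigma> * b i q)))) \<in> M2"
    by (intro M2_cmult M2_diff uM FM GM[unfolded Gu])
  have split: "(\<Sum>i\<in>I. g i) = g j + (\<Sum>i\<in>I - {j}. g i)" for g :: "'i \<Rightarrow> complex"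
    using finI jI by (simp add: sum.remove)
  define a where "a = (\<lambda>i. (l i - l j / c * lF i) * \<sigma> / u p)"
  have "(1 / u p) * ((u q * f q - (\<Sum>i\<in>I. l i * \<sigma> * b i q)) - (u q - u p) * f q - (l j / c) * (- (\<Sum>i\<in>I. lF i * \<sigma> * b i q))) =
     f q - (\<Sum>i\<in>I - {j}. a i * b i q)" for q
  proof -
    have "(\<Sum>i\<in>I - {j}. a i * b i q) = (1 / u p) * ((\<Sum>i\<in>I - {j}. l i * \<sigma> * b i q) - (l j / c) * (\<Sum>i\<in>I - {j}. lF i * \<sigma> * b i q))"
      unfolding sum_distrib_left sum_subtractf[symmetric] a_def by (intro sum.cong refl) (simp add: field_simps)
    also have "(\<Sum>i\<in>I - {j}. l i * \<sigma> * b i q) - (l j / c) * (\<Sum>i\<in>I - {j}. lF i * \<sigma> * b i q) =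
       (\<Sum>i\<in>I. l i * \<sigma> * b i q) - (l j / c) * (\<Sum>i\<in>I. lF i * \<sigma> * b i q)"
      unfolding split[of "\<lambda>i. l i * \<sigma> * b i q"] split[of "\<lambda>i. lF i * \<sigma> * b i q"] lFj using c0 by (simp add: field_simps)
    finally have *: "(\<Sum>i\<in>I - {j}. a i * b i q) = (1 / u p) * ((\<Sum>i\<in>I. l i * \<sigma> * b i q) - (l j / c) * (\<Sum>i\<in>I. lF i * \<sigma> * b i q))" .
    show ?thesis unfolding * using up by (simp add: field_simps)
  qed
  with comb have "(\<lambda>q. f q - (\<Sum>i\<in>I - {j}. a i * b i q)) \<in> M2" by simp
  then show ?thesis unfolding b_def by blast
qed

theorem chain_and_independence:
  shows "\<exists>Ps. length Ps = card I \<and> sorted_wrt (\<subset>) Ps \<and> (\<forall>P\<in>set Ps. prime_in A P \<and> P \<subseteq> M)"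
    and "\<And>a i. (\<lambda>q. \<Sum>k\<in>I - {j}. a k * (s q * x k q)) \<in> M2 ==> i \<in> I - {j} ==> a i = 0"
proof -
  obtain \<rho> h where "implicit_solution \<rho> h" using implicit_function by blast
  note sol = this[unfolded implicit_solution_def]
  have \<rho>: "\<rho> > 0" using sol by (rule conjunct1)
  have h: "F (y(j := h y)) = 0 \<and> norm (h y) \<le> 2 / norm c * norm (F (y(j := 0))) \<and>
        (\<exists>q. s q \<noteq> 0 \<and> (\<forall>i\<in>I. x i q = (y(j := h y)) i))" if "\<forall>i\<in>I. norm (y i) < \<rho>" for y
    using sol[THEN conjunct2, THEN conjunct1, rule_format, of y] that by simp
  have hol: "(\<lambda>z. h (g z)) holomorphic_on S" if "open S" "\<And>i. i \<in> I ==> (\<lambda>z. g z i) holomorphic_on S"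
     "\<And>z i. z \<in> S ==> i \<in> I ==> norm (g z i) < \<rho>" for g S
    using sol[THEN conjunct2, THEN conjunct2, rule_format, of S g] that by simp
  define pt where "pt = (\<lambda>y. SOME q. s q \<noteq> 0 \<and> (\<forall>i\<in>I. x i q = (y(j := h y)) i))"
  have pts: "s (pt y) \<noteq> 0 \<and> (\<forall>i\<in>I. x i (pt y) = (y(j := h y)) i)" if "\<forall>i\<in>I. norm (y i) < \<rho>" for y
    unfolding pt_def by (rule someI_ex) (rule h[OF that, THEN conjunct2, THEN conjunct2])
  have hb: "norm (h y) \<le> 2 / norm c * norm (F (y(j := 0)))" if "\<forall>i\<in>I. norm (y i) < \<rho>" for y
    using h[OF that, THEN conjunct2, THEN conjunct1] .
  have card: "card I = Suc (card (I - {j}))" using card_Suc_Diff1[OF finI jI] by simp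
  interpret hypersurface_section A p I x s F j c \<rho> h pt
  proof
    show "\<rho> > 0" by fact
  next
    fix y :: "'i \<Rightarrow> complex" assume "\<forall>i\<in>I. norm (y i) < \<rho>"
    then show "norm (h y) \<le> 2 / norm c * norm (F (y(j := 0)))" by (rule hb)
  next
    fix y :: "'i \<Rightarrow> complex" assume "\<forall>i\<in>I. norm (y i) < \<rho>"
    then show "s (pt y) \<noteq> 0 \<and> (\<forall>i\<in>I. x i (pt y) = (y(j := h y)) i)" by (rule pts)
  next
    fix g :: "complex \<Rightarrow> 'i \<Rightarrow> complex" and S assume "open S" "\<And>i. i \<in> I ==> (\<lambda>z. g z i) holomorphic_on S"
     "\<And>z i. z \<in> S ==> i \<in> I ==> norm (g z i) < \<rho>"
    then show "(\<lambda>z. h (g z)) holomorphic_on S" by (rule hol[of S g])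
  qed
  obtain Ps where "length Ps = Suc (card (I - {j}))" "sorted_wrt (\<subset>) Ps" "\<forall>P\<in>set Ps. prime_in A P \<and> P \<subseteq> M"
    using germ_chain[OF finite_Diff[OF finI] subset_refl, of "{}"] by blast
  then show "\<exists>Ps. length Ps = card I \<and> sorted_wrt (\<subset>) Ps \<and> (\<forall>P\<in>set Ps. prime_in A P \<and> P \<subseteq> M)"
    using card by metis
  show "a i = 0" if "(\<lambda>q. \<Sum>k\<in>I - {j}. a k * (s q * x k q)) \<in> M2" "i \<in> I - {j}" for a i
    using coordinates_independent[of a i] that by simp
qed

end

section \<open>Local dimension and cotangent dimension of the ring\<close>

text \<open>A ring with an injective evaluation into functions. This transports the analytic results to the abstract quotient ring that appears in the notion of a smooth point.\<close>
locale evaluated_ring = cring A + local_hypersurface "ev ` carrier A" p I x s F j c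
  for A :: "('a, 'b) ring_scheme" (structure) and ev :: "'a \<Rightarrow> 'q \<Rightarrow> complex" and p and I :: "'i set" and x s F j c +
  fixes K :: "'a set"
  assumes ev_add: "a \<in> carrier A ==> b \<in> carrier A ==> ev (a \<oplus> b) = (\<lambda>q. ev a q + ev b q)"
    and ev_mult: "a \<in> carrier A ==> b \<in> carrier A ==> ev (a \<otimes> b) = (\<lambda>q. ev a q * ev b q)"
    and ev_one: "ev \<one> = (\<lambda>q. 1)"
    and ev_inj: "inj_on ev (carrier A)"
    and K_carrier: "K \<subseteq> carrier A" and ev_K: "ev ` K = range (\<lambda>c q. c)"
begin

definition MA where "MA = {a \<in> carrier A. ev a p = 0}"

lemma ev_zero: "ev \<zero> = (\<lambda>q. 0)"
proof -
  have "ev \<zero> = (\<lambda>q. ev \<zero> q + ev \<zero> q)" using ev_add[OF zero_closed zero_closed] by simp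
  then show ?thesis by (metis add_cancel_right_right)
qed

lemma ev_uminus: "a \<in> carrier A ==> ev (\<ominus> a) = (\<lambda>q. - ev a q)"
proof -
  assume a: "a \<in> carrier A"
  have "(\<lambda>q. ev a q + ev (\<ominus> a) q) = (\<lambda>q. 0)" using ev_add[OF a a_inv_closed[OF a]] ev_zero r_neg[OF a] by simp
  then show ?thesis by (auto simp: fun_eq_iff add_eq_0_iff)
qed

lemma ev_minus: "a \<in> carrier A ==> b \<in> carrier A ==> ev (a \<ominus> b) = (\<lambda>q. ev a q - ev b q)"
  unfolding a_minus_def using ev_add[of a "\<ominus> b"] ev_uminus[of b] by simp

lemma ev_image_iff: "a \<in> carrier A ==> P \<subseteq> carrier A ==> ev a \<in> ev ` P \<longleftrightarrow> a \<in> P"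
  using ev_inj by (meson inj_on_image_mem_iff)

lemma prime_image:
  assumes "primeideal P A" shows "prime_in (ev ` carrier A) (ev ` P)"
proof -
  interpret P: primeideal P A by fact
  have sub: "P \<subseteq> carrier A" using P.a_subset .
  show ?thesis unfolding prime_in_def
  proof (intro conjI ballI impI)
    show "ev ` P \<subseteq> ev ` carrier A" using sub by auto
    have "\<zero> \<in> P" using P.zero_closed .
    then show "(\<lambda>q. 0) \<in> ev ` P" unfolding ev_zero[symmetric] by blast
    have "\<one> \<notin> P" using P.one_imp_carrier P.I_notcarr by blast
    then show "(\<lambda>q. 1) \<notin> ev ` P" unfolding ev_one[symmetric] using ev_image_iff[OF one_closed sub] by blast
  next
    fix f g assume "f \<in> ev ` P" "g \<in> ev ` P"
    then obtain a b where ab: "a \<in> P" "b \<in> P" "f = ev a" "g = ev b" by auto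
    have "ev (a \<oplus> b) = (\<lambda>q. f q + g q)" using ev_add[of a b] ab sub by auto
    moreover have "ev (a \<oplus> b) \<in> ev ` P" using P.a_closed[OF ab(1,2)] by (rule imageI)
    ultimately show "(\<lambda>q. f q + g q) \<in> ev ` P" by simp
  next
    fix f g assume "f \<in> ev ` carrier A" "g \<in> ev ` P"
    then obtain a b where ab: "a \<in> carrier A" "b \<in> P" "f = ev a" "g = ev b" by auto
    have "ev (a \<otimes> b) = (\<lambda>q. f q * g q)" using ev_mult[of a b] ab sub by auto
    moreover have "ev (a \<otimes> b) \<in> ev ` P" using P.I_l_closed[OF ab(2,1)] by (rule imageI)
    ultimately show "(\<lambda>q. f q * g q) \<in> ev ` P" by simp
  next
    fix f g assume "f \<in> ev ` carrier A" "g \<in> ev ` carrier A" and fg: "(\<lambda>q. f q * g q) \<in> ev ` P"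
    then obtain a b where ab: "a \<in> carrier A" "b \<in> carrier A" "f = ev a" "g = ev b" by auto
    then have "ev (a \<otimes> b) \<in> ev ` P" using fg ev_mult by simp
    then have "a \<otimes> b \<in> P" using ev_image_iff[OF _ sub] ab by simp
    then show "f \<in> ev ` P \<or> g \<in> ev ` P" using P.I_prime ab by auto
  qed
qed

lemma prime_vimage:
  assumes P: "prime_in (ev ` carrier A) P" shows "primeideal {a \<in> carrier A. ev a \<in> P} A"
proof -
  note D = prime_inD[OF P]
  have I: "ideal {a \<in> carrier A. ev a \<in> P} A"
  proof (rule idealI)
    show "ring A" by (rule ring_axioms)
    show "subgroup {a \<in> carrier A. ev a \<in> P} (add_monoid A)"
    proof
      fix a b assume "a \<in> {a \<in> carrier A. ev a \<in> P}" "b \<in> {a \<in> carrier A. ev a \<in> P}"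
      then show "a \<otimes>\<^bsub>add_monoid A\<^esub> b \<in> {a \<in> carrier A. ev a \<in> P}"
        using D(4)[of "ev a" "ev b"] ev_add[of a b] by simp
    next
      show "\<one>\<^bsub>add_monoid A\<^esub> \<in> {a \<in> carrier A. ev a \<in> P}" using ev_zero D(2) by simp
    next
      fix a assume a: "a \<in> {a \<in> carrier A. ev a \<in> P}"
      then have "ev (\<ominus> a) = (\<lambda>q. ev (\<ominus> \<one>) q * ev a q)" using ev_uminus[of a] ev_uminus[OF one_closed] ev_one by simp
      moreover have "(\<lambda>q. ev (\<ominus> \<one>) q * ev a q) \<in> P" using D(5)[of "ev (\<ominus> \<one>)" "ev a"] a by simp
      ultimately show "inv\<^bsub>add_monoid A\<^esub> a \<in> {a \<in> carrier A. ev a \<in> P}" using a by (simp add: a_inv_def[symmetric])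
    qed auto
  next
    fix a b assume "a \<in> {a \<in> carrier A. ev a \<in> P}" "b \<in> carrier A"
    then show "b \<otimes> a \<in> {a \<in> carrier A. ev a \<in> P}" "a \<otimes> b \<in> {a \<in> carrier A. ev a \<in> P}"
      using D(5)[of "ev b" "ev a"] ev_mult[of a b] ev_mult[of b a] by (simp_all add: mult.commute)
  qed
  show ?thesis
  proof (rule primeidealI[OF I is_cring])
    show "carrier A \<noteq> {a \<in> carrier A. ev a \<in> P}"
    proof
      assume "carrier A = {a \<in> carrier A. ev a \<in> P}"
      then have "ev \<one> \<in> P" using one_closed by blast
      then show False using D(3) ev_one by simp
    qed
    fix a b assume "a \<in> carrier A" "b \<in> carrier A" "a \<otimes> b \<in> {a \<in> carrier A. ev a \<in> P}"
    then show "a \<in> {a \<in> carrier A. ev a \<in> P} \<or> b \<in> {a \<in> carrier A. ev a \<in> P}"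
      using D(6)[of "ev a" "ev b"] ev_mult[of a b] by simp
  qed
qed

lemma M_image: "M = ev ` MA"
  unfolding M_def MA_def by auto

theorem local_dimension_hypersurface: "local_dimension A MA = enat (card I - 1)"
proof (rule antisym)
  show "local_dimension A MA \<le> enat (card I - 1)"
    unfolding local_dimension_def
  proof (rule SUP_least, clarify)
    fix Ps :: "'a set list" assume Ps: "Ps \<noteq> []" "sorted_wrt (\<subset>) Ps" "\<forall>P\<in>set Ps. primeideal P A \<and> P \<subseteq> MA"
    have carr: "P \<subseteq> carrier A" if "P \<in> set Ps" for P using Ps(3) that unfolding MA_def by blast
    have "sorted_wrt (\<lambda>P Q. ev ` P \<subset> ev ` Q) Ps"
    proof (rule sorted_wrt_mono_rel[OF _ Ps(2)])
      fix P Q assume PQ: "P \<in> set Ps" "Q \<in> set Ps" "P \<subset> Q"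
      then obtain a where "a \<in> Q" "a \<notin> P" by auto
      then have "ev a \<in> ev ` Q" "ev a \<notin> ev ` P" using ev_image_iff[of a P] carr PQ by auto
      then show "ev ` P \<subset> ev ` Q" using PQ by blast
    qed
    then have "length (map ((`) ev) Ps) \<le> card I"
      using Ps(3) prime_image M_image by (intro chain_upper_bound) (auto simp: sorted_wrt_map)
    then show "enat (length Ps - 1) \<le> enat (card I - 1)" by simp
  qed
next
  obtain Ps where Ps: "length Ps = card I" "sorted_wrt (\<subset>) Ps" "\<forall>P\<in>set Ps. prime_in (ev ` carrier A) P \<and> P \<subseteq> M"
    using chain_and_independence(1) by blast
  define pre where "pre = (\<lambda>P. {a \<in> carrier A. ev a \<in> P})"
  have "sorted_wrt (\<lambda>P Q. pre P \<subset> pre Q) Ps"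
  proof (rule sorted_wrt_mono_rel[OF _ Ps(2)])
    fix P Q assume PQ: "P \<in> set Ps" "Q \<in> set Ps" "P \<subset> Q"
    then obtain f where f: "f \<in> Q" "f \<notin> P" by auto
    then obtain a where "a \<in> carrier A" "f = ev a" using Ps(3) PQ prime_inD(1) by blast
    then have "a \<in> pre Q" "a \<notin> pre P" using f by (auto simp: pre_def)
    then show "pre P \<subset> pre Q" using PQ(3) by (auto simp: pre_def)
  qed
  then have 1: "sorted_wrt (\<subset>) (map pre Ps)" by (simp add: sorted_wrt_map)
  have 2: "primeideal P A \<and> P \<subseteq> MA" if P: "P \<in> set (map pre Ps)" for P
  proof -
    obtain P' where P': "P' \<in> set Ps" "P = pre P'" using P by auto
    have "pre P' \<subseteq> MA" using Ps(3) P'(1) unfolding pre_def MA_def M_def by auto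
    then show ?thesis using P' Ps(3) prime_vimage[of P'] unfolding pre_def by auto
  qed
  have "card I > 0" using finI jI by (auto simp: card_gt_0_iff)
  then have "map pre Ps \<noteq> []" using Ps(1) by auto
  then have "enat (length (map pre Ps) - 1) \<le> local_dimension A MA"
    unfolding local_dimension_def using 1 2 by (intro SUP_upper) auto
  then show "enat (card I - 1) \<le> local_dimension A MA" using Ps(1) by simp
qed

lemma MA_ideal: "ideal MA A"
proof (rule idealI)
  show "ring A" by (rule ring_axioms)
  show "subgroup MA (add_monoid A)"
  proof
    fix a assume "a \<in> MA"
    then show "inv\<^bsub>add_monoid A\<^esub> a \<in> MA" unfolding MA_def using ev_uminus by (simp add: a_inv_def[symmetric])
  qed (auto simp: MA_def ev_add ev_zero)
qed (auto simp: MA_def ev_mult)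

abbreviation J where "J \<equiv> ideal_prod A MA MA"

lemma J_ideal: "ideal J A" using ideal_prod_is_ideal[OF MA_ideal MA_ideal] .

lemma J_iff:
  assumes a: "a \<in> carrier A" shows "a \<in> J \<longleftrightarrow> ev a \<in> M2"
proof
  have carr: "J \<subseteq> carrier A" using ideal_prod_in_carrier[OF MA_ideal MA_ideal] .
  show "a \<in> J ==> ev a \<in> M2"
  proof (induction rule: ideal_prod.induct)
    case (prod i j)
    then have "ev (i \<otimes> j) = (\<lambda>q. ev i q * ev j q)" by (intro ev_mult) (auto simp: MA_def)
    moreover have "ev i \<in> M" "ev j \<in> M" using prod M_image by auto
    ultimately show ?case using M2.prod[of "ev i" "ev j"] by simp
  next
    case (sum s1 s2)
    then have "ev (s1 \<oplus> s2) = (\<lambda>q. ev s1 q + ev s2 q)" using carr by (intro ev_add) auto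
    then show ?case using M2.sum[OF sum.IH] by simp
  qed
  have "f \<in> M2 ==> \<exists>b\<in>J. ev b = f" for f
  proof (induction rule: M2.induct)
    case (prod f g)
    then obtain a b where ab: "a \<in> MA" "b \<in> MA" "f = ev a" "g = ev b" unfolding M_image by auto
    have "ev (a \<otimes> b) = (\<lambda>q. f q * g q)" unfolding ab(3,4) using ab(1,2) by (intro ev_mult) (auto simp: MA_def)
    then show ?case using ideal_prod.prod[OF ab(1,2)] by (rule bexI)
  next
    case (sum f g)
    then obtain a b where ab: "a \<in> J" "b \<in> J" "f = ev a" "g = ev b" by auto
    have "ev (a \<oplus> b) = (\<lambda>q. f q + g q)" unfolding ab(3,4) using ab(1,2) carr by (intro ev_add) auto
    then show ?case using ideal_prod.sum[OF ab(1,2)] by (rule bexI)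
  qed
  then show "ev a \<in> M2 ==> a \<in> J" using ev_inj a carr by (metis inj_onD subsetD)
qed

text \<open>The combinations of the coordinates in \<open>T\<close>, modulo the square of the maximal ideal.\<close>
definition linear_span :: "'i set \<Rightarrow> 'a set" where
  "linear_span T = {a \<in> carrier A. \<exists>co. (\<lambda>q. ev a q - (\<Sum>i\<in>T. co i * (s q * x i q))) \<in> M2}"

text \<open>Each new coordinate raises the dimension by one because the coordinates are independent modulo \<open>M2\<close>.\<close>
lemma dimension_linear_span:
  assumes "finite T" "T \<subseteq> I - {j}"
  shows "ring.dimension (A Quot J) (card T) (a_r_coset A J ` K) (a_r_coset A J ` linear_span T)"
  using assms
proof (induction rule: finite_induct)
  interpret J: ideal J A by (rule J_ideal)
  interpret Q: ring "A Quot J" by (rule J.quotient_is_ring)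
  case empty
  have "a_r_coset A J ` linear_span {} = {\<zero>\<^bsub>A Quot J\<^esub>}"
  proof -
    have "linear_span {} = J"
      using J_iff ideal_prod_in_carrier[OF MA_ideal MA_ideal] unfolding linear_span_def by auto
    moreover have "a_r_coset A J a = J" if "a \<in> J" for a
      using that J.a_rcos_const by blast
    moreover have "J \<noteq> {}" using J.zero_closed by blast
    ultimately show ?thesis by (auto simp: FactRing_def)
  qed
  then show ?case by (simp add: Q.zero_dim)
next
  interpret J: ideal J A by (rule J_ideal)
  interpret Q: ring "A Quot J" by (rule J.quotient_is_ring)
  let ?\<pi> = "a_r_coset A J"
  note hom = J.rcos_ring_hom
  case (insert i T)
  have i: "i \<in> I" "i \<noteq> j" using insert by auto
  obtain b where b: "b \<in> carrier A" "ev b = (\<lambda>q. s q * x i q)" using sx[OF i(1)] by auto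
  have E: "Q.line_extension (?\<pi> ` K) (?\<pi> b) (?\<pi> ` linear_span T) = ?\<pi> ` linear_span (insert i T)"
  proof (rule equalityI; rule subsetI)
    fix u assume "u \<in> Q.line_extension (?\<pi> ` K) (?\<pi> b) (?\<pi> ` linear_span T)"
    then obtain k a where ka: "k \<in> K" "a \<in> linear_span T" "u = ?\<pi> k \<otimes>\<^bsub>A Quot J\<^esub> ?\<pi> b \<oplus>\<^bsub>A Quot J\<^esub> ?\<pi> a"
      unfolding Q.line_extension_mem_iff by auto
    have carr: "k \<in> carrier A" "a \<in> carrier A" using ka K_carrier unfolding linear_span_def by auto
    have u: "u = ?\<pi> (k \<otimes> b \<oplus> a)" using ka(3) ring_hom_mult[OF hom carr(1) b(1)] ring_hom_add[OF hom _ carr(2), of "k \<otimes> b"] carr b by simp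
    obtain \<kappa> where \<kappa>: "ev k = (\<lambda>q. \<kappa>)" using ka(1) ev_K by auto
    obtain co where co: "(\<lambda>q. ev a q - (\<Sum>i\<in>T. co i * (s q * x i q))) \<in> M2" using ka(2) unfolding linear_span_def by auto
    have "ev (k \<otimes> b \<oplus> a) q - (\<Sum>m\<in>insert i T. (if m = i then \<kappa> else co m) * (s q * x m q)) = ev a q - (\<Sum>i\<in>T. co i * (s q * x i q))" for q
    proof -
      have "(\<Sum>m\<in>T. (if m = i then \<kappa> else co m) * (s q * x m q)) = (\<Sum>i\<in>T. co i * (s q * x i q))"
        using insert(2) by (intro sum.cong) auto
      then show ?thesis using insert(1,2) carr b \<kappa> by (simp add: ev_add ev_mult)
    qed
    then have "k \<otimes> b \<oplus> a \<in> linear_span (insert i T)" unfolding linear_span_def using co carr b(1)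
      by (auto intro!: exI[of _ "\<lambda>m. if m = i then \<kappa> else co m"])
    then show "u \<in> ?\<pi> ` linear_span (insert i T)" using u by blast
  next
    fix u assume "u \<in> ?\<pi> ` linear_span (insert i T)"
    then obtain a co where a: "a \<in> carrier A" "u = ?\<pi> a" and co: "(\<lambda>q. ev a q - (\<Sum>i\<in>insert i T. co i * (s q * x i q))) \<in> M2"
      unfolding linear_span_def by auto
    have "(\<lambda>q. co i) \<in> ev ` K" unfolding ev_K by blast
    then obtain k where k: "k \<in> K" "ev k = (\<lambda>q. co i)" by (metis imageE)
    have kc: "k \<in> carrier A" using k K_carrier by auto
    define a' where "a' = a \<ominus> k \<otimes> b"
    have a'c: "a' \<in> carrier A" unfolding a'_def using a kc b by simp
    have "ev a' = (\<lambda>q. ev a q - co i * (s q * x i q))" unfolding a'_def using a kc b k by (simp add: ev_minus ev_mult)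
    then have eq: "ev a' q - (\<Sum>i\<in>T. co i * (s q * x i q)) = ev a q - (\<Sum>i\<in>insert i T. co i * (s q * x i q))" for q
      using insert(1,2) by simp
    have "(\<lambda>q. ev a' q - (\<Sum>i\<in>T. co i * (s q * x i q))) \<in> M2" unfolding eq by (rule co)
    then have "a' \<in> linear_span T" unfolding linear_span_def using a'c by blast
    moreover have "u = ?\<pi> k \<otimes>\<^bsub>A Quot J\<^esub> ?\<pi> b \<oplus>\<^bsub>A Quot J\<^esub> ?\<pi> a'"
    proof -
      have "k \<otimes> b \<oplus> a' = a" unfolding a'_def using a kc b by (simp add: a_minus_def) algebra
      then show ?thesis using a(2) ring_hom_mult[OF hom kc b(1)] ring_hom_add[OF hom _ a'c, of "k \<otimes> b"] kc b by simp
    qed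
    ultimately show "u \<in> Q.line_extension (?\<pi> ` K) (?\<pi> b) (?\<pi> ` linear_span T)"
      unfolding Q.line_extension_mem_iff using k(1) by blast
  qed
  have notin: "?\<pi> b \<notin> ?\<pi> ` linear_span T"
  proof
    assume "?\<pi> b \<in> ?\<pi> ` linear_span T"
    then obtain a co where a: "a \<in> carrier A" "?\<pi> b = ?\<pi> a" and co: "(\<lambda>q. ev a q - (\<Sum>i\<in>T. co i * (s q * x i q))) \<in> M2"
      unfolding linear_span_def by auto
    have "b \<ominus> a \<in> J" using quotient_eq_iff_same_a_r_cos[OF J_ideal b(1) a(1)] a(2) by blast
    then have "(\<lambda>q. ev b q - ev a q) \<in> M2" using J_iff[of "b \<ominus> a"] ev_minus[OF b(1) a(1)] a b by simp
    from M2.sum[OF this co] have "(\<lambda>q. s q * x i q - (\<Sum>i\<in>T. co i * (s q * x i q))) \<in> M2" using b(2) by simp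
    moreover have "s q * x i q - (\<Sum>i\<in>T. co i * (s q * x i q)) =
       (\<Sum>m\<in>I - {j}. (if m = i then 1 else if m \<in> T then - co m else 0) * (s q * x m q))" for q
    proof -
      have "(\<Sum>m\<in>I - {j}. (if m = i then 1 else if m \<in> T then - co m else 0) * (s q * x m q)) =
         (\<Sum>m\<in>insert i T. (if m = i then 1 else if m \<in> T then - co m else 0) * (s q * x m q))"
        using insert finI by (intro sum.mono_neutral_right) auto
      also have "\<dots> = s q * x i q + (\<Sum>m\<in>T. (if m = i then 1 else if m \<in> T then - co m else 0) * (s q * x m q))"
        using insert(1,2) by simp
      also have "(\<Sum>m\<in>T. (if m = i then 1 else if m \<in> T then - co m else 0) * (s q * x m q)) = - (\<Sum>i\<in>T. co i * (s q * x i q))"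
        unfolding sum_negf[symmetric] using insert(2) by (intro sum.cong) auto
      finally show ?thesis by simp
    qed
    ultimately have "(\<lambda>q. \<Sum>m\<in>I - {j}. (if m = i then 1 else if m \<in> T then - co m else 0) * (s q * x m q)) \<in> M2" by simp
    from chain_and_independence(2)[OF this, of i] i show False by simp
  qed
  have "Q.dimension (card T) (?\<pi> ` K) (?\<pi> ` linear_span T)" using insert by auto
  moreover have "?\<pi> b \<in> carrier (A Quot J)" using ring_hom_closed[OF hom b(1)] .
  ultimately have "Q.dimension (Suc (card T)) (?\<pi> ` K) (Q.line_extension (?\<pi> ` K) (?\<pi> b) (?\<pi> ` linear_span T))"
    using Q.Suc_dim notin by blast
  then show ?case unfolding E using insert by simp
qed

lemma linear_span_full: "linear_span (I - {j}) = MA"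
proof (rule equalityI; rule subsetI)
  fix a assume "a \<in> linear_span (I - {j})"
  then obtain co where a: "a \<in> carrier A" and co: "(\<lambda>q. ev a q - (\<Sum>i\<in>I - {j}. co i * (s q * x i q))) \<in> M2"
    unfolding linear_span_def by auto
  have van: "f \<in> M2 ==> f p = 0" for f by (induction rule: M2.induct) (auto simp: M_def)
  have "(\<Sum>i\<in>I - {j}. co i * (s p * x i p)) = 0" using xp by (intro sum.neutral) auto
  then show "a \<in> MA" unfolding MA_def using van[OF co] a by simp
next
  fix a assume a: "a \<in> MA"
  then have "ev a \<in> M" using M_image by auto
  from coordinates_span[OF this] show "a \<in> linear_span (I - {j})" using a unfolding linear_span_def MA_def by auto
qed

theorem cotangent_dimension_hypersurface: "has_cotangent_dimension A K MA (card I - 1)"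
proof -
  have "card (I - {j}) = card I - 1" using finI jI by simp
  then show ?thesis
    using dimension_linear_span[of "I - {j}"] finI linear_span_full
    unfolding has_cotangent_dimension_def Let_def by simp
qed

end


section \<open>Two by two matrices\<close>

type_synonym mtx = "complex^2^2"

definition mat2 :: "complex \<Rightarrow> complex \<Rightarrow> complex \<Rightarrow> complex \<Rightarrow> mtx" where
  "mat2 a b c d = (\<chi> i j. if i = 1 then (if j = 1 then a else b) else (if j = 1 then c else d))"

lemma mat2_entries [simp]:
  "mat2 a b c d $ 1 $ 1 = a" "mat2 a b c d $ 1 $ 2 = b" "mat2 a b c d $ 2 $ 1 = c" "mat2 a b c d $ 2 $ 2 = d"
  by (simp_all add: mat2_def)

text \<open>The adjugate. It is the inverse on \<open>SL\<^sub>2\<close>, and unlike the inverse it is polynomial without assumptions.\<close>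
definition adj :: "mtx \<Rightarrow> mtx" where "adj A = mat2 (A $ 2 $ 2) (- A $ 1 $ 2) (- A $ 2 $ 1) (A $ 1 $ 1)"

lemma matrix2_eq_iff: "A = B \<longleftrightarrow> A $ 1 $ 1 = B $ 1 $ 1 \<and> A $ 1 $ 2 = B $ 1 $ 2 \<and> A $ 2 $ 1 = B $ 2 $ 1 \<and> A $ 2 $ 2 = (B :: mtx) $ 2 $ 2"
  unfolding vec_eq_iff forall_2 by (rule conj_assoc)

lemma mult_entry: "(A ** B) $ i $ j = A $ i $ 1 * B $ 1 $ j + A $ i $ 2 * (B :: mtx) $ 2 $ j"
  by (simp add: matrix_matrix_mult_def sum_2)

lemma mat_entry: "(mat c :: mtx) $ 1 $ 1 = c" "(mat c :: mtx) $ 1 $ 2 = 0" "(mat c :: mtx) $ 2 $ 1 = 0" "(mat c :: mtx) $ 2 $ 2 = c"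
  by (simp_all add: mat_def)

lemma trace2: "trace (A :: mtx) = A $ 1 $ 1 + A $ 2 $ 2"
  by (simp add: trace_def sum_2)

lemma adj_entries [simp]: "adj A $ 1 $ 1 = A $ 2 $ 2" "adj A $ 1 $ 2 = - A $ 1 $ 2" "adj A $ 2 $ 1 = - A $ 2 $ 1" "adj A $ 2 $ 2 = A $ 1 $ 1"
  by (simp_all add: adj_def)

lemmas mtx_simps = matrix2_eq_iff mult_entry mat_entry trace2 det_2

lemma scalar_mat_commute: "mat c ** (A :: mtx) = A ** mat c"
  by (simp add: mtx_simps)

lemma adj_mult: assumes "det A = 1" shows "A ** adj A = mat 1" "adj A ** A = mat 1"
  using assms by (simp_all add: mtx_simps algebra_simps)

lemma det_adj [simp]: "det (adj A) = det A"
  by (simp add: det_2 algebra_simps)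

lemma trace_adj [simp]: "trace (adj A) = trace A"
  by (simp add: trace2)

lemma adj_adj [simp]: "adj (adj A) = A"
  by (simp add: mtx_simps)

lemma adj_prod: "adj (A ** B) = adj B ** adj A"
  by (simp add: mtx_simps)

lemma matrix_inv_adj: assumes "det A = 1" shows "matrix_inv A = adj A"
  unfolding matrix_inv_def
proof (rule some_equality)
  show "A ** adj A = mat 1 \<and> adj A ** A = mat 1" using adj_mult[OF assms] by blast
  fix B assume "A ** B = mat 1 \<and> B ** A = mat 1"
  then have "(B ** A) ** adj A = adj A" by simp
  then show "B = adj A" unfolding matrix_mul_assoc[symmetric] adj_mult(1)[OF assms] by simp
qed

lemma trace_mult_commute: "trace (A ** B) = trace (B ** (A :: mtx))"
  by (simp add: mtx_simps)

lemma trace_conj: "det P = 1 ==> trace (P ** A ** adj P) = trace A"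
  using trace_mult_commute[of "P ** A" "adj P"] by (simp add: matrix_mul_assoc adj_mult)

lemma det_conj: "det P = 1 ==> det (P ** A ** adj P) = det A"
  by (simp add: det_mul)

lemma conj_mult: "det P = 1 ==> (P ** A ** adj P) ** (P ** B ** adj P) = P ** (A ** B) ** adj P"
proof -
  assume P: "det P = 1"
  have "(P ** A ** adj P) ** (P ** B ** adj P) = P ** A ** (adj P ** P) ** B ** adj P" by (simp only: matrix_mul_assoc)
  then show ?thesis by (simp add: adj_mult(2)[OF P] matrix_mul_assoc)
qed

fun mprod :: "mtx list \<Rightarrow> mtx" where
  "mprod [] = mat 1"
| "mprod (A # As) = A ** mprod As"

lemma mprod_append: "mprod (As @ Bs) = mprod As ** mprod Bs"
  by (induction As) (auto simp: matrix_mul_assoc)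

lemma det_mprod: "(\<And>A. A \<in> set As ==> det A = 1) ==> det (mprod As) = 1"
  by (induction As) (auto simp: det_mul)

lemma mprod_conj: "det P = 1 ==> mprod (map (\<lambda>A. P ** A ** adj P) As) = P ** mprod As ** adj P"
  by (induction As) (auto simp: adj_mult conj_mult)

lemma diagonalize:
  assumes "det (A :: mtx) = 1" "trace A \<noteq> 2" "trace A \<noteq> - 2"
  obtains l P where "l \<noteq> 0" "l \<noteq> 1 / l" "trace A = l + 1 / l" "det P = 1" "P ** A ** adj P = mat2 l 0 0 (1 / l)"
proof -
  define t where "t = trace A"
  define r where "r = csqrt (t\<^sup>2 - 4)"
  have r2: "r\<^sup>2 = t\<^sup>2 - 4" by (simp add: r_def)
  have r0: "r \<noteq> 0"
  proof
    assume "r = 0"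
    then have "(t - 2) * (t + 2) = 0" using r2 by (simp add: power2_eq_square algebra_simps)
    then show False using assms by (auto simp: t_def eq_neg_iff_add_eq_0)
  qed
  define l \<mu> where "l = (t + r) / 2" and "\<mu> = (t - r) / 2"
  have lm: "l * \<mu> = 1" using r2 by (simp add: l_def \<mu>_def field_simps power2_eq_square)
  have l0: "l \<noteq> 0" using lm by auto
  have mu: "\<mu> = 1 / l" using lm l0 by (simp add: field_simps)
  have sum: "l + \<mu> = t" by (simp add: l_def \<mu>_def field_simps)
  have diff: "l - \<mu> = r" by (simp add: l_def \<mu>_def field_simps)
  have ne: "l \<noteq> \<mu>" using diff r0 by auto
  obtain a b c d where A: "A = mat2 a b c d" by (metis mat2_entries matrix2_eq_iff)
  have tr: "a + d = l + \<mu>" using sum unfolding t_def A by (simp add: trace2)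
  have dt: "a * d - b * c = 1" using assms(1) unfolding A by (simp add: det_2)
  have key: "b * c = (a - l) * (d - l)" and key': "(l - d) = (a - \<mu>)" "(a - l) = \<mu> - d"
  proof -
    show "l - d = a - \<mu>" "a - l = \<mu> - d" using tr by (simp_all add: algebra_simps)
    have "(a - l) * (d - l) = a * d - l * (a + d) + l * l" by (simp add: algebra_simps)
    also have "\<dots> = a * d - 1" unfolding tr using lm by (simp add: algebra_simps)
    finally show "b * c = (a - l) * (d - l)" using dt by (simp add: algebra_simps)
  qed
  have cases: "\<exists>P. det P = 1 \<and> P ** A ** adj P = mat2 l 0 0 \<mu>"
  proof -
    have "\<exists>P. det P \<noteq> 0 \<and> P ** A = mat2 l 0 0 \<mu> ** P"
    proof (cases "a = \<mu>")
      case False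
      then have ne': "l - d \<noteq> 0" "l - d = a - \<mu>" using key' by auto
      \<comment> \<open>rows are left eigenvectors\<close>
      have "det (mat2 (l - d) b (- c) (l - d)) \<noteq> 0"
      proof -
        have "det (mat2 (l - d) b (- c) (l - d)) = (l - d) * (l - d) + b * c" by (simp add: det_2)
        also have "\<dots> = (l - d) * (l - \<mu>)" unfolding key key'(2) by (simp add: algebra_simps)
        finally show ?thesis using ne' ne by simp
      qed
      moreover have "mat2 (l - d) b (- c) (l - d) ** A = mat2 l 0 0 \<mu> ** mat2 (l - d) b (- c) (l - d)"
      proof -
        have "(l - d) * a + b * c = l * (l - d)" unfolding key by (simp add: algebra_simps)
        moreover have "- (c * b) + (l - d) * d = \<mu> * (l - d)"
        proof -
          have "- (c * b) + (l - d) * d = (l - d) * (d + (a - l))" using key by (simp add: algebra_simps)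
          then show ?thesis unfolding key'(2) using sum tr by (simp add: algebra_simps)
        qed
        moreover have "(l - d) * b + b * d = l * b" by (simp add: algebra_simps)
        moreover have "- (c * a) + (l - d) * c = - (\<mu> * c)" unfolding key'(1) by (simp add: algebra_simps)
        ultimately show ?thesis unfolding A by (simp add: mtx_simps)
      qed
      ultimately show ?thesis by blast
    next
      case True
      then have d: "d = l" using key' by auto
      have bc: "b * c = 0" unfolding key d by simp
      have "det (mat2 c (l - \<mu>) (\<mu> - l) b) \<noteq> 0"
      proof -
        have "det (mat2 c (l - \<mu>) (\<mu> - l) b) = b * c + (l - \<mu>) * (l - \<mu>)" by (simp add: det_2 algebra_simps)
        then show ?thesis using bc ne by simp
      qed
      moreover have "mat2 c (l - \<mu>) (\<mu> - l) b ** A = mat2 l 0 0 \<mu> ** mat2 c (l - \<mu>) (\<mu> - l) b"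
        unfolding A using bc by (simp add: mtx_simps True d algebra_simps)
      ultimately show ?thesis by blast
    qed
    then obtain P where P: "det P \<noteq> 0" "P ** A = mat2 l 0 0 \<mu> ** P" by blast
    define k where "k = 1 / csqrt (det P)"
    have k2: "k * k * det P = 1" using P(1) unfolding k_def by (simp add: field_simps flip: power2_eq_square)
    define P' where "P' = mat k ** P"
    have dP': "det P' = 1"
    proof -
      have "det P' = k * k * det P" unfolding P'_def det_2 mult_entry mat_entry by (simp add: algebra_simps)
      then show ?thesis using k2 by simp
    qed
    have "P' ** A = mat2 l 0 0 \<mu> ** P'"

    proof -
      have "P' ** A = mat k ** (mat2 l 0 0 \<mu> ** P)" unfolding P'_def P(2)[symmetric] matrix_mul_assoc ..
      then show ?thesis unfolding P'_def matrix_mul_assoc scalar_mat_commute[of k "mat2 l 0 0 \<mu>"] .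
    qed
    then have "P' ** A ** adj P' = mat2 l 0 0 \<mu>"
      using adj_mult(1)[OF dP'] by (metis matrix_mul_assoc matrix_mul_rid)
    then show ?thesis using dP' by blast
  qed
  then obtain P where "det P = 1" "P ** A ** adj P = mat2 l 0 0 \<mu>" by blast
  then show thesis using that[of l P] l0 mu ne sum t_def by simp
qed

text \<open>A matrix all of whose \<open>SL\<^sub>2\<close>-conjugates are lower triangular is scalar, and a scalar matrix of determinant \<open>1\<close> has trace \<open>2\<close> or \<open>-2\<close>.\<close>
lemma offdiagonal_conjugate:
  assumes "det (A :: mtx) = 1" "trace A \<noteq> 2" "trace A \<noteq> - 2"
  shows "\<exists>P. det P = 1 \<and> (P ** A ** adj P) $ 1 $ 2 \<noteq> 0"
proof (rule ccontr)
  assume no: "\<not> ?thesis"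
  have dets: "det (mat2 0 1 (- 1) 0) = 1" "det (mat2 1 1 0 1) = 1" by (simp_all add: det_2)
  have 1: "(mat 1 ** A ** adj (mat 1)) $ 1 $ 2 = 0" using no det_I by blast
  have 2: "(mat2 0 1 (- 1) 0 ** A ** adj (mat2 0 1 (- 1) 0)) $ 1 $ 2 = 0" using no dets by blast
  have 3: "(mat2 1 1 0 1 ** A ** adj (mat2 1 1 0 1)) $ 1 $ 2 = 0" using no dets by blast
  have b: "A $ 1 $ 2 = 0" using 1 by (simp add: mtx_simps)
  have c: "A $ 2 $ 1 = 0" using 2 by (simp add: mtx_simps)
  have ad: "A $ 1 $ 1 = A $ 2 $ 2" using 3 b c by (simp add: mtx_simps)
  have "A $ 2 $ 2 * A $ 2 $ 2 = 1" using assms(1) b c ad by (simp add: det_2)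
  then have "A $ 2 $ 2 = 1 \<or> A $ 2 $ 2 = - 1" by (simp add: square_eq_1_iff)
  then show False using assms(2,3) ad by (auto simp: trace2)
qed

lemma eigenspace_exists:
  assumes "det (A :: mtx) = 1" "trace A \<noteq> 2" "trace A \<noteq> - 2"
  obtains \<mu> where "{v. A *v v = \<mu> *s v} \<noteq> {0}" "{v. A *v v = \<mu> *s v} \<noteq> UNIV"
proof -
  obtain l P where P: "l \<noteq> 0" "l \<noteq> 1 / l" "trace A = l + 1 / l" "det P = 1" "P ** A ** adj P = mat2 l 0 0 (1 / l)"
    using diagonalize[OF assms] by metis
  have A: "A ** adj P = adj P ** mat2 l 0 0 (1 / l)"
    using P(5) adj_mult(2)[OF P(4)] by (metis matrix_mul_assoc matrix_mul_lid)
  define e1 e2 :: "complex^2" where "e1 = axis 1 1" and "e2 = axis 2 1"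
  have D: "mat2 l 0 0 (1 / l) *v e1 = l *s e1" "mat2 l 0 0 (1 / l) *v e2 = (1 / l) *s e2"
    by (auto simp: vec_eq_iff forall_2 matrix_vector_mult_def sum_2 e1_def e2_def axis_def)
  have Ae: "A *v (adj P *v e1) = l *s (adj P *v e1)" "A *v (adj P *v e2) = (1 / l) *s (adj P *v e2)"
    unfolding matrix_vector_mul_assoc A
    by (simp_all only: matrix_vector_mul_assoc[symmetric] D vector_scalar_commute)
  have ne: "adj P *v e \<noteq> 0" if "e \<noteq> 0" for e
  proof
    assume "adj P *v e = 0"
    then have "P *v (adj P *v e) = 0" by simp
    then show False using that unfolding matrix_vector_mul_assoc adj_mult(1)[OF P(4)] by simp
  qed
  have e: "e1 \<noteq> 0" "e2 \<noteq> 0" by (auto simp: e1_def e2_def)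
  show thesis
  proof (rule that[of l])
    show "{v. A *v v = l *s v} \<noteq> {0}" using Ae(1) ne[OF e(1)] by blast
    have "adj P *v e2 \<notin> {v. A *v v = l *s v}"
    proof
      assume "adj P *v e2 \<in> {v. A *v v = l *s v}"
      then have "A *v (adj P *v e2) = l *s (adj P *v e2)" by (rule CollectD)
      from trans[OF this[symmetric] Ae(2)] have eq: "l *s (adj P *v e2) = (1 / l) *s (adj P *v e2)" .
      have "(l - 1 / l) *s (adj P *v e2) = 0" unfolding vec.scale_left_diff_distrib eq by (rule diff_self)
      then show False using ne[OF e(2)] P(2) P(2)[symmetric] by (simp add: vec.scale_eq_0_iff)
    qed
    then show "{v. A *v v = l *s v} \<noteq> UNIV" by blast
  qed
qed

text \<open>
The matrices of determinant \<open>1\<close> and given trace are parametrised, where \<open>b \<noteq> 0\<close>, by the two entries of the first row. The two last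
hypotheses say that the derivatives of \<open>A \<mapsto> trace (A ** Q)\<close> along this surface vanish; the critical points are the matrices that commute with \<open>Q\<close>.
\<close>
lemma critical_on_quadric:
  assumes "b \<noteq> 0" "c = (a * d - 1) / b"
    and "Q $ 1 $ 1 - Q $ 2 $ 2 + Q $ 1 $ 2 * (d - a) / b = 0" "Q $ 2 $ 1 - Q $ 1 $ 2 * c / b = 0"
  shows "mat2 a b c d ** Q = Q ** mat2 a b c d"
proof -
  have 1: "Q $ 2 $ 1 = Q $ 1 $ 2 * c / b" using assms(4) by simp
  have 2: "Q $ 1 $ 1 = Q $ 2 $ 2 - Q $ 1 $ 2 * (d - a) / b" using assms(3) by (simp add: algebra_simps)
  show ?thesis using assms(1) unfolding matrix2_eq_iff mult_entry mat2_entries 1 2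
    by (simp add: field_simps)
qed


lemma function_ring_simps [simp]:
  "carrier (function_ring X) = X \<rightarrow>\<^sub>E UNIV"
  "f \<otimes>\<^bsub>function_ring X\<^esub> g = (\<lambda>x\<in>X. f x * g x)"
  "\<one>\<^bsub>function_ring X\<^esub> = (\<lambda>x\<in>X. 1)"
  "\<zero>\<^bsub>function_ring X\<^esub> = (\<lambda>x\<in>X. 0)"
  "f \<oplus>\<^bsub>function_ring X\<^esub> g = (\<lambda>x\<in>X. f x + g x)"
  by (simp_all add: function_ring_def)

lemma cring_function_ring: "cring (function_ring X)"
proof (rule cringI)
  show "abelian_group (function_ring X)"
  proof (rule abelian_groupI)
    fix f assume f: "f \<in> carrier (function_ring X)"
    show "\<exists>g\<in>carrier (function_ring X). g \<oplus>\<^bsub>function_ring X\<^esub> f = \<zero>\<^bsub>function_ring X\<^esub>"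
      by (rule bexI[of _ "\<lambda>x\<in>X. - f x"]) auto
    show "\<zero>\<^bsub>function_ring X\<^esub> \<oplus>\<^bsub>function_ring X\<^esub> f = f"
      using f by (auto simp: PiE_iff extensional_def fun_eq_iff)
  qed (auto simp: fun_eq_iff algebra_simps)
  show "comm_monoid (function_ring X)"
  proof (rule comm_monoidI)
    fix f assume f: "f \<in> carrier (function_ring X)"
    show "\<one>\<^bsub>function_ring X\<^esub> \<otimes>\<^bsub>function_ring X\<^esub> f = f"
      using f by (auto simp: PiE_iff extensional_def fun_eq_iff)
  qed (auto simp: fun_eq_iff algebra_simps)
qed (auto simp: fun_eq_iff algebra_simps)

lemma function_ring_uminus:
  assumes "f \<in> X \<rightarrow>\<^sub>E UNIV" shows "\<ominus>\<^bsub>function_ring X\<^esub> f = (\<lambda>x\<in>X. - f x)"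
proof -
  interpret cring "function_ring X" by (rule cring_function_ring)
  show ?thesis by (rule minus_equality) (use assms in auto)
qed

section \<open>Regular and invariant functions\<close>

text \<open>Membership in the coordinate ring for functions whose values outside \<open>rep_space G\<close> are arbitrary.\<close>
definition regular :: "'g monoid \<Rightarrow> (('g \<Rightarrow> mtx) \<Rightarrow> complex) \<Rightarrow> bool" where
  "regular G f \<longleftrightarrow> restrict f (rep_space G) \<in> regular_functions G"

lemma regular_cong: "regular G f ==> (\<And>\<rho>. \<rho> \<in> rep_space G ==> f \<rho> = g \<rho>) ==> regular G g"
  unfolding regular_def by (metis (no_types, lifting) restrict_ext)

lemma regular_const: "regular G (\<lambda>\<rho>. c)"
  unfolding regular_def regular_functions_def constant_functions_def
  by (rule generate_ring.incl) auto

lemma regular_entry: "g \<in> carrier G ==> regular G (\<lambda>\<rho>. \<rho> g $ i $ j)"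
  unfolding regular_def regular_functions_def
  by (rule generate_ring.incl) auto

lemma regular_add:
  assumes "regular G f" "regular G g" shows "regular G (\<lambda>\<rho>. f \<rho> + g \<rho>)"
proof -
  have eq: "restrict (\<lambda>\<rho>. f \<rho> + g \<rho>) (rep_space G) = restrict f (rep_space G) \<oplus>\<^bsub>function_ring (rep_space G)\<^esub> restrict g (rep_space G)"
    by (auto simp: fun_eq_iff)
  show ?thesis unfolding regular_def eq regular_functions_def
    by (rule generate_ring.eng_add) (use assms in \<open>auto simp: regular_def regular_functions_def\<close>)
qed

lemma regular_mult:
  assumes "regular G f" "regular G g" shows "regular G (\<lambda>\<rho>. f \<rho> * g \<rho>)"
proof -
  have eq: "restrict (\<lambda>\<rho>. f \<rho> * g \<rho>) (rep_space G) = restrict f (rep_space G) \<otimes>\<^bsub>function_ring (rep_space G)\<^esub> restrict g (rep_space G)"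
    by (auto simp: fun_eq_iff)
  show ?thesis unfolding regular_def eq regular_functions_def
    by (rule generate_ring.eng_mult) (use assms in \<open>auto simp: regular_def regular_functions_def\<close>)
qed

lemma regular_functions_carrier: "regular_functions G \<subseteq> rep_space G \<rightarrow>\<^sub>E UNIV"
proof -
  interpret cring "function_ring (rep_space G)" by (rule cring_function_ring)
  have "regular_functions G \<subseteq> carrier (function_ring (rep_space G))"
    unfolding regular_functions_def
    by (rule subsetI, rule generate_ring_in_carrier[rotated]) (auto simp: constant_functions_def)
  then show ?thesis by simp
qed

definition invariant_fun :: "'g monoid \<Rightarrow> (('g \<Rightarrow> mtx) \<Rightarrow> complex) \<Rightarrow> bool" where
  "invariant_fun G f \<longleftrightarrow> regular G f \<and> (\<forall>P \<rho>. det P = 1 --> \<rho> \<in> rep_space G --> f (conjugate_rep G P \<rho>) = f \<rho>)"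

lemma SL2_simps [simp]: "carrier SL2 = {A. det A = 1}" "A \<otimes>\<^bsub>SL2\<^esub> B = A ** B" "\<one>\<^bsub>SL2\<^esub> = mat 1"
  by (simp_all add: SL2_def)

lemma rep_spaceD:
  assumes "\<rho> \<in> rep_space G"
  shows "g \<in> carrier G ==> det (\<rho> g) = 1" "g \<in> carrier G ==> h \<in> carrier G ==> \<rho> (g \<otimes>\<^bsub>G\<^esub> h) = \<rho> g ** \<rho> h"
  using assms unfolding rep_space_def hom_def by auto

lemma conjugate_rep_apply: "det P = 1 ==> g \<in> carrier G ==> conjugate_rep G P \<rho> g = P ** \<rho> g ** adj P"
  unfolding conjugate_rep_def by (simp add: matrix_inv_adj)

lemma conjugate_rep_space:
  assumes "group G" "det P = 1" "\<rho> \<in> rep_space G" shows "conjugate_rep G P \<rho> \<in> rep_space G"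
proof -
  interpret group G by fact
  have "conjugate_rep G P \<rho> \<in> hom G SL2"
    unfolding hom_def using assms(2) rep_spaceD[OF assms(3)]
    by (auto simp: conjugate_rep_apply det_conj conj_mult)
  then show ?thesis unfolding rep_space_def conjugate_rep_def by auto
qed

lemma invariant_ring_carrier_iff:
  assumes "group G"
  shows "f \<in> carrier (invariant_ring G) \<longleftrightarrow> f \<in> extensional (rep_space G) \<and> invariant_fun G f"
proof -
  have "f \<in> regular_functions G \<longleftrightarrow> f \<in> extensional (rep_space G) \<and> regular G f"
    using regular_functions_carrier[of G] unfolding regular_def by (auto simp: PiE_iff extensional_restrict)
  then show ?thesis unfolding invariant_ring_def invariant_fun_def by auto
qed

lemma invariant_restrict:
  assumes "group G" "invariant_fun G f" shows "restrict f (rep_space G) \<in> carrier (invariant_ring G)"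
  unfolding invariant_ring_carrier_iff[OF assms(1)] invariant_fun_def
  using assms(2) conjugate_rep_space[OF assms(1)] regular_cong[of G f "restrict f (rep_space G)"]
  unfolding invariant_fun_def by auto

lemma invariant_const: "invariant_fun G (\<lambda>\<rho>. c)"
  unfolding invariant_fun_def by (auto intro: regular_const)

lemma invariant_add: "invariant_fun G f ==> invariant_fun G g ==> invariant_fun G (\<lambda>\<rho>. f \<rho> + g \<rho>)"
  unfolding invariant_fun_def by (auto intro: regular_add)

lemma invariant_mult: "invariant_fun G f ==> invariant_fun G g ==> invariant_fun G (\<lambda>\<rho>. f \<rho> * g \<rho>)"
  unfolding invariant_fun_def by (auto intro: regular_mult)

lemma invariant_diff: "invariant_fun G f ==> invariant_fun G g ==> invariant_fun G (\<lambda>\<rho>. f \<rho> - g \<rho>)"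
  using invariant_add[of G f "\<lambda>\<rho>. -1 * g \<rho>"] invariant_mult[OF invariant_const[of G "-1"], of g] by simp

lemma invariant_prod: "(\<And>k. k \<in> S ==> invariant_fun G (f k)) ==> invariant_fun G (\<lambda>\<rho>. \<Prod>k\<in>S. f k \<rho>)"
  by (induction S rule: infinite_finite_induct) (auto intro: invariant_const invariant_mult)

text \<open>Matrix valued regular functions that transform by conjugation. They are closed under sums and products, and their traces are invariant functions.\<close>
definition equivariant :: "'g monoid \<Rightarrow> (('g \<Rightarrow> mtx) \<Rightarrow> mtx) \<Rightarrow> bool" where
  "equivariant G \<Psi> \<longleftrightarrow> (\<forall>i j. regular G (\<lambda>\<rho>. \<Psi> \<rho> $ i $ j)) \<and>
     (\<forall>P \<rho>. det P = 1 --> \<rho> \<in> rep_space G --> \<Psi> (conjugate_rep G P \<rho>) = P ** \<Psi> \<rho> ** adj P)"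

lemma equivariant_apply: "g \<in> carrier G ==> equivariant G (\<lambda>\<rho>. \<rho> g)"
  unfolding equivariant_def by (auto intro: regular_entry simp: conjugate_rep_apply)

lemma equivariant_scalar: "equivariant G (\<lambda>\<rho>. mat c)"
  unfolding equivariant_def
proof (intro conjI allI impI)
  show "regular G (\<lambda>\<rho>. mat c $ i $ j)" for i j :: 2 by (rule regular_const)
  fix P :: mtx assume P: "det P = 1"
  have "P ** mat c ** adj P = mat c ** (P ** adj P)"
    unfolding scalar_mat_commute[of c P, symmetric] matrix_mul_assoc ..
  then show "mat c = P ** mat c ** adj P" unfolding adj_mult(1)[OF P] by simp
qed

lemma equivariant_mult: "equivariant G \<Psi> ==> equivariant G \<Xi> ==> equivariant G (\<lambda>\<rho>. \<Psi> \<rho> ** \<Xi> \<rho>)"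
  unfolding equivariant_def by (auto simp: mult_entry conj_mult intro!: regular_add regular_mult)

lemma equivariant_add: "equivariant G \<Psi> ==> equivariant G \<Xi> ==> equivariant G (\<lambda>\<rho>. \<Psi> \<rho> + \<Xi> \<rho>)"
  unfolding equivariant_def
  by (auto intro!: regular_add) (simp add: mtx_simps algebra_simps)

lemma invariant_trace: "equivariant G \<Psi> ==> invariant_fun G (\<lambda>\<rho>. trace (\<Psi> \<rho>))"
  unfolding equivariant_def invariant_fun_def
  by (auto simp: trace_conj) (auto simp: trace2 intro!: regular_add)

lemma cring_invariant_ring:
  assumes "group G" shows "cring (invariant_ring G)"
proof -
  interpret R: cring "function_ring (rep_space G)" by (rule cring_function_ring)
  define S where "S = carrier (invariant_ring G)"
  have S: "invariant_ring G = (function_ring (rep_space G))\<lparr>carrier := S\<rparr>"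
    unfolding S_def invariant_ring_def by simp
  have sub: "S \<subseteq> carrier (function_ring (rep_space G))"
    unfolding S_def invariant_ring_def using regular_functions_carrier by auto
  note iff = invariant_ring_carrier_iff[OF assms, folded S_def]
  have mem: "restrict f (rep_space G) \<in> S" if "invariant_fun G f" for f
    unfolding S_def by (rule invariant_restrict[OF assms that])
  have "subring S (function_ring (rep_space G))"
  proof (rule R.subringI)
    show "S \<subseteq> carrier (function_ring (rep_space G))" by (rule sub)
    show "\<one>\<^bsub>function_ring (rep_space G)\<^esub> \<in> S" using mem[OF invariant_const] by simp
    fix f assume f: "f \<in> S"
    have "(\<lambda>x\<in>rep_space G. - 1 * f x) \<in> S"
      using f iff by (intro mem invariant_mult invariant_const) auto
    then show "\<ominus>\<^bsub>function_ring (rep_space G)\<^esub> f \<in> S" using function_ring_uminus[of f "rep_space G"] f sub by auto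
    fix g assume g: "g \<in> S"
    show "f \<otimes>\<^bsub>function_ring (rep_space G)\<^esub> g \<in> S" using f g iff by (auto intro!: mem invariant_mult)
    show "f \<oplus>\<^bsub>function_ring (rep_space G)\<^esub> g \<in> S" using f g iff by (auto intro!: mem invariant_add)
  qed
  then have "subcring S (function_ring (rep_space G))"
    using R.subcringI' by blast
  then show ?thesis unfolding S using R.subcring_iff[OF sub] by blast
qed

lemma invariant_ring_ops:
  "f \<otimes>\<^bsub>invariant_ring G\<^esub> g = (\<lambda>x\<in>rep_space G. f x * g x)"
  "\<one>\<^bsub>invariant_ring G\<^esub> = (\<lambda>x\<in>rep_space G. 1)"
  "\<zero>\<^bsub>invariant_ring G\<^esub> = (\<lambda>x\<in>rep_space G. 0)"
  "f \<oplus>\<^bsub>invariant_ring G\<^esub> g = (\<lambda>x\<in>rep_space G. f x + g x)"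
  unfolding invariant_ring_def by simp_all

lemma invariant_ring_uminus:
  assumes "group G" "f \<in> carrier (invariant_ring G)"
  shows "\<ominus>\<^bsub>invariant_ring G\<^esub> f = (\<lambda>x\<in>rep_space G. - f x)"
proof -
  interpret cring "invariant_ring G" by (rule cring_invariant_ring[OF assms(1)])
  have "(\<lambda>x\<in>rep_space G. - 1 * f x) \<in> carrier (invariant_ring G)"
    using assms invariant_ring_carrier_iff[OF assms(1)] by (intro invariant_restrict invariant_mult invariant_const) auto
  then show ?thesis using assms(2) by (intro minus_equality) (auto simp: invariant_ring_ops)
qed

text \<open>The kernel of evaluation at \<open>\<rho>\<close> is maximal because the constants are invariant: a function with nonzero value differs from a unit by an element of the kernel.\<close>
lemma character_maximal:
  assumes "group G" "\<rho> \<in> rep_space G"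
  shows "maximalideal (character G \<rho>) (invariant_ring G)"
proof -
  interpret cring "invariant_ring G" by (rule cring_invariant_ring[OF assms(1)])
  let ?R = "invariant_ring G"
  have id: "ideal (character G \<rho>) ?R"
  proof (rule idealI)
    show "ring ?R" by (rule ring_axioms)
    show "subgroup (character G \<rho>) (add_monoid ?R)"
    proof
      fix f assume f: "f \<in> character G \<rho>"
      then show "inv\<^bsub>add_monoid ?R\<^esub> f \<in> character G \<rho>"
        using a_inv_closed[of f] invariant_ring_uminus[OF assms(1), of f] assms(2)
        unfolding character_def a_inv_def[symmetric] by simp
    next
      fix f g assume "f \<in> character G \<rho>" "g \<in> character G \<rho>"
      then show "f \<otimes>\<^bsub>add_monoid ?R\<^esub> g \<in> character G \<rho>"
        using a_closed[of f g] assms(2) unfolding character_def by (simp add: invariant_ring_ops)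
    next
      show "\<one>\<^bsub>add_monoid ?R\<^esub> \<in> character G \<rho>" using zero_closed assms(2) unfolding character_def by (simp add: invariant_ring_ops)
    qed (auto simp: character_def)
  next
    fix f g assume "f \<in> character G \<rho>" "g \<in> carrier ?R"
    then show "g \<otimes>\<^bsub>?R\<^esub> f \<in> character G \<rho>" "f \<otimes>\<^bsub>?R\<^esub> g \<in> character G \<rho>"
      using m_closed[of f g] m_closed[of g f] assms(2) unfolding character_def by (simp_all add: invariant_ring_ops)
  qed
  show ?thesis
  proof (rule maximalidealI[OF id])
    show "carrier ?R \<noteq> character G \<rho>"
    proof
      assume "carrier ?R = character G \<rho>"
      then have "\<one>\<^bsub>?R\<^esub> \<in> character G \<rho>" using one_closed by simp
      then show False using assms(2) unfolding character_def by (simp add: invariant_ring_ops)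
    qed
    fix J assume J: "ideal J ?R" "character G \<rho> \<subseteq> J" "J \<subseteq> carrier ?R"
    interpret J: ideal J ?R by fact
    show "J = character G \<rho> \<or> J = carrier ?R"
    proof (cases "J \<subseteq> character G \<rho>")
      case True then show ?thesis using J(2) by blast
    next
      case False
      then obtain f where f: "f \<in> J" "f \<notin> character G \<rho>" by auto
      then have fR: "f \<in> carrier ?R" and f0: "f \<rho> \<noteq> 0" using J(3) unfolding character_def by auto
      have inv: "invariant_fun G f" using fR invariant_ring_carrier_iff[OF assms(1)] by blast
      define u where "u = (\<lambda>x\<in>rep_space G. 1 / f \<rho>)"
      have u: "u \<in> carrier ?R" unfolding u_def by (intro invariant_restrict assms(1) invariant_const)
      define k where "k = (\<lambda>x\<in>rep_space G. 1 - 1 / f \<rho> * f x)"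
      have "k \<in> carrier ?R" unfolding k_def by (intro invariant_restrict assms(1) invariant_diff invariant_mult invariant_const inv)
      then have "k \<in> J" using J(2) f0 assms(2) unfolding character_def k_def by auto
      moreover have "u \<otimes>\<^bsub>?R\<^esub> f \<in> J" using J.I_l_closed[OF f(1) u] .
      ultimately have "k \<oplus>\<^bsub>?R\<^esub> (u \<otimes>\<^bsub>?R\<^esub> f) \<in> J" by (rule J.a_closed)
      moreover have "k \<oplus>\<^bsub>?R\<^esub> (u \<otimes>\<^bsub>?R\<^esub> f) = \<one>\<^bsub>?R\<^esub>"
        unfolding invariant_ring_ops k_def u_def by (auto simp: fun_eq_iff)
      ultimately show ?thesis using J.one_imp_carrier by simp
    qed
  qed
qed

text \<open>
The coordinate ring of the set of characters of \<open>X\<close> is the ring of restrictions of invariant functions to \<open>X\<close>. Precomposition with the map that fixes \<open>X\<close>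
and sends everything else to \<open>p\<close> encodes these restrictions as total functions.
\<close>
theorem smooth_point_criterion:
  fixes G :: "'g monoid"
  assumes G: "group G" and X: "X \<subseteq> rep_space G" and pX: "p \<in> X"
    and hyp: "local_hypersurface ((\<lambda>f q. f (if q \<in> X then q else p)) ` carrier (invariant_ring G)) p I x s F j c"
  shows "smooth_point (invariant_ring G) (constant_functions (rep_space G)) (character G ` X) (character G p)"
proof -
  let ?R = "invariant_ring G"
  interpret R: cring ?R by (rule cring_invariant_ring[OF G])
  define V where "V = vanishing_ideal ?R (character G ` X)"
  have V: "V = {f \<in> carrier ?R. \<forall>q\<in>X. f q = 0}" unfolding V_def vanishing_ideal_def character_def by auto
  have Vid: "ideal V ?R"
  proof (rule idealI)
    show "ring ?R" by (rule R.ring_axioms)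
    show "subgroup V (add_monoid ?R)"
    proof
      fix f assume f: "f \<in> V"
      then show "inv\<^bsub>add_monoid ?R\<^esub> f \<in> V"
        using R.a_inv_closed[of f] invariant_ring_uminus[OF G, of f] X
        unfolding V a_inv_def[symmetric] by auto
    next
      fix f g assume "f \<in> V" "g \<in> V"
      then show "f \<otimes>\<^bsub>add_monoid ?R\<^esub> g \<in> V"
        using R.a_closed[of f g] X unfolding V by (auto simp: invariant_ring_ops)
    next
      show "\<one>\<^bsub>add_monoid ?R\<^esub> \<in> V" using R.zero_closed X unfolding V by (auto simp: invariant_ring_ops)
    qed (auto simp: V)
  next
    fix f g assume "f \<in> V" "g \<in> carrier ?R"
    then show "g \<otimes>\<^bsub>?R\<^esub> f \<in> V" "f \<otimes>\<^bsub>?R\<^esub> g \<in> V"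
      using R.m_closed[of f g] R.m_closed[of g f] X unfolding V by (auto simp: invariant_ring_ops)
  qed
  interpret V: ideal V ?R by (rule Vid)
  let ?A = "?R Quot V"
  let ?\<pi> = "a_r_coset ?R V"
  note hom = V.rcos_ring_hom
  have carA: "carrier ?A = ?\<pi> ` carrier ?R" by (auto simp: FactRing_def A_RCOSETS_defs a_r_coset_def)
  define r where "r = (\<lambda>q. if q \<in> X then q else p)"
  have rX: "r q \<in> X" "r q \<in> rep_space G" for q using pX X by (auto simp: r_def)
  define ev where "ev = (\<lambda>a q. (SOME f. f \<in> carrier ?R \<and> ?\<pi> f = a) (r q))"
  have ev: "ev (?\<pi> f) = (\<lambda>q. f (r q))" if f: "f \<in> carrier ?R" for f
  proof
    fix q
    define g where "g = (SOME g. g \<in> carrier ?R \<and> ?\<pi> g = ?\<pi> f)"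
    have g: "g \<in> carrier ?R \<and> ?\<pi> g = ?\<pi> f" unfolding g_def by (rule someI[of _ f]) (use f in auto)
    then have "g \<ominus>\<^bsub>?R\<^esub> f \<in> V" using R.quotient_eq_iff_same_a_r_cos[OF Vid, of g f] f by blast
    then have "(g \<ominus>\<^bsub>?R\<^esub> f) (r q) = 0" using rX unfolding V by blast
    then have "g (r q) = f (r q)" using rX(2)[of q] invariant_ring_uminus[OF G f]
      by (simp add: a_minus_def invariant_ring_ops)
    then show "ev (?\<pi> f) q = f (r q)" unfolding ev_def g_def by simp
  qed
  have img: "ev ` carrier ?A = (\<lambda>f q. f (r q)) ` carrier ?R"
    unfolding carA image_image using ev by (intro image_cong) auto
  have evA: "evaluated_ring ?A ev p I x s F j c (?\<pi> ` constant_functions (rep_space G))"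
  proof (intro evaluated_ring.intro)
    show "cring ?A" by (rule V.quotient_is_cring) (rule R.is_cring)
    show "local_hypersurface (ev ` carrier ?A) p I x s F j c"
      using hyp unfolding img r_def .
    have const_carrier: "constant_functions (rep_space G) \<subseteq> carrier ?R"
      unfolding constant_functions_def using invariant_restrict[OF G invariant_const] by auto
    show "evaluated_ring_axioms ?A ev (?\<pi> ` constant_functions (rep_space G))"
    proof
      fix a b assume "a \<in> carrier ?A" "b \<in> carrier ?A"
      then obtain f g where fg: "f \<in> carrier ?R" "g \<in> carrier ?R" "a = ?\<pi> f" "b = ?\<pi> g" unfolding carA by auto
      show "ev (a \<oplus>\<^bsub>?A\<^esub> b) = (\<lambda>q. ev a q + ev b q)"
        unfolding fg ring_hom_add[OF hom fg(1,2), symmetric]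
        using ev[OF fg(1)] ev[OF fg(2)] ev[OF R.a_closed[OF fg(1,2)]] rX(2) by (simp add: invariant_ring_ops)
      show "ev (a \<otimes>\<^bsub>?A\<^esub> b) = (\<lambda>q. ev a q * ev b q)"
        unfolding fg ring_hom_mult[OF hom fg(1,2), symmetric]
        using ev[OF fg(1)] ev[OF fg(2)] ev[OF R.m_closed[OF fg(1,2)]] rX(2) by (simp add: invariant_ring_ops)
    next
      show "ev \<one>\<^bsub>?A\<^esub> = (\<lambda>q. 1)"
        unfolding ring_hom_one[OF hom, symmetric] using ev[OF R.one_closed] rX(2) by (simp add: invariant_ring_ops)
      show "inj_on ev (carrier ?A)"
      proof (rule inj_onI)
        fix a b assume "a \<in> carrier ?A" "b \<in> carrier ?A" and eq: "ev a = ev b"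
        then obtain f g where fg: "f \<in> carrier ?R" "g \<in> carrier ?R" "a = ?\<pi> f" "b = ?\<pi> g" unfolding carA by auto
        have "f q = g q" if "q \<in> X" for q
          using fun_cong[OF eq, of q] that unfolding fg ev[OF fg(1)] ev[OF fg(2)] by (simp add: r_def)
        then have "f \<ominus>\<^bsub>?R\<^esub> g \<in> V" using fg(1,2) X R.minus_closed[OF fg(1,2)] unfolding V
          by (auto simp: a_minus_def invariant_ring_ops invariant_ring_uminus[OF G fg(2)])
        then show "a = b" using R.quotient_eq_iff_same_a_r_cos[OF Vid fg(1,2)] fg(3,4) by blast
      qed
      show "?\<pi> ` constant_functions (rep_space G) \<subseteq> carrier ?A" unfolding carA using const_carrier by blast
      have "ev (?\<pi> (\<lambda>x\<in>rep_space G. c)) = (\<lambda>q. c)" for c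
        using ev[OF invariant_restrict[OF G invariant_const]] rX(2) by simp
      then show "ev ` ?\<pi> ` constant_functions (rep_space G) = range (\<lambda>c q. c)"
        unfolding constant_functions_def image_image by auto
    qed
  qed
  interpret E: evaluated_ring ?A ev p I x s F j c "?\<pi> ` constant_functions (rep_space G)" by (rule evA)
  have MA: "E.MA = ?\<pi> ` character G p"
  proof -
    have "ev (?\<pi> f) p = f p" if "f \<in> carrier ?R" for f using ev[OF that] pX by (simp add: r_def)
    then show ?thesis unfolding E.MA_def carA character_def by auto
  qed
  have "p \<in> X" by fact
  then show ?thesis
    unfolding smooth_point_def coordinate_ring_def Let_def V_def[symmetric]
    using E.cotangent_dimension_hypersurface E.local_dimension_hypersurface unfolding MA by blast
qed


section \<open>Critical points of the trace of a product\<close>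

text \<open>The product of the other matrices in cyclic order, starting after \<open>A k\<close>. By cyclicity the trace of the whole product, as a function of the \<open>k\<close>-th factor, is the trace of that factor times its cofactor.\<close>
definition cofactor :: "(nat \<Rightarrow> mtx) \<Rightarrow> nat \<Rightarrow> nat \<Rightarrow> mtx" where
  "cofactor A n k = mprod (map A [Suc k..<n]) ** mprod (map A [0..<k])"

lemma mprod_split:
  assumes "k < n" shows "mprod (map A [0..<n]) = mprod (map A [0..<k]) ** A k ** mprod (map A [Suc k..<n])"
proof -
  have "[0..<n] = [0..<k] @ k # [Suc k..<n]"
    using assms by (metis upt_add_eq_append upt_conv_Cons le0 less_imp_le_nat le_add_diff_inverse)
  then show ?thesis by (simp add: mprod_append matrix_mul_assoc)
qed

lemma trace_cofactor:
  assumes "k < n" shows "trace (mprod (map (A(k := Z)) [0..<n])) = trace (Z ** cofactor A n k)"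
proof -
  have 1: "map (A(k := Z)) [0..<k] = map A [0..<k]" "map (A(k := Z)) [Suc k..<n] = map A [Suc k..<n]" by auto
  have "trace (mprod (map (A(k := Z)) [0..<n])) = trace (mprod (map A [0..<k]) ** (Z ** mprod (map A [Suc k..<n])))"
    unfolding mprod_split[OF assms] 1 by (simp add: matrix_mul_assoc)
  also have "\<dots> = trace (Z ** mprod (map A [Suc k..<n]) ** mprod (map A [0..<k]))" by (rule trace_mult_commute)
  finally show ?thesis by (simp add: cofactor_def matrix_mul_assoc)
qed

lemma cofactor_Suc:
  assumes "Suc k < n" shows "A (Suc k) ** cofactor A n (Suc k) = cofactor A n k ** A k"
proof -
  have "[Suc k..<n] = Suc k # [Suc (Suc k)..<n]" using assms by (rule upt_conv_Cons)
  then show ?thesis unfolding cofactor_def by (simp add: mprod_append matrix_mul_assoc)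
qed

lemma cofactor_0: "n > 0 ==> A 0 ** cofactor A n 0 = mprod (map A [0..<n])"
  using mprod_split[of 0 n A] by (simp add: cofactor_def)

lemma cofactor_last: "n > 0 ==> cofactor A n (n - 1) ** A (n - 1) = mprod (map A [0..<n])"
  using mprod_split[of "n - 1" n A] by (simp add: cofactor_def)

text \<open>
The hypotheses at \<open>i\<close> contain only one of the two derivatives that \<open>critical_on_quadric\<close> needs; the missing direction at \<open>i\<close> is conjugation by
diagonal matrices, with infinitesimal generator \<open>H\<close>. Conjugating all factors at once does not change the trace of the product, \<open>A 0\<close> commutes with diagonal matrices,
and the other factors contribute nothing because they commute with their cofactors; so the derivative in this direction vanishes too. Once all \<open>A k\<close> with \<open>k \<ge> 1\<close> commute with
their cofactors, all cyclic rotations of the product agree, and every factor commutes with it.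
\<close>
lemma critical_commute:
  assumes n: "n \<ge> 2" and i: "1 \<le> i" "i < n"
    and A0: "A 0 = mat2 l 0 0 m" and Ai: "A i = mat2 a 1 (a * b - 1) b"
    and crit_i: "cofactor A n i $ 1 $ 1 - cofactor A n i $ 2 $ 2 + (b - a) * cofactor A n i $ 1 $ 2 = 0"
    and comm: "\<And>k. 1 \<le> k ==> k < n ==> k \<noteq> i ==> A k ** cofactor A n k = cofactor A n k ** A k"
    and k: "k < n"
  shows "A k ** mprod (map A [0..<n]) = mprod (map A [0..<n]) ** A k"
proof -
  define Q where "Q = cofactor A n"
  define H where "H = mat2 1 0 0 (- 1)"
  have up: "trace (H ** (A k ** Q k)) = trace (H ** (A 0 ** Q 0))" if "k \<le> i" for k
    using that
  proof (induction k)
    case (Suc k)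
    have "trace (H ** (A (Suc k) ** Q (Suc k))) = trace (H ** (Q k ** A k))"
      using cofactor_Suc[of k n A] Suc.prems i by (simp add: Q_def)
    also have "\<dots> = trace (H ** (A k ** Q k))"
    proof (cases "k = 0")
      case True
      have "H ** A 0 = A 0 ** H" unfolding A0 H_def by (simp add: mtx_simps)
      then show ?thesis unfolding True using trace_mult_commute[of "H ** Q 0" "A 0"]
        by (simp add: matrix_mul_assoc)
    next
      case False
      then show ?thesis using comm[of k] Suc.prems i by (simp add: Q_def)
    qed
    finally show ?case using Suc by simp
  qed simp
  have down: "trace (H ** (Q k ** A k)) = trace (H ** mprod (map A [0..<n]))" if "i \<le> k" "k \<le> n - 1" for k
    using that(2,1)
  proof (induction k rule: inc_induct)
    case base
    then show ?case using cofactor_last[of n A] n by (simp add: Q_def)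
  next
    case (step k)
    have "trace (H ** (Q k ** A k)) = trace (H ** (A (Suc k) ** Q (Suc k)))"
      using cofactor_Suc[of k n A] step by (simp add: Q_def)
    also have "\<dots> = trace (H ** (Q (Suc k) ** A (Suc k)))"
      using comm[of "Suc k"] step i by (simp add: Q_def)
    finally show ?case using step by simp
  qed
  have "trace (H ** (A i ** Q i)) = trace (H ** (Q i ** A i))"
    using up[of i] down[of i] cofactor_0[of n A] n i by (simp add: Q_def)
  then have "2 * (Q i $ 2 $ 1 - Q i $ 1 $ 2 * (a * b - 1)) = 0"
    unfolding Ai H_def by (simp add: mtx_simps algebra_simps)
  then have torus: "Q i $ 2 $ 1 - Q i $ 1 $ 2 * (a * b - 1) / 1 = 0" by simp
  have "A i ** Q i = Q i ** A i" unfolding Ai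
    by (rule critical_on_quadric) (use crit_i torus in \<open>auto simp: Q_def mult.commute\<close>)
  then have comm': "A k ** Q k = Q k ** A k" if "1 \<le> k" "k < n" for k
    using comm[of k] that by (cases "k = i") (auto simp: Q_def)
  have all: "A k ** Q k = mprod (map A [0..<n])" if "k \<le> n - 1" "1 \<le> k" for k
    using that
  proof (induction k rule: inc_induct)
    case base
    then show ?case using cofactor_last[of n A] n comm'[of "n - 1"] by (simp add: Q_def)
  next
    case (step k)
    then show ?case using comm'[of k] cofactor_Suc[of k n A] by (simp add: Q_def)
  qed
  show ?thesis
  proof (cases "k = 0")
    case True
    have "Q 0 ** A 0 = mprod (map A [0..<n])" using all[of 1] cofactor_Suc[of 0 n A] n by (simp add: Q_def)
    moreover have "A 0 ** Q 0 = mprod (map A [0..<n])" using cofactor_0[of n A] n by (simp add: Q_def)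
    moreover have "A 0 ** (Q 0 ** A 0) = (A 0 ** Q 0) ** A 0" by (simp only: matrix_mul_assoc)
    ultimately show ?thesis unfolding True by simp
  next
    case False
    then have "A k ** Q k = mprod (map A [0..<n])" "A k ** Q k = Q k ** A k" using all[of k] comm'[of k] k by auto
    moreover have "A k ** (Q k ** A k) = (A k ** Q k) ** A k" by (simp only: matrix_mul_assoc)
    ultimately show ?thesis by simp
  qed
qed

lemma diagonalize_to:
  assumes A: "det (A :: mtx) = 1" "trace A = l + 1 / l" and l: "l \<noteq> 0" "l \<noteq> 1 / l"
  shows "\<exists>P. det P = 1 \<and> P ** A ** adj P = mat2 l 0 0 (1 / l)"
proof -
  have l1: "l \<noteq> 1" "l \<noteq> - 1" using l by auto
  have tr: "trace A \<noteq> 2" "trace A \<noteq> - 2"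
  proof -
    have "(l - 1) * (l - 1) \<noteq> 0" using l1 by simp
    then show "trace A \<noteq> 2" unfolding A(2) using l(1) by (auto simp: field_simps)
    have "(l + 1) * (l + 1) \<noteq> 0" using l1 by (simp add: eq_neg_iff_add_eq_0)
    then show "trace A \<noteq> - 2" unfolding A(2) using l(1) by (auto simp: field_simps eq_neg_iff_add_eq_0)
  qed
  obtain k P where P: "k \<noteq> 0" "trace A = k + 1 / k" "det P = 1" "P ** A ** adj P = mat2 k 0 0 (1 / k)"
    using diagonalize[OF A(1) tr] by metis
  have "(k - l) * (k * l - 1) = k * l * ((k + 1 / k) - (l + 1 / l))" using P(1) l(1) by (simp add: field_simps)
  then have "(k - l) * (k * l - 1) = 0" using P(2) A(2) by simp
  then have "k - l = 0 \<or> k * l - 1 = 0" unfolding mult_eq_0_iff .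
  then have "k = l \<or> k = 1 / l" using l(1) by (simp add: eq_divide_eq)
  then show ?thesis
  proof
    assume "k = l" then show ?thesis using P by blast
  next
    assume k: "k = 1 / l"
    define S where "S = mat2 0 1 (- 1) 0"
    have S: "det S = 1" by (simp add: S_def det_2)
    have "(S ** P) ** A ** adj (S ** P) = S ** (P ** A ** adj P) ** adj S"
      by (simp only: adj_prod matrix_mul_assoc)
    also have "\<dots> = mat2 l 0 0 (1 / l)" unfolding P(4) k S_def by (simp add: mtx_simps)
    finally show ?thesis using S P(3) by (intro exI[of _ "S ** P"]) (simp add: det_mul)
  qed
qed

lemma representation_one:
  assumes "group G" "\<rho> \<in> rep_space G" shows "\<rho> \<one>\<^bsub>G\<^esub> = mat 1"
proof -
  interpret group G by (rule assms(1))
  have "\<rho> \<one>\<^bsub>G\<^esub> = \<rho> \<one>\<^bsub>G\<^esub> ** \<rho> \<one>\<^bsub>G\<^esub>" using rep_spaceD(2)[OF assms(2) one_closed one_closed] by simp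
  then have "adj (\<rho> \<one>\<^bsub>G\<^esub>) ** \<rho> \<one>\<^bsub>G\<^esub> = adj (\<rho> \<one>\<^bsub>G\<^esub>) ** \<rho> \<one>\<^bsub>G\<^esub> ** \<rho> \<one>\<^bsub>G\<^esub>" by (metis matrix_mul_assoc)
  then show ?thesis using adj_mult(2)[OF rep_spaceD(1)[OF assms(2) one_closed]] by simp
qed

lemma representation_inv: assumes "group G" "\<rho> \<in> rep_space G" "g \<in> carrier G" shows "\<rho> (inv\<^bsub>G\<^esub> g) = adj (\<rho> g)"
proof -
  interpret group G by (rule assms(1))
  have "\<rho> (inv\<^bsub>G\<^esub> g) ** \<rho> g = mat 1"
    using rep_spaceD(2)[OF assms(2) inv_closed[OF assms(3)] assms(3)] representation_one[OF assms(1,2)] l_inv[OF assms(3)] by simp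
  then have "\<rho> (inv\<^bsub>G\<^esub> g) ** (\<rho> g ** adj (\<rho> g)) = adj (\<rho> g)" by (simp add: matrix_mul_assoc)
  then show ?thesis using adj_mult(1)[OF rep_spaceD(1)[OF assms(2,3)]] by simp
qed

section \<open>Representations of free groups with prescribed traces\<close>

text \<open>A group that behaves for \<open>SL\<^sub>2\<close>-representations like a free group on \<open>d 0, \<dots>, d (n - 1)\<close>, together with trace conditions on the generators and on their product.\<close>
locale free_reps =
  fixes G :: "'g monoid" and n :: nat and d :: "nat \<Rightarrow> 'g" and w :: "nat \<Rightarrow> complex" and wl :: complex
  assumes G: "group G" and n: "n \<ge> 2" and dG: "k < n ==> d k \<in> carrier G"
    and gen: "carrier G = generate G (d ` {..<n})"
    and free: "(\<And>k. k < n ==> det (A k) = 1) ==> \<exists>\<rho>\<in>rep_space G. \<forall>k<n. \<rho> (d k) = A k"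
    and w: "k < n ==> w k \<noteq> 2 \<and> w k \<noteq> - 2" and wl: "wl \<noteq> 2" "wl \<noteq> - 2"
begin

definition X where
  "X = {\<rho> \<in> rep_space G. (\<forall>k<n. trace (\<rho> (d k)) = w k) \<and> trace (mprod (map (\<lambda>k. \<rho> (d k)) [0..<n])) = wl}"

lemma XD:
  assumes "\<rho> \<in> X"
  shows "\<rho> \<in> rep_space G" "k < n ==> det (\<rho> (d k)) = 1" "k < n ==> trace (\<rho> (d k)) = w k"
   "trace (mprod (map (\<lambda>k. \<rho> (d k)) [0..<n])) = wl"
  using assms rep_spaceD(1)[of \<rho> G "d k"] dG unfolding X_def by auto

definition entries :: "('g \<Rightarrow> mtx) \<Rightarrow> nat \<times> 2 \<times> 2 \<Rightarrow> complex" where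
  "entries \<rho> = (\<lambda>(k, a, b). \<rho> (d k) $ a $ b)"

abbreviation EI :: "(nat \<times> 2 \<times> 2) set" where "EI \<equiv> {..<n} \<times> UNIV"

text \<open>The inverse of a matrix in \<open>SL\<^sub>2\<close> is its adjugate, so no denominators occur.\<close>
lemma entry_polynomial:
  assumes "g \<in> generate G (d ` {..<n})"
  shows "\<forall>a b. \<exists>\<Phi>\<in>polyfun EI. \<forall>\<rho>\<in>rep_space G. \<rho> g $ a $ b = \<Phi> (entries \<rho>)"
  using assms
proof (induction rule: generate.induct)
  case one
  show ?case
  proof (intro allI)
    fix a b :: 2
    show "\<exists>\<Phi>\<in>polyfun EI. \<forall>\<rho>\<in>rep_space G. \<rho> \<one>\<^bsub>G\<^esub> $ a $ b = \<Phi> (entries \<rho>)"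
      by (rule bexI[OF _ polyfun.const[of "mat 1 $ a $ b"]]) (simp add: representation_one[OF G])
  qed
next
  case (incl h)
  then obtain k where k: "k < n" "h = d k" by auto
  show ?case
  proof (intro allI)
    fix a b :: 2
    have "(\<lambda>y. y (k, a, b)) \<in> polyfun EI" by (rule polyfun.var) (use k in auto)
    then show "\<exists>\<Phi>\<in>polyfun EI. \<forall>\<rho>\<in>rep_space G. \<rho> h $ a $ b = \<Phi> (entries \<rho>)"
      by (rule bexI[rotated]) (simp add: entries_def k)
  qed
next
  case (inv h)
  then obtain k where k: "k < n" "h = d k" by auto
  have v: "(\<lambda>y. y (k, a, b)) \<in> polyfun EI" for a b by (rule polyfun.var) (use k in auto)
  have r: "\<rho> (inv\<^bsub>G\<^esub> h) = adj (\<rho> (d k))" if "\<rho> \<in> rep_space G" for \<rho> using representation_inv[OF G that dG] k by simp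
  show ?case
  proof (intro allI)
    fix a b :: 2
    consider "a = 1" "b = 1" | "a = 1" "b = 2" | "a = 2" "b = 1" | "a = 2" "b = 2" using exhaust_2 by blast
    then show "\<exists>\<Phi>\<in>polyfun EI. \<forall>\<rho>\<in>rep_space G. \<rho> (inv\<^bsub>G\<^esub> h) $ a $ b = \<Phi> (entries \<rho>)"
    proof cases
      case 1 show ?thesis by (rule bexI[OF _ v[of 2 2]]) (simp add: r 1 entries_def)
    next
      case 2 show ?thesis by (rule bexI[OF _ polyfun_uminus[OF v[of 1 2]]]) (simp add: r 2 entries_def)
    next
      case 3 show ?thesis by (rule bexI[OF _ polyfun_uminus[OF v[of 2 1]]]) (simp add: r 3 entries_def)
    next
      case 4 show ?thesis by (rule bexI[OF _ v[of 1 1]]) (simp add: r 4 entries_def)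
    qed
  qed
next
  case (eng g h)
  have gh: "g \<in> carrier G" "h \<in> carrier G" using eng.hyps gen by auto
  show ?case
  proof (intro allI)
    fix a b :: 2
    obtain f1 where f1: "f1 \<in> polyfun EI" "\<forall>\<rho>\<in>rep_space G. \<rho> g $ a $ 1 = f1 (entries \<rho>)"
      using eng.IH(1)[rule_format, of a 1] by (rule bexE)
    obtain f2 where f2: "f2 \<in> polyfun EI" "\<forall>\<rho>\<in>rep_space G. \<rho> g $ a $ 2 = f2 (entries \<rho>)"
      using eng.IH(1)[rule_format, of a 2] by (rule bexE)
    obtain f3 where f3: "f3 \<in> polyfun EI" "\<forall>\<rho>\<in>rep_space G. \<rho> h $ 1 $ b = f3 (entries \<rho>)"
      using eng.IH(2)[rule_format, of 1 b] by (rule bexE)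
    obtain f4 where f4: "f4 \<in> polyfun EI" "\<forall>\<rho>\<in>rep_space G. \<rho> h $ 2 $ b = f4 (entries \<rho>)"
      using eng.IH(2)[rule_format, of 2 b] by (rule bexE)
    have "(\<lambda>y. f1 y * f3 y + f2 y * f4 y) \<in> polyfun EI" by (intro polyfun_intros f1 f2 f3 f4)
    then show "\<exists>\<Phi>\<in>polyfun EI. \<forall>\<rho>\<in>rep_space G. \<rho> (g \<otimes>\<^bsub>G\<^esub> h) $ a $ b = \<Phi> (entries \<rho>)"
      by (rule bexI[rotated]) (simp add: mult_entry rep_spaceD(2)[OF _ gh] f1(2) f2(2) f3(2) f4(2))
  qed
qed

lemma regular_polynomial:
  assumes "regular G f" shows "\<exists>\<Phi>\<in>polyfun EI. \<forall>\<rho>\<in>rep_space G. f \<rho> = \<Phi> (entries \<rho>)"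
proof -
  have "h \<in> regular_functions G ==> \<exists>\<Phi>\<in>polyfun EI. \<forall>\<rho>\<in>rep_space G. h \<rho> = \<Phi> (entries \<rho>)" for h
    unfolding regular_functions_def
  proof (induction rule: generate_ring.induct)
    case one
    show ?case by (rule bexI[OF _ polyfun.const[of 1]]) simp
  next
    case (incl h)
    then consider c where "h = (\<lambda>\<rho>\<in>rep_space G. c)" | g i j where "g \<in> carrier G" "h = (\<lambda>\<rho>\<in>rep_space G. \<rho> g $ i $ j)"
      unfolding constant_functions_def by auto
    then show ?case
    proof cases
      case 1 show ?thesis by (rule bexI[OF _ polyfun.const[of c]]) (simp add: 1)
    next
      case 2
      then obtain \<Phi> where "\<Phi>\<in>polyfun EI" "\<forall>\<rho>\<in>rep_space G. \<rho> g $ i $ j = \<Phi> (entries \<rho>)" using entry_polynomial gen by metis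
      then show ?thesis using 2 by auto
    qed
  next
    case (a_inv h)
    then obtain \<Phi> where \<Phi>: "\<Phi>\<in>polyfun EI" "\<forall>\<rho>\<in>rep_space G. h \<rho> = \<Phi> (entries \<rho>)" by auto
    have "h \<in> rep_space G \<rightarrow>\<^sub>E UNIV" using a_inv.hyps regular_functions_carrier unfolding regular_functions_def by blast
    then show ?case using \<Phi>(2) by (intro bexI[OF _ polyfun_uminus[OF \<Phi>(1)]]) (simp add: function_ring_uminus)
  next
    case (eng_add h1 h2)
    then obtain f g where fg: "f\<in>polyfun EI" "\<forall>\<rho>\<in>rep_space G. h1 \<rho> = f (entries \<rho>)" "g\<in>polyfun EI" "\<forall>\<rho>\<in>rep_space G. h2 \<rho> = g (entries \<rho>)" by auto
    show ?case by (rule bexI[OF _ polyfun.add[OF fg(1,3)]]) (use fg(2,4) in simp)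
  next
    case (eng_mult h1 h2)
    then obtain f g where fg: "f\<in>polyfun EI" "\<forall>\<rho>\<in>rep_space G. h1 \<rho> = f (entries \<rho>)" "g\<in>polyfun EI" "\<forall>\<rho>\<in>rep_space G. h2 \<rho> = g (entries \<rho>)" by auto
    show ?case by (rule bexI[OF _ polyfun.mult[OF fg(1,3)]]) (use fg(2,4) in simp)
  qed
  from this[of "restrict f (rep_space G)"] assms show ?thesis unfolding regular_def by auto
qed

lemma irreducible_common:
  assumes \<rho>: "\<rho> \<in> rep_space G" "irreducible_rep G \<rho>"
    and W: "vec.subspace W" "\<And>k v. k < n ==> v \<in> W ==> \<rho> (d k) *v v \<in> W"
  shows "W = {0} \<or> W = UNIV"
proof -
  have "g \<in> generate G (d ` {..<n}) ==> \<forall>v\<in>W. \<rho> g *v v \<in> W" for g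
  proof (induction rule: generate.induct)
    case one then show ?case using representation_one[OF G \<rho>(1)] by simp
  next
    case (incl h) then show ?case using W(2) by auto
  next
    case (inv h)
    then obtain k where k: "k < n" "h = d k" by auto
    show ?case
    proof
      fix v assume v: "v \<in> W"
      have "adj (\<rho> h) *v v = trace (\<rho> h) *s v - \<rho> h *v v"
        by (simp add: vec_eq_iff forall_2 matrix_vector_mult_def sum_2 trace2 algebra_simps)
      moreover have "trace (\<rho> h) *s v - \<rho> h *v v \<in> W"
        using W(1) v W(2)[OF k(1) v] k(2) by (intro vec.subspace_diff vec.subspace_scale) auto
      ultimately show "\<rho> (inv\<^bsub>G\<^esub> h) *v v \<in> W" using representation_inv[OF G \<rho>(1) dG[OF k(1)]] k(2) by simp
    qed
  next
    case (eng g h)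
    have gh: "g \<in> carrier G" "h \<in> carrier G" using eng.hyps gen by auto
    show ?case using eng.IH rep_spaceD(2)[OF \<rho>(1) gh] by (simp add: matrix_vector_mul_assoc[symmetric])
  qed
  then show ?thesis using \<rho>(2) W(1) gen unfolding irreducible_rep_def by blast
qed

end

text \<open>The matrix of determinant \<open>1\<close>, trace \<open>t\<close> and first row \<open>u\<close>, \<open>v\<close>.\<close>
definition quadric_matrix :: "complex \<Rightarrow> complex \<Rightarrow> complex \<Rightarrow> mtx" where
  "quadric_matrix u v t = mat2 u v ((u * (t - u) - 1) / v) (t - u)"

lemma quadric_matrix_eq:
  assumes "det (A :: mtx) = 1" "trace A = t" "A $ 1 $ 2 \<noteq> 0"
  shows "quadric_matrix (A $ 1 $ 1) (A $ 1 $ 2) t = A"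
  using assms by (auto simp: quadric_matrix_def mtx_simps field_simps)

lemma quadric_matrix_det: "v \<noteq> 0 ==> det (quadric_matrix u v t) = 1"
  by (simp add: quadric_matrix_def det_2)

lemma quadric_matrix_trace: "trace (quadric_matrix u v t) = t"
  by (simp add: quadric_matrix_def trace2)

lemma adj_conj_cancel: "det P = 1 ==> adj P ** (P ** A ** adj P) ** P = A" "det P = 1 ==> P ** (adj P ** A ** P) ** adj P = A"
proof -
  assume P: "det P = 1"
  have "adj P ** (P ** A ** adj P) ** P = (adj P ** P) ** A ** (adj P ** P)" by (simp only: matrix_mul_assoc)
  then show "adj P ** (P ** A ** adj P) ** P = A" unfolding adj_mult(2)[OF P] by simp
  have "P ** (adj P ** A ** P) ** adj P = (P ** adj P) ** A ** (P ** adj P)" by (simp only: matrix_mul_assoc)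
  then show "P ** (adj P ** A ** P) ** adj P = A" unfolding adj_mult(1)[OF P] by simp
qed

lemma polyfun_mat_entry:
  fixes A B :: "('i \<Rightarrow> complex) \<Rightarrow> mtx"
  assumes "\<And>a b. (\<lambda>y. A y $ a $ b) \<in> polyfun I" "\<And>a b. (\<lambda>y. B y $ a $ b) \<in> polyfun I"
  shows "(\<lambda>y. (A y ** B y) $ a $ b) \<in> polyfun I"
  unfolding mult_entry by (intro polyfun_intros assms)

lemma polyfun_mprod_entry:
  fixes A :: "('i \<Rightarrow> complex) \<Rightarrow> nat \<Rightarrow> mtx"
  assumes "\<And>k a b. k \<in> set ks ==> (\<lambda>y. A y k $ a $ b) \<in> polyfun I"
  shows "(\<lambda>y. mprod (map (A y) ks) $ a $ b) \<in> polyfun I"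
  using assms
proof (induction ks arbitrary: a b)
  case Nil then show ?case by (simp add: polyfun.const)
next
  case (Cons k ks)
  then show ?case using polyfun_mat_entry[of "\<lambda>y. A y k" I "\<lambda>y. mprod (map (A y) ks)"] by simp
qed

lemma scalar_entry: "(mat c ** (A :: mtx)) $ a $ b = c * A $ a $ b"
proof -
  have "\<forall>a b. (mat c ** A) $ a $ b = c * A $ a $ b" unfolding forall_2 by (simp add: mult_entry mat_entry)
  then show ?thesis by blast
qed

lemma mprod_scale: "mprod (map (\<lambda>k. mat (c k) ** A k) ks) = mat (\<Prod>k\<leftarrow>ks. c k) ** mprod (map A ks)"
proof (induction ks)
  case (Cons k ks)
  have "mat (c k) ** A k ** (mat (\<Prod>k\<leftarrow>ks. c k) ** mprod (map A ks)) = mat (c k) ** (mat (\<Prod>k\<leftarrow>ks. c k) ** A k) ** mprod (map A ks)"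
    unfolding scalar_mat_commute[of "\<Prod>k\<leftarrow>ks. c k" "A k"] by (simp only: matrix_mul_assoc)
  also have "\<dots> = mat (c k * (\<Prod>k\<leftarrow>ks. c k)) ** (A k ** mprod (map A ks))"
  proof -
    have "mat (c k) ** mat (\<Prod>k\<leftarrow>ks. c k) = (mat (c k * (\<Prod>k\<leftarrow>ks. c k)) :: mtx)" by (simp add: mtx_simps)
    then show ?thesis by (simp only: matrix_mul_assoc)
  qed
  finally show ?case using Cons by simp
qed simp

section \<open>A slice for the conjugation action\<close>

text \<open>
A point \<open>p\<close> in normal form: \<open>p (d 0)\<close> is diagonal and the upper right entry of \<open>p (d i)\<close> is \<open>1\<close>. The index \<open>jj\<close> provides a nonzero lower left
entry; it exists by irreducibility. The matrices \<open>g k\<close> turn each \<open>p (d k)\<close> to a position in which the entries of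
the first row are coordinates on the surface of matrices with determinant \<open>1\<close> and fixed trace.
\<close>
locale slice = free_reps G n d w wl
  for G :: "'g monoid" and n d w wl +
  fixes p :: "'g \<Rightarrow> mtx" and l :: complex and i jj :: nat and g :: "nat \<Rightarrow> mtx"
  assumes pX: "p \<in> X" and p_irr: "irreducible_rep G p"
    and l: "l \<noteq> 0" "l \<noteq> 1 / l" and p0: "p (d 0) = mat2 l 0 0 (1 / l)"
    and i: "1 \<le> i" "i < n" and pi: "p (d i) $ 1 $ 2 = 1"
    and jj: "1 \<le> jj" "jj < n" and pj: "p (d jj) $ 2 $ 1 \<noteq> 0"
    and g: "k < n ==> det (g k) = 1" "k < n ==> (g k ** p (d k) ** adj (g k)) $ 1 $ 2 \<noteq> 0"
begin

definition K where "K = {1..<n} - {i}"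

text \<open>The index \<open>(k, True)\<close> stands for the first and \<open>(k, False)\<close> for the second entry of the first row of the \<open>k\<close>-th matrix. The generator \<open>d 0\<close> has no coordinate, and \<open>d i\<close> only one.\<close>
definition I :: "(nat \<times> bool) set" where "I = insert (i, True) (K \<times> UNIV)"

lemma K: "k \<in> K ==> k < n \<and> k \<noteq> 0 \<and> k \<noteq> i" "finite K" unfolding K_def by auto

lemma finI: "finite I" unfolding I_def K_def by auto

text \<open>\<open>E T\<close> and \<open>E\' T\<close> are the projections onto the two eigenlines of \<open>T 0\<close>.\<close>
definition E :: "(nat \<Rightarrow> mtx) \<Rightarrow> mtx" where "E T = mat (1 / (l - 1 / l)) ** (T 0 + mat (- (1 / l)))"
definition E' :: "(nat \<Rightarrow> mtx) \<Rightarrow> mtx" where "E' T = mat 1 + mat (- 1) ** E T"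

text \<open>For a tuple in normal form this is the lower left entry of \<open>T jj\<close>; it tests whether the off-diagonal entries at \<open>i\<close> and \<open>jj\<close> can be normalised.\<close>
definition sg where "sg T = trace (E T ** T i ** E' T ** T jj)"

text \<open>
Up to the factor \<open>sg T\<close>, the normalised \<open>k\<close>-th matrix. All entries are traces of words in the \<open>T k\<close> and the projections, hence invariant
functions: the entries of the normal form of a representation can be computed without conjugating it.
\<close>
definition NN :: "(nat \<Rightarrow> mtx) \<Rightarrow> nat \<Rightarrow> mtx" where
  "NN T k = mat2 (sg T * trace (E T ** T k)) (trace (E T ** T k ** E' T ** T jj))
     (sg T * trace (E T ** T i ** E' T ** T k)) (sg T * trace (E' T ** T k))"

definition cf :: "(nat \<Rightarrow> mtx) \<Rightarrow> nat \<times> bool \<Rightarrow> complex" where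
  "cf T = (\<lambda>(k, b). if k = i then T i $ 1 $ 1 else if b then (g k ** T k ** adj (g k)) $ 1 $ 1 else (g k ** T k ** adj (g k)) $ 1 $ 2)"

abbreviation tup :: "('g \<Rightarrow> mtx) \<Rightarrow> nat \<Rightarrow> mtx" where "tup \<rho> \<equiv> \<lambda>k. \<rho> (d k)"


definition N where "N T k = mat (1 / sg T) ** NN T k"

lemma E_normal:
  assumes "T 0 = mat2 l 0 0 (1 / l)" shows "E T = mat2 1 0 0 0" "E' T = mat2 0 0 0 1"
proof -
  have "l - 1 / l \<noteq> 0" using l by simp
  then show E: "E T = mat2 1 0 0 0" unfolding E_def assms by (simp add: mtx_simps)
  show "E' T = mat2 0 0 0 1" unfolding E'_def E by (simp add: mtx_simps)
qed

lemma normal: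
  assumes T0: "T 0 = mat2 l 0 0 (1 / l)"
  shows "sg T = T i $ 1 $ 2 * T jj $ 2 $ 1"
    and "T i $ 1 $ 2 = 1 ==> sg T \<noteq> 0 ==> N T k = T k"
proof -
  show sg: "sg T = T i $ 1 $ 2 * T jj $ 2 $ 1" unfolding sg_def E_normal[where T=T, OF T0] by (simp add: mtx_simps)
  assume Ti: "T i $ 1 $ 2 = 1" and s0: "sg T \<noteq> 0"
  then have "T jj $ 2 $ 1 = sg T" using sg by simp
  then have "NN T k = mat (sg T) ** T k" unfolding NN_def E_normal[where T=T, OF T0] using Ti by (simp add: mtx_simps)
  then have "N T k = (mat (1 / sg T) ** mat (sg T)) ** T k" unfolding N_def by (simp only: matrix_mul_assoc)
  moreover have "mat (1 / sg T) ** mat (sg T) = (mat 1 :: mtx)" using s0 by (simp add: mtx_simps)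
  ultimately show "N T k = T k" by simp
qed

lemma cf_N: "cf (N T) \<kappa> = cf (NN T) \<kappa> / sg T"
proof (cases \<kappa>)
  case (Pair k b)
  have "g k ** (mat (1 / sg T) ** NN T k) ** adj (g k) = mat (1 / sg T) ** (g k ** NN T k ** adj (g k))"
    unfolding matrix_mul_assoc scalar_mat_commute[of _ "g k"] ..
  then show ?thesis unfolding cf_def N_def Pair by (simp add: scalar_entry)
qed

lemma cf_cong: "\<kappa> \<in> I ==> (\<And>k. k < n ==> T k = T' k) ==> cf T \<kappa> = cf T' \<kappa>"
  unfolding cf_def I_def using K(1) i by auto

lemma equivariant_E: "equivariant G (\<lambda>\<rho>. E (tup \<rho>))" "equivariant G (\<lambda>\<rho>. E' (tup \<rho>))"
proof -
  have "d 0 \<in> carrier G" using dG[of 0] n by simp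
  then show E: "equivariant G (\<lambda>\<rho>. E (tup \<rho>))" unfolding E_def
    by (intro equivariant_mult equivariant_add equivariant_scalar equivariant_apply)
  show "equivariant G (\<lambda>\<rho>. E' (tup \<rho>))" unfolding E'_def
    by (intro equivariant_mult equivariant_add equivariant_scalar E)
qed

lemma invariant_sg: "invariant_fun G (\<lambda>\<rho>. sg (tup \<rho>))"
  unfolding sg_def by (intro invariant_trace equivariant_mult equivariant_E equivariant_apply dG i jj)

lemma invariant_NN:
  assumes k: "k < n" shows "invariant_fun G (\<lambda>\<rho>. NN (tup \<rho>) k $ a $ b)"
proof -
  have "invariant_fun G (\<lambda>\<rho>. sg (tup \<rho>) * trace (E (tup \<rho>) ** \<rho> (d k)))"
    "invariant_fun G (\<lambda>\<rho>. trace (E (tup \<rho>) ** \<rho> (d k) ** E' (tup \<rho>) ** \<rho> (d jj)))"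
    "invariant_fun G (\<lambda>\<rho>. sg (tup \<rho>) * trace (E (tup \<rho>) ** \<rho> (d i) ** E' (tup \<rho>) ** \<rho> (d k)))"
    "invariant_fun G (\<lambda>\<rho>. sg (tup \<rho>) * trace (E' (tup \<rho>) ** \<rho> (d k)))"
    by (intro invariant_mult invariant_sg invariant_trace equivariant_mult equivariant_E equivariant_apply dG i jj k)+
  then have *: "invariant_fun G (\<lambda>\<rho>. NN (tup \<rho>) k $ 1 $ 1)" "invariant_fun G (\<lambda>\<rho>. NN (tup \<rho>) k $ 1 $ 2)"
     "invariant_fun G (\<lambda>\<rho>. NN (tup \<rho>) k $ 2 $ 1)" "invariant_fun G (\<lambda>\<rho>. NN (tup \<rho>) k $ 2 $ 2)"
    unfolding NN_def mat2_entries .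
  have "\<forall>a b. invariant_fun G (\<lambda>\<rho>. NN (tup \<rho>) k $ a $ b)" unfolding forall_2 by (intro conjI *)
  then show ?thesis by (elim allE)
qed

lemma invariant_cf: "\<kappa> \<in> I ==> invariant_fun G (\<lambda>\<rho>. cf (NN (tup \<rho>)) \<kappa>)"
proof -
  assume \<kappa>: "\<kappa> \<in> I"
  have *: "invariant_fun G (\<lambda>\<rho>. (g k ** NN (tup \<rho>) k ** adj (g k)) $ a $ b)" if "k < n" for k a b
    unfolding mult_entry by (intro invariant_add invariant_mult invariant_const invariant_NN that)
  show ?thesis using \<kappa> *[of "fst \<kappa>" 1 1] *[of "fst \<kappa>" 1 2] invariant_NN[OF i(2), of 1 1] K(1)[of "fst \<kappa>"]
    unfolding cf_def I_def by (cases \<kappa>; cases "snd \<kappa>") auto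
qed

text \<open>Nonzero exactly where the normal form exists and the coordinates that occur as denominators are not zero (\<open>s_nonzero\<close>).\<close>
definition s where "s \<rho> = (sg (tup \<rho>))\<^sup>2 * (\<Prod>k\<in>K. cf (NN (tup \<rho>)) (k, False))"

lemma K_I: "k \<in> K ==> (k, b) \<in> I" by (simp add: I_def)

lemma invariant_s: "invariant_fun G s"
  unfolding s_def power2_eq_square by (intro invariant_mult invariant_sg invariant_prod invariant_cf K_I)

lemma s_nonzero: "s \<rho> \<noteq> 0 \<longleftrightarrow> sg (tup \<rho>) \<noteq> 0 \<and> (\<forall>k\<in>K. cf (N (tup \<rho>)) (k, False) \<noteq> 0)"
  unfolding s_def cf_N using K(2) by auto

lemma invariantD: "invariant_fun G f ==> det P = 1 ==> \<rho> \<in> rep_space G ==> f (conjugate_rep G P \<rho>) = f \<rho>"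
  unfolding invariant_fun_def by blast

lemma p_normal: "k < n ==> N (tup p) k = p (d k)" "sg (tup p) \<noteq> 0"
proof -
  show s0: "sg (tup p) \<noteq> 0" using normal(1)[of "tup p"] p0 pi pj by simp
  show "N (tup p) k = p (d k)" by (rule normal(2)) (use p0 pi s0 in auto)
qed

lemma cf_p: "\<kappa> \<in> I ==> cf (N (tup p)) \<kappa> = cf (tup p) \<kappa>"
  by (rule cf_cong) (auto simp: p_normal)

lemma s_p: "s p \<noteq> 0"
  unfolding s_nonzero
proof (intro conjI p_normal ballI)
  fix k assume k: "k \<in> K"
  have "cf (tup p) (k, False) \<noteq> 0" using K(1)[OF k] g(2)[of k] unfolding cf_def by simp
  then show "cf (N (tup p)) (k, False) \<noteq> 0" using cf_p[OF K_I[OF k]] by simp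
qed

text \<open>Diagonalise the first matrix, then rescale by a diagonal matrix; this needs a square root of the upper right entry at \<open>i\<close>.\<close>
lemma normal_form:
  assumes \<rho>: "\<rho> \<in> X" and s0: "sg (tup \<rho>) \<noteq> 0"
  shows "\<exists>P. det P = 1 \<and> conjugate_rep G P \<rho> (d 0) = mat2 l 0 0 (1 / l) \<and> conjugate_rep G P \<rho> (d i) $ 1 $ 2 = 1"
proof -
  note XD = XD[OF \<rho>]
  have n0: "0 < n" using n by simp
  have "w 0 = l + 1 / l" using free_reps.XD(3)[OF free_reps_axioms pX n0] p0 by (simp add: trace2)
  then have "trace (\<rho> (d 0)) = l + 1 / l" using XD(3)[OF n0] by simp
  from diagonalize_to[OF XD(2)[OF n0] this l] obtain P where P: "det P = 1" "P ** \<rho> (d 0) ** adj P = mat2 l 0 0 (1 / l)" by blast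
  define T where "T = tup (conjugate_rep G P \<rho>)"
  have T: "T k = P ** \<rho> (d k) ** adj P" if "k < n" for k unfolding T_def using conjugate_rep_apply[OF P(1) dG[OF that]] .
  have T0: "T 0 = mat2 l 0 0 (1 / l)" using T[OF n0] P(2) by simp
  have "sg T \<noteq> 0" using invariantD[OF invariant_sg P(1) XD(1)] s0 unfolding T_def by simp
  then have b: "T i $ 1 $ 2 \<noteq> 0" using normal(1)[of T, OF T0] by auto
  define t where "t = 1 / csqrt (T i $ 1 $ 2)"
  have t: "t \<noteq> 0" "t * t * T i $ 1 $ 2 = 1" unfolding t_def using b by (auto simp: field_simps simp flip: power2_eq_square)
  define D where "D = mat2 t 0 0 (1 / t)"
  have D: "det D = 1" using t by (simp add: D_def det_2)
  have DP: "(D ** P) ** A ** adj (D ** P) = D ** (P ** A ** adj P) ** adj D" for A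
    by (simp only: adj_prod matrix_mul_assoc)
  have dDP: "det (D ** P) = 1" using D P(1) by (simp add: det_mul)
  have "conjugate_rep G (D ** P) \<rho> (d k) = D ** T k ** adj D" if "k < n" for k
    unfolding conjugate_rep_apply[OF dDP dG[OF that]] DP T[OF that] ..
  moreover have "D ** mat2 l 0 0 (1 / l) ** adj D = mat2 l 0 0 (1 / l)" unfolding D_def using t(1) by (simp add: mtx_simps)
  moreover have "(D ** A ** adj D) $ 1 $ 2 = t * t * A $ 1 $ 2" for A unfolding D_def by (simp add: mult_entry)
  ultimately show ?thesis using dDP T0 n0 i t(2) by (intro exI[of _ "D ** P"]) simp
qed

definition u where "u y \<kappa> = y \<kappa> + cf (tup p) \<kappa>"

text \<open>The tuple in normal form with coordinates \<open>y\<close>, centred so that \<open>y = 0\<close> is the point \<open>p\<close>.\<close>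
definition R :: "(nat \<times> bool \<Rightarrow> complex) \<Rightarrow> nat \<Rightarrow> mtx" where
  "R y k = (if k = i then mat2 (u y (i, True)) 1 (u y (i, True) * (w i - u y (i, True)) - 1) (w i - u y (i, True))
     else if k \<in> K then adj (g k) ** quadric_matrix (u y (k, True)) (u y (k, False)) (w k) ** g k
     else mat2 l 0 0 (1 / l))"

definition good where "good y \<longleftrightarrow> (\<forall>k\<in>K. u y (k, False) \<noteq> 0)"

lemma R_normal:
  assumes T0: "T 0 = mat2 l 0 0 (1 / l)" and Ti: "T i $ 1 $ 2 = 1"
    and dt: "\<And>k. k < n ==> det (T k) = 1" and tr: "\<And>k. k < n ==> trace (T k) = w k"
    and gd: "\<And>k. k \<in> K ==> cf T (k, False) \<noteq> 0" and y: "\<And>\<kappa>. \<kappa> \<in> I ==> u y \<kappa> = cf T \<kappa>" and k: "k < n"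
  shows "R y k = T k"
proof -
  consider "k = i" | "k \<in> K" | "k = 0" using k unfolding K_def by fastforce
  then show ?thesis
  proof cases
    case 1
    have "u y (i, True) = T i $ 1 $ 1" using y[of "(i, True)"] by (simp add: I_def cf_def)
    moreover have "w i - T i $ 1 $ 1 = T i $ 2 $ 2" using tr[OF i(2)] unfolding trace2 by (metis add_diff_cancel_left')
    moreover have "T i $ 2 $ 1 = T i $ 1 $ 1 * T i $ 2 $ 2 - 1" using dt[OF i(2)] Ti by (simp add: det_2 algebra_simps)
    ultimately show ?thesis using Ti unfolding 1 R_def by (simp add: matrix2_eq_iff)
  next
    case 2
    then have ki: "k \<noteq> i" using K by auto
    let ?A = "g k ** T k ** adj (g k)"
    have uu: "u y (k, True) = ?A $ 1 $ 1" "u y (k, False) = ?A $ 1 $ 2" using y[OF K_I[OF 2]] ki by (simp_all add: cf_def)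
    have "?A $ 1 $ 2 \<noteq> 0" using gd[OF 2] ki by (simp add: cf_def)
    then have "quadric_matrix (?A $ 1 $ 1) (?A $ 1 $ 2) (w k) = ?A"
      using dt[OF k] tr[OF k] g(1)[OF k] by (intro quadric_matrix_eq) (simp_all add: det_conj trace_conj)
    then show ?thesis unfolding R_def uu using 2 ki adj_conj_cancel(1)[OF g(1)[OF k]] by simp
  next
    case 3
    then show ?thesis using T0 K i unfolding R_def by auto
  qed
qed

definition xx where "xx \<kappa> \<rho> = cf (N (tup \<rho>)) \<kappa> - cf (N (tup p)) \<kappa>"

text \<open>The invariant coordinates determine a representation up to conjugation.\<close>
lemma reconstruct:
  assumes \<rho>: "\<rho> \<in> X" and s0: "s \<rho> \<noteq> 0"
  shows "good (\<lambda>\<kappa>. xx \<kappa> \<rho>)" "\<exists>P. det P = 1 \<and> (\<forall>k<n. P ** \<rho> (d k) ** adj P = R (\<lambda>\<kappa>. xx \<kappa> \<rho>) k)"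
proof -
  note XD = XD[OF \<rho>]
  have sg0: "sg (tup \<rho>) \<noteq> 0" and cf0: "\<And>k. k \<in> K ==> cf (N (tup \<rho>)) (k, False) \<noteq> 0" using s0 unfolding s_nonzero by auto
  have uu: "u (\<lambda>\<kappa>. xx \<kappa> \<rho>) \<kappa> = cf (N (tup \<rho>)) \<kappa>" if "\<kappa> \<in> I" for \<kappa>
    using cf_p[OF that] by (simp add: u_def xx_def)
  then show "good (\<lambda>\<kappa>. xx \<kappa> \<rho>)" unfolding good_def using cf0 K_I by simp
  obtain P where P: "det P = 1" "conjugate_rep G P \<rho> (d 0) = mat2 l 0 0 (1 / l)" "conjugate_rep G P \<rho> (d i) $ 1 $ 2 = 1"
    using normal_form[OF \<rho> sg0] by blast
  define T where "T = tup (conjugate_rep G P \<rho>)"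
  have T: "T k = P ** \<rho> (d k) ** adj P" if "k < n" for k unfolding T_def using conjugate_rep_apply[OF P(1) dG[OF that]] .
  have sgT: "sg T = sg (tup \<rho>)" unfolding T_def using invariantD[OF invariant_sg P(1) XD(1)] .
  have NT: "N T k = T k" for k by (rule normal(2)) (use P sgT sg0 in \<open>auto simp: T_def\<close>)
  have cfT: "cf T \<kappa> = cf (N (tup \<rho>)) \<kappa>" if "\<kappa> \<in> I" for \<kappa>
  proof -
    have "cf T \<kappa> = cf (N T) \<kappa>" by (rule cf_cong[OF that]) (simp add: NT)
    also have "\<dots> = cf (NN T) \<kappa> / sg (tup \<rho>)" unfolding cf_N sgT ..
    also have "cf (NN T) \<kappa> = cf (NN (tup \<rho>)) \<kappa>" unfolding T_def using invariantD[OF invariant_cf[OF that] P(1) XD(1)] .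
    finally show ?thesis unfolding cf_N .
  qed
  have "R (\<lambda>\<kappa>. xx \<kappa> \<rho>) k = T k" if "k < n" for k
  proof (rule R_normal[OF _ _ _ _ _ _ that])
    show "T 0 = mat2 l 0 0 (1 / l)" "T i $ 1 $ 2 = 1" using P by (auto simp: T_def)
    show "det (T k) = 1" "trace (T k) = w k" if "k < n" for k
      using T[OF that] XD(2)[OF that] XD(3)[OF that] P(1) by (simp_all add: det_conj trace_conj)
    show "cf T (k, False) \<noteq> 0" if "k \<in> K" for k using cfT[OF K_I[OF that]] cf0[OF that] by simp
    show "u (\<lambda>\<kappa>. xx \<kappa> \<rho>) \<kappa> = cf T \<kappa>" if "\<kappa> \<in> I" for \<kappa> using uu[OF that] cfT[OF that] by simp
  qed
  then show "\<exists>P. det P = 1 \<and> (\<forall>k<n. P ** \<rho> (d k) ** adj P = R (\<lambda>\<kappa>. xx \<kappa> \<rho>) k)" using P(1) T by auto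
qed

lemma R_p: "k < n ==> R (\<lambda>\<kappa>. 0) k = p (d k)"
proof (rule R_normal)
  show "cf (tup p) (k, False) \<noteq> 0" if "k \<in> K" for k using K(1)[OF that] g(2)[of k] unfolding cf_def by simp
qed (use p0 pi XD[OF pX] in \<open>auto simp: u_def\<close>)

end


context slice
begin

text \<open>Extends functions on \<open>X\<close> to the whole type, with the value at \<open>p\<close> elsewhere.\<close>
definition rr where "rr q = (if q \<in> X then q else p)"
definition AA where "AA = (\<lambda>f q. f (rr q)) ` carrier (invariant_ring G)"

lemma rr: "rr q \<in> X" "rr q \<in> rep_space G"
  using pX XD(1) by (auto simp: rr_def)

lemma AA_mem: "invariant_fun G f ==> (\<lambda>q. f (rr q)) \<in> AA"
  unfolding AA_def using invariant_restrict[OF G, of f] rr(2) by (intro image_eqI[of _ _ "restrict f (rep_space G)"]) auto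

lemma AA_elim: "f \<in> AA ==> \<exists>a. invariant_fun G a \<and> f = (\<lambda>q. a (rr q))"
  unfolding AA_def using invariant_ring_carrier_iff[OF G] by auto

lemma function_algebra_AA: "function_algebra AA"
proof
  show "(\<lambda>q. c) \<in> AA" for c using AA_mem[OF invariant_const[of G c]] .
  fix f h assume "f \<in> AA" "h \<in> AA"
  then obtain a b where "invariant_fun G a" "f = (\<lambda>q. a (rr q))" "invariant_fun G b" "h = (\<lambda>q. b (rr q))" using AA_elim by blast
  then show "(\<lambda>q. f q + h q) \<in> AA" "(\<lambda>q. f q * h q) \<in> AA"
    using AA_mem[OF invariant_add[of G a b]] AA_mem[OF invariant_mult[of G a b]] by auto
qed

lemma u_poly: "\<kappa> \<in> I ==> (\<lambda>y. u y \<kappa>) \<in> polyfun I"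
  unfolding u_def by (intro polyfun_intros)

lemma i_I: "(i, True) \<in> I" by (simp add: I_def)

lemma good_0: "good (\<lambda>\<kappa>. 0)"
  unfolding good_def u_def using s_p[unfolded s_nonzero] cf_p[OF K_I] by auto

text \<open>Rational in \<open>y\<close> with denominator not vanishing at the origin.\<close>
definition frac where
  "frac f \<longleftrightarrow> (\<exists>G H. G \<in> polyfun I \<and> H \<in> polyfun I \<and> H (\<lambda>\<kappa>. 0) \<noteq> 0 \<and> (\<forall>y. good y --> H y * f y = G y))"

lemma frac_poly: "f \<in> polyfun I ==> frac f"
  unfolding frac_def by (rule exI[of _ f], rule exI[of _ "\<lambda>y. 1"]) (auto intro: polyfun.intros)

lemma frac_add: assumes "frac f" "frac h" shows "frac (\<lambda>y. f y + h y)"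
proof -
  obtain G H where 1: "G \<in> polyfun I" "H \<in> polyfun I" "H (\<lambda>\<kappa>. 0) \<noteq> 0" "\<forall>y. good y --> H y * f y = G y" using assms(1) unfolding frac_def by (elim exE conjE) (rule that)
  obtain G' H' where 2: "G' \<in> polyfun I" "H' \<in> polyfun I" "H' (\<lambda>\<kappa>. 0) \<noteq> 0" "\<forall>y. good y --> H' y * h y = G' y" using assms(2) unfolding frac_def by (elim exE conjE) (rule that)
  show ?thesis unfolding frac_def
  proof (intro exI conjI allI impI)
    show "(\<lambda>y. G y * H' y + G' y * H y) \<in> polyfun I" "(\<lambda>y. H y * H' y) \<in> polyfun I" by (intro polyfun_intros 1 2)+
    show "H (\<lambda>\<kappa>. 0) * H' (\<lambda>\<kappa>. 0) \<noteq> 0" using 1 2 by simp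
    show "H y * H' y * (f y + h y) = G y * H' y + G' y * H y" if "good y" for y
    proof -
      have "G y = H y * f y" "G' y = H' y * h y" using 1(4) 2(4) that by auto
      then show ?thesis by (simp add: algebra_simps)
    qed
  qed
qed

lemma frac_mult: assumes "frac f" "frac h" shows "frac (\<lambda>y. f y * h y)"
proof -
  obtain G H where 1: "G \<in> polyfun I" "H \<in> polyfun I" "H (\<lambda>\<kappa>. 0) \<noteq> 0" "\<forall>y. good y --> H y * f y = G y" using assms(1) unfolding frac_def by (elim exE conjE) (rule that)
  obtain G' H' where 2: "G' \<in> polyfun I" "H' \<in> polyfun I" "H' (\<lambda>\<kappa>. 0) \<noteq> 0" "\<forall>y. good y --> H' y * h y = G' y" using assms(2) unfolding frac_def by (elim exE conjE) (rule that)
  show ?thesis unfolding frac_def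
  proof (intro exI conjI allI impI)
    show "(\<lambda>y. G y * G' y) \<in> polyfun I" "(\<lambda>y. H y * H' y) \<in> polyfun I" by (intro polyfun_intros 1 2)+
    show "H (\<lambda>\<kappa>. 0) * H' (\<lambda>\<kappa>. 0) \<noteq> 0" using 1 2 by simp
    show "H y * H' y * (f y * h y) = G y * G' y" if "good y" for y
    proof -
      have "G y = H y * f y" "G' y = H' y * h y" using 1(4) 2(4) that by auto
      then show ?thesis by (simp add: algebra_simps)
    qed
  qed
qed

lemma frac_inverse: assumes k: "k \<in> K" shows "frac (\<lambda>y. 1 / u y (k, False))"
  unfolding frac_def
proof (intro exI conjI allI impI)
  show "(\<lambda>y. 1) \<in> polyfun I" by (rule polyfun.const)
  show "(\<lambda>y. u y (k, False)) \<in> polyfun I" by (rule u_poly[OF K_I[OF k]])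
  show "u (\<lambda>\<kappa>. 0) (k, False) \<noteq> 0" using good_0 k unfolding good_def by blast
  show "u y (k, False) * (1 / u y (k, False)) = 1" if "good y" for y using that k unfolding good_def by simp
qed

lemma frac_const: "frac (\<lambda>y. c)" by (rule frac_poly[OF polyfun.const])

lemma frac_mult_entry: fixes A B :: "(nat \<times> bool \<Rightarrow> complex) \<Rightarrow> mtx" assumes "\<And>a b. frac (\<lambda>y. A y $ a $ b)" "\<And>a b. frac (\<lambda>y. B y $ a $ b)"
  shows "frac (\<lambda>y. ((A y :: mtx) ** B y) $ a $ b)"
  unfolding mult_entry by (intro frac_add frac_mult assms)

lemma poly_R_i: "\<forall>a b. (\<lambda>y. R y i $ a $ b) \<in> polyfun I"
  unfolding forall_2 R_def by (auto intro!: polyfun_intros u_poly i_I)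

lemma R_frac: "frac (\<lambda>y. R y k $ a $ b)"
proof -
  consider "k = i" | "k \<in> K" "k \<noteq> i" | "k \<notin> K" "k \<noteq> i" by blast
  then show ?thesis
  proof cases
    case 1 then show ?thesis using poly_R_i frac_poly by blast
  next
    case 2
    have U: "frac (\<lambda>y. u y (k, b))" for b by (rule frac_poly[OF u_poly[OF K_I[OF 2(1)]]])
    have "\<forall>a b. frac (\<lambda>y. quadric_matrix (u y (k, True)) (u y (k, False)) (w k) $ a $ b)"
      unfolding forall_2 quadric_matrix_def mat2_entries
    proof (intro conjI U)
      have "frac (\<lambda>y. (u y (k, True) * (w k + (-1) * u y (k, True)) + (-1)) * (1 / u y (k, False)))"
        by (intro frac_add frac_mult U frac_const frac_inverse 2)
      then show "frac (\<lambda>y. (u y (k, True) * (w k - u y (k, True)) - 1) / u y (k, False))" by simp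
      have "frac (\<lambda>y. w k + (-1) * u y (k, True))" by (intro frac_add frac_mult U frac_const)
      then show "frac (\<lambda>y. w k - u y (k, True))" by simp
    qed
    then have Q: "frac (\<lambda>y. quadric_matrix (u y (k, True)) (u y (k, False)) (w k) $ a $ b)" for a b by blast
    have "R y k = adj (g k) ** quadric_matrix (u y (k, True)) (u y (k, False)) (w k) ** g k" for y
      unfolding R_def using 2 by simp
    then show ?thesis by (simp only:) (intro frac_mult_entry Q frac_const)
  next
    case 3
    then have "R y k = mat2 l 0 0 (1 / l)" for y unfolding R_def by simp
    then show ?thesis by (simp only:) (rule frac_const)
  qed
qed

lemma frac_compose:
  assumes "\<Phi> \<in> polyfun EI" shows "frac (\<lambda>y. \<Phi> (\<lambda>(k, a, b). R y k $ a $ b))"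
  using assms
proof (induction rule: polyfun.induct)
  case (const c) show ?case by (rule frac_const)
next
  case (var e) then show ?case by (cases e) (simp add: R_frac)
next
  case (add f h) then show ?case by (rule_tac frac_add)
next
  case (mult f h) then show ?case by (rule_tac frac_mult)
qed

text \<open>An invariant function is a polynomial in the matrix entries of the normal form, which are rational in the coordinates.\<close>
lemma local_presentation:
  assumes f: "f \<in> AA"
  shows "\<exists>G\<in>polyfun I. \<exists>H\<in>polyfun I. H (\<lambda>\<kappa>. 0) \<noteq> 0 \<and>
     (\<forall>q. s (rr q) \<noteq> 0 --> H (\<lambda>\<kappa>. xx \<kappa> (rr q)) * f q = G (\<lambda>\<kappa>. xx \<kappa> (rr q)))"
proof -
  obtain a where a: "invariant_fun G a" "f = (\<lambda>q. a (rr q))" using AA_elim[OF f] by blast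
  then obtain \<Phi> where \<Phi>: "\<Phi> \<in> polyfun EI" "\<forall>\<rho>\<in>rep_space G. a \<rho> = \<Phi> (entries \<rho>)"
    using regular_polynomial unfolding invariant_fun_def by blast
  obtain P H where PH: "P \<in> polyfun I" "H \<in> polyfun I" "H (\<lambda>\<kappa>. 0) \<noteq> 0" "\<forall>y. good y --> H y * \<Phi> (\<lambda>(k, a, b). R y k $ a $ b) = P y"
    using frac_compose[OF \<Phi>(1)] unfolding frac_def by (elim exE conjE) (rule that)
  show ?thesis
  proof (rule bexI[OF _ PH(1)], rule bexI[OF _ PH(2)], intro conjI PH(3) allI impI)
    fix q assume s0: "s (rr q) \<noteq> 0"
    let ?y = "\<lambda>\<kappa>. xx \<kappa> (rr q)"
    obtain Q where Q: "det Q = 1" "\<forall>k<n. Q ** rr q (d k) ** adj Q = R ?y k" using reconstruct(2)[OF rr(1) s0] by blast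
    have "a (rr q) = a (conjugate_rep G Q (rr q))" using invariantD[OF a(1) Q(1) rr(2)] by simp
    also have "\<dots> = \<Phi> (entries (conjugate_rep G Q (rr q)))" using \<Phi>(2) conjugate_rep_space[OF G Q(1) rr(2)] by blast
    also have "\<dots> = \<Phi> (\<lambda>(k, a, b). R ?y k $ a $ b)"
    proof (rule polyfun_cong[OF \<Phi>(1)])
      fix e assume "e \<in> EI"
      then obtain k a b where e: "e = (k, a, b)" "k < n" by auto
      then show "entries (conjugate_rep G Q (rr q)) e = (\<lambda>(k, a, b). R ?y k $ a $ b) e"
        using Q(2) conjugate_rep_apply[OF Q(1) dG[OF e(2)]] by (simp add: entries_def)
    qed
    finally show "H ?y * f q = P ?y" using PH(4) reconstruct(1)[OF rr(1) s0] a(2) by simp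
  qed
qed

definition Mm where
  "Mm y k = (if k \<in> K then adj (g k) ** mat2 (u y (k, True) * u y (k, False)) (u y (k, False) * u y (k, False))
        (u y (k, True) * (w k - u y (k, True)) - 1) ((w k - u y (k, True)) * u y (k, False)) ** g k else R y k)"

definition V where "V y = (\<Prod>k\<in>K. u y (k, False))"

text \<open>The equation for the trace of the product, multiplied by \<open>V\<close>, the product of the second coordinates, to make it polynomial.\<close>
definition F where "F y = trace (mprod (map (Mm y) [0..<n])) - wl * V y"

lemma V_poly: "V \<in> polyfun I"
proof -
  have "V = (\<lambda>y. \<Prod>k\<in>K. u y (k, False))" unfolding V_def by auto
  then show ?thesis using polyfun_prod[of K "\<lambda>k y. u y (k, False)" I] u_poly K_I by auto
qed

lemma Mm_poly: "(\<lambda>y. Mm y k $ a $ b) \<in> polyfun I"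
proof -
  have "\<forall>a b. (\<lambda>y. Mm y k $ a $ b) \<in> polyfun I"
  proof (cases "k \<in> K")
    case True
    let ?Q = "\<lambda>y. mat2 (u y (k, True) * u y (k, False)) (u y (k, False) * u y (k, False))
        (u y (k, True) * (w k - u y (k, True)) - 1) ((w k - u y (k, True)) * u y (k, False))"
    have "\<forall>a b. (\<lambda>y. ?Q y $ a $ b) \<in> polyfun I"
      unfolding forall_2 mat2_entries by (intro conjI polyfun_intros u_poly K_I True)
    then have Q: "(\<lambda>y. ?Q y $ a $ b) \<in> polyfun I" for a b by blast
    have "Mm y k = adj (g k) ** ?Q y ** g k" for y unfolding Mm_def using True by simp
    then show ?thesis by (simp only:) (intro allI polyfun_mat_entry Q polyfun.const)
  next
    case False
    show ?thesis
    proof (cases "k = i")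
      case True
      have "Mm y k = R y i" for y unfolding Mm_def using False True by simp
      then show ?thesis using poly_R_i by simp
    next
      case ki: False
      have "Mm y k = mat2 l 0 0 (1 / l)" for y unfolding Mm_def R_def using False ki by simp
      then show ?thesis by (simp add: polyfun.const)
    qed
  qed
  then show ?thesis by blast
qed

lemma F_poly: "F \<in> polyfun I"
proof -
  have "(\<lambda>y. (mprod (map (Mm y) [0..<n]) $ 1 $ 1 + mprod (map (Mm y) [0..<n]) $ 2 $ 2) - wl * V y) \<in> polyfun I"
    by (intro polyfun_diff polyfun.add polyfun_mprod_entry Mm_poly polyfun_cmult V_poly)
  moreover have "F = (\<lambda>y. (mprod (map (Mm y) [0..<n]) $ 1 $ 1 + mprod (map (Mm y) [0..<n]) $ 2 $ 2) - wl * V y)"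
    unfolding F_def trace2 by auto
  ultimately show ?thesis by simp
qed

lemma Mm_good: assumes "k \<in> K" "u y (k, False) \<noteq> 0" shows "Mm y k = mat (u y (k, False)) ** R y k"
proof -
  have "mat2 (u y (k, True) * u y (k, False)) (u y (k, False) * u y (k, False))
        (u y (k, True) * (w k - u y (k, True)) - 1) ((w k - u y (k, True)) * u y (k, False))
      = mat (u y (k, False)) ** quadric_matrix (u y (k, True)) (u y (k, False)) (w k)"
    unfolding quadric_matrix_def using assms(2) by (simp add: mtx_simps)
  moreover have "R y k = adj (g k) ** quadric_matrix (u y (k, True)) (u y (k, False)) (w k) ** g k"
    unfolding R_def using assms(1) K(1)[OF assms(1)] by simp
  ultimately show ?thesis unfolding Mm_def using assms(1) scalar_mat_commute[of "u y (k, False)" "adj (g k)"]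
    by (simp add: matrix_mul_assoc)
qed

lemma V_nonzero: "good y \<longleftrightarrow> V y \<noteq> 0"
  unfolding good_def V_def using K(2) by auto

lemma F_good:
  assumes "good y" shows "F y = V y * (trace (mprod (map (R y) [0..<n])) - wl)"
proof -
  define c where "c = (\<lambda>k. if k \<in> K then u y (k, False) else 1)"
  have "Mm y k = mat (c k) ** R y k" for k
    using Mm_good[of k y] assms unfolding good_def c_def by (auto simp: Mm_def)
  then have "Mm y = (\<lambda>k. mat (c k) ** R y k)" by (rule ext)
  then have "mprod (map (Mm y) [0..<n]) = mat (\<Prod>k\<leftarrow>[0..<n]. c k) ** mprod (map (R y) [0..<n])"
    using mprod_scale[of c "R y" "[0..<n]"] by simp
  moreover have "(\<Prod>k\<leftarrow>[0..<n]. c k) = V y"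
  proof -
    have "(\<Prod>k\<leftarrow>[0..<n]. c k) = (\<Prod>k\<in>{0..<n}. c k)" using prod.distinct_set_conv_list[of "[0..<n]" c] by simp
    also have "\<dots> = (\<Prod>k\<in>K. c k)" by (rule prod.mono_neutral_right) (use K(1) in \<open>auto simp: c_def\<close>)
    also have "\<dots> = V y" unfolding V_def by (intro prod.cong) (auto simp: c_def)
    finally show ?thesis .
  qed
  ultimately show ?thesis unfolding F_def trace2 by (simp add: scalar_entry algebra_simps)
qed

lemma F_points: assumes s0: "s (rr q) \<noteq> 0" shows "F (\<lambda>\<kappa>. xx \<kappa> (rr q)) = 0"
proof -
  let ?y = "\<lambda>\<kappa>. xx \<kappa> (rr q)"
  obtain Q where Q: "det Q = 1" "\<forall>k<n. Q ** rr q (d k) ** adj Q = R ?y k" using reconstruct(2)[OF rr(1) s0] by blast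
  have "map (R ?y) [0..<n] = map (\<lambda>A. Q ** A ** adj Q) (map (\<lambda>k. rr q (d k)) [0..<n])" using Q(2) by simp
  from arg_cong[OF this, of mprod, unfolded mprod_conj[OF Q(1)]]
  have "mprod (map (R ?y) [0..<n]) = Q ** mprod (map (\<lambda>k. rr q (d k)) [0..<n]) ** adj Q" .
  then have "trace (mprod (map (R ?y) [0..<n])) = wl" using trace_conj[OF Q(1)] XD(4)[OF rr(1)] by simp
  then show ?thesis using F_good[OF reconstruct(1)[OF rr(1) s0]] by simp
qed

lemma R_props:
  assumes gd: "good y" and k: "k < n" shows "det (R y k) = 1" "trace (R y k) = w k"
proof -
  consider "k = i" | "k \<in> K" | "k = 0" using k unfolding K_def by fastforce
  then have "det (R y k) = 1 \<and> trace (R y k) = w k"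
  proof cases
    case 1 then show ?thesis unfolding R_def by (simp add: det_2 trace2)
  next
    case 2
    then have R: "R y k = adj (g k) ** quadric_matrix (u y (k, True)) (u y (k, False)) (w k) ** g k"
      unfolding R_def using K(1)[OF 2] by simp
    have v: "u y (k, False) \<noteq> 0" using gd 2 unfolding good_def by blast
    have a: "det (adj (g k)) = 1" using g(1)[OF k] by simp
    show ?thesis unfolding R using det_conj[OF a] trace_conj[OF a] quadric_matrix_det[OF v] quadric_matrix_trace by simp
  next
    case 3
    have "R y 0 = p (d 0)" using K i unfolding R_def p0 by auto
    then show ?thesis using XD(2,3)[OF pX] k 3 by simp
  qed
  then show "det (R y k) = 1" "trace (R y k) = w k" by auto
qed

text \<open>Since the group is free, every tuple \<open>R y\<close> comes from a representation, and \<open>F y = 0\<close> puts it into \<open>X\<close>.\<close>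
lemma points_nearby:
  "\<exists>\<epsilon>>0. \<forall>y. (\<forall>\<kappa>\<in>I. norm (y \<kappa>) < \<epsilon>) --> F y = 0 --> (\<exists>q. s (rr q) \<noteq> 0 \<and> (\<forall>\<kappa>\<in>I. xx \<kappa> (rr q) = y \<kappa>))"
proof -
  have lim: "eventually (\<lambda>y. f y \<noteq> 0) (box_filter I)" if "f \<in> polyfun I" "f (\<lambda>\<kappa>. 0) \<noteq> 0" for f
    by (rule tendsto_imp_eventually_ne[OF polyfun_tendsto[OF that(1)] that(2)]) (rule tendsto_box_filter[OF finI])
  have Mjj: "Mm (\<lambda>\<kappa>. 0) jj $ 2 $ 1 \<noteq> 0"
  proof (cases "jj \<in> K")
    case True
    have "u (\<lambda>\<kappa>. 0) (jj, False) \<noteq> 0" using good_0 True unfolding good_def by blast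
    then show ?thesis using Mm_good[OF True] R_p[OF jj(2)] pj by (simp add: scalar_entry)
  next
    case False
    then show ?thesis unfolding Mm_def using R_p[OF jj(2)] pj by simp
  qed
  have "eventually (\<lambda>y. V y \<noteq> 0) (box_filter I)" by (rule lim[OF V_poly]) (use good_0 V_nonzero in blast)
  moreover have "eventually (\<lambda>y. Mm y jj $ 2 $ 1 \<noteq> 0) (box_filter I)" by (rule lim[OF Mm_poly Mjj])
  ultimately have "eventually (\<lambda>y. V y \<noteq> 0 \<and> Mm y jj $ 2 $ 1 \<noteq> 0) (box_filter I)" by (rule eventually_conj)
  then obtain \<epsilon> where \<epsilon>: "\<epsilon> > 0" "\<And>y. (\<forall>\<kappa>\<in>I. norm (y \<kappa>) < \<epsilon>) ==> V y \<noteq> 0 \<and> Mm y jj $ 2 $ 1 \<noteq> 0"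
    unfolding eventually_box_filter[OF finI] by blast
  show ?thesis
  proof (intro exI[of _ \<epsilon>] conjI \<epsilon>(1) allI impI)
    fix y assume y: "\<forall>\<kappa>\<in>I. norm (y \<kappa>) < \<epsilon>" and F0: "F y = 0"
    have gd: "good y" using \<epsilon>(2)[OF y] V_nonzero by blast
    have Rjj: "R y jj $ 2 $ 1 \<noteq> 0"
    proof (cases "jj \<in> K")
      case True
      then have "u y (jj, False) \<noteq> 0" using gd unfolding good_def by blast
      then show ?thesis using Mm_good[OF True] \<epsilon>(2)[OF y] by (auto simp: scalar_entry)
    next
      case False
      then show ?thesis using \<epsilon>(2)[OF y] unfolding Mm_def by simp
    qed
    obtain \<rho> where \<rho>: "\<rho> \<in> rep_space G" "\<forall>k<n. \<rho> (d k) = R y k" using free[of "R y"] R_props(1)[OF gd] by blast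
    have "map (\<lambda>k. \<rho> (d k)) [0..<n] = map (R y) [0..<n]" using \<rho>(2) by simp
    from arg_cong[OF this, of "\<lambda>As. trace (mprod As)"]
    have "trace (mprod (map (\<lambda>k. \<rho> (d k)) [0..<n])) = trace (mprod (map (R y) [0..<n]))" .
    moreover have "trace (mprod (map (R y) [0..<n])) = wl" using F_good[OF gd] F0 V_nonzero gd by simp
    ultimately have \<rho>X: "\<rho> \<in> X" unfolding X_def using \<rho> R_props(2)[OF gd] by simp
    then have rq: "rr \<rho> = \<rho>" by (simp add: rr_def)
    have T0: "tup \<rho> 0 = mat2 l 0 0 (1 / l)" using \<rho>(2) n K i unfolding R_def by auto
    have Ti: "tup \<rho> i $ 1 $ 2 = 1" using \<rho>(2) i unfolding R_def by simp
    have sg0: "sg (tup \<rho>) \<noteq> 0" using normal(1)[of "tup \<rho>", OF T0] Ti \<rho>(2) jj Rjj by simp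
    have N: "N (tup \<rho>) k = tup \<rho> k" for k by (rule normal(2)[of "tup \<rho>", OF T0 Ti sg0])
    have NT: "cf (N (tup \<rho>)) \<kappa> = cf (R y) \<kappa>" if "\<kappa> \<in> I" for \<kappa>
      by (rule cf_cong[OF that]) (simp add: N \<rho>(2))
    have cR: "cf (R y) \<kappa> = u y \<kappa>" if \<kappa>: "\<kappa> \<in> I" for \<kappa>
    proof -
      consider "\<kappa> = (i, True)" | k b where "\<kappa> = (k, b)" "k \<in> K" using \<kappa> unfolding I_def by auto
      then show ?thesis
      proof cases
        case 1 then show ?thesis by (simp add: cf_def R_def)
      next
        case 2
        have ki: "k \<noteq> i" "k < n" using K(1)[OF 2(2)] by auto
        have "g k ** R y k ** adj (g k) = quadric_matrix (u y (k, True)) (u y (k, False)) (w k)"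
          unfolding R_def using 2(2) ki adj_conj_cancel(2)[OF g(1)[OF ki(2)]] by simp
        then show ?thesis using ki unfolding 2 cf_def by (simp add: quadric_matrix_def)
      qed
    qed
    have "s \<rho> \<noteq> 0" unfolding s_nonzero using sg0 NT cR K_I gd unfolding good_def by simp
    moreover have "xx \<kappa> \<rho> = y \<kappa>" if "\<kappa> \<in> I" for \<kappa>
      unfolding xx_def NT[OF that] cR[OF that] cf_p[OF that] by (simp add: u_def)
    ultimately show "\<exists>q. s (rr q) \<noteq> 0 \<and> (\<forall>\<kappa>\<in>I. xx \<kappa> (rr q) = y \<kappa>)" using rq by metis
  qed
qed

lemma s_x_invariant: assumes "\<kappa> \<in> I" shows "(\<lambda>q. s (rr q) * xx \<kappa> (rr q)) \<in> AA"
proof -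
  have "invariant_fun G (\<lambda>\<rho>. sg (tup \<rho>) * (\<Prod>k\<in>K. cf (NN (tup \<rho>)) (k, False)) * cf (NN (tup \<rho>)) \<kappa> - cf (N (tup p)) \<kappa> * s \<rho>)"
    by (intro invariant_diff invariant_mult invariant_const invariant_sg invariant_prod invariant_cf assms invariant_s K_I)
  from AA_mem[OF this]
  have "(\<lambda>q. sg (tup (rr q)) * (\<Prod>k\<in>K. cf (NN (tup (rr q))) (k, False)) * cf (NN (tup (rr q))) \<kappa> - cf (N (tup p)) \<kappa> * s (rr q)) \<in> AA" .
  moreover have "sg (tup \<rho>) * (\<Prod>k\<in>K. cf (NN (tup \<rho>)) (k, False)) * cf (NN (tup \<rho>)) \<kappa> - cf (N (tup p)) \<kappa> * s \<rho> = s \<rho> * xx \<kappa> \<rho>" for \<rho>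
    unfolding xx_def cf_N[of "tup \<rho>"] by (cases "sg (tup \<rho>) = 0") (simp_all add: s_def power2_eq_square field_simps)
  ultimately show ?thesis by simp
qed

end


context slice
begin

definition along where "along \<kappa> \<xi> = (\<lambda>\<kappa>'. 0 :: complex)(\<kappa> := \<xi>)"

lemma along_0: "along \<kappa> 0 = (\<lambda>_. 0)" by (auto simp: along_def)

lemma along_poly_derivative:
  assumes "f \<in> polyfun I" shows "\<exists>c. ((\<lambda>\<xi>. f (along \<kappa> \<xi>)) has_field_derivative c) (at 0)"
proof -
  have "(\<lambda>\<xi>. f (along \<kappa> \<xi>)) holomorphic_on UNIV"
  proof (rule polyfun_holomorphic[OF assms])
    show "(\<lambda>\<xi>. along \<kappa> \<xi> \<kappa>') holomorphic_on UNIV" for \<kappa>' unfolding along_def by (cases "\<kappa>' = \<kappa>") auto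
  qed
  then show ?thesis using holomorphic_on_imp_differentiable_at[of _ UNIV 0] by (auto simp: field_differentiable_def)
qed

text \<open>At a zero of \<open>F\<close>, the derivatives of \<open>F\<close> and of the trace differ only by the value of \<open>V\<close>, which is not zero.\<close>
lemma critical_trace:
  assumes dF: "((\<lambda>\<xi>. F (along \<kappa> \<xi>)) has_field_derivative 0) (at 0)"
  shows "((\<lambda>\<xi>. trace (mprod (map (R (along \<kappa> \<xi>)) [0..<n]))) has_field_derivative 0) (at 0)"
proof -
  obtain v' where v': "((\<lambda>\<xi>. V (along \<kappa> \<xi>)) has_field_derivative v') (at 0)" using along_poly_derivative[OF V_poly] by blast
  have V0: "V (along \<kappa> 0) \<noteq> 0" unfolding along_0 using good_0 V_nonzero by blast
  have "map (R (\<lambda>_. 0)) [0..<n] = map (\<lambda>k. p (d k)) [0..<n]" using R_p by simp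
  from arg_cong[OF this, of "\<lambda>As. trace (mprod As)"]
  have "F (along \<kappa> 0) = 0" unfolding along_0 using F_good[OF good_0] XD(4)[OF pX] by simp
  have "((\<lambda>\<xi>. F (along \<kappa> \<xi>) / V (along \<kappa> \<xi>) + wl) has_field_derivative (0 * V (along \<kappa> 0) - F (along \<kappa> 0) * v') / (V (along \<kappa> 0) * V (along \<kappa> 0)) + 0) (at 0)"
    by (intro DERIV_add DERIV_divide dF v' V0 DERIV_const)
  then have D: "((\<lambda>\<xi>. F (along \<kappa> \<xi>) / V (along \<kappa> \<xi>) + wl) has_field_derivative 0) (at 0)"
    using \<open>F (along \<kappa> 0) = 0\<close> by simp
  have "isCont (\<lambda>\<xi>. V (along \<kappa> \<xi>)) 0" using v' by (rule DERIV_isCont)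
  from tendsto_imp_eventually_ne[OF this[unfolded isCont_def] V0]
  have "eventually (\<lambda>\<xi>. \<xi> \<noteq> 0 --> V (along \<kappa> \<xi>) \<noteq> 0) (nhds 0)" unfolding eventually_at_filter by simp
  then have "eventually (\<lambda>\<xi>. V (along \<kappa> \<xi>) \<noteq> 0) (nhds 0)"
    by (rule eventually_mono) (use V0 in auto)
  then have ev: "eventually (\<lambda>\<xi>. F (along \<kappa> \<xi>) / V (along \<kappa> \<xi>) + wl = trace (mprod (map (R (along \<kappa> \<xi>)) [0..<n]))) (nhds 0)"
  proof eventually_elim
    case (elim \<xi>)
    then have "good (along \<kappa> \<xi>)" using V_nonzero by blast
    from F_good[OF this] elim show ?case by simp
  qed
  show ?thesis using D DERIV_cong_ev[OF refl ev refl] by blast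
qed

lemma R_along:
  assumes "k < n" "k' \<noteq> k" "k' < n" shows "R (along (k, b) \<xi>) k' = p (d k')"
proof -
  have "u (along (k, b) \<xi>) (k', c) = u (\<lambda>_. 0) (k', c)" for c using assms(2) by (simp add: u_def along_def)
  then have "R (along (k, b) \<xi>) k' = R (\<lambda>_. 0) k'"
    unfolding R_def using assms by auto
  then show ?thesis using R_p[OF assms(3)] by simp
qed

abbreviation C where "C k \<equiv> cofactor (tup p) n k"

lemma trace_along:
  assumes "k < n" shows "trace (mprod (map (R (along (k, b) \<xi>)) [0..<n])) = trace (R (along (k, b) \<xi>) k ** C k)"
proof -
  have "map (R (along (k, b) \<xi>)) [0..<n] = map ((tup p)(k := R (along (k, b) \<xi>) k)) [0..<n]"
    using R_along[OF assms] by auto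
  from arg_cong[OF this, of "\<lambda>As. trace (mprod As)"] show ?thesis using trace_cofactor[OF assms, of "tup p"] by simp
qed

lemma critical_i:
  assumes "((\<lambda>\<xi>. F (along (i, True) \<xi>)) has_field_derivative 0) (at 0)"
  shows "C i $ 1 $ 1 - C i $ 2 $ 2 + (p (d i) $ 2 $ 2 - p (d i) $ 1 $ 1) * C i $ 1 $ 2 = 0"
proof -
  define a where "a = p (d i) $ 1 $ 1"
  define b where "b = p (d i) $ 2 $ 2"
  have ab: "w i = a + b" using XD(3)[OF pX i(2)] by (simp add: a_def b_def trace2)
  have R: "R (along (i, True) \<xi>) i = mat2 (\<xi> + a) 1 ((\<xi> + a) * (b - \<xi>) - 1) (b - \<xi>)" for \<xi>
    unfolding R_def by (simp add: u_def along_def cf_def ab a_def b_def)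
  have "((\<lambda>\<xi>. trace (R (along (i, True) \<xi>) i ** C i)) has_field_derivative 0) (at 0)"
    using critical_trace[OF assms] unfolding trace_along[OF i(2)] .
  moreover have "((\<lambda>\<xi>. trace (R (along (i, True) \<xi>) i ** C i)) has_field_derivative (C i $ 1 $ 1 - C i $ 2 $ 2 + (b - a) * C i $ 1 $ 2)) (at 0)"
    unfolding R trace2 mult_entry mat2_entries by (auto intro!: derivative_eq_intros simp: algebra_simps)
  ultimately show ?thesis unfolding a_def b_def using DERIV_unique by blast
qed

lemma critical_K:
  assumes k: "k \<in> K" and d1: "((\<lambda>\<xi>. F (along (k, True) \<xi>)) has_field_derivative 0) (at 0)"
    and d2: "((\<lambda>\<xi>. F (along (k, False) \<xi>)) has_field_derivative 0) (at 0)"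
  shows "p (d k) ** C k = C k ** p (d k)"
proof -
  have kn: "k < n" "k \<noteq> i" using K(1)[OF k] by auto
  define a b t where "a = cf (tup p) (k, True)" and "b = cf (tup p) (k, False)" and "t = w k"
  define Q where "Q = g k ** C k ** adj (g k)"
  have b0: "b \<noteq> 0" using good_0 k unfolding good_def u_def b_def by simp
  have tr: "trace (adj (g k) ** A ** g k ** C k) = trace (A ** Q)" for A
  proof -
    have "trace (adj (g k) ** A ** g k ** C k) = trace (adj (g k) ** (A ** g k ** C k))" by (simp add: matrix_mul_assoc)
    also have "\<dots> = trace (A ** g k ** C k ** adj (g k))" by (rule trace_mult_commute)
    finally show ?thesis unfolding Q_def by (simp add: matrix_mul_assoc)
  qed
  have RT: "R (along (k, True) \<xi>) k = adj (g k) ** quadric_matrix (\<xi> + a) b t ** g k" for \<xi>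
    unfolding R_def using k kn by (simp add: u_def along_def a_def b_def t_def)
  have RF: "R (along (k, False) \<xi>) k = adj (g k) ** quadric_matrix a (\<xi> + b) t ** g k" for \<xi>
    unfolding R_def using k kn by (simp add: u_def along_def a_def b_def t_def)
  have "((\<lambda>\<xi>. trace (quadric_matrix (\<xi> + a) b t ** Q)) has_field_derivative 0) (at 0)"
    using critical_trace[OF d1] unfolding trace_along[OF kn(1)] RT tr .
  moreover have "((\<lambda>\<xi>. trace (quadric_matrix (\<xi> + a) b t ** Q)) has_field_derivative
     (Q $ 1 $ 1 - Q $ 2 $ 2 + Q $ 1 $ 2 * ((t - a) - a) / b)) (at 0)"
    unfolding quadric_matrix_def trace2 mult_entry mat2_entries using b0
    by (auto intro!: derivative_eq_intros simp: field_simps)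
  ultimately have 1: "Q $ 1 $ 1 - Q $ 2 $ 2 + Q $ 1 $ 2 * ((t - a) - a) / b = 0" using DERIV_unique by blast
  have "((\<lambda>\<xi>. trace (quadric_matrix a (\<xi> + b) t ** Q)) has_field_derivative 0) (at 0)"
    using critical_trace[OF d2] unfolding trace_along[OF kn(1)] RF tr .
  moreover have "((\<lambda>\<xi>. trace (quadric_matrix a (\<xi> + b) t ** Q)) has_field_derivative
     (Q $ 2 $ 1 - Q $ 1 $ 2 * ((a * (t - a) - 1) / b) / b)) (at 0)"
    unfolding quadric_matrix_def trace2 mult_entry mat2_entries using b0
    by (auto intro!: derivative_eq_intros simp: field_simps)
  ultimately have 2: "Q $ 2 $ 1 - Q $ 1 $ 2 * ((a * (t - a) - 1) / b) / b = 0" using DERIV_unique by blast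
  have comm: "quadric_matrix a b t ** Q = Q ** quadric_matrix a b t"
    unfolding quadric_matrix_def by (rule critical_on_quadric[OF b0 refl 1 2])
  have P: "p (d k) = adj (g k) ** quadric_matrix a b t ** g k"
    using RT[of 0] R_p[OF kn(1)] by (simp add: along_0)
  have Ck: "C k = adj (g k) ** Q ** g k" unfolding Q_def using adj_conj_cancel(1)[OF g(1)[OF kn(1)]] by simp
  have gg: "det (adj (g k)) = 1" using g(1)[OF kn(1)] by simp
  show ?thesis unfolding P Ck using conj_mult[OF gg, of "quadric_matrix a b t" Q] conj_mult[OF gg, of Q "quadric_matrix a b t"] comm
    by simp
qed

text \<open>
Otherwise all matrices commute with their product. The product is not scalar because its trace is prescribed to differ from \<open>2\<close> and \<open>-2\<close>, so one of its eigenlines is a common invariant line.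
\<close>
lemma noncritical: "\<exists>\<kappa>\<in>I. \<exists>c. c \<noteq> 0 \<and> ((\<lambda>\<xi>. F (along \<kappa> \<xi>)) has_field_derivative c) (at 0)"
proof (rule ccontr)
  assume no: "\<not> ?thesis"
  have crit: "((\<lambda>\<xi>. F (along \<kappa> \<xi>)) has_field_derivative 0) (at 0)" if "\<kappa> \<in> I" for \<kappa>
  proof -
    obtain c where c: "((\<lambda>\<xi>. F (along \<kappa> \<xi>)) has_field_derivative c) (at 0)" using along_poly_derivative[OF F_poly] by blast
    then have "c = 0" using no that by blast
    then show ?thesis using c by simp
  qed
  define Pr where "Pr = mprod (map (tup p) [0..<n])"
  have comm: "p (d k) ** Pr = Pr ** p (d k)" if k: "k < n" for k
    unfolding Pr_def
  proof (rule critical_commute[where A="tup p" and i=i and l=l and m="1 / l" and a="p (d i) $ 1 $ 1" and b="p (d i) $ 2 $ 2", OF n i _ _ _ _ k])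
    show "p (d 0) = mat2 l 0 0 (1 / l)" by (rule p0)
    show "p (d i) = mat2 (p (d i) $ 1 $ 1) 1 (p (d i) $ 1 $ 1 * p (d i) $ 2 $ 2 - 1) (p (d i) $ 2 $ 2)"
      using pi XD(2)[OF pX i(2)] by (simp add: matrix2_eq_iff det_2 algebra_simps)
    show "C i $ 1 $ 1 - C i $ 2 $ 2 + (p (d i) $ 2 $ 2 - p (d i) $ 1 $ 1) * C i $ 1 $ 2 = 0"
      by (rule critical_i[OF crit[OF i_I]])
    show "p (d k) ** C k = C k ** p (d k)" if "1 \<le> k" "k < n" "k \<noteq> i" for k
      by (rule critical_K) (use that in \<open>auto simp: K_def I_def intro!: crit\<close>)
  qed
  have "det Pr = 1" unfolding Pr_def by (rule det_mprod) (use XD(2)[OF pX] in auto)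
  moreover have "trace Pr = wl" unfolding Pr_def using XD(4)[OF pX] .
  ultimately have dt: "det Pr = 1" "trace Pr \<noteq> 2" "trace Pr \<noteq> - 2" using wl by auto
  obtain \<mu> where \<mu>: "{v. Pr *v v = \<mu> *s v} \<noteq> {0}" "{v. Pr *v v = \<mu> *s v} \<noteq> UNIV"
    by (rule eigenspace_exists[OF dt])
  have "vec.subspace {v. Pr *v v = \<mu> *s v}"
    unfolding vec.subspace_def by (auto simp: matrix_vector_right_distrib vec.scale_right_distrib vector_scalar_commute vec.scale_left_commute)
  moreover have "p (d k) *v v \<in> {v. Pr *v v = \<mu> *s v}" if k: "k < n" and v: "v \<in> {v. Pr *v v = \<mu> *s v}" for k v
  proof -
    have "Pr *v (p (d k) *v v) = p (d k) *v (Pr *v v)" by (simp only: matrix_vector_mul_assoc comm[OF k])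
    also have "\<dots> = \<mu> *s (p (d k) *v v)" using v by (simp add: vector_scalar_commute)
    finally show ?thesis by simp
  qed
  ultimately show False using irreducible_common[OF XD(1)[OF pX] p_irr] \<mu> by blast
qed

theorem smooth: "smooth_point (invariant_ring G) (constant_functions (rep_space G)) (character G ` X) (character G p)"
proof -
  obtain \<kappa> c where \<kappa>: "\<kappa> \<in> I" "c \<noteq> 0" "((\<lambda>\<xi>. F (along \<kappa> \<xi>)) has_field_derivative c) (at 0)" using noncritical by blast
  have "local_hypersurface AA p I (\<lambda>\<kappa> q. xx \<kappa> (rr q)) (\<lambda>q. s (rr q)) F \<kappa> c"
  proof (intro local_hypersurface.intro function_algebra_AA, unfold_locales)
    show "finite I" by (rule finI)
    show "\<kappa> \<in> I" "c \<noteq> 0" by fact+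
    show "(\<lambda>q. s (rr q)) \<in> AA" by (rule AA_mem[OF invariant_s])
    have rp: "rr p = p" using pX by (simp add: rr_def)
    show "s (rr p) \<noteq> 0" unfolding rp by (rule s_p)
    show "xx \<kappa> (rr p) = 0" for \<kappa> unfolding rp xx_def by simp
    show "(\<lambda>q. s (rr q) * xx \<kappa> (rr q)) \<in> AA" if "\<kappa> \<in> I" for \<kappa> by (rule s_x_invariant[OF that])
    show "F \<in> polyfun I" by (rule F_poly)
    show "F (\<lambda>\<kappa>. xx \<kappa> (rr q)) = 0" if "s (rr q) \<noteq> 0" for q by (rule F_points[OF that])
    show "((\<lambda>\<xi>. F ((\<lambda>_. 0)(\<kappa> := \<xi>))) has_field_derivative c) (at 0)" using \<kappa>(3) unfolding along_def .
    show "\<exists>\<epsilon>>0. \<forall>y. (\<forall>\<kappa>\<in>I. norm (y \<kappa>) < \<epsilon>) --> F y = 0 --> (\<exists>q. s (rr q) \<noteq> 0 \<and> (\<forall>\<kappa>\<in>I. xx \<kappa> (rr q) = y \<kappa>))"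
      by (rule points_nearby)
    show "\<exists>G\<in>polyfun I. \<exists>H\<in>polyfun I. H (\<lambda>i. 0) \<noteq> 0 \<and> (\<forall>q. s (rr q) \<noteq> 0 --> H (\<lambda>\<kappa>. xx \<kappa> (rr q)) * f q = G (\<lambda>\<kappa>. xx \<kappa> (rr q)))"
      if "f \<in> AA" for f by (rule local_presentation[OF that])
  qed
  moreover have "X \<subseteq> rep_space G" using XD(1) by blast
  ultimately show ?thesis
    using smooth_point_criterion[OF G _ pX, of I "\<lambda>\<kappa> q. xx \<kappa> (rr q)" "\<lambda>q. s (rr q)" F \<kappa> c] unfolding AA_def rr_def by blast
qed

end

section \<open>Reduction to the normal form\<close>

context free_reps
begin

lemma character_conjugate:
  assumes "det P = 1" "\<rho> \<in> rep_space G" shows "character G (conjugate_rep G P \<rho>) = character G \<rho>"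
  unfolding character_def using invariant_ring_carrier_iff[OF G] assms unfolding invariant_fun_def by auto

lemma irreducible_conjugate:
  assumes P: "det P = 1" and irr: "irreducible_rep G \<rho>" shows "irreducible_rep G (conjugate_rep G P \<rho>)"
  unfolding irreducible_rep_def
proof (intro allI impI, elim conjE)
  fix W assume W: "vec.subspace W" "\<forall>g\<in>carrier G. \<forall>x\<in>W. conjugate_rep G P \<rho> g *v x \<in> W"
  define W' where "W' = {v. P *v v \<in> W}"
  have aP: "adj P *v (P *v v) = v" "P *v (adj P *v v) = v" for v
    by (simp_all add: matrix_vector_mul_assoc adj_mult[OF P])
  have sub: "vec.subspace W'"
    using W(1) unfolding vec.subspace_def W'_def by (auto simp: matrix_vector_right_distrib vector_scalar_commute)
  have "\<rho> g *v v \<in> W'" if g: "g \<in> carrier G" and v: "v \<in> W'" for g v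
  proof -
    have "conjugate_rep G P \<rho> g *v (P *v v) \<in> W" using W(2) g v unfolding W'_def by blast
    moreover have "conjugate_rep G P \<rho> g *v (P *v v) = P *v (\<rho> g *v v)"
      unfolding conjugate_rep_apply[OF P g] by (simp add: matrix_vector_mul_assoc[symmetric] aP)
    ultimately show ?thesis unfolding W'_def by simp
  qed
  then have "W' = {0} \<or> W' = UNIV" using irr sub unfolding irreducible_rep_def by blast
  moreover have W: "W = (*v) P ` W'"
  proof
    show "W \<subseteq> (*v) P ` W'"
    proof
      fix x assume "x \<in> W"
      then have "adj P *v x \<in> W'" using aP(2)[of x] by (metis W'_def mem_Collect_eq)
      then have "P *v (adj P *v x) \<in> (*v) P ` W'" by (rule imageI)
      then show "x \<in> (*v) P ` W'" unfolding aP(2) .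
    qed
  qed (auto simp: W'_def)
  moreover have "range ((*v) P) = UNIV" using aP(2) by (metis surjI)
  ultimately show "W = {0} \<or> W = UNIV" by auto
qed

lemma conjugate_X:
  assumes P: "det P = 1" and \<rho>: "\<rho> \<in> X" shows "conjugate_rep G P \<rho> \<in> X"
proof -
  have c: "conjugate_rep G P \<rho> (d k) = P ** \<rho> (d k) ** adj P" if "k < n" for k
    using conjugate_rep_apply[OF P dG[OF that]] .
  have "map (\<lambda>k. conjugate_rep G P \<rho> (d k)) [0..<n] = map (\<lambda>A. P ** A ** adj P) (map (\<lambda>k. \<rho> (d k)) [0..<n])" using c by simp
  from arg_cong[OF this, of mprod, unfolded mprod_conj[OF P]]
  have "mprod (map (\<lambda>k. conjugate_rep G P \<rho> (d k)) [0..<n]) = P ** mprod (map (\<lambda>k. \<rho> (d k)) [0..<n]) ** adj P" .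
  then show ?thesis unfolding X_def using conjugate_rep_space[OF G P XD(1)[OF \<rho>]] c XD[OF \<rho>] trace_conj[OF P] by simp
qed

text \<open>Otherwise a coordinate axis is invariant.\<close>
lemma irreducible_offdiagonal:
  assumes \<rho>: "\<rho> \<in> rep_space G" "irreducible_rep G \<rho>" and ab: "a \<noteq> (b :: 2)" and d0: "\<rho> (d 0) $ a $ b = 0"
  shows "\<exists>k. 1 \<le> k \<and> k < n \<and> \<rho> (d k) $ a $ b \<noteq> 0"
proof (rule ccontr)
  assume "\<not> ?thesis"
  then have z: "\<rho> (d k) $ a $ b = 0" if "k < n" for k using that d0 by (cases "k = 0") auto
  define W where "W = {v :: complex^2. v $ a = 0}"
  have "vec.subspace W" unfolding vec.subspace_def W_def by auto
  moreover have "\<rho> (d k) *v v \<in> W" if "k < n" "v \<in> W" for k v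
  proof -
    have "(A *v v) $ a = A $ a $ a * v $ a + A $ a $ b * v $ b" for A :: mtx
      using exhaust_2[of a] exhaust_2[of b] ab by (auto simp: matrix_vector_mult_def sum_2)
    then show ?thesis using z[OF that(1)] that(2) by (simp add: W_def)
  qed
  ultimately have "W = {0} \<or> W = UNIV" using irreducible_common[OF \<rho>] by blast
  moreover have "axis b 1 \<in> W" "axis b 1 \<noteq> (0 :: complex^2)" "axis a 1 \<notin> W"
    using ab by (auto simp: W_def axis_def vec_eq_iff)
  ultimately show False by blast
qed

text \<open>Conjugation does not change the character, so the representation may be put in normal form; irreducibility supplies the two nonzero off-diagonal entries.\<close>
theorem smooth_irreducible:
  assumes \<rho>: "\<rho> \<in> X" and irr: "irreducible_rep G \<rho>"
  shows "smooth_point (invariant_ring G) (constant_functions (rep_space G)) (character G ` X) (character G \<rho>)"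
proof -
  have n0: "0 < n" using n by simp
  note XD0 = XD[OF \<rho>]
  obtain l P where l: "l \<noteq> 0" "l \<noteq> 1 / l" and P: "det P = 1" "P ** \<rho> (d 0) ** adj P = mat2 l 0 0 (1 / l)"
    using diagonalize[OF XD0(2)[OF n0]] XD0(3)[OF n0] w[OF n0] by metis
  define \<rho>1 where "\<rho>1 = conjugate_rep G P \<rho>"
  have \<rho>1: "\<rho>1 \<in> X" "irreducible_rep G \<rho>1" unfolding \<rho>1_def by (rule conjugate_X[OF P(1) \<rho>], rule irreducible_conjugate[OF P(1) irr])
  have \<rho>10: "\<rho>1 (d 0) = mat2 l 0 0 (1 / l)" unfolding \<rho>1_def conjugate_rep_apply[OF P(1) dG[OF n0]] by (rule P(2))
  obtain i where i: "1 \<le> i" "i < n" "\<rho>1 (d i) $ 1 $ 2 \<noteq> 0"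
    using irreducible_offdiagonal[OF XD(1)[OF \<rho>1(1)] \<rho>1(2), of 1 2] \<rho>10 by auto
  obtain j where j: "1 \<le> j" "j < n" "\<rho>1 (d j) $ 2 $ 1 \<noteq> 0"
    using irreducible_offdiagonal[OF XD(1)[OF \<rho>1(1)] \<rho>1(2), of 2 1] \<rho>10 by auto
  define t where "t = 1 / csqrt (\<rho>1 (d i) $ 1 $ 2)"
  have t: "t \<noteq> 0" "t * t * \<rho>1 (d i) $ 1 $ 2 = 1" unfolding t_def using i(3) by (auto simp: field_simps simp flip: power2_eq_square)
  define D where "D = mat2 t 0 0 (1 / t)"
  have D: "det D = 1" using t by (simp add: D_def det_2)
  define p where "p = conjugate_rep G D \<rho>1"
  have p: "p \<in> X" "irreducible_rep G p" unfolding p_def by (rule conjugate_X[OF D \<rho>1(1)], rule irreducible_conjugate[OF D \<rho>1(2)])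
  have pk: "p (d k) = D ** \<rho>1 (d k) ** adj D" if "k < n" for k unfolding p_def using conjugate_rep_apply[OF D dG[OF that]] .
  have "\<forall>k. \<exists>Q. k < n --> det Q = 1 \<and> (Q ** p (d k) ** adj Q) $ 1 $ 2 \<noteq> 0"
    using offdiagonal_conjugate XD(2,3)[OF p(1)] w by metis
  then obtain g where g: "\<And>k. k < n ==> det (g k) = 1 \<and> (g k ** p (d k) ** adj (g k)) $ 1 $ 2 \<noteq> 0" by metis
  interpret slice G n d w wl p l i j g
  proof
    show "p (d 0) = mat2 l 0 0 (1 / l)" unfolding pk[OF n0] \<rho>10 D_def using t(1) by (simp add: mtx_simps)
    show "p (d i) $ 1 $ 2 = 1" unfolding pk[OF i(2)] D_def using t by (simp add: mult_entry mult_ac)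
    show "p (d j) $ 2 $ 1 \<noteq> 0" unfolding pk[OF j(2)] D_def using t(1) j(3) by (simp add: mult_entry)
  qed (use p l i j g in auto)
  have "character G p = character G \<rho>"
    unfolding p_def \<rho>1_def using character_conjugate[OF D XD(1)[OF \<rho>1(1)]] character_conjugate[OF P(1) XD0(1)] by (simp add: \<rho>1_def)
  then show ?thesis using smooth by simp
qed

end


section \<open>The groupoid of path classes\<close>

text \<open>The multiplication of the fundamental group, for path classes with different end points. Working in the groupoid avoids choosing connecting paths.\<close>
definition pmult :: "'a::real_normed_vector set \<Rightarrow> (real \<Rightarrow> 'a) set \<Rightarrow> (real \<Rightarrow> 'a) set \<Rightarrow> (real \<Rightarrow> 'a) set" where
  "pmult S P Q = (\<Union>p\<in>P. \<Union>q\<in>Q. path_class S (p +++ q))"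

definition pinv :: "'a::real_normed_vector set \<Rightarrow> (real \<Rightarrow> 'a) set \<Rightarrow> (real \<Rightarrow> 'a) set" where
  "pinv S P = (\<Union>p\<in>P. path_class S (reversepath p))"

definition path_from_to :: "'a::real_normed_vector set \<Rightarrow> 'a \<Rightarrow> 'a \<Rightarrow> (real \<Rightarrow> 'a) \<Rightarrow> bool" where
  "path_from_to S a b p \<longleftrightarrow> path p \<and> path_image p \<subseteq> S \<and> pathstart p = a \<and> pathfinish p = b"

definition Hom :: "'a::real_normed_vector set \<Rightarrow> 'a \<Rightarrow> 'a \<Rightarrow> (real \<Rightarrow> 'a) set set" where
  "Hom S a b = path_class S ` {p. path_from_to S a b p}"

lemma HomI: "path_from_to S a b p ==> path_class S p \<in> Hom S a b"
  unfolding Hom_def by blast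

lemma HomE: "P \<in> Hom S a b ==> (\<And>p. path_from_to S a b p ==> P = path_class S p ==> thesis) ==> thesis"
  unfolding Hom_def by blast

lemma path_class_eqI: assumes "homotopic_paths S p q" shows "path_class S p = path_class S q"
  unfolding path_class_def using assms homotopic_paths_trans homotopic_paths_sym by blast

lemma path_class_eqD: "path_class S p = path_class S q ==> path p ==> path_image p \<subseteq> S ==> homotopic_paths S p q"
  unfolding path_class_def by (metis homotopic_paths_refl homotopic_paths_sym mem_Collect_eq)

lemma path_from_to_join: "path_from_to S a b p ==> path_from_to S b c q ==> path_from_to S a c (p +++ q)"
  unfolding path_from_to_def by (auto simp: path_image_join)

lemma path_from_to_reverse: "path_from_to S a b p ==> path_from_to S b a (reversepath p)"
  unfolding path_from_to_def by auto

lemma path_from_to_const: "a \<in> S ==> path_from_to S a a (linepath a a)"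
  unfolding path_from_to_def by auto

lemma path_from_to_mono: "path_from_to T a b p ==> T \<subseteq> S ==> path_from_to S a b p"
  unfolding path_from_to_def by auto

lemma pmult_class:
  assumes "path_from_to S a b p" "path_from_to S b c q"
  shows "pmult S (path_class S p) (path_class S q) = path_class S (p +++ q)"
proof -
  have eq: "path_class S (p' +++ q') = path_class S (p +++ q)" if "p' \<in> path_class S p" "q' \<in> path_class S q" for p' q'
  proof -
    have "homotopic_paths S (p +++ q) (p' +++ q')"
      using that assms unfolding path_class_def path_from_to_def by (intro homotopic_paths_join) auto
    then show ?thesis using path_class_eqI by blast
  qed
  have "p \<in> path_class S p" "q \<in> path_class S q" using assms unfolding path_class_def path_from_to_def by auto
  then show ?thesis unfolding pmult_def using eq by blast
qed

lemma pinv_class: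
  assumes "path_from_to S a b p" shows "pinv S (path_class S p) = path_class S (reversepath p)"
proof -
  have eq: "path_class S (reversepath p') = path_class S (reversepath p)" if "p' \<in> path_class S p" for p'
  proof -
    have "homotopic_paths S (reversepath p) (reversepath p')"
      using that unfolding path_class_def by (simp add: homotopic_paths_reversepath)
    then show ?thesis using path_class_eqI by blast
  qed
  have "p \<in> path_class S p" using assms unfolding path_class_def path_from_to_def by auto
  then show ?thesis unfolding pinv_def using eq by blast
qed

definition pone :: "'a::real_normed_vector set \<Rightarrow> 'a \<Rightarrow> (real \<Rightarrow> 'a) set" where
  "pone S a = path_class S (linepath a a)"

lemma pmult_Hom: "P \<in> Hom S a b ==> Q \<in> Hom S b c ==> pmult S P Q \<in> Hom S a c"
  by (elim HomE) (auto simp: pmult_class intro!: HomI path_from_to_join)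

lemma pinv_Hom: "P \<in> Hom S a b ==> pinv S P \<in> Hom S b a"
  by (elim HomE) (auto simp: pinv_class intro!: HomI path_from_to_reverse)

lemma pone_Hom: "a \<in> S ==> pone S a \<in> Hom S a a"
  unfolding pone_def by (intro HomI path_from_to_const)

lemma pmult_assoc:
  assumes "P \<in> Hom S a b" "Q \<in> Hom S b c" "R \<in> Hom S c e"
  shows "pmult S (pmult S P Q) R = pmult S P (pmult S Q R)"
proof -
  obtain p q r where pqr: "path_from_to S a b p" "P = path_class S p" "path_from_to S b c q" "Q = path_class S q"
    "path_from_to S c e r" "R = path_class S r" using assms by (elim HomE)
  have "homotopic_paths S (p +++ (q +++ r)) ((p +++ q) +++ r)"
    by (rule homotopic_paths_assoc) (use pqr in \<open>auto simp: path_from_to_def\<close>)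
  from path_class_eqI[OF this] show ?thesis
    using pmult_class[OF pqr(1,3)] pmult_class[OF pqr(3,5)] pmult_class[OF path_from_to_join[OF pqr(1,3)] pqr(5)]
      pmult_class[OF pqr(1) path_from_to_join[OF pqr(3,5)]] pqr by simp
qed

lemma pmult_one_left: assumes "P \<in> Hom S a b" shows "pmult S (pone S a) P = P"
proof -
  obtain p where p: "path_from_to S a b p" "P = path_class S p" using assms by (elim HomE)
  have "a \<in> S" using p(1) unfolding path_from_to_def by auto
  have "homotopic_paths S (linepath a a +++ p) p"
    by (rule homotopic_paths_lid') (use p in \<open>auto simp: path_from_to_def\<close>)
  from path_class_eqI[OF this] show ?thesis
    unfolding pone_def p(2) pmult_class[OF path_from_to_const[OF \<open>a \<in> S\<close>] p(1)] .
qed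

lemma pmult_one_right: assumes "P \<in> Hom S a b" shows "pmult S P (pone S b) = P"
proof -
  obtain p where p: "path_from_to S a b p" "P = path_class S p" using assms by (elim HomE)
  have "b \<in> S" using p(1) unfolding path_from_to_def by auto
  have "homotopic_paths S (p +++ linepath b b) p"
    by (rule homotopic_paths_rid') (use p in \<open>auto simp: path_from_to_def\<close>)
  from path_class_eqI[OF this] show ?thesis
    unfolding pone_def p(2) pmult_class[OF p(1) path_from_to_const[OF \<open>b \<in> S\<close>]] .
qed

lemma pmult_inv_left: assumes "P \<in> Hom S a b" shows "pmult S (pinv S P) P = pone S b"
proof -
  obtain p where p: "path_from_to S a b p" "P = path_class S p" using assms by (elim HomE)
  have "homotopic_paths S (reversepath p +++ p) (linepath b b)"
    using homotopic_paths_linv[of p S] p unfolding path_from_to_def by auto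
  from path_class_eqI[OF this] show ?thesis
    unfolding pone_def p(2) pinv_class[OF p(1)] pmult_class[OF path_from_to_reverse[OF p(1)] p(1)] .
qed

lemma fundamental_group_simps:
  "carrier (fundamental_group S x) = Hom S x x"
  "P \<otimes>\<^bsub>fundamental_group S x\<^esub> Q = pmult S P Q"
  "\<one>\<^bsub>fundamental_group S x\<^esub> = pone S x"
  unfolding fundamental_group_def Hom_def loops_at_def path_from_to_def pmult_def pone_def by auto

lemma group_fundamental_group:
  assumes "x \<in> S" shows "group (fundamental_group S x)"
proof (rule groupI; unfold fundamental_group_simps)
  fix P Q R assume PQR: "P \<in> Hom S x x" "Q \<in> Hom S x x"
  show "pmult S P Q \<in> Hom S x x" using pmult_Hom[OF PQR] .
  show "pmult S (pone S x) P = P" using pmult_one_left[OF PQR(1)] .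
  show "\<exists>y\<in>Hom S x x. pmult S y P = pone S x" using pinv_Hom[OF PQR(1)] pmult_inv_left[OF PQR(1)] by blast
  assume "R \<in> Hom S x x"
  then show "pmult S (pmult S P Q) R = pmult S P (pmult S Q R)" using pmult_assoc PQR by blast
next
  show "pone S x \<in> Hom S x x" using pone_Hom[OF assms] .
qed

lemma fundamental_group_inv:
  assumes "x \<in> S" "P \<in> Hom S x x" shows "inv\<^bsub>fundamental_group S x\<^esub> P = pinv S P"
proof -
  interpret group "fundamental_group S x" by (rule group_fundamental_group[OF assms(1)])
  show ?thesis
    by (rule inv_equality) (use pmult_inv_left[OF assms(2)] pinv_Hom[OF assms(2)] assms(2) in \<open>auto simp: fundamental_group_simps\<close>)
qed

text \<open>The conjugating path \<open>c\<close> is the trace of the base point during the homotopy. The square is convex, so its left side is homotopic to the path along the three other sides.\<close>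
lemma homotopic_loops_imp_conjugate:
  assumes "homotopic_loops S p q"
  shows "\<exists>c. path_from_to S (pathstart p) (pathstart q) c \<and> homotopic_paths S p (c +++ q +++ reversepath c)"
proof -
  obtain h where h: "continuous_on ({0..1::real} \<times> {0..1::real}) h" "h \<in> ({0..1} \<times> {0..1}) \<rightarrow> S"
    "\<And>t. t \<in> {0..1} ==> h (0, t) = p t" "\<And>t. t \<in> {0..1} ==> h (1, t) = q t"
    "\<And>t. t \<in> {0..1} ==> h (t, 1) = h (t, 0)"
    using assms unfolding homotopic_loops by (auto simp: pathstart_def pathfinish_def)
  define b where "b = linepath (0::real, 0::real) (0, 1)"
  define l where "l = linepath (0::real, 0::real) (1, 0)"
  define t where "t = linepath (1::real, 0::real) (1, 1)"
  define r where "r = linepath (1::real, 1::real) (0, 1)"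
  let ?Q = "{0..1::real} \<times> {0..1::real}"
  have Q: "convex ?Q" by (intro convex_Times) auto
  have pts: "(0,0) \<in> ?Q" "(0,1) \<in> ?Q" "(1,0) \<in> ?Q" "(1,1) \<in> ?Q" by auto
  have seg: "path_image b \<subseteq> ?Q" "path_image l \<subseteq> ?Q" "path_image t \<subseteq> ?Q" "path_image r \<subseteq> ?Q"
    unfolding b_def l_def t_def r_def path_image_linepath using pts by (intro closed_segment_subset Q; simp)+
  have "homotopic_paths ?Q b (l +++ t +++ r)"
    using convex_imp_simply_connected[OF Q] seg unfolding simply_connected_eq_homotopic_paths
    by (auto simp: b_def l_def t_def r_def path_image_join)
  then have hom: "homotopic_paths S (h \<circ> b) (h \<circ> (l +++ t +++ r))"
    by (rule homotopic_paths_continuous_image[OF _ h(1,2)])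
  define c where "c = h \<circ> l"
  have c: "path_from_to S (pathstart p) (pathstart q) c"
    unfolding path_from_to_def c_def
  proof (intro conjI)
    show "path (h \<circ> l)" by (rule path_continuous_image) (use continuous_on_subset[OF h(1) seg(2)] in \<open>auto simp: l_def\<close>)
    show "path_image (h \<circ> l) \<subseteq> S" using seg(2) h(2) unfolding path_image_compose by blast
    show "pathstart (h \<circ> l) = pathstart p" "pathfinish (h \<circ> l) = pathstart q"
      using h(3)[of 0] h(4)[of 0] by (simp_all add: l_def pathstart_compose pathfinish_compose) (simp_all add: pathstart_def)
  qed
  have e1: "(h \<circ> b) s = p s" if "s \<in> {0..1}" for s using h(3)[OF that] by (simp add: b_def linepath_def)
  have e2: "(h \<circ> (l +++ t +++ r)) s = (c +++ q +++ reversepath c) s" if "s \<in> {0..1}" for s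
    using that h(4)[of "2 * (2 * s - 1)"] h(5)[of "1 - (2 * (2 * s - 1) - 1)"]
    by (auto simp: joinpaths_def c_def l_def t_def r_def linepath_def reversepath_def)
  have pp: "path p" "path_image p \<subseteq> S" using assms homotopic_loops_imp_path homotopic_loops_imp_subset by blast+
  have "homotopic_paths S p (h \<circ> b)" using homotopic_paths_eq[OF pp, of "h \<circ> b"] e1 by simp
  also have "homotopic_paths S (h \<circ> b) (h \<circ> (l +++ t +++ r))" by (rule hom)
  also have "homotopic_paths S (h \<circ> (l +++ t +++ r)) (c +++ q +++ reversepath c)"
    by (rule homotopic_paths_eq) (use hom homotopic_paths_imp_path homotopic_paths_imp_subset e2 in blast)+
  finally show ?thesis using c by blast
qed

section \<open>Paths in simply connected subsets\<close>

text \<open>The class in \<open>S\<close> of the paths from \<open>a\<close> to \<open>b\<close> inside a simply connected subset \<open>U\<close>; it does not depend on the path.\<close>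
definition J :: "'a::real_normed_vector set \<Rightarrow> 'a set \<Rightarrow> 'a \<Rightarrow> 'a \<Rightarrow> (real \<Rightarrow> 'a) set" where
  "J S U a b = path_class S (SOME p. path_from_to U a b p)"

lemma J_unique:
  assumes U: "simply_connected U" "U \<subseteq> S" and p: "path_from_to U a b p"
  shows "path_class S p = J S U a b"
proof -
  define q where "q = (SOME p. path_from_to U a b p)"
  have q: "path_from_to U a b q" unfolding q_def by (rule someI[of _ p]) (rule p)
  have "homotopic_paths U p q"
    by (rule U(1)[unfolded simply_connected_eq_homotopic_paths, THEN conjunct2, rule_format, of p q])
      (use p q in \<open>auto simp: path_from_to_def\<close>)
  then have "homotopic_paths S p q" using U(2) homotopic_paths_subset by blast
  then show ?thesis unfolding J_def q_def[symmetric] by (rule path_class_eqI)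
qed

lemma simply_connected_path:
  assumes "simply_connected U" "a \<in> U" "b \<in> U" obtains p where "path_from_to U a b p"
  using simply_connected_imp_path_connected[OF assms(1)] assms(2,3)
  unfolding path_connected_def path_from_to_def by blast

lemma J_Hom:
  assumes "simply_connected U" "U \<subseteq> S" "a \<in> U" "b \<in> U" shows "J S U a b \<in> Hom S a b"
proof -
  obtain p where p: "path_from_to U a b p" using simply_connected_path assms by blast
  show ?thesis using J_unique[OF assms(1,2) p] HomI[OF path_from_to_mono[OF p assms(2)]] by simp
qed

lemma J_mult:
  assumes U: "simply_connected U" "U \<subseteq> S" and "a \<in> U" "b \<in> U" "c \<in> U"
  shows "pmult S (J S U a b) (J S U b c) = J S U a c"
proof -
  obtain p q where pq: "path_from_to U a b p" "path_from_to U b c q" using simply_connected_path assms by metis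
  show ?thesis
    unfolding J_unique[OF U pq(1), symmetric] J_unique[OF U pq(2), symmetric] J_unique[OF U path_from_to_join[OF pq], symmetric]
    by (rule pmult_class[OF path_from_to_mono[OF pq(1) U(2)] path_from_to_mono[OF pq(2) U(2)]])
qed

lemma J_refl:
  assumes U: "simply_connected U" "U \<subseteq> S" and "a \<in> U" shows "J S U a a = pone S a"
  using J_unique[OF U path_from_to_const[OF assms(3)]] by (simp add: pone_def)

section \<open>Holonomy\<close>

lemma openin_eventually:
  assumes "openin (top_of_set S) U" "continuous_on D K" "K ` D \<subseteq> S" "p \<in> D" "K p \<in> U"
  shows "eventually (\<lambda>q. K q \<in> U) (at p within D)"
proof -
  obtain T where T: "open T" "U = S \<inter> T" using assms(1) unfolding openin_open by blast
  have "(K \<longlongrightarrow> K p) (at p within D)" using assms(2,4) unfolding continuous_on_def by blast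
  then have "eventually (\<lambda>q. K q \<in> T) (at p within D)" using T assms(5) by (intro topological_tendstoD) auto
  moreover have "eventually (\<lambda>q. q \<in> D) (at p within D)" by (simp add: eventually_at_filter)
  ultimately show ?thesis by eventually_elim (use assms(3) T in blast)
qed

lemma open_box:
  assumes "open T" "(a, b) \<in> T" shows "\<exists>A B. open A \<and> open B \<and> a \<in> A \<and> b \<in> B \<and> A \<times> B \<subseteq> T"
  using assms(2) by (rule open_prod_elim[OF assms(1)]) blast

text \<open>A flat \<open>SL\<^sub>2\<close>-bundle on \<open>S\<close> that is trivial on \<open>U\<close> and on \<open>V\<close>, glued by the locally constant matrices \<open>e\<close>.\<close>
locale two_charts =
  fixes S U V :: "'a::real_normed_vector set" and e :: "'a \<Rightarrow> mtx"
  assumes SUV: "S = U \<union> V" and opU: "openin (top_of_set S) U" and opV: "openin (top_of_set S) V"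
    and det_e: "det (e z) = 1"
    and e_local: "z \<in> U \<inter> V ==> \<exists>W. openin (top_of_set S) W \<and> z \<in> W \<and> (\<forall>z'\<in>W. e z' = e z)"
begin

definition chart :: "bool \<Rightarrow> 'a set" where "chart b = (if b then V else U)"
definition gauge :: "bool \<Rightarrow> 'a \<Rightarrow> mtx" where "gauge b z = (if b then e z else mat 1)"

lemma chart_S: "chart b \<subseteq> S" using SUV by (auto simp: chart_def)

lemma chart_open: "openin (top_of_set S) (chart b)" using opU opV by (auto simp: chart_def)

lemma chart_cover: "z \<in> S ==> \<exists>b. z \<in> chart b"
proof -
  assume "z \<in> S"
  then consider "z \<in> U" | "z \<in> V" using SUV by blast
  then show ?thesis by cases (auto simp: chart_def intro: exI[of _ False] exI[of _ True])
qed

lemma det_gauge: "det (gauge b z) = 1" using det_e by (simp add: gauge_def)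

lemma gauge_cancel: "A ** gauge b z ** adj (gauge b z) = A" "A ** adj (gauge b z) ** gauge b z = A"
  by (simp_all only: matrix_mul_assoc[symmetric] adj_mult[OF det_gauge] matrix_mul_rid)

text \<open>
A flat section of the pulled back bundle, expressed in the frame over \<open>U\<close>: in each chart, \<open>\<Phi>\<close> times the gauge is locally constant. No continuity of \<open>\<Phi>\<close> is required, as it may jump where \<open>K\<close> is outside \<open>U\<close>.
\<close>
definition is_lift :: "'t::topological_space set \<Rightarrow> ('t \<Rightarrow> 'a) \<Rightarrow> ('t \<Rightarrow> mtx) \<Rightarrow> bool" where
  "is_lift D K \<Phi> \<longleftrightarrow> (\<forall>p\<in>D. \<forall>b. K p \<in> chart b -->
     eventually (\<lambda>q. \<Phi> q ** gauge b (K q) = \<Phi> p ** gauge b (K p)) (at p within D))"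

lemma is_liftD: "is_lift D K \<Phi> ==> p \<in> D ==> K p \<in> chart b ==>
    eventually (\<lambda>q. \<Phi> q ** gauge b (K q) = \<Phi> p ** gauge b (K p)) (at p within D)"
  unfolding is_lift_def by (drule bspec, assumption, drule spec, drule mp, assumption)

lemma transition_local:
  assumes K: "continuous_on D K" "K ` D \<subseteq> S" and p: "p \<in> D" "K p \<in> chart b" "K p \<in> chart b'"
  shows "eventually (\<lambda>q. adj (gauge b (K q)) ** gauge b' (K q) = adj (gauge b (K p)) ** gauge b' (K p)) (at p within D)"
proof (cases "b = b'")
  case True then show ?thesis by (simp add: adj_mult[OF det_gauge])
next
  case False
  then have "K p \<in> U \<inter> V" using p by (auto simp: chart_def split: if_splits)
  then obtain W where W: "openin (top_of_set S) W" "K p \<in> W" "\<forall>z'\<in>W. e z' = e (K p)" using e_local by blast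
  have "eventually (\<lambda>q. K q \<in> W) (at p within D)" by (rule openin_eventually[OF W(1) K p(1) W(2)])
  then show ?thesis by eventually_elim (use W(3) in \<open>auto simp: gauge_def\<close>)
qed

lemma lift_one_chart:
  assumes K: "continuous_on D K" "K ` D \<subseteq> S" and p: "p \<in> D" "K p \<in> chart b"
    and ev: "eventually (\<lambda>q. \<Phi> q ** gauge b (K q) = \<Phi> p ** gauge b (K p)) (at p within D)" and b': "K p \<in> chart b'"
  shows "eventually (\<lambda>q. \<Phi> q ** gauge b' (K q) = \<Phi> p ** gauge b' (K p)) (at p within D)"
  using ev transition_local[OF K p b']
proof eventually_elim
  case (elim q)
  have "\<Phi> q ** gauge b' (K q) = (\<Phi> q ** gauge b (K q) ** adj (gauge b (K q))) ** gauge b' (K q)" by (simp only: gauge_cancel)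
  also have "\<dots> = (\<Phi> q ** gauge b (K q)) ** (adj (gauge b (K q)) ** gauge b' (K q))" by (simp only: matrix_mul_assoc)
  also have "\<dots> = (\<Phi> p ** gauge b (K p)) ** (adj (gauge b (K p)) ** gauge b' (K p))" unfolding elim ..
  also have "\<dots> = (\<Phi> p ** gauge b (K p) ** adj (gauge b (K p))) ** gauge b' (K p)" by (simp only: matrix_mul_assoc)
  also have "\<dots> = \<Phi> p ** gauge b' (K p)" by (simp only: gauge_cancel)
  finally show ?case .
qed

lemma is_liftI:
  assumes K: "continuous_on D K" "K ` D \<subseteq> S"
    and ev: "\<And>p. p \<in> D ==> \<exists>b. K p \<in> chart b \<and> eventually (\<lambda>q. \<Phi> q ** gauge b (K q) = \<Phi> p ** gauge b (K p)) (at p within D)"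
  shows "is_lift D K \<Phi>"
  unfolding is_lift_def
proof (intro ballI allI impI)
  fix p b assume p: "p \<in> D" "K p \<in> chart b"
  then obtain b' where "K p \<in> chart b'" "eventually (\<lambda>q. \<Phi> q ** gauge b' (K q) = \<Phi> p ** gauge b' (K p)) (at p within D)" using ev by blast
  then show "eventually (\<lambda>q. \<Phi> q ** gauge b (K q) = \<Phi> p ** gauge b (K p)) (at p within D)"
    using lift_one_chart[OF K p(1) _ _ p(2)] by blast
qed

lemma is_lift_cong:
  assumes L: "is_lift D \<gamma> \<Theta>" and eq: "\<And>t. t \<in> D ==> \<gamma> t = \<gamma>' t"
  shows "is_lift D \<gamma>' \<Theta>"
  unfolding is_lift_def
proof (intro ballI allI impI)
  fix t b assume t: "t \<in> D" "\<gamma>' t \<in> chart b"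
  have gt: "\<gamma>' t = \<gamma> t" by (rule eq[OF t(1), symmetric])
  have "\<gamma> t \<in> chart b" using t(2) unfolding gt .
  from L[unfolded is_lift_def, THEN bspec, OF t(1), THEN spec, THEN mp, OF this]
  have "eventually (\<lambda>r. \<Theta> r ** gauge b (\<gamma> r) = \<Theta> t ** gauge b (\<gamma> t)) (at t within D)" .
  moreover have "eventually (\<lambda>r. r \<in> D) (at t within D)" by (simp add: eventually_at_filter)
  ultimately show "eventually (\<lambda>r. \<Theta> r ** gauge b (\<gamma>' r) = \<Theta> t ** gauge b (\<gamma>' t)) (at t within D)"
  proof eventually_elim
    case (elim r)
    show ?case unfolding gt eq[OF elim(2), symmetric] by (rule elim(1))
  qed
qed

lemma is_lift_subset: "is_lift D K \<Phi> ==> D' \<subseteq> D ==> is_lift D' K \<Phi>"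
  unfolding is_lift_def using filter_leD[OF at_le] by blast

lemma is_lift_cmult: "is_lift D K \<Phi> ==> is_lift D K (\<lambda>q. A ** \<Phi> q)"
  unfolding is_lift_def
proof (intro ballI allI impI)
  fix p b assume L: "\<forall>p\<in>D. \<forall>b. K p \<in> chart b --> eventually (\<lambda>q. \<Phi> q ** gauge b (K q) = \<Phi> p ** gauge b (K p)) (at p within D)"
    and p: "p \<in> D" "K p \<in> chart b"
  have "eventually (\<lambda>q. \<Phi> q ** gauge b (K q) = \<Phi> p ** gauge b (K p)) (at p within D)" using L p by blast
  then show "eventually (\<lambda>q. A ** \<Phi> q ** gauge b (K q) = A ** \<Phi> p ** gauge b (K p)) (at p within D)"
    by eventually_elim (simp add: matrix_mul_assoc[symmetric])
qed

lemma is_lift_compose: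
  assumes L: "is_lift D K \<Phi>" and f: "continuous_on D' f" "f ` D' \<subseteq> D"
  shows "is_lift D' (\<lambda>t. K (f t)) (\<lambda>t. \<Phi> (f t))"
  unfolding is_lift_def
proof (intro ballI allI impI)
  fix t b assume t: "t \<in> D'" "K (f t) \<in> chart b"
  have "eventually (\<lambda>q. \<Phi> q ** gauge b (K q) = \<Phi> (f t) ** gauge b (K (f t))) (at (f t) within D)"
    using L t f(2) unfolding is_lift_def by blast
  then obtain T where T: "open T" "f t \<in> T" "\<And>q. q \<in> T ==> q \<noteq> f t ==> q \<in> D ==> \<Phi> q ** gauge b (K q) = \<Phi> (f t) ** gauge b (K (f t))"
    unfolding eventually_at_topological by blast
  have "(f \<longlongrightarrow> f t) (at t within D')" using f(1) t unfolding continuous_on_def by blast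
  then have "eventually (\<lambda>s. f s \<in> T) (at t within D')" using T by (intro topological_tendstoD) auto
  moreover have "eventually (\<lambda>s. s \<in> D') (at t within D')" by (simp add: eventually_at_filter)
  ultimately show "eventually (\<lambda>s. \<Phi> (f s) ** gauge b (K (f s)) = \<Phi> (f t) ** gauge b (K (f t))) (at t within D')"
  proof eventually_elim
    case (elim s)
    show ?case by (cases "f s = f t") (use T(3) elim f(2) in auto)
  qed
qed

lemma locally_constant_openin:
  assumes "p \<in> D" "eventually P (at p within D)" "P p"
  shows "\<exists>T. openin (top_of_set D) T \<and> p \<in> T \<and> (\<forall>q\<in>T. P q)"
proof -
  obtain T where "open T" "p \<in> T" "\<forall>q\<in>T. q \<noteq> p --> q \<in> D --> P q" using assms(2) unfolding eventually_at_topological by blast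
  then show ?thesis using assms by (intro exI[of _ "D \<inter> T"]) auto
qed

lemma lift_unique:
  assumes D: "connected D" and L: "is_lift D K \<Phi>" "is_lift D K \<Psi>" and K: "K ` D \<subseteq> S"
    and a: "a \<in> D" "\<Phi> a = \<Psi> a" and b: "b \<in> D"
  shows "\<Phi> b = \<Psi> b"
proof (rule connected_induction_simple[OF D a(1) b, of "\<lambda>q. \<Phi> q = \<Psi> q"])
  show "\<Phi> a = \<Psi> a" by (rule a)
  fix p assume p: "p \<in> D"
  obtain c where c: "K p \<in> chart c" using chart_cover K p by blast
  have "eventually (\<lambda>q. \<Phi> q ** gauge c (K q) = \<Phi> p ** gauge c (K p)) (at p within D)"
    "eventually (\<lambda>q. \<Psi> q ** gauge c (K q) = \<Psi> p ** gauge c (K p)) (at p within D)"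
    using L p c unfolding is_lift_def by blast+
  then have "eventually (\<lambda>q. \<Phi> q ** gauge c (K q) = \<Phi> p ** gauge c (K p) \<and> \<Psi> q ** gauge c (K q) = \<Psi> p ** gauge c (K p)) (at p within D)"
    by (rule eventually_conj)
  from locally_constant_openin[OF p this] obtain T where T: "openin (top_of_set D) T" "p \<in> T"
    "\<forall>q\<in>T. \<Phi> q ** gauge c (K q) = \<Phi> p ** gauge c (K p) \<and> \<Psi> q ** gauge c (K q) = \<Psi> p ** gauge c (K p)" by blast
  have "\<Phi> q = \<Psi> q \<longleftrightarrow> \<Phi> p = \<Psi> p" if "q \<in> T" for q
    using T(3) that gauge_cancel(1)[of "\<Phi> q" c "K q"] gauge_cancel(1)[of "\<Psi> q" c "K q"]
      gauge_cancel(1)[of "\<Phi> p" c "K p"] gauge_cancel(1)[of "\<Psi> p" c "K p"] by metis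
  then show "\<exists>T. openin (top_of_set D) T \<and> p \<in> T \<and> (\<forall>x\<in>T. \<forall>y\<in>T. \<Phi> x = \<Psi> x --> \<Phi> y = \<Psi> y)"
    using T(1,2) by blast
qed

text \<open>
The lift is extended in the direction of the second variable, simultaneously for all rows near \<open>s0\<close>; the set of heights that can be reached is open and closed in the unit interval.
\<close>
lemma strip_lift:
  fixes K :: "real \<times> real \<Rightarrow> 'a"
  assumes K: "continuous_on ({0..1} \<times> {0..1}) K" "K ` ({0..1} \<times> {0..1}) \<subseteq> S"
    and start: "\<And>s. s \<in> {0..1} ==> K (s, 0) = x" and s0: "s0 \<in> {0..1}"
  shows "\<exists>B \<Phi>. open B \<and> s0 \<in> B \<and> is_lift ((B \<inter> {0..1}) \<times> {0..1}) K \<Phi> \<and> (\<forall>s\<in>B \<inter> {0..1}. \<Phi> (s, 0) = mat 1)"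
proof -
  define P where "P = (\<lambda>t. \<exists>B \<Phi>. open B \<and> s0 \<in> B \<and> is_lift ((B \<inter> {0..1}) \<times> {0..t}) K \<Phi> \<and> (\<forall>s\<in>B \<inter> {0..1}. \<Phi> (s, 0) = mat 1))"
  have contK: "continuous_on ((B \<inter> {0..1}) \<times> {0..t}) K" if "t \<le> 1" for B t
    by (rule continuous_on_subset[OF K(1)]) (use that in auto)
  have KS: "K ` ((B \<inter> {0..1}) \<times> {0..t}) \<subseteq> S" if "t \<le> 1" for B t using K(2) that by fastforce
  have P_I: "P t" if "open B" "s0 \<in> B" "is_lift ((B \<inter> {0..1}) \<times> {0..t}) K \<Phi>" "\<forall>s\<in>B \<inter> {0..1}. \<Phi> (s, 0) = mat 1" for B \<Phi> t
    unfolding P_def by (rule exI[of _ B], rule exI[of _ \<Phi>]) (intro conjI that)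
  have "P 1"
  proof (rule connected_induction_simple[of "{0..1::real}" 0 1 P])
    show "connected {0..1::real}" "0 \<in> {0..1::real}" "1 \<in> {0..1::real}" by auto
    show "P 0" unfolding P_def
    proof (intro exI conjI)
      show "is_lift ((UNIV \<inter> {0..1}) \<times> {0..0}) K (\<lambda>_. mat 1)"
      proof (rule is_liftI[OF contK KS])
        fix p :: "real \<times> real" assume p: "p \<in> (UNIV \<inter> {0..1}) \<times> {0..0}"
        have eq: "K q = K p" if "q \<in> (UNIV \<inter> {0..1}) \<times> {0..0}" for q using start that p by auto
        have "K p \<in> S" using K(2) p by auto
        then obtain b where "K p \<in> chart b" using chart_cover by blast
        moreover have "eventually (\<lambda>q. q \<in> (UNIV \<inter> {0..1}) \<times> {0..0}) (at p within (UNIV \<inter> {0..1}) \<times> {0..0})"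
          by (simp add: eventually_at_filter)
        then have "eventually (\<lambda>q. mat 1 ** gauge b (K q) = mat 1 ** gauge b (K p)) (at p within (UNIV \<inter> {0..1}) \<times> {0..0})"
          by eventually_elim (use eq in metis)
        ultimately show "\<exists>b. K p \<in> chart b \<and> eventually (\<lambda>q. mat 1 ** gauge b (K q) = mat 1 ** gauge b (K p)) (at p within (UNIV \<inter> {0..1}) \<times> {0..0})" by blast
      qed auto
    qed auto
  next
    fix t0 :: real assume t0: "t0 \<in> {0..1}"
    have "K (s0, t0) \<in> S" using K(2) s0 t0 by auto
    then obtain b where b: "K (s0, t0) \<in> chart b" using chart_cover by blast
    have "eventually (\<lambda>q. K q \<in> chart b) (at (s0, t0) within {0..1} \<times> {0..1})"
      by (rule openin_eventually[OF chart_open K]) (use b s0 t0 in auto)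
    then obtain O' where O': "open O'" "(s0, t0) \<in> O'" "\<And>q. q \<in> O' ==> q \<in> {0..1} \<times> {0..1} ==> K q \<in> chart b"
      using b unfolding eventually_at_topological by metis
    obtain B0 T0 where BT: "open B0" "open T0" "s0 \<in> B0" "t0 \<in> T0" "B0 \<times> T0 \<subseteq> O'"
      using open_box[OF O'(1,2)] by (elim exE conjE) (rule that)
    obtain \<epsilon> where \<epsilon>: "\<epsilon> > 0" "ball t0 \<epsilon> \<subseteq> T0" using BT(2,4) open_contains_ball by blast
    have inb: "K (s, t) \<in> chart b" if "s \<in> B0 \<inter> {0..1}" "t \<in> ball t0 \<epsilon> \<inter> {0..1}" for s t
    proof -
      have "t \<in> T0" using that(2) \<epsilon>(2) by blast
      then have "(s, t) \<in> O'" using that(1) BT(5) by blast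
      then show ?thesis using O'(3)[of "(s, t)"] that by auto
    qed
    have ext: "P t'" if t: "t \<in> ball t0 \<epsilon> \<inter> {0..1}" and t': "t' \<in> ball t0 \<epsilon> \<inter> {0..1}" and Pt: "P t" for t t'
    proof -
      obtain B \<Phi> where B: "open B" "s0 \<in> B" "is_lift ((B \<inter> {0..1}) \<times> {0..t}) K \<Phi>" "\<forall>s\<in>B \<inter> {0..1}. \<Phi> (s, 0) = mat 1"
        using Pt[unfolded P_def] by (elim exE conjE) (rule that)
      show ?thesis
      proof (cases "t' \<le> t")
        case True
        have "is_lift ((B \<inter> {0..1}) \<times> {0..t'}) K \<Phi>" by (rule is_lift_subset[OF B(3)]) (use True in auto)
        then show ?thesis by (rule P_I[OF B(1,2) _ B(4)])
      next
        case False
        define B' where "B' = B \<inter> B0"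
        define D where "D = (B' \<inter> {0..1}) \<times> {0..t'}"
        define \<Phi>' where "\<Phi>' = (\<lambda>(s, r). if r \<le> t then \<Phi> (s, r) else \<Phi> (s, t) ** gauge b (K (s, t)) ** adj (gauge b (K (s, r))))"
        have between: "r \<in> ball t0 \<epsilon> \<inter> {0..1}" if "t \<le> r" "r \<le> t'" for r
          using t t' that by (auto simp: dist_real_def)
        have \<Phi>'_late: "\<Phi>' (s, r) ** gauge b (K (s, r)) = \<Phi> (s, t) ** gauge b (K (s, t))" if "t \<le> r" for s r
          unfolding \<Phi>'_def using that gauge_cancel(2) by (cases "r = t") auto
        have "is_lift D K \<Phi>'"
        proof (rule is_liftI)
          show "continuous_on D K" "K ` D \<subseteq> S" unfolding D_def using contK[of t' B'] KS[of t' B'] t' by auto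
          fix p assume p: "p \<in> D"
          obtain s r where sr: "p = (s, r)" by (cases p) auto
          have s: "s \<in> B' \<inter> {0..1}" and r: "0 \<le> r" "r \<le> t'" using p sr unfolding D_def by auto
          have evD: "eventually (\<lambda>q. q \<in> D) (at p within D)" by (simp add: eventually_at_filter)
          show "\<exists>b. K p \<in> chart b \<and> eventually (\<lambda>q. \<Phi>' q ** gauge b (K q) = \<Phi>' p ** gauge b (K p)) (at p within D)"
          proof (cases "r < t")
            case True
            have "K p \<in> S" using KS[of t' B'] p t' unfolding D_def by auto
            then obtain c where c: "K p \<in> chart c" using chart_cover by blast
            have "eventually (\<lambda>q. \<Phi> q ** gauge c (K q) = \<Phi> p ** gauge c (K p)) (at p within (B \<inter> {0..1}) \<times> {0..t})"
              by (rule is_liftD[OF B(3) _ c]) (use s r True in \<open>auto simp: sr B'_def\<close>)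
            then obtain T where T: "open T" "p \<in> T" "\<And>q. q \<in> T ==> q \<noteq> p ==> q \<in> (B \<inter> {0..1}) \<times> {0..t} ==> \<Phi> q ** gauge c (K q) = \<Phi> p ** gauge c (K p)"
              unfolding eventually_at_topological by blast
            have "open (T \<inter> (UNIV \<times> {..<t}))" using T(1) by (intro open_Int open_Times) auto
            moreover have "p \<in> T \<inter> (UNIV \<times> {..<t})" using T(2) True sr by auto
            moreover have "\<Phi>' q ** gauge c (K q) = \<Phi>' p ** gauge c (K p)" if "q \<in> T \<inter> (UNIV \<times> {..<t})" "q \<noteq> p" "q \<in> D" for q
              using T(3)[of q] that True unfolding sr \<Phi>'_def D_def B'_def by (cases q) auto
            ultimately have "eventually (\<lambda>q. \<Phi>' q ** gauge c (K q) = \<Phi>' p ** gauge c (K p)) (at p within D)"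
              unfolding eventually_at_topological by (intro exI[of _ "T \<inter> (UNIV \<times> {..<t})"] conjI) auto
            with c show ?thesis by (intro exI[of _ c] conjI)
          next
            case rt: False
            have tp: "(s, t) \<in> (B \<inter> {0..1}) \<times> {0..t}" using s t unfolding B'_def by auto
            have cb: "K p \<in> chart b" unfolding sr using inb[of s r] s between[of r] rt r unfolding B'_def by auto
            have cb': "K (s, t) \<in> chart b" using inb[of s t] s t unfolding B'_def by auto
            have "eventually (\<lambda>q. \<Phi> q ** gauge b (K q) = \<Phi> (s, t) ** gauge b (K (s, t))) (at (s, t) within (B \<inter> {0..1}) \<times> {0..t})"
              by (rule is_liftD[OF B(3) tp cb'])
            then obtain T where T: "open T" "(s, t) \<in> T" "\<And>q. q \<in> T ==> q \<noteq> (s, t) ==> q \<in> (B \<inter> {0..1}) \<times> {0..t} ==> \<Phi> q ** gauge b (K q) = \<Phi> (s, t) ** gauge b (K (s, t))"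
              unfolding eventually_at_topological by blast
            then have T': "\<Phi> q ** gauge b (K q) = \<Phi> (s, t) ** gauge b (K (s, t))" if "q \<in> T" "q \<in> (B \<inter> {0..1}) \<times> {0..t}" for q
              using that by (cases "q = (s, t)") auto
            obtain B1 T1 where BT1: "open B1" "open T1" "s \<in> B1" "t \<in> T1" "B1 \<times> T1 \<subseteq> T"
              using open_box[OF T(1,2)] by (elim exE conjE) (rule that)
            define O1 where "O1 = (if r = t then B1 \<times> T1 else B1 \<times> {t<..})"
            have "open O1" unfolding O1_def using BT1 by (auto intro: open_Times)
            moreover have "p \<in> O1" unfolding O1_def sr using BT1 rt by auto
            moreover have "\<Phi>' q ** gauge b (K q) = \<Phi>' p ** gauge b (K p)" if q: "q \<in> O1" "q \<in> D" for q
            proof -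
              obtain s' r' where q': "q = (s', r')" by (cases q) auto
              have s': "s' \<in> B1" "s' \<in> B \<inter> {0..1}" and r': "0 \<le> r'" "r' \<le> t'" using q q' unfolding O1_def D_def B'_def by (auto split: if_splits)
              have "(s', t) \<in> T" using s' BT1 by auto
              then have base: "\<Phi> (s', t) ** gauge b (K (s', t)) = \<Phi> (s, t) ** gauge b (K (s, t))"
                using T'[of "(s', t)"] s' t by auto
              have pp: "\<Phi>' p ** gauge b (K p) = \<Phi> (s, t) ** gauge b (K (s, t))" unfolding sr using \<Phi>'_late rt by auto
              show ?thesis
              proof (cases "t \<le> r'")
                case True then show ?thesis unfolding pp q' \<Phi>'_late[OF True] using base by simp
              next
                case False
                then have "r = t" using q q' unfolding O1_def by (auto split: if_splits)
                then have "(s', r') \<in> T" using q q' BT1 unfolding O1_def by auto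
                then have "\<Phi> (s', r') ** gauge b (K (s', r')) = \<Phi> (s, t) ** gauge b (K (s, t))" using T'[of "(s', r')"] s' r' False by auto
                then show ?thesis unfolding pp q' using False by (simp add: \<Phi>'_def)
              qed
            qed
            ultimately have "eventually (\<lambda>q. \<Phi>' q ** gauge b (K q) = \<Phi>' p ** gauge b (K p)) (at p within D)"
              unfolding eventually_at_topological by (intro exI[of _ O1] conjI) auto
            with cb show ?thesis by (intro exI[of _ b] conjI)
          qed
        qed
        moreover have "\<forall>s\<in>B' \<inter> {0..1}. \<Phi>' (s, 0) = mat 1" using B(4) t unfolding \<Phi>'_def B'_def by auto
        moreover have "open B'" "s0 \<in> B'" unfolding B'_def using B BT by auto
        ultimately show ?thesis unfolding D_def by (intro P_I[of B' _ \<Phi>'])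
      qed
    qed
    show "\<exists>T. openin (top_of_set {0..1}) T \<and> t0 \<in> T \<and> (\<forall>x\<in>T. \<forall>y\<in>T. P x --> P y)"
    proof (intro exI conjI)
      show "openin (top_of_set {0..1}) ({0..1} \<inter> ball t0 \<epsilon>)" by (rule openin_open_Int) simp
      show "t0 \<in> {0..1} \<inter> ball t0 \<epsilon>" using t0 \<epsilon> by auto
      show "\<forall>x\<in>{0..1} \<inter> ball t0 \<epsilon>. \<forall>y\<in>{0..1} \<inter> ball t0 \<epsilon>. P x --> P y" using ext by blast
    qed
  qed
  then show ?thesis unfolding P_def by blast
qed

lemma path_lift:
  assumes "path \<gamma>" "path_image \<gamma> \<subseteq> S" shows "\<exists>\<Phi>. is_lift {0..1} \<gamma> \<Phi> \<and> \<Phi> 0 = mat 1"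
proof -
  define K where "K = (\<lambda>st::real \<times> real. \<gamma> (snd st))"
  have K: "continuous_on ({0..1} \<times> {0..1}) K" unfolding K_def
    by (rule continuous_on_compose2[of "{0..1}" \<gamma>]) (use assms(1) in \<open>auto simp: path_def intro!: continuous_intros\<close>)
  have "K ` ({0..1} \<times> {0..1}) \<subseteq> S" using assms(2) unfolding K_def path_image_def by auto
  from strip_lift[OF K this, of "\<gamma> 0" 0] obtain B \<Phi> where B: "0 \<in> B" "is_lift ((B \<inter> {0..1}) \<times> {0..1}) K \<Phi>" "\<forall>s\<in>B \<inter> {0..1}. \<Phi> (s, 0) = mat 1"
    unfolding K_def by auto
  have "is_lift {0..1} (\<lambda>t. K (0, t)) (\<lambda>t. \<Phi> (0, t))"
    by (rule is_lift_compose[OF B(2)]) (use B(1) in \<open>auto intro!: continuous_intros\<close>)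
  then show ?thesis using B by (intro exI[of _ "\<lambda>t. \<Phi> (0, t)"]) (auto simp: K_def)
qed

definition holonomy :: "(real \<Rightarrow> 'a) \<Rightarrow> mtx" where
  "holonomy \<gamma> = (THE A. \<exists>\<Phi>. is_lift {0..1} \<gamma> \<Phi> \<and> \<Phi> 0 = mat 1 \<and> \<Phi> 1 = A)"

lemma holonomy_eq:
  assumes "path \<gamma>" "path_image \<gamma> \<subseteq> S" "is_lift {0..1} \<gamma> \<Phi>" "\<Phi> 0 = mat 1"
  shows "holonomy \<gamma> = \<Phi> 1"
  unfolding holonomy_def
proof (rule the_equality)
  show "\<exists>\<Psi>. is_lift {0..1} \<gamma> \<Psi> \<and> \<Psi> 0 = mat 1 \<and> \<Psi> 1 = \<Phi> 1" using assms by blast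
  fix A assume "\<exists>\<Psi>. is_lift {0..1} \<gamma> \<Psi> \<and> \<Psi> 0 = mat 1 \<and> \<Psi> 1 = A"
  then obtain \<Psi> where "is_lift {0..1} \<gamma> \<Psi>" "\<Psi> 0 = mat 1" "\<Psi> 1 = A" by blast
  then show "A = \<Phi> 1" using lift_unique[of "{0..1}" \<gamma> \<Psi> \<Phi> 0 1] assms unfolding path_image_def by auto
qed

text \<open>On a strip the lift at the final end point is locally constant in the homotopy parameter, because the end point is fixed.\<close>
lemma holonomy_homotopic:
  assumes hom: "homotopic_paths S p q" shows "holonomy p = holonomy q"
proof -
  define C where "C = (\<lambda>h. continuous_on ({0..1::real} \<times> {0..1::real}) h \<and> h \<in> ({0..1} \<times> {0..1}) \<rightarrow> S \<and>
    (\<forall>t\<in>{0..1}. h (0, t) = p t) \<and> (\<forall>t\<in>{0..1}. h (1, t) = q t) \<and>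
    (\<forall>t\<in>{0..1}. pathstart (h \<circ> Pair t) = pathstart p \<and> pathfinish (h \<circ> Pair t) = pathfinish p))"
  have "\<exists>h. C h" using hom unfolding homotopic_paths C_def .
  then obtain K where CK: "C K" by (elim exE)
  note CK' = CK[unfolded C_def]
  note K12 = CK'[THEN conjunct1] CK'[THEN conjunct2, THEN conjunct1]
    and K3 = CK'[THEN conjunct2, THEN conjunct2, THEN conjunct1]
    and K4 = CK'[THEN conjunct2, THEN conjunct2, THEN conjunct2, THEN conjunct1]
    and K5 = CK'[THEN conjunct2, THEN conjunct2, THEN conjunct2, THEN conjunct2]
  have K: "continuous_on ({0..1} \<times> {0..1}) K" "K \<in> ({0..1} \<times> {0..1}) \<rightarrow> S"
    "\<And>t. t \<in> {0..1} ==> K (0, t) = p t" "\<And>t. t \<in> {0..1} ==> K (1, t) = q t"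
    "\<And>s. s \<in> {0..1} ==> K (s, 0) = p 0" "\<And>s. s \<in> {0..1} ==> K (s, 1) = p 1"
  proof -
    show "continuous_on ({0..1} \<times> {0..1}) K" "K \<in> ({0..1} \<times> {0..1}) \<rightarrow> S" by (rule K12)+
    show "K (0, t) = p t" if t: "t \<in> {0..1}" for t using K3 t by (rule bspec)
    show "K (1, t) = q t" if t: "t \<in> {0..1}" for t using K4 t by (rule bspec)
    show "K (t, 0) = p 0" if t: "t \<in> {0..1}" for t using bspec[OF K5 t] by (simp add: pathstart_def pathfinish_def)
    show "K (t, 1) = p 1" if t: "t \<in> {0..1}" for t using bspec[OF K5 t] by (simp add: pathstart_def pathfinish_def)
  qed
  have KS: "K ` ({0..1} \<times> {0..1}) \<subseteq> S" using K(2) by auto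
  have row: "path (\<lambda>t. K (s, t))" "path_image (\<lambda>t. K (s, t)) \<subseteq> S" if "s \<in> {0..1}" for s
  proof -
    show "path (\<lambda>t. K (s, t))" unfolding path_def
      by (rule continuous_on_compose2[OF K(1)]) (use that in \<open>auto intro!: continuous_intros\<close>)
    show "path_image (\<lambda>t. K (s, t)) \<subseteq> S" unfolding path_image_def using KS that by auto
  qed
  have rows: "holonomy (\<lambda>t. K (0, t)) = holonomy (\<lambda>t. K (1, t))"
  proof (rule connected_induction_simple[of "{0..1::real}" 0 1 "\<lambda>s. holonomy (\<lambda>t. K (0, t)) = holonomy (\<lambda>t. K (s, t))"])
    fix s0 :: real assume s0: "s0 \<in> {0..1}"
    from strip_lift[OF K(1) KS K(5) s0] obtain B \<Phi> where B: "open B" "s0 \<in> B" "is_lift ((B \<inter> {0..1}) \<times> {0..1}) K \<Phi>" "\<forall>s\<in>B \<inter> {0..1}. \<Phi> (s, 0) = mat 1" by blast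
    have h: "holonomy (\<lambda>t. K (s, t)) = \<Phi> (s, 1)" if s: "s \<in> B \<inter> {0..1}" for s
    proof -
      have "is_lift {0..1} (\<lambda>t. K (s, t)) (\<lambda>t. \<Phi> (s, t))"
        by (rule is_lift_compose[OF B(3)]) (use s in \<open>auto intro!: continuous_intros\<close>)
      then show ?thesis using holonomy_eq[OF row, of s "\<lambda>t. \<Phi> (s, t)"] B(4) s by auto
    qed
    have "K (s0, 1) \<in> S" using KS s0 by auto
    then obtain b where b: "K (s0, 1) \<in> chart b" using chart_cover by blast
    have "is_lift (B \<inter> {0..1}) (\<lambda>s. K (s, 1)) (\<lambda>s. \<Phi> (s, 1))"
      by (rule is_lift_compose[OF B(3)]) (auto intro!: continuous_intros)
    then have ev: "eventually (\<lambda>s. \<Phi> (s, 1) ** gauge b (K (s, 1)) = \<Phi> (s0, 1) ** gauge b (K (s0, 1))) (at s0 within B \<inter> {0..1})"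
      using b B(2) s0 unfolding is_lift_def by blast
    obtain T where T: "openin (top_of_set (B \<inter> {0..1})) T" "s0 \<in> T" "\<forall>s\<in>T. \<Phi> (s, 1) ** gauge b (K (s, 1)) = \<Phi> (s0, 1) ** gauge b (K (s0, 1))"
      using locally_constant_openin[OF _ ev] B(2) s0 by auto
    have TB: "T \<subseteq> B \<inter> {0..1}" using T(1) openin_imp_subset by blast
    have "\<Phi> (s, 1) = \<Phi> (s0, 1)" if "s \<in> T" for s
    proof -
      have "K (s, 1) = K (s0, 1)" using K(6) TB that s0 by auto
      then have "\<Phi> (s, 1) ** gauge b (K (s0, 1)) = \<Phi> (s0, 1) ** gauge b (K (s0, 1))" using T(3) that by metis
      then show ?thesis using gauge_cancel(1)[of "\<Phi> (s, 1)" b "K (s0, 1)"] gauge_cancel(1)[of "\<Phi> (s0, 1)" b "K (s0, 1)"] by metis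
    qed
    then have "holonomy (\<lambda>t. K (s, t)) = \<Phi> (s0, 1)" if "s \<in> T" for s
      using h[OF subsetD[OF TB that]] that by simp
    moreover have "openin (top_of_set {0..1}) T"
    proof -
      have "openin (top_of_set {0..1}) (B \<inter> {0..1})" unfolding Int_commute[of B] by (rule openin_open_Int[OF B(1)])
      then show ?thesis using T(1) openin_trans by blast
    qed
    ultimately show "\<exists>T. openin (top_of_set {0..1}) T \<and> s0 \<in> T \<and> (\<forall>s\<in>T. \<forall>s'\<in>T. holonomy (\<lambda>t. K (0, t)) = holonomy (\<lambda>t. K (s, t)) --> holonomy (\<lambda>t. K (0, t)) = holonomy (\<lambda>t. K (s', t)))"
      using T(2) by (intro exI[of _ T]) auto
  qed auto
  have "holonomy \<gamma> = holonomy \<gamma>'" if eq: "\<And>t. t \<in> {0..1} ==> \<gamma> t = \<gamma>' t" and g: "path \<gamma>" "path_image \<gamma> \<subseteq> S" "path \<gamma>'" "path_image \<gamma>' \<subseteq> S" for \<gamma> \<gamma>'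
  proof -
    obtain \<Phi> where \<Phi>: "is_lift {0..1} \<gamma> \<Phi>" "\<Phi> 0 = mat 1" using path_lift g by blast
    have L': "is_lift {0..1} \<gamma>' \<Phi>" by (rule is_lift_cong[OF \<Phi>(1) eq])
    show ?thesis unfolding holonomy_eq[OF g(1,2) \<Phi>] holonomy_eq[OF g(3,4) L' \<Phi>(2)] ..
  qed
  note cong = this
  have "path p" "path_image p \<subseteq> S" "path q" "path_image q \<subseteq> S"
    using hom homotopic_paths_imp_path homotopic_paths_imp_subset by blast+
  note pq = this
  have "holonomy p = holonomy (\<lambda>t. K (0, t))" by (rule cong[OF K(3)[symmetric] pq(1,2) row]) simp_all
  moreover have "holonomy (\<lambda>t. K (1, t)) = holonomy q" by (rule cong[OF K(4) row pq(3,4)]) simp_all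
  ultimately show ?thesis using rows by simp
qed

lemma det_holonomy:
  assumes "path \<gamma>" "path_image \<gamma> \<subseteq> S" shows "det (holonomy \<gamma>) = 1"
proof -
  obtain \<Phi> where \<Phi>: "is_lift {0..1} \<gamma> \<Phi>" "\<Phi> 0 = mat 1" using path_lift[OF assms] by blast
  have "det (\<Phi> 1) = 1"
  proof (rule connected_induction_simple[of "{0..1::real}" 0 1 "\<lambda>t. det (\<Phi> t) = 1"])
    show "det (\<Phi> 0) = 1" using \<Phi>(2) by simp
    fix t :: real assume t: "t \<in> {0..1}"
    then have "\<gamma> t \<in> S" using assms unfolding path_image_def by auto
    then obtain b where b: "\<gamma> t \<in> chart b" using chart_cover by blast
    then have "eventually (\<lambda>q. \<Phi> q ** gauge b (\<gamma> q) = \<Phi> t ** gauge b (\<gamma> t)) (at t within {0..1})" using \<Phi>(1) t unfolding is_lift_def by blast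
    from locally_constant_openin[OF t this] obtain T where T: "openin (top_of_set {0..1}) T" "t \<in> T" "\<forall>q\<in>T. \<Phi> q ** gauge b (\<gamma> q) = \<Phi> t ** gauge b (\<gamma> t)" by blast
    have "det (\<Phi> q) = det (\<Phi> t)" if "q \<in> T" for q
      using arg_cong[of _ _ det, OF T(3)[rule_format, OF that]] by (simp add: det_mul det_gauge)
    then show "\<exists>T. openin (top_of_set {0..1}) T \<and> t \<in> T \<and> (\<forall>x\<in>T. \<forall>y\<in>T. det (\<Phi> x) = 1 --> det (\<Phi> y) = 1)" using T(1,2) by metis
  qed auto
  then show ?thesis using holonomy_eq[OF assms \<Phi>] by simp
qed

lemma holonomy_join:
  assumes p: "path p" "path_image p \<subseteq> S" and q: "path q" "path_image q \<subseteq> S" and pq: "pathfinish p = pathstart q"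
  shows "holonomy (p +++ q) = holonomy p ** holonomy q"
proof -
  have j: "path (p +++ q)" "path_image (p +++ q) \<subseteq> S" using p q pq by (auto simp: path_image_join)
  obtain \<Phi> where \<Phi>: "is_lift {0..1} (p +++ q) \<Phi>" "\<Phi> 0 = mat 1" using path_lift[OF j] by blast
  obtain \<Psi> where \<Psi>: "is_lift {0..1} q \<Psi>" "\<Psi> 0 = mat 1" using path_lift[OF q] by blast
  have "is_lift {0..1} (\<lambda>t. (p +++ q) (t / 2)) (\<lambda>t. \<Phi> (t / 2))"
    by (rule is_lift_compose[OF \<Phi>(1), where f = "\<lambda>t. t / 2"]) (auto intro!: continuous_intros)
  then have L0: "is_lift {0..1} p (\<lambda>t. \<Phi> (t / 2))" by (rule is_lift_cong[where \<gamma>' = p]) (simp add: joinpaths_def)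
  have hp: "holonomy p = \<Phi> (1 / 2)" using holonomy_eq[OF p L0] \<Phi>(2) by simp
  have "is_lift {0..1} (\<lambda>t. (p +++ q) ((t + 1) / 2)) (\<lambda>t. \<Phi> ((t + 1) / 2))"
    by (rule is_lift_compose[OF \<Phi>(1), where f = "\<lambda>t. (t + 1) / 2"]) (auto intro!: continuous_intros)
  then have L1: "is_lift {0..1} q (\<lambda>t. \<Phi> ((t + 1) / 2))"
  proof (rule is_lift_cong[where \<gamma>' = q])
    fix t :: real assume "t \<in> {0..1}"
    then show "(p +++ q) ((t + 1) / 2) = q t"
      using pq by (cases "t = 0") (auto simp: joinpaths_def pathfinish_def pathstart_def add_divide_distrib)
  qed
  have L2: "is_lift {0..1} q (\<lambda>t. \<Phi> (1 / 2) ** \<Psi> t)" by (rule is_lift_cmult[OF \<Psi>(1)])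
  have "\<Phi> ((1 + 1) / 2) = \<Phi> (1 / 2) ** \<Psi> 1"
    by (rule lift_unique[OF _ L1 L2, of 0 1]) (use q \<Psi>(2) in \<open>auto simp: path_image_def\<close>)
  then show ?thesis using holonomy_eq[OF j \<Phi>] holonomy_eq[OF q \<Psi>] hp by simp
qed

text \<open>In a single chart a constant section is a lift.\<close>
lemma holonomy_chart:
  assumes "path \<gamma>" "path_image \<gamma> \<subseteq> chart b"
  shows "holonomy \<gamma> = gauge b (pathstart \<gamma>) ** adj (gauge b (pathfinish \<gamma>))"
proof -
  have S: "path_image \<gamma> \<subseteq> S" using assms(2) chart_S by blast
  have "is_lift {0..1} \<gamma> (\<lambda>t. gauge b (\<gamma> 0) ** adj (gauge b (\<gamma> t)))"
  proof (rule is_liftI)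
    show "continuous_on {0..1} \<gamma>" "\<gamma> ` {0..1} \<subseteq> S" using assms(1) S unfolding path_def path_image_def by auto
    fix t :: real assume "t \<in> {0..1}"
    then have "\<gamma> t \<in> chart b" using assms(2) unfolding path_image_def by auto
    then show "\<exists>c. \<gamma> t \<in> chart c \<and> eventually (\<lambda>q. gauge b (\<gamma> 0) ** adj (gauge b (\<gamma> q)) ** gauge c (\<gamma> q) = gauge b (\<gamma> 0) ** adj (gauge b (\<gamma> t)) ** gauge c (\<gamma> t)) (at t within {0..1})"
      by (intro exI[of _ b]) (simp add: gauge_cancel)
  qed
  from holonomy_eq[OF assms(1) S this] show ?thesis by (simp add: adj_mult[OF det_gauge] pathstart_def pathfinish_def)
qed

end


section \<open>Generators of the fundamental group of a union of two simply connected sets\<close>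

text \<open>
The numbers \<open>comp z\<close> name the components of \<open>U \<inter> V\<close>, with \<open>0\<close> for the one of the base point. The assumptions are those under which the
theorem of Seifert and van Kampen gives a free group with one generator for each other component.
\<close>
locale uv_cover =
  fixes S U V :: "'a::real_normed_vector set" and x :: 'a and comp :: "'a \<Rightarrow> nat" and m :: nat
  assumes SUV: "S = U \<union> V" and opU: "openin (top_of_set S) U" and opV: "openin (top_of_set S) V"
    and scU: "simply_connected U" and scV: "simply_connected V" and x: "x \<in> U" "x \<in> V" "comp x = 0"
    and comp_less: "z \<in> U \<inter> V ==> comp z < m"
    and comp_local: "z \<in> U \<inter> V ==> \<exists>W. openin (top_of_set S) W \<and> z \<in> W \<and> (\<forall>z'\<in>W. comp z' = comp z)"
    and comp_connected: "j < m ==> path_connected {z \<in> U \<inter> V. comp z = j}"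
    and comp_nonempty: "j < m ==> \<exists>z. z \<in> U \<inter> V \<and> comp z = j"
begin

lemma US: "U \<subseteq> S" and VS: "V \<subseteq> S" using SUV by auto

abbreviation G where "G \<equiv> fundamental_group S x"

lemma grp: "group G" using group_fundamental_group x US by blast

abbreviation pm (infixl "\<cdot>" 70) where "P \<cdot> Q \<equiv> pmult S P Q"

lemmas hU = J_Hom[OF scU US] and hV = J_Hom[OF scV VS]

text \<open>The loop that goes to \<open>z\<close> inside \<open>U\<close> and returns inside \<open>V\<close>.\<close>
definition crossing :: "'a \<Rightarrow> (real \<Rightarrow> 'a) set" where
  "crossing z = J S U x z \<cdot> J S V z x"

lemma crossing_Hom: "z \<in> U ==> z \<in> V ==> crossing z \<in> Hom S x x"
  unfolding crossing_def by (rule pmult_Hom[OF hU hV]) (use x in auto)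

lemma crossing_V: assumes "z \<in> U" "z \<in> V" shows "crossing z \<cdot> J S V x z = J S U x z"
proof -
  have "crossing z \<cdot> J S V x z = J S U x z \<cdot> (J S V z x \<cdot> J S V x z)"
    unfolding crossing_def by (rule pmult_assoc[OF hU hV hV]) (use x assms in auto)
  also have "\<dots> = J S U x z" using J_mult[OF scV VS assms(2) x(2) assms(2)] J_refl[OF scV VS assms(2)] pmult_one_right[OF hU[OF x(1) assms(1)]] by simp
  finally show ?thesis .
qed

lemma crossing_U: assumes "z \<in> U" "z \<in> V" shows "pinv S (crossing z) \<cdot> J S U x z = J S V x z"
proof -
  note s = crossing_Hom[OF assms]
  have "pinv S (crossing z) \<cdot> J S U x z = pinv S (crossing z) \<cdot> (crossing z \<cdot> J S V x z)" unfolding crossing_V[OF assms] ..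
  also have "\<dots> = pinv S (crossing z) \<cdot> crossing z \<cdot> J S V x z"
    by (rule pmult_assoc[OF pinv_Hom[OF s] s hV, symmetric]) (use x assms in auto)
  also have "\<dots> = J S V x z" using pmult_inv_left[OF s] pmult_one_left[OF hV[OF x(2) assms(2)]] by simp
  finally show ?thesis .
qed

text \<open>Two points of one component of \<open>U \<inter> V\<close> are joined by a path that lies in both sets.\<close>
lemma crossing_cong:
  assumes "z \<in> U \<inter> V" "z' \<in> U \<inter> V" "comp z = comp z'" shows "crossing z = crossing z'"
proof -
  have "path_connected {y \<in> U \<inter> V. comp y = comp z}" by (rule comp_connected[OF comp_less[OF assms(1)]])
  then obtain p where "path p" "path_image p \<subseteq> {y \<in> U \<inter> V. comp y = comp z}" "pathstart p = z" "pathfinish p = z'"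
    unfolding path_connected_def using assms by auto
  then have p: "path_from_to U z z' p" "path_from_to V z z' p" unfolding path_from_to_def by auto
  have zU: "z \<in> U" "z \<in> V" "z' \<in> U" "z' \<in> V" using assms by auto
  have J: "J S U z z' = J S V z z'" using J_unique[OF scU US p(1)] J_unique[OF scV VS p(2)] by simp
  have "crossing z' = (J S U x z \<cdot> J S U z z') \<cdot> J S V z' x"
    unfolding crossing_def using J_mult[OF scU US x(1) zU(1) zU(3)] by simp
  also have "\<dots> = J S U x z \<cdot> (J S U z z' \<cdot> J S V z' x)" by (rule pmult_assoc[OF hU hU hV]) (use x zU in auto)
  also have "J S U z z' \<cdot> J S V z' x = J S V z x" unfolding J by (rule J_mult[OF scV VS zU(2,4) x(2)])
  finally show ?thesis unfolding crossing_def by simp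
qed

definition q :: "nat \<Rightarrow> (real \<Rightarrow> 'a) set" where
  "q j = crossing (SOME z. z \<in> U \<inter> V \<and> comp z = j)"

lemma crossing_eq_q: assumes "z \<in> U \<inter> V" shows "crossing z = q (comp z)"
proof -
  have "\<exists>y. y \<in> U \<inter> V \<and> comp y = comp z" using assms by auto
  from someI_ex[OF this] show ?thesis unfolding q_def by (intro crossing_cong[OF assms]) auto
qed

lemma q_obtain: assumes "j < m" obtains z where "z \<in> U" "z \<in> V" "comp z = j" "q j = crossing z"
proof -
  obtain z where "z \<in> U \<inter> V" "comp z = j" using comp_nonempty[OF assms] by blast
  then show ?thesis using crossing_eq_q[of z] that by auto
qed

lemma q_Hom: "j < m ==> q j \<in> Hom S x x"
  using q_obtain crossing_Hom by metis

lemma q_0: "q 0 = pone S x"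
proof -
  have "q 0 = J S U x x \<cdot> J S V x x" using crossing_eq_q[of x] x unfolding crossing_def by simp
  then show ?thesis unfolding J_refl[OF scU US x(1)] J_refl[OF scV VS x(2)] using pmult_one_left[OF pone_Hom] x US by auto
qed

definition H where "H = generate G (q ` {..<m})"

lemma H_Hom: "k \<in> H ==> k \<in> Hom S x x"
  using group.generate_in_carrier[OF grp, of "q ` {..<m}" k] q_Hom unfolding H_def fundamental_group_simps by blast

lemma H_mult: "k \<in> H ==> l \<in> H ==> k \<cdot> l \<in> H"
  unfolding H_def using generate.eng[of k G "q ` {..<m}" l] by (simp add: fundamental_group_simps)

lemma H_crossing: assumes "z \<in> U" "z \<in> V" shows "crossing z \<in> H" "pinv S (crossing z) \<in> H"
proof -
  have "comp z \<in> {..<m}" using comp_less assms by auto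
  then have "crossing z \<in> q ` {..<m}" using crossing_eq_q[of z] assms by auto
  from generate.incl[OF this, of G] generate.inv[OF this, of G] show "crossing z \<in> H" "pinv S (crossing z) \<in> H"
    using fundamental_group_inv[OF _ crossing_Hom[OF assms]] x US unfolding H_def by auto
qed

text \<open>The invariant of the subdivision argument: the class of the path travelled so far is an element of \<open>H\<close> followed by a path inside the set \<open>A\<close> that contains the present point.\<close>
definition reach :: "'a set \<Rightarrow> 'a \<Rightarrow> (real \<Rightarrow> 'a) set \<Rightarrow> bool" where
  "reach A z P \<longleftrightarrow> (\<exists>k\<in>H. P = k \<cdot> J S A x z)"

lemma reach_UV: assumes z: "z \<in> U" "z \<in> V" shows "reach U z P \<longleftrightarrow> reach V z P"
proof
  assume "reach U z P"
  then obtain k where k: "k \<in> H" "P = k \<cdot> J S U x z" unfolding reach_def by blast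
  have "P = (k \<cdot> crossing z) \<cdot> J S V x z"
    unfolding k(2) crossing_V[OF z, symmetric] by (rule pmult_assoc[OF H_Hom[OF k(1)] crossing_Hom[OF z] hV[OF x(2) z(2)], symmetric])
  then show "reach V z P" unfolding reach_def using H_mult[OF k(1) H_crossing(1)[OF z]] by blast
next
  assume "reach V z P"
  then obtain k where k: "k \<in> H" "P = k \<cdot> J S V x z" unfolding reach_def by blast
  have "P = (k \<cdot> pinv S (crossing z)) \<cdot> J S U x z"
    unfolding k(2) crossing_U[OF z, symmetric] by (rule pmult_assoc[OF H_Hom[OF k(1)] pinv_Hom[OF crossing_Hom[OF z]] hU[OF x(1) z(1)], symmetric])
  then show "reach U z P" unfolding reach_def using H_mult[OF k(1) H_crossing(2)[OF z]] by blast
qed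

lemma reach_step:
  assumes A: "A = U \<or> A = V" and R: "reach A z P" and p: "path_from_to A z z' p"
  shows "reach A z' (P \<cdot> path_class S p)"
proof -
  have sc: "simply_connected A" "A \<subseteq> S" "x \<in> A" using A scU scV US VS x by auto
  have zA: "z \<in> A" "z' \<in> A" using p unfolding path_from_to_def by auto
  obtain k where k: "k \<in> H" "P = k \<cdot> J S A x z" using R unfolding reach_def by blast
  have "P \<cdot> path_class S p = k \<cdot> (J S A x z \<cdot> J S A z z')"
    unfolding k(2) J_unique[OF sc(1,2) p] by (rule pmult_assoc[OF H_Hom[OF k(1)] J_Hom[OF sc zA(1)] J_Hom[OF sc(1,2) zA]])
  then show ?thesis unfolding reach_def J_mult[OF sc zA] using k(1) by blast
qed

text \<open>Travelling along the loop, the invariant \<open>reach\<close> persists inside each of the two sets, and at points of the intersection it passes from one set to the other by \<open>reach_UV\<close>.\<close>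
lemma loop_in_H:
  assumes g: "path_from_to S x x \<gamma>" shows "path_class S \<gamma> \<in> H"
proof -
  have pg: "path \<gamma>" "path_image \<gamma> \<subseteq> S" "\<gamma> 0 = x" "\<gamma> 1 = x" using g unfolding path_from_to_def pathstart_def pathfinish_def by auto
  have contg: "continuous_on {0..1} \<gamma>" "\<gamma> ` {0..1} \<subseteq> S" using pg unfolding path_def path_image_def by auto
  define P where "P = (\<lambda>t. \<forall>A. (A = U \<or> A = V) --> \<gamma> t \<in> A --> reach A (\<gamma> t) (path_class S (subpath 0 t \<gamma>)))"
  have Hone: "pone S x \<in> H" unfolding H_def using generate.one[of G] by (simp add: fundamental_group_simps)
  have PI: "P t" if "A = U \<or> A = V" "\<gamma> t \<in> A" "reach A (\<gamma> t) (path_class S (subpath 0 t \<gamma>))" for t A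
    unfolding P_def
  proof (intro allI impI)
    fix B assume B: "B = U \<or> B = V" "\<gamma> t \<in> B"
    show "reach B (\<gamma> t) (path_class S (subpath 0 t \<gamma>))"
    proof (cases "A = B")
      case True then show ?thesis using that(3) by simp
    next
      case False
      then have "\<gamma> t \<in> U" "\<gamma> t \<in> V" using B that by auto
      from reach_UV[OF this] show ?thesis using B(1) that False by auto
    qed
  qed
  have "P 1"
  proof (rule connected_induction_simple[of "{0..1::real}" 0 1 P])
    show "connected {0..1::real}" "0 \<in> {0..1::real}" "1 \<in> {0..1::real}" by auto
    have "subpath 0 0 \<gamma> = linepath x x" using pg(3) by (auto simp: subpath_def linepath_def algebra_simps)
    then have e: "path_class S (subpath 0 0 \<gamma>) = pone S x" by (simp add: pone_def)
    have "pone S x = pone S x \<cdot> J S U x x" using J_refl[OF scU US x(1)] pmult_one_left[OF pone_Hom] x US by auto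
    then have "reach U x (pone S x)" unfolding reach_def using Hone by blast
    then show "P 0" by (intro PI[of U]) (use x pg e in auto)
  next
    fix t0 :: real assume t0: "t0 \<in> {0..1}"
    then have "\<gamma> t0 \<in> S" using contg by auto
    then obtain A where A: "A = U \<or> A = V" "\<gamma> t0 \<in> A" using SUV by blast
    have "openin (top_of_set S) A" using A opU opV by auto
    from openin_eventually[OF this contg t0 A(2)]
    obtain \<epsilon> where \<epsilon>: "\<epsilon> > 0" "\<And>t. t \<in> {0..1} ==> t \<noteq> t0 ==> dist t t0 < \<epsilon> ==> \<gamma> t \<in> A"
      unfolding eventually_at by blast
    have inA: "\<gamma> t \<in> A" if "t \<in> {0..1} \<inter> ball t0 \<epsilon>" for t
      using \<epsilon>(2)[of t] A(2) that by (cases "t = t0") (auto simp: dist_commute)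
    have step: "P t'" if t: "t \<in> {0..1} \<inter> ball t0 \<epsilon>" and t': "t' \<in> {0..1} \<inter> ball t0 \<epsilon>" and Pt: "P t" for t t'
    proof -
      have seg: "closed_segment t t' \<subseteq> {0..1} \<inter> ball t0 \<epsilon>"
        by (rule closed_segment_subset[OF t t']) (intro convex_Int convex_ball convex_real_interval)
      have p: "path_from_to A (\<gamma> t) (\<gamma> t') (subpath t t' \<gamma>)"
        unfolding path_from_to_def path_image_subpath_gen
      proof (intro conjI image_subsetI)
        fix r assume "r \<in> closed_segment t t'"
        then show "\<gamma> r \<in> A" by (rule inA[OF subsetD[OF seg]])
      qed (use pg(1) t t' in auto)
      have AS: "A \<subseteq> S" using A US VS by auto
      have p0: "path_from_to S x (\<gamma> t) (subpath 0 t \<gamma>)"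
        unfolding path_from_to_def using pg t path_image_subpath_subset[of 0 t \<gamma>] by auto
      have "homotopic_paths S (subpath 0 t \<gamma> +++ subpath t t' \<gamma>) (subpath 0 t' \<gamma>)"
        by (rule homotopic_join_subpaths[OF pg(1,2)]) (use t t' in auto)
      then have e: "path_class S (subpath 0 t' \<gamma>) = path_class S (subpath 0 t \<gamma>) \<cdot> path_class S (subpath t t' \<gamma>)"
        using path_class_eqI pmult_class[OF p0 path_from_to_mono[OF p AS]] by metis
      have "reach A (\<gamma> t) (path_class S (subpath 0 t \<gamma>))" using Pt A(1) inA[OF t] unfolding P_def by blast
      from reach_step[OF A(1) this p] have "reach A (\<gamma> t') (path_class S (subpath 0 t' \<gamma>))" unfolding e .
      then show ?thesis by (rule PI[OF A(1) inA[OF t']])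
    qed
    show "\<exists>T. openin (top_of_set {0..1}) T \<and> t0 \<in> T \<and> (\<forall>x\<in>T. \<forall>y\<in>T. P x --> P y)"
    proof (intro exI conjI)
      show "openin (top_of_set {0..1}) ({0..1} \<inter> ball t0 \<epsilon>)" by (rule openin_open_Int) simp
      show "t0 \<in> {0..1} \<inter> ball t0 \<epsilon>" using t0 \<epsilon> by auto
      show "\<forall>x\<in>{0..1} \<inter> ball t0 \<epsilon>. \<forall>y\<in>{0..1} \<inter> ball t0 \<epsilon>. P x --> P y" using step by blast
    qed
  qed
  then have "reach U x (path_class S \<gamma>)" unfolding P_def using x pg(4) by auto
  then obtain k where "k \<in> H" "path_class S \<gamma> = k \<cdot> J S U x x" unfolding reach_def by blast
  then show ?thesis using J_refl[OF scU US x(1)] pmult_one_right[OF H_Hom] by auto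
qed

lemma carrier_eq_H: "carrier G = H"
  using loop_in_H H_Hom unfolding fundamental_group_simps by (auto elim!: HomE)

text \<open>The holonomy of the bundle glued by \<open>h\<close>. Only the crossing from \<open>U\<close> to \<open>V\<close> in the component \<open>j\<close> contributes to the loop \<open>q j\<close>.\<close>
lemma representation_exists:
  assumes h: "\<And>j. det (h j) = 1" "h 0 = mat 1"
  shows "\<exists>\<rho>\<in>rep_space G. \<forall>j<m. \<rho> (q j) = h j"
proof -
  interpret two_charts S U V "\<lambda>z. h (comp z)"
  proof
    fix z assume "z \<in> U \<inter> V"
    from comp_local[OF this] show "\<exists>W. openin (top_of_set S) W \<and> z \<in> W \<and> (\<forall>z'\<in>W. h (comp z') = h (comp z))" by metis
  qed (use SUV opU opV h in auto)
  define \<rho> where "\<rho> = (\<lambda>P\<in>carrier G. holonomy (SOME p. path_from_to S x x p \<and> P = path_class S p))"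
  have \<rho>: "\<rho> (path_class S p) = holonomy p" if p: "path_from_to S x x p" for p
  proof -
    have c: "path_class S p \<in> carrier G" unfolding fundamental_group_simps using HomI[OF p] .
    have "\<exists>p'. path_from_to S x x p' \<and> path_class S p = path_class S p'" using p by blast
    from someI_ex[OF this] have "homotopic_paths S p (SOME p'. path_from_to S x x p' \<and> path_class S p = path_class S p')"
      using path_class_eqD p unfolding path_from_to_def by blast
    from holonomy_homotopic[OF this] show ?thesis unfolding \<rho>_def using c by simp
  qed
  have "\<rho> \<in> hom G SL2"
    unfolding hom_def
  proof (intro CollectI conjI ballI Pi_I)
    fix P assume "P \<in> carrier G"
    then obtain p where p: "path_from_to S x x p" "P = path_class S p" unfolding fundamental_group_simps by (elim HomE)
    show "\<rho> P \<in> carrier SL2" unfolding p(2) \<rho>[OF p(1)] using det_holonomy p(1) unfolding path_from_to_def SL2_def by auto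
    fix Q assume "Q \<in> carrier G"
    then obtain r where r: "path_from_to S x x r" "Q = path_class S r" unfolding fundamental_group_simps by (elim HomE)
    show "\<rho> (P \<otimes>\<^bsub>G\<^esub> Q) = \<rho> P \<otimes>\<^bsub>SL2\<^esub> \<rho> Q"
      unfolding fundamental_group_simps p(2) r(2) pmult_class[OF p(1) r(1)] \<rho>[OF p(1)] \<rho>[OF r(1)] \<rho>[OF path_from_to_join[OF p(1) r(1)]]
      using holonomy_join[of p r] p(1) r(1) unfolding path_from_to_def SL2_def by auto
  qed
  then have "\<rho> \<in> rep_space G" unfolding rep_space_def \<rho>_def by auto
  moreover have "\<rho> (q j) = h j" if j: "j < m" for j
  proof -
    obtain z where z: "z \<in> U" "z \<in> V" "comp z = j" "q j = crossing z" using q_obtain[OF j] by blast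
    obtain p where p: "path_from_to U x z p" using simply_connected_path[OF scU x(1) z(1)] by blast
    obtain r where r: "path_from_to V z x r" using simply_connected_path[OF scV z(2) x(2)] by blast
    note pS = path_from_to_mono[OF p US] and rS = path_from_to_mono[OF r VS]
    have q: "q j = path_class S (p +++ r)"
      unfolding z(4) crossing_def J_unique[OF scU US p, symmetric] J_unique[OF scV VS r, symmetric] by (rule pmult_class[OF pS rS])
    have "holonomy p = mat 1" using holonomy_chart[of p False] p unfolding path_from_to_def chart_def gauge_def
      by (simp add: adj_mult(1)[of "mat 1", simplified])
    moreover have "holonomy r = h j" using holonomy_chart[of r True] r z(3) x(3) h(2) unfolding path_from_to_def chart_def gauge_def
      by (simp add: adj_mult(1)[of "mat 1", simplified])
    ultimately show ?thesis unfolding q \<rho>[OF path_from_to_join[OF pS rS]]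
      using holonomy_join[of p r] pS rS unfolding path_from_to_def by auto
  qed
  ultimately show ?thesis by blast
qed

text \<open>Connect the base point to \<open>z0\<close> inside \<open>U\<close>, and decompose the loop according to the two sets.\<close>
lemma loop_around:
  assumes z0: "z0 \<in> U" "z0 \<in> V" and z1: "z1 \<in> U" "z1 \<in> V"
    and p: "path_from_to U z0 z1 p" and r: "path_from_to V z1 z0 r"
  shows "\<exists>l\<in>loops_at S x. homotopic_loops S l (p +++ r) \<and> path_class S l = crossing z1 \<cdot> pinv S (crossing z0)"
proof -
  obtain c where c: "path_from_to U x z0 c" using simply_connected_path[OF scU x(1) z0(1)] by blast
  note pS = path_from_to_mono[OF p US] and rS = path_from_to_mono[OF r VS] and cS = path_from_to_mono[OF c US]
  note prS = path_from_to_join[OF pS rS] and c'S = path_from_to_reverse[OF cS]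
  define l where "l = c +++ (p +++ r) +++ reversepath c"
  have "l \<in> loops_at S x" using path_from_to_join[OF cS path_from_to_join[OF prS c'S]]
    unfolding l_def path_from_to_def loops_at_def by simp
  moreover have "homotopic_loops S l (p +++ r)" unfolding l_def
    by (rule homotopic_loops_conjugate) (use cS prS in \<open>auto simp: path_from_to_def\<close>)
  moreover have "path_class S l = crossing z1 \<cdot> pinv S (crossing z0)"
  proof -
    note h1 = hU[OF x(1) z1(1)] and h2 = hV[OF z1(2) x(2)] and h3 = hV[OF x(2) z0(2)] and h4 = hU[OF z0(1) x(1)]
      and h5 = hV[OF z1(2) z0(2)] and h6 = hU[OF x(1) z0(1)] and h7 = hU[OF z0(1) z1(1)]
    have inv0: "pinv S (crossing z0) = J S V x z0 \<cdot> J S U z0 x"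
    proof -
      note s = pinv_Hom[OF crossing_Hom[OF z0]]
      have "pinv S (crossing z0) = pinv S (crossing z0) \<cdot> (J S U x z0 \<cdot> J S U z0 x)"
        using J_mult[OF scU US x(1) z0(1) x(1)] J_refl[OF scU US x(1)] pmult_one_right[OF s] by simp
      also have "\<dots> = pinv S (crossing z0) \<cdot> J S U x z0 \<cdot> J S U z0 x" by (rule pmult_assoc[OF s h6 h4, symmetric])
      finally show ?thesis unfolding crossing_U[OF z0] .
    qed
    have "path_class S l = J S U x z0 \<cdot> ((J S U z0 z1 \<cdot> J S V z1 z0) \<cdot> J S U z0 x)"
      unfolding l_def J_unique[OF scU US c, symmetric] J_unique[OF scU US p, symmetric] J_unique[OF scV VS r, symmetric]
        J_unique[OF scU US path_from_to_reverse[OF c], symmetric] pmult_class[OF pS rS] pmult_class[OF prS c'S]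
        pmult_class[OF cS path_from_to_join[OF prS c'S]] ..
    also have "\<dots> = J S U x z0 \<cdot> (J S U z0 z1 \<cdot> (J S V z1 z0 \<cdot> J S U z0 x))" unfolding pmult_assoc[OF h7 h5 h4] ..
    also have "\<dots> = J S U x z0 \<cdot> J S U z0 z1 \<cdot> (J S V z1 z0 \<cdot> J S U z0 x)" by (rule pmult_assoc[OF h6 h7 pmult_Hom[OF h5 h4], symmetric])
    also have "\<dots> = J S U x z1 \<cdot> (J S V z1 x \<cdot> J S V x z0 \<cdot> J S U z0 x)"
      unfolding J_mult[OF scU US x(1) z0(1) z1(1)] J_mult[OF scV VS z1(2) x(2) z0(2)] ..
    also have "\<dots> = J S U x z1 \<cdot> (J S V z1 x \<cdot> (J S V x z0 \<cdot> J S U z0 x))" unfolding pmult_assoc[OF h2 h3 h4] ..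
    also have "\<dots> = crossing z1 \<cdot> (J S V x z0 \<cdot> J S U z0 x)" unfolding crossing_def by (rule pmult_assoc[OF h1 h2 pmult_Hom[OF h3 h4], symmetric])
    finally show ?thesis unfolding inv0 .
  qed
  ultimately show ?thesis by blast
qed

text \<open>With cyclic indices the product of all \<open>d k\<close> telescopes to \<open>1\<close>; geometrically \<open>d k\<close> encircles what lies between the components \<open>k\<close> and \<open>k + 1\<close> of \<open>U \<inter> V\<close>.\<close>
definition d :: "nat \<Rightarrow> (real \<Rightarrow> 'a) set" where
  "d k = q k \<cdot> pinv S (q (Suc k mod m))"

lemma m_pos: "m > 0" using comp_less[of x] x by auto

lemma d_carrier: assumes "k < m" shows "d k \<in> carrier G"
  unfolding d_def fundamental_group_simps by (rule pmult_Hom[OF q_Hom pinv_Hom[OF q_Hom]]) (use assms m_pos in auto)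

lemma d_generate: "carrier G = generate G (d ` {..<m - 1})"
proof -
  interpret group G by (rule grp)
  have dc: "d ` {..<m - 1} \<subseteq> carrier G" using d_carrier by auto
  have q_in: "q j \<in> generate G (d ` {..<m - 1})" if "j < m" for j
    using that
  proof (induction j)
    case 0 show ?case using generate.one[of G] unfolding q_0 fundamental_group_simps by blast
  next
    case (Suc j)
    have dj: "d j \<in> d ` {..<m - 1}" using Suc.prems by auto
    have c: "q j \<in> carrier G" "q (Suc j) \<in> carrier G" using q_Hom Suc.prems by (auto simp: fundamental_group_simps)
    have "d j = q j \<otimes>\<^bsub>G\<^esub> inv\<^bsub>G\<^esub> q (Suc j)"
      unfolding d_def using Suc.prems fundamental_group_inv[OF _ q_Hom[OF Suc.prems]] x US by (auto simp: fundamental_group_simps)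
    then have "q (Suc j) = inv\<^bsub>G\<^esub> (d j) \<otimes>\<^bsub>G\<^esub> q j" using c by (simp add: inv_mult_group m_assoc)
    then show ?case using generate.eng[OF generate.inv[OF dj] Suc.IH] Suc.prems by auto
  qed
  have "H \<subseteq> generate G (d ` {..<m - 1})" unfolding H_def
    by (rule generate_subgroup_incl[OF _ generate_is_subgroup[OF dc]]) (use q_in in auto)
  then show ?thesis using carrier_eq_H generate_incl[OF dc] by blast
qed

lemma rep_d:
  assumes "\<rho> \<in> rep_space G" "k < m" shows "\<rho> (d k) = \<rho> (q k) ** adj (\<rho> (q (Suc k mod m)))"
proof -
  have c: "q k \<in> carrier G" "q (Suc k mod m) \<in> carrier G" using q_Hom assms m_pos by (auto simp: fundamental_group_simps)
  interpret group G by (rule grp)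
  have "d k = q k \<otimes>\<^bsub>G\<^esub> inv\<^bsub>G\<^esub> q (Suc k mod m)"
    unfolding d_def using c fundamental_group_inv[of x S "q (Suc k mod m)"] x US by (auto simp: fundamental_group_simps)
  then show ?thesis using rep_spaceD(2)[OF assms(1) c(1) inv_closed[OF c(2)]] representation_inv[OF grp assms(1) c(2)] by simp
qed

lemma rep_q_det: "\<rho> \<in> rep_space G ==> j < m ==> det (\<rho> (q j)) = 1"
  using rep_spaceD(1)[of \<rho> G "q j"] q_Hom by (auto simp: fundamental_group_simps)

lemma rep_q_0: "\<rho> \<in> rep_space G ==> \<rho> (q 0) = mat 1"
  using representation_one[OF grp] by (simp add: q_0 fundamental_group_simps)

lemma d_product:
  assumes "\<rho> \<in> rep_space G" "j < m" shows "mprod (map (\<lambda>k. \<rho> (d k)) [0..<j]) = adj (\<rho> (q j))"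
  using assms(2)
proof (induction j)
  case 0 show ?case using rep_q_0[OF assms(1)] adj_mult(1)[of "mat 1"] by simp
next
  case (Suc j)
  have "mprod (map (\<lambda>k. \<rho> (d k)) [0..<Suc j]) = adj (\<rho> (q j)) ** (\<rho> (q j) ** adj (\<rho> (q (Suc j))))"
    using Suc rep_d[OF assms(1), of j] by (simp add: mprod_append)
  then show ?case using adj_mult(2)[OF rep_q_det[OF assms(1), of j]] Suc.prems by (simp add: matrix_mul_assoc)
qed

text \<open>The product of the first \<open>m - 1\<close> generators is the inverse of the last \<open>d\<close>, and inversion in \<open>SL\<^sub>2\<close> preserves the trace.\<close>
lemma d_last_trace:
  assumes "\<rho> \<in> rep_space G" shows "trace (mprod (map (\<lambda>k. \<rho> (d k)) [0..<m - 1])) = trace (\<rho> (d (m - 1)))"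
proof -
  have "\<rho> (d (m - 1)) = \<rho> (q (m - 1))"
    using rep_d[OF assms, of "m - 1"] rep_q_0[OF assms] adj_mult(1)[of "mat 1"] m_pos by simp
  then show ?thesis using d_product[OF assms, of "m - 1"] m_pos by simp
qed

text \<open>The value on \<open>q j\<close> has to be the inverse of \<open>A 0 ** \<dots> ** A (j - 1)\<close>.\<close>
lemma d_free:
  assumes A: "\<And>k. k < m - 1 ==> det (A k) = 1" shows "\<exists>\<rho>\<in>rep_space G. \<forall>k<m - 1. \<rho> (d k) = A k"
proof -
  define h where "h = (\<lambda>j. if j < m then adj (mprod (map A [0..<j])) else mat 1)"
  have dp: "det (mprod (map A [0..<j])) = 1" if "j < m" for j using A that by (intro det_mprod) auto
  have det_adj: "det (adj B) = 1" if "det B = 1" for B :: mtx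
    using arg_cong[OF adj_mult(1)[OF that], of det] that by (simp add: det_mul)
  have "det (h j) = 1" for j unfolding h_def using det_adj[OF dp] by simp
  moreover have "h 0 = mat 1" unfolding h_def using m_pos adj_mult(1)[of "mat 1"] by simp
  ultimately obtain \<rho> where \<rho>: "\<rho> \<in> rep_space G" "\<forall>j<m. \<rho> (q j) = h j" using representation_exists[of h] by blast
  have "\<rho> (d k) = A k" if k: "k < m - 1" for k
  proof -
    have "\<rho> (d k) = h k ** adj (h (Suc k))" using rep_d[OF \<rho>(1), of k] \<rho>(2) k by simp
    also have "\<dots> = adj (mprod (map A [0..<k])) ** (mprod (map A [0..<k]) ** A k)"
      proof -
      have "k < m" "Suc k < m" using k by auto
      then show ?thesis unfolding h_def by (simp add: mprod_append)
    qed
    also have "\<dots> = A k" using adj_mult(2)[OF dp, of k] k by (simp add: matrix_mul_assoc)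
    finally show ?thesis .
  qed
  then show ?thesis using \<rho>(1) by blast
qed

end


section \<open>Cutting a punctured sphere along meridians\<close>

lemma frame_expand:
  fixes a b c y :: "real^3"
  assumes n: "norm a = 1" "norm b = 1" "norm c = 1" and o: "a \<bullet> b = 0" "a \<bullet> c = 0" "b \<bullet> c = 0"
  shows "y = (y \<bullet> a) *\<^sub>R a + (y \<bullet> b) *\<^sub>R b + (y \<bullet> c) *\<^sub>R c"
proof -
  have aa: "a \<bullet> a = 1" "b \<bullet> b = 1" "c \<bullet> c = 1" using n by (simp_all add: norm_eq_1)
  have d: "a \<noteq> b" "a \<noteq> c" "b \<noteq> c" using aa o by auto
  have pw: "pairwise orthogonal {a, b, c}" using o by (auto simp: pairwise_def orthogonal_def inner_commute)
  have "0 \<notin> {a, b, c}" using aa by auto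
  then have "independent {a, b, c}" using pairwise_orthogonal_independent pw by blast
  moreover have "card {a, b, c} = DIM(real^3)" using d by simp
  ultimately have "span {a, b, c} = UNIV" using card_ge_dim_independent[of "{a, b, c}" UNIV] by auto
  then have "(\<Sum>i\<in>{a, b, c}. (y \<bullet> i) *\<^sub>R i) = y"
    using pw n by (intro orthonormal_basis_expand) auto
  then show ?thesis using d by (simp add: add.assoc)
qed

lemma orthonormal_frame:
  fixes N :: "real^3" assumes N: "norm N = 1"
  obtains a b where "norm a = 1" "norm b = 1" "a \<bullet> b = 0" "a \<bullet> N = 0" "b \<bullet> N = 0"
proof -
  obtain f where f: "orthogonal_transformation f" "f (axis 3 1 :: real^3) = N"
    using orthogonal_transformation_exists[of "axis 3 1 :: real^3" N] N by (auto simp: norm_axis_1)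
  have i: "f y \<bullet> f z = y \<bullet> z" for y z using f(1) unfolding orthogonal_transformation_def by blast
  show ?thesis
    by (rule that[of "f (axis 1 1)" "f (axis 2 1)"])
      (simp_all add: orthogonal_transformation_norm[OF f(1)] norm_axis_1 i f(2)[symmetric] inner_axis_axis)
qed

text \<open>The axis \<open>N\<close> is generic: no two of the marked points (punctures and base point) lie in a common plane through the axis. In particular they have different longitudes and none is a pole.\<close>
locale sphere_frame =
  fixes m :: nat and v :: "nat \<Rightarrow> real^3" and x N E1 E2 :: "real^3"
  assumes m: "m > 0" and inj: "inj_on v {..<m}" and vs: "i < m ==> norm (v i) = 1" and xs: "norm x = 1"
    and xv: "i < m ==> x \<noteq> v i"
    and fr: "norm N = 1" "norm E1 = 1" "norm E2 = 1" "E1 \<bullet> E2 = 0" "E1 \<bullet> N = 0" "E2 \<bullet> N = 0"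
    and generic: "p \<in> insert x (v ` {..<m}) ==> r \<in> insert x (v ` {..<m}) ==> p \<noteq> r ==> N \<notin> span {p, r}"
begin

text \<open>Cylindrical coordinates: the projection to the equatorial plane as a complex number, and the height.\<close>
definition cc :: "real^3 \<Rightarrow> complex" where "cc z = Complex (z \<bullet> E1) (z \<bullet> E2)"
definition ht :: "real^3 \<Rightarrow> real" where "ht z = z \<bullet> N"
definition pt :: "complex \<Rightarrow> real \<Rightarrow> real^3" where "pt c h = Re c *\<^sub>R E1 + Im c *\<^sub>R E2 + h *\<^sub>R N"

lemma fr': "E1 \<bullet> E1 = 1" "E2 \<bullet> E2 = 1" "N \<bullet> N = 1" "E2 \<bullet> E1 = 0" "N \<bullet> E1 = 0" "N \<bullet> E2 = 0"
  using fr by (simp_all add: norm_eq_1 inner_commute)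

lemma pt_cc_ht [simp]: "pt (cc z) (ht z) = z"
  using frame_expand[OF fr(2,3,1,4,5,6), of z] by (simp add: pt_def cc_def ht_def)

lemma cc_pt [simp]: "cc (pt c h) = c" and ht_pt [simp]: "ht (pt c h) = h"
  by (simp_all add: cc_def ht_def pt_def inner_add_left fr fr' complex_eq_iff)

lemma coords_eqI: "cc y = cc z ==> ht y = ht z ==> y = z"
  by (metis pt_cc_ht)

lemma inner_coords: "y \<bullet> z = Re (cc y * cnj (cc z)) + ht y * ht z"
proof -
  have "y \<bullet> z = pt (cc y) (ht y) \<bullet> z" by simp
  also have "\<dots> = Re (cc y) * (E1 \<bullet> z) + Im (cc y) * (E2 \<bullet> z) + ht y * (N \<bullet> z)" unfolding pt_def by (simp add: inner_add_left)
  finally show ?thesis by (simp add: cc_def ht_def inner_commute)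
qed

lemma norm_coords: "(norm z)\<^sup>2 = (cmod (cc z))\<^sup>2 + (ht z)\<^sup>2"
  unfolding power2_norm_eq_inner inner_coords complex_norm_square[symmetric] by (simp add: power2_eq_square)

lemma cc_linear [simp]: "cc (y + z) = cc y + cc z" "cc (r *\<^sub>R z) = of_real r * cc z" "cc (y - z) = cc y - cc z" "cc 0 = 0" "cc N = 0"
  by (simp_all add: cc_def complex_eq_iff inner_add_left inner_diff_left fr fr')

lemma ht_linear [simp]: "ht (y + z) = ht y + ht z" "ht (r *\<^sub>R z) = r * ht z" "ht (y - z) = ht y - ht z" "ht 0 = 0" "ht N = 1"
  by (simp_all add: ht_def inner_add_left inner_diff_left fr')

lemma cc_cont [continuous_intros]: "continuous_on A f ==> continuous_on A (\<lambda>t. cc (f t))"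
  unfolding cc_def Complex_eq by (intro continuous_intros)

lemma ht_cont [continuous_intros]: "continuous_on A f ==> continuous_on A (\<lambda>t. ht (f t))"
  unfolding ht_def by (intro continuous_intros)

lemma pt_cont [continuous_intros]: "continuous_on A f ==> continuous_on A g ==> continuous_on A (\<lambda>t. pt (f t) (g t))"
  unfolding pt_def by (intro continuous_intros)

definition F where "F = insert x (v ` {..<m})"

lemma F_norm: "p \<in> F ==> norm p = 1" using vs xs unfolding F_def by auto

lemma cc_eq_N: assumes "cc y = 0" "y \<noteq> 0" shows "N \<in> span {y}"
proof -
  have e: "y = ht y *\<^sub>R N" by (rule coords_eqI) (simp_all add: assms)
  then have "ht y \<noteq> 0" using assms by auto
  then have "N = (1 / ht y) *\<^sub>R y" using e by (metis divide_inverse mult_1 pth_1 right_inverse scaleR_scaleR mult.commute)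
  then show ?thesis by (metis span_base span_scale insertI1)
qed

lemma cc_F: assumes p: "p \<in> F" shows "cc p \<noteq> 0"
proof
  assume c: "cc p = 0"
  have "p \<noteq> 0" using F_norm[OF p] by auto
  from cc_eq_N[OF c this] have N: "N \<in> span {p}" .
  obtain r where r: "r \<in> F" "r \<noteq> p" using p xv[OF m] m unfolding F_def by (cases "p = x") auto
  have "N \<in> span {p, r}" using N span_mono[of "{p}" "{p, r}"] by auto
  then show False using generic p r unfolding F_def by metis
qed

text \<open>The points on the closed half plane through the axis and \<open>p\<close>. The formula is a closed condition, which the longitude would not give.\<close>
definition ray :: "real^3 \<Rightarrow> real^3 \<Rightarrow> bool" where
  "ray z p \<longleftrightarrow> Im (cc z * cnj (cc p)) = 0 \<and> Re (cc z * cnj (cc p)) \<ge> 0"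

lemma ray_iff: assumes "cc p \<noteq> 0" shows "ray z p \<longleftrightarrow> (\<exists>r\<ge>0. cc z = of_real r * cc p)"
proof
  assume R: "ray z p"
  define r where "r = Re (cc z * cnj (cc p)) / (cmod (cc p))\<^sup>2"
  have "cc z * cnj (cc p) = of_real (Re (cc z * cnj (cc p)))" using R unfolding ray_def by (simp add: complex_eq_iff)
  then have "cc z * (cc p * cnj (cc p)) = of_real (Re (cc z * cnj (cc p))) * cc p" by (metis mult.assoc mult.commute)
  then have "cc z * of_real ((cmod (cc p))\<^sup>2) = of_real (Re (cc z * cnj (cc p))) * cc p" unfolding complex_norm_square by simp
  then have "cc z = of_real r * cc p" using assms unfolding r_def by (simp add: field_simps)
  then show "\<exists>r\<ge>0. cc z = of_real r * cc p" using R unfolding ray_def r_def by (intro exI[of _ r]) (auto simp: r_def)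
next
  assume "\<exists>r\<ge>0. cc z = of_real r * cc p"
  then obtain r where r: "r \<ge> 0" "cc z = of_real r * cc p" by blast
  have "cc z * cnj (cc p) = of_real (r * (cmod (cc p))\<^sup>2)" unfolding r(2) mult.assoc complex_norm_square[symmetric] by simp
  then show "ray z p" unfolding ray_def using r(1) by simp
qed

lemma ray_F: assumes "p \<in> F" "r \<in> F" "ray p r" shows "p = r"
proof (rule ccontr)
  assume "p \<noteq> r"
  obtain s where s: "s \<ge> 0" "cc p = of_real s * cc r" using assms(3) ray_iff[OF cc_F[OF assms(2)]] by blast
  define y where "y = p - s *\<^sub>R r"
  have "cc y = 0" using s(2) by (simp add: y_def)
  moreover have "y \<noteq> 0"
  proof
    assume "y = 0"
    then have "p = s *\<^sub>R r" by (simp add: y_def)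
    moreover from this have "s = 1" using F_norm[OF assms(1)] F_norm[OF assms(2)] s(1) by simp
    ultimately show False using \<open>p \<noteq> r\<close> by simp
  qed
  ultimately have "N \<in> span {y}" by (rule cc_eq_N)
  moreover have "y \<in> span {p, r}" unfolding y_def by (intro span_diff span_scale span_base) auto
  then have "span {y} \<subseteq> span {p, r}" by (simp add: span_minimal)
  ultimately show False using generic[of p r] assms \<open>p \<noteq> r\<close> unfolding F_def by blast
qed

text \<open>The longitude, measured from the base point.\<close>
definition ang :: "real^3 \<Rightarrow> real" where "ang z = Arg2pi (cc z / cc x)"

lemma ang_bounds: "0 \<le> ang z" "ang z < 2 * pi" using Arg2pi[of "cc z / cc x"] by (auto simp: ang_def)

lemma xF: "x \<in> F" and vF: "i < m ==> v i \<in> F" by (auto simp: F_def)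

lemma cx: "cc x \<noteq> 0" by (rule cc_F[OF xF])

lemma ang_x: "ang x = 0" using cx Arg2pi_of_real[of 1] by (simp add: ang_def)

lemma ray_ang: assumes "cc z \<noteq> 0" "cc p \<noteq> 0" shows "ray z p \<longleftrightarrow> ang z = ang p"
proof -
  have "ang z = ang p \<longleftrightarrow> (\<exists>r. 0 < r \<and> cc z / cc x = of_real r * (cc p / cc x))"
    unfolding ang_def by (rule Arg2pi_eq_iff) (use assms cx in auto)
  also have "\<dots> \<longleftrightarrow> (\<exists>r>0. cc z = of_real r * cc p)" using cx by (simp add: field_simps)
  also have "\<dots> \<longleftrightarrow> (\<exists>r\<ge>0. cc z = of_real r * cc p)" using assms(1)
    by (metis less_eq_real_def mult_zero_left of_real_0)
  finally show ?thesis using ray_iff[OF assms(2)] by blast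
qed

lemma ang_polar: "cc z = of_real (cmod (cc z) / cmod (cc x)) * cc x * exp (\<i> * of_real (ang z))"
proof -
  have "cc z / cc x = of_real (cmod (cc z / cc x)) * exp (\<i> * of_real (ang z))"
    using Arg2pi_eq[of "cc z / cc x"] unfolding ang_def by simp
  then have "cc z = of_real (cmod (cc z / cc x)) * exp (\<i> * of_real (ang z)) * cc x" using cx by (simp add: field_simps)
  then show ?thesis by (simp add: norm_divide mult_ac)
qed

lemma ang_unique: assumes "cc z = of_real r * cc x * exp (\<i> * of_real a)" "r > 0" "0 \<le> a" "a < 2 * pi" shows "ang z = a"
  unfolding ang_def by (rule Arg2pi_unique[OF _ assms(2,3,4)]) (use cx assms(1) in \<open>simp add: field_simps\<close>)

abbreviation \<theta> where "\<theta> i \<equiv> ang (v i)"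

lemma \<theta>_inj: assumes "i < m" "j < m" "\<theta> i = \<theta> j" shows "i = j"
proof -
  have "ray (v i) (v j)" using ray_ang[OF cc_F[OF vF] cc_F[OF vF]] assms by blast
  then show ?thesis using ray_F[OF vF vF] assms(1,2) inj unfolding inj_on_def by auto
qed

lemma \<theta>_pos: assumes "i < m" shows "0 < \<theta> i"
proof -
  have "\<theta> i \<noteq> ang x" using ray_ang[OF cc_F[OF vF[OF assms]] cx] ray_F[OF vF[OF assms] xF] xv[OF assms] by auto
  then show ?thesis using ang_bounds(1)[of "v i"] ang_x by auto
qed

text \<open>For \<open>\<sigma> = 1\<close>, the meridian arc from the puncture to the south pole, extended to a cone; for \<open>\<sigma> = -1\<close>, the one to the north pole.\<close>
definition cut :: "real \<Rightarrow> nat \<Rightarrow> real^3 \<Rightarrow> bool" where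
  "cut \<sigma> i z \<longleftrightarrow> ray z (v i) \<and> \<sigma> * ht z * cmod (cc (v i)) \<le> \<sigma> * ht (v i) * cmod (cc z)"

definition cone :: "real \<Rightarrow> (real^3) set" where "cone \<sigma> = {z. \<forall>i<m. \<not> cut \<sigma> i z}"
definition side :: "real \<Rightarrow> (real^3) set" where "side \<sigma> = sphere 0 1 \<inter> cone \<sigma>"

lemma cut_closed: "closed {z. cut \<sigma> i z}"
  unfolding cut_def ray_def by (intro closed_Collect_conj closed_Collect_eq closed_Collect_le continuous_intros)

lemma side_open: "openin (top_of_set (sphere 0 1)) (side \<sigma>)"
proof -
  have "cone \<sigma> = - (\<Union>i\<in>{..<m}. {z. cut \<sigma> i z})" unfolding cone_def by auto
  moreover have "closed (\<Union>i\<in>{..<m}. {z. cut \<sigma> i z})" by (rule closed_UN) (auto intro: cut_closed)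
  ultimately have "open (cone \<sigma>)" using open_Compl by metis
  then show ?thesis unfolding side_def by (rule openin_open_Int)
qed

lemma cone_scale: assumes "z \<in> cone \<sigma>" "r > 0" shows "r *\<^sub>R z \<in> cone \<sigma>"
proof -
  have "cut \<sigma> i z" if i: "i < m" and c: "cut \<sigma> i (r *\<^sub>R z)" for i
  proof -
    have nz: "cc (v i) \<noteq> 0" using cc_F[OF vF[OF i]] .
    obtain s where s: "s \<ge> 0" "of_real r * cc z = of_real s * cc (v i)" using c ray_iff[OF nz] unfolding cut_def by auto
    have "cc z = of_real (s / r) * cc (v i)" using s(2) assms(2) by (simp add: field_simps)
    then have "ray z (v i)" using ray_iff[OF nz] s(1) assms(2) by (metis divide_nonneg_pos)
    moreover have "r * (\<sigma> * ht z * cmod (cc (v i))) \<le> r * (\<sigma> * ht (v i) * cmod (cc z))"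
      using c assms(2) unfolding cut_def by (simp add: norm_mult mult_ac)
    ultimately show ?thesis unfolding cut_def using assms(2) by simp
  qed
  then show ?thesis using assms(1) unfolding cone_def by blast
qed

lemma cone_0: "0 \<notin> cone \<sigma>" unfolding cone_def cut_def ray_def using m by auto

text \<open>The cone over the cut sphere is starlike with respect to the pole that was not cut, since moving towards it keeps the longitude and raises the slope; radial projection retracts the cone to the sphere.\<close>
lemma side_simply_connected:
  assumes \<sigma>: "\<sigma> = 1 \<or> \<sigma> = - 1" shows "simply_connected (side \<sigma>)"
proof (rule retract_of_simply_connected)
  have seg: "(1 - s) *\<^sub>R z + s *\<^sub>R (\<sigma> *\<^sub>R N) \<in> cone \<sigma>" if z: "z \<in> cone \<sigma>" and s: "0 \<le> s" "s < 1" for z s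
  proof -
    have "cut \<sigma> i z" if i: "i < m" and c: "cut \<sigma> i ((1 - s) *\<^sub>R z + s *\<^sub>R (\<sigma> *\<^sub>R N))" for i
    proof -
      have nz: "cc (v i) \<noteq> 0" using cc_F[OF vF[OF i]] .
      obtain r where r: "r \<ge> 0" "of_real (1 - s) * cc z = of_real r * cc (v i)" using c ray_iff[OF nz] unfolding cut_def by auto
      have "of_real (1 - s) \<noteq> (0::complex)" using s(2) by (metis diff_gt_0_iff_gt of_real_eq_0_iff order_less_irrefl)
      then have "cc z = of_real r * cc (v i) / of_real (1 - s)" using r(2) by (metis nonzero_mult_div_cancel_left)
      then have "cc z = of_real (r / (1 - s)) * cc (v i)" by simp
      then have R: "ray z (v i)" using ray_iff[OF nz] r(1) s(2) by (metis diff_gt_0_iff_gt divide_nonneg_pos)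
      have "\<sigma> * ((1 - s) * ht z + s * \<sigma>) * cmod (cc (v i)) \<le> \<sigma> * ht (v i) * ((1 - s) * cmod (cc z))"
        using c s(2) unfolding cut_def by (simp add: norm_mult del: of_real_diff)
      moreover have "\<sigma> * ((1 - s) * ht z + s * \<sigma>) * cmod (cc (v i)) = (1 - s) * (\<sigma> * ht z * cmod (cc (v i))) + s * cmod (cc (v i))"
        using \<sigma> by (auto simp: algebra_simps)
      moreover have "s * cmod (cc (v i)) \<ge> 0" using s by simp
      ultimately have "(1 - s) * (\<sigma> * ht z * cmod (cc (v i))) \<le> (1 - s) * (\<sigma> * ht (v i) * cmod (cc z))" by (simp add: mult_ac)
      then show ?thesis unfolding cut_def using R s(2) by simp
    qed
    then show ?thesis using z unfolding cone_def by blast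
  qed
  have pole: "\<sigma> *\<^sub>R N \<in> cone \<sigma>"
    using cc_F[OF vF] \<sigma> unfolding cone_def cut_def by auto
  have "starlike (cone \<sigma>)" unfolding starlike_def
  proof (intro bexI[of _ "\<sigma> *\<^sub>R N"] ballI subsetI)
    fix z y assume z: "z \<in> cone \<sigma>" and "y \<in> closed_segment (\<sigma> *\<^sub>R N) z"
    then have "y \<in> closed_segment z (\<sigma> *\<^sub>R N)" by (simp add: closed_segment_commute)
    then obtain s where s: "0 \<le> s" "s \<le> 1" "y = (1 - s) *\<^sub>R z + s *\<^sub>R (\<sigma> *\<^sub>R N)" unfolding in_segment by blast
    show "y \<in> cone \<sigma>" using seg[OF z s(1)] pole s by (cases "s = 1") auto
  qed (rule pole)
  then show "simply_connected (cone \<sigma>)" by (rule starlike_imp_simply_connected)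
  have "retraction (cone \<sigma>) (side \<sigma>) (\<lambda>z. (1 / norm z) *\<^sub>R z)"
    unfolding retraction_def side_def
  proof (intro conjI)
    show "continuous_on (cone \<sigma>) (\<lambda>z. (1 / norm z) *\<^sub>R z)" using cone_0 by (intro continuous_intros) auto
    show "(\<lambda>z. (1 / norm z) *\<^sub>R z) \<in> cone \<sigma> \<rightarrow> sphere 0 1 \<inter> cone \<sigma>"
    proof
      fix z assume z: "z \<in> cone \<sigma>"
      then have "norm z > 0" using cone_0 by auto
      then show "(1 / norm z) *\<^sub>R z \<in> sphere 0 1 \<inter> cone \<sigma>" using cone_scale[OF z, of "1 / norm z"] by simp
    qed
  qed auto
  then show "side \<sigma> retract_of cone \<sigma>" unfolding retract_of_def by blast
qed

lemma sides_union: "punctured_sphere m v = side 1 \<union> side (- 1)"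
proof (intro equalityI subsetI)
  fix z assume z: "z \<in> punctured_sphere m v"
  then have z1: "norm z = 1" and zv: "\<And>i. i < m ==> z \<noteq> v i" unfolding punctured_sphere_def by auto
  show "z \<in> side 1 \<union> side (- 1)"
  proof (rule ccontr)
    assume "z \<notin> side 1 \<union> side (- 1)"
    then obtain i j where i: "i < m" "cut 1 i z" and j: "j < m" "cut (- 1) j z" using z1 unfolding side_def cone_def by auto
    have nz: "cc (v i) \<noteq> 0" "cc (v j) \<noteq> 0" using cc_F vF i j by auto
    show False
    proof (cases "cc z = 0")
      case True
      then have "ht z * cmod (cc (v i)) \<le> 0" "ht z * cmod (cc (v j)) \<ge> 0" using i j unfolding cut_def by auto
      then have "ht z = 0" using nz by (auto simp: mult_le_0_iff zero_le_mult_iff)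
      then show False using True z1 norm_coords[of z] by simp
    next
      case False
      have "\<theta> i = \<theta> j" using ray_ang[OF False nz(1)] ray_ang[OF False nz(2)] i j unfolding cut_def by simp
      then have ij: "i = j" using \<theta>_inj i j by blast
      obtain r where r: "r \<ge> 0" "cc z = of_real r * cc (v i)" using i ray_iff[OF nz(1)] unfolding cut_def by blast
      have "ht z * cmod (cc (v i)) = ht (v i) * cmod (cc z)" using i j ij unfolding cut_def by auto
      then have "ht z = r * ht (v i)" using nz(1) r by (simp add: norm_mult)
      then have e: "z = r *\<^sub>R v i" using r(2) by (intro coords_eqI) simp_all
      then have "r = 1" using z1 vs[OF i(1)] r(1) by simp
      then show False using e zv[OF i(1)] by simp
    qed
  qed
next
  fix z assume z: "z \<in> side 1 \<union> side (- 1)"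
  have "cut \<sigma> i (v i)" if "i < m" for i \<sigma>
    unfolding cut_def using ray_iff[OF cc_F[OF vF[OF that]], of "v i"] by (auto intro: exI[of _ 1])
  then show "z \<in> punctured_sphere m v" using z unfolding side_def cone_def punctured_sphere_def by auto
qed

lemma sides_inter: "z \<in> side 1 \<inter> side (- 1) \<longleftrightarrow> norm z = 1 \<and> cc z \<noteq> 0 \<and> (\<forall>i<m. ang z \<noteq> \<theta> i)"
proof
  assume z: "z \<in> side 1 \<inter> side (- 1)"
  have nr: "\<not> ray z (v i)" if i: "i < m" for i
  proof
    assume "ray z (v i)"
    then have "cut 1 i z \<or> cut (- 1) i z" unfolding cut_def by auto
    then show False using z i unfolding side_def cone_def by auto
  qed
  have "cc z \<noteq> 0" using nr[OF m] unfolding ray_def by auto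
  then show "norm z = 1 \<and> cc z \<noteq> 0 \<and> (\<forall>i<m. ang z \<noteq> \<theta> i)" using nr ray_ang cc_F[OF vF] z unfolding side_def by auto
next
  assume z: "norm z = 1 \<and> cc z \<noteq> 0 \<and> (\<forall>i<m. ang z \<noteq> \<theta> i)"
  then show "z \<in> side 1 \<inter> side (- 1)" using ray_ang[of z] cc_F[OF vF] unfolding side_def cone_def cut_def by auto
qed

end


context sphere_frame
begin

section \<open>Sectors of the sphere between the meridians\<close>

text \<open>The number of punctures of smaller longitude. It is taken modulo \<open>m\<close> because the sector of the base point extends to both sides of longitude \<open>0\<close>.\<close>
definition sector :: "real^3 \<Rightarrow> nat" where
  "sector z = card {i \<in> {..<m}. \<theta> i < ang z} mod m"

lemma cc_isCont: "isCont (\<lambda>w. cc w / cc x) z"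
proof -
  have "continuous_on UNIV (\<lambda>w. cc w / cc x)" using cx by (intro continuous_intros) auto
  then show ?thesis by (simp add: continuous_on_eq_continuous_at)
qed

lemma ang_isCont: assumes "cc z \<noteq> 0" "ang z \<noteq> 0" shows "isCont ang z"
proof -
  have "cc z / cc x \<notin> \<real>\<^sub>\<ge>\<^sub>0"
  proof
    assume "cc z / cc x \<in> \<real>\<^sub>\<ge>\<^sub>0"
    then have "Arg2pi (cc z / cc x) = 0" unfolding Arg2pi_eq_0 by (auto simp: nonneg_Reals_def)
    then show False using assms(2) by (simp add: ang_def)
  qed
  from isCont_o2[OF cc_isCont continuous_at_Arg2pi[OF this]] show ?thesis unfolding ang_def by simp
qed

text \<open>The longitude is continuous away from \<open>0\<close>. Near longitude \<open>0\<close> it is close to \<open>0\<close> or to \<open>2 * pi\<close>, and then the count is \<open>0\<close> or \<open>m\<close>.\<close>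
lemma sector_local: assumes "cc z \<noteq> 0" "\<forall>i<m. ang z \<noteq> \<theta> i" shows "eventually (\<lambda>w. sector w = sector z) (nhds z)"
proof (cases "ang z = 0")
  case False
  have lim: "(ang \<longlongrightarrow> ang z) (nhds z)" using ang_isCont[OF assms(1) False] by (simp add: continuous_at tendsto_nhds_iff isCont_def)
  have "eventually (\<lambda>w. \<theta> i < ang w \<longleftrightarrow> \<theta> i < ang z) (nhds z)" if "i < m" for i
  proof (cases "\<theta> i < ang z")
    case True
    from order_tendstoD(1)[OF lim this] show ?thesis by eventually_elim (use True in simp)
  next
    case F: False
    then have "ang z < \<theta> i" using assms(2) that by force
    from order_tendstoD(2)[OF lim this] show ?thesis by eventually_elim (use F in simp)
  qed
  then have "eventually (\<lambda>w. \<forall>i\<in>{..<m}. \<theta> i < ang w \<longleftrightarrow> \<theta> i < ang z) (nhds z)"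
    by (intro eventually_ball_finite) auto
  then show ?thesis
  proof eventually_elim
    case (elim w)
    then have "{i \<in> {..<m}. \<theta> i < ang w} = {i \<in> {..<m}. \<theta> i < ang z}" by blast
    then show ?case by (simp add: sector_def)
  qed
next
  case True
  define u where "u = cc z / cc x"
  define \<alpha> where "\<alpha> w = Im (Ln (cc w / cc x))" for w
  have u: "u \<in> \<real>" "Re u \<ge> 0" "u \<noteq> 0" using True assms(1) cx unfolding ang_def Arg2pi_eq_0 u_def by auto
  have Imu: "Im u = 0" using u(1) by (simp add: complex_is_Real_iff)
  then have "Re u \<noteq> 0" using u(3) by (metis complex_eqI zero_complex.simps)
  then have Reu: "Re u > 0" using u(2) by simp
  have un: "u \<notin> \<real>\<^sub>\<le>\<^sub>0" using Reu by (auto simp: complex_nonpos_Reals_iff)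
  have \<alpha>z: "\<alpha> z = 0" using Reu Imu Ln_of_real[of "Re u"] unfolding \<alpha>_def u_def[symmetric]
    by (metis Im_complex_of_real complex_is_Real_iff of_real_Re)
  have "isCont (\<lambda>w. Ln (cc w / cc x)) z"
    by (rule isCont_o2[OF cc_isCont]) (use un in \<open>auto simp: u_def intro: continuous_at_Ln\<close>)
  then have "isCont \<alpha> z" unfolding \<alpha>_def by (intro isCont_Im)
  then have lim: "(\<alpha> \<longlongrightarrow> 0) (nhds z)" using \<alpha>z by (simp add: tendsto_nhds_iff isCont_def)
  have "eventually (\<lambda>w. \<bar>\<alpha> w\<bar> < \<theta> i \<and> \<bar>\<alpha> w\<bar> < 2 * pi - \<theta> i) (nhds z)" if "i < m" for i
    using order_tendstoD(2)[OF tendsto_rabs[OF lim], of "min (\<theta> i) (2 * pi - \<theta> i)"] \<theta>_pos[OF that] ang_bounds(2)[of "v i"] by simp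
  then have ev1: "eventually (\<lambda>w. \<forall>i\<in>{..<m}. \<bar>\<alpha> w\<bar> < \<theta> i \<and> \<bar>\<alpha> w\<bar> < 2 * pi - \<theta> i) (nhds z)"
    by (intro eventually_ball_finite) auto
  have "((\<lambda>w. cc w / cc x) \<longlongrightarrow> u) (nhds z)" using cc_isCont[of z] by (simp add: tendsto_nhds_iff isCont_def u_def)
  then have ev2: "eventually (\<lambda>w. cc w / cc x \<noteq> 0) (nhds z)" using u(3) by (rule tendsto_imp_eventually_ne)
  have e: "{i \<in> {..<m}. \<theta> i < ang z} = {}" unfolding True using \<theta>_pos by force
  have sz: "sector z = 0" unfolding sector_def e by simp
  show ?thesis using ev1 ev2
  proof eventually_elim
    case (elim w)
    define c where "c = cc w / cc x"
    have c0: "c \<noteq> 0" using elim(2) by (simp add: c_def)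
    have "c = exp (of_real (Re (Ln c)) + \<i> * of_real (\<alpha> w))" using c0 complex_eq[of "Ln c"] exp_Ln[OF c0] unfolding \<alpha>_def c_def[symmetric] by simp
    then have "c = of_real (exp (Re (Ln c))) * exp (\<i> * of_real (\<alpha> w))" by (simp only: exp_add exp_of_real)
    then have cw: "cc w = of_real (exp (Re (Ln c))) * cc x * exp (\<i> * of_real (\<alpha> w))" using cx unfolding c_def by (simp add: field_simps)
    show ?case
    proof (cases "\<alpha> w \<ge> 0")
      case True
      have "\<bar>\<alpha> w\<bar> < \<theta> 0" using bspec[OF elim(1), of 0] m by simp
      then have "\<alpha> w < 2 * pi" using ang_bounds(2)[of "v 0"] by simp
      then have "ang w = \<alpha> w" by (intro ang_unique[OF cw]) (use True in auto)
      then have e: "{i \<in> {..<m}. \<theta> i < ang w} = {}" using elim(1) by force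
      have "sector w = 0" unfolding sector_def e by simp
      then show ?thesis using sz by simp
    next
      case False
      have "exp (\<i> * of_real (\<alpha> w)) = exp (\<i> * of_real (\<alpha> w + 2 * pi))"
        unfolding of_real_add ring_distribs exp_add using exp_two_pi_i by (simp add: mult_ac)
      then have cw': "cc w = of_real (exp (Re (Ln c))) * cc x * exp (\<i> * of_real (\<alpha> w + 2 * pi))" using cw by simp
      have "\<bar>\<alpha> w\<bar> < 2 * pi" using bspec[OF elim(1), of 0] m \<theta>_pos[OF m] by simp
      then have "ang w = \<alpha> w + 2 * pi" by (intro ang_unique[OF cw']) (use False in auto)
      then have e: "{i \<in> {..<m}. \<theta> i < ang w} = {..<m}" using elim(1) by force
      have "sector w = 0" unfolding sector_def e by simp
      then show ?thesis using sz by simp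
    qed
  qed
qed

text \<open>Parametrisation of the sphere by longitude and height.\<close>
definition sph :: "real \<times> real \<Rightarrow> real^3" where
  "sph = (\<lambda>(\<phi>, t). pt (of_real (sqrt (1 - t\<^sup>2) / cmod (cc x)) * cc x * exp (\<i> * of_real \<phi>)) t)"

lemma sph_cc: "cc (sph (\<phi>, t)) = of_real (sqrt (1 - t\<^sup>2) / cmod (cc x)) * cc x * exp (\<i> * of_real \<phi>)" and sph_ht: "ht (sph (\<phi>, t)) = t"
  by (simp_all add: sph_def)

lemma sph_cmod: "\<bar>t\<bar> < 1 ==> cmod (cc (sph (\<phi>, t))) = sqrt (1 - t\<^sup>2)"
  unfolding sph_cc using cx by (simp add: norm_mult norm_divide abs_square_le_1)

lemma sqrt_pos: "\<bar>t\<bar> < 1 ==> 0 < sqrt (1 - t\<^sup>2)" for t :: real by (simp add: abs_square_less_1)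

lemma sph_norm: assumes "\<bar>t\<bar> < 1" shows "norm (sph (\<phi>, t)) = 1" "cc (sph (\<phi>, t)) \<noteq> 0"
proof -
  have "(norm (sph (\<phi>, t)))\<^sup>2 = 1" unfolding norm_coords sph_cmod[OF assms] sph_ht using sqrt_pos[OF assms] by simp
  then show "norm (sph (\<phi>, t)) = 1" by (simp add: power2_eq_1_iff) (metis norm_ge_zero not_one_le_zero neg_0_le_iff_le order.trans zero_le_one)
  show "cc (sph (\<phi>, t)) \<noteq> 0" using sph_cmod[OF assms, of \<phi>] sqrt_pos[OF assms] by auto
qed

lemma sph_ang: assumes "\<bar>t\<bar> < 1" "0 \<le> \<phi>" "\<phi> < 2 * pi" shows "ang (sph (\<phi>, t)) = \<phi>"
  by (rule ang_unique[OF sph_cc]) (use assms sqrt_pos[OF assms(1)] cx in auto)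

lemma sph_period: "sph (\<phi> + 2 * pi, t) = sph (\<phi>, t)"
proof -
  have "exp (\<i> * of_real (\<phi> + 2 * pi)) = exp (\<i> * of_real \<phi>)"
    unfolding of_real_add ring_distribs exp_add using exp_two_pi_i by (simp add: mult_ac)
  then show ?thesis unfolding sph_def by simp
qed

lemma sph_surj: assumes "norm z = 1" "cc z \<noteq> 0" shows "z = sph (ang z, ht z)" "\<bar>ht z\<bar> < 1"
proof -
  have e: "1 = (cmod (cc z))\<^sup>2 + (ht z)\<^sup>2" using norm_coords[of z] assms(1) by simp
  have "cmod (cc z) > 0" using assms(2) by simp
  then have "(ht z)\<^sup>2 < 1" using e by (smt (verit) zero_less_power2)
  then show "\<bar>ht z\<bar> < 1" by (simp add: abs_square_less_1)
  have c: "cmod (cc z) = sqrt (1 - (ht z)\<^sup>2)" using e by (smt (verit) norm_ge_zero real_sqrt_unique)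
  have "cc (sph (ang z, ht z)) = cc z" unfolding sph_cc c[symmetric] by (rule ang_polar[symmetric])
  then show "z = sph (ang z, ht z)" by (intro coords_eqI) (simp_all add: sph_ht)
qed

lemma sph_cont: "continuous_on A sph"
proof -
  have "continuous_on A (\<lambda>p. pt (of_real (sqrt (1 - (snd p)\<^sup>2) / cmod (cc x)) * cc x * exp (\<i> * of_real (fst p))) (snd p))"
    using cx by (intro continuous_intros) auto
  then show ?thesis by (simp add: sph_def case_prod_unfold)
qed

lemma sector_image_connected:
  assumes "convex I" shows "path_connected (sph ` (I \<times> {- 1<..<1}))"
  by (intro path_connected_continuous_image sph_cont convex_imp_path_connected convex_Times assms) auto

lemma card_all: "card {i \<in> {..<m}. P i} = m ==> i < m ==> P i"
  using card_subset_eq[of "{..<m}" "{i \<in> {..<m}. P i}"] by auto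

text \<open>A sector is the image of a rectangle: longitudes with a given count form an interval. For the sector of the base point the interval contains negative longitudes.\<close>
lemma sector_connected: assumes j: "j < m" shows "path_connected {z \<in> side 1 \<inter> side (- 1). sector z = j}"
proof (cases "j = 0")
  case False
  define I where "I = {\<phi>. 0 \<le> \<phi> \<and> \<phi> < 2 * pi \<and> (\<forall>i<m. \<phi> \<noteq> \<theta> i) \<and> card {i \<in> {..<m}. \<theta> i < \<phi>} = j}"
  have "is_interval I" unfolding is_interval_1
  proof (intro ballI allI impI)
    fix a b c assume a: "a \<in> I" and b: "b \<in> I" and c: "a \<le> c \<and> c \<le> b"
    have ab: "{i \<in> {..<m}. \<theta> i < a} = {i \<in> {..<m}. \<theta> i < b}"
      by (rule card_subset_eq) (use a b c in \<open>auto simp: I_def\<close>)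
    have "{i \<in> {..<m}. \<theta> i < a} \<subseteq> {i \<in> {..<m}. \<theta> i < c}" "{i \<in> {..<m}. \<theta> i < c} \<subseteq> {i \<in> {..<m}. \<theta> i < b}" using c by auto
    then have "{i \<in> {..<m}. \<theta> i < c} = {i \<in> {..<m}. \<theta> i < a}" using ab by blast
    moreover have "c \<noteq> \<theta> i" if "i < m" for i
    proof
      assume e: "c = \<theta> i"
      then have "\<theta> i < b" using b c that unfolding I_def by force
      then have "\<theta> i < a" using ab that by blast
      then show False using e c by simp
    qed
    ultimately show "c \<in> I" using a b c unfolding I_def by auto
  qed
  then have "convex I" by (simp add: is_interval_convex)
  moreover have "{z \<in> side 1 \<inter> side (- 1). sector z = j} = sph ` (I \<times> {- 1<..<1})"
  proof (intro equalityI subsetI)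
    fix z assume "z \<in> {z \<in> side 1 \<inter> side (- 1). sector z = j}"
    then have z: "norm z = 1" "cc z \<noteq> 0" "\<forall>i<m. ang z \<noteq> \<theta> i" "sector z = j" using sides_inter by blast+
    have "card {i \<in> {..<m}. \<theta> i < ang z} \<le> m" using card_mono[of "{..<m}" "{i \<in> {..<m}. \<theta> i < ang z}"] by auto
    moreover have "card {i \<in> {..<m}. \<theta> i < ang z} \<noteq> m" using z(4) False unfolding sector_def by auto
    ultimately have "card {i \<in> {..<m}. \<theta> i < ang z} = j" using z(4) unfolding sector_def by simp
    then have "ang z \<in> I" using z ang_bounds unfolding I_def by auto
    then show "z \<in> sph ` (I \<times> {- 1<..<1})" using sph_surj[OF z(1,2)] by (intro image_eqI[of _ _ "(ang z, ht z)"]) auto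
  next
    fix z assume "z \<in> sph ` (I \<times> {- 1<..<1})"
    then obtain y where y: "y \<in> I \<times> {- 1<..<1}" "z = sph y" by blast
    obtain \<phi> t where "y = (\<phi>, t)" by (cases y)
    then have p: "\<phi> \<in> I" "\<bar>t\<bar> < 1" "z = sph (\<phi>, t)" using y by auto
    have "ang z = \<phi>" using sph_ang[OF p(2)] p unfolding I_def by auto
    then show "z \<in> {z \<in> side 1 \<inter> side (- 1). sector z = j}"
      using p sph_norm[OF p(2), of \<phi>] sides_inter[of z] j unfolding I_def sector_def by auto
  qed
  ultimately show ?thesis using sector_image_connected by simp
next
  case True
  define I where "I = (\<Inter>i\<in>{..<m}. {\<theta> i - 2 * pi<..<\<theta> i})"
  have "convex I" unfolding I_def by (intro convex_INT) auto
  moreover have "{z \<in> side 1 \<inter> side (- 1). sector z = j} = sph ` (I \<times> {- 1<..<1})"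
  proof (intro equalityI subsetI)
    fix z assume "z \<in> {z \<in> side 1 \<inter> side (- 1). sector z = j}"
    then have z: "norm z = 1" "cc z \<noteq> 0" "\<forall>i<m. ang z \<noteq> \<theta> i" "sector z = 0" using sides_inter True by blast+
    have "card {i \<in> {..<m}. \<theta> i < ang z} \<le> m" using card_mono[of "{..<m}" "{i \<in> {..<m}. \<theta> i < ang z}"] by auto
    then have "card {i \<in> {..<m}. \<theta> i < ang z} = 0 \<or> card {i \<in> {..<m}. \<theta> i < ang z} = m"
      using z(4) unfolding sector_def by (metis mod_less le_neq_implies_less)
    then show "z \<in> sph ` (I \<times> {- 1<..<1})"
    proof
      assume "card {i \<in> {..<m}. \<theta> i < ang z} = 0"
      then have "{i \<in> {..<m}. \<theta> i < ang z} = {}" by simp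
      then have "ang z < \<theta> i" if "i < m" for i using z(3) that by force
      moreover have "\<theta> i - 2 * pi < ang z" for i using ang_bounds(2)[of "v i"] ang_bounds(1)[of z] by simp
      ultimately have "ang z \<in> I" unfolding I_def by auto
      then show ?thesis using sph_surj[OF z(1,2)] by (intro image_eqI[of _ _ "(ang z, ht z)"]) auto
    next
      assume "card {i \<in> {..<m}. \<theta> i < ang z} = m"
      from card_all[OF this] have "\<theta> i < ang z" if "i < m" for i using that .
      moreover have "ang z - 2 * pi < \<theta> i" for i using ang_bounds(1)[of "v i"] ang_bounds(2)[of z] by simp
      ultimately have "ang z - 2 * pi \<in> I" unfolding I_def by auto
      then show ?thesis using sph_surj[OF z(1,2)] sph_period[of "ang z - 2 * pi" "ht z"] by (intro image_eqI[of _ _ "(ang z - 2 * pi, ht z)"]) auto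
    qed
  next
    fix z assume "z \<in> sph ` (I \<times> {- 1<..<1})"
    then obtain y where y: "y \<in> I \<times> {- 1<..<1}" "z = sph y" by blast
    obtain \<phi> t where "y = (\<phi>, t)" by (cases y)
    then have p: "\<phi> \<in> I" "\<bar>t\<bar> < 1" "z = sph (\<phi>, t)" using y by auto
    have \<phi>: "\<theta> i - 2 * pi < \<phi>" "\<phi> < \<theta> i" if "i < m" for i using p(1) that unfolding I_def by auto
    have "(\<forall>i<m. ang z \<noteq> \<theta> i) \<and> sector z = 0"
    proof (cases "\<phi> \<ge> 0")
      case True
      have a: "ang z = \<phi>" using sph_ang[OF p(2) True] \<phi>(2)[OF m] ang_bounds(2)[of "v 0"] p(3) by simp
      have e: "{i \<in> {..<m}. \<theta> i < \<phi>} = {}" using \<phi>(2) by force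
      have "\<phi> \<noteq> \<theta> i" if "i < m" for i using \<phi>(2)[OF that] by simp
      moreover have "sector z = 0" unfolding sector_def a e by simp
      ultimately show ?thesis using a by simp
    next
      case False
      have "ang z = \<phi> + 2 * pi" using sph_ang[OF p(2), of "\<phi> + 2 * pi"] \<phi>(1)[OF m] \<theta>_pos[OF m] p(3) False by (simp add: sph_period)
      moreover have e: "{i \<in> {..<m}. \<theta> i < \<phi> + 2 * pi} = {..<m}" using \<phi>(1) by force
      moreover have "\<phi> + 2 * pi \<noteq> \<theta> i" if "i < m" for i using \<phi>(1)[OF that] by simp
      ultimately show ?thesis unfolding sector_def by (simp only: e) simp
    qed
    then show "z \<in> {z \<in> side 1 \<inter> side (- 1). sector z = j}"
      using p(3) sph_norm[OF p(2), of \<phi>] sides_inter[of z] True by auto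
  qed
  ultimately show ?thesis using sector_image_connected by simp
qed

section \<open>Small loops around the punctures\<close>

definition rank :: "nat \<Rightarrow> nat" where "rank i = card {j \<in> {..<m}. \<theta> j < \<theta> i}"

lemma rank_less: assumes "i < m" shows "rank i < m"
proof -
  have "{j \<in> {..<m}. \<theta> j < \<theta> i} \<subset> {..<m}" using assms by auto
  from psubset_card_mono[OF _ this] show ?thesis by (simp add: rank_def)
qed

lemma rank_inj: "inj_on rank {..<m}"
proof (rule inj_onI)
  have lt: "rank i < rank j" if "i < m" "j < m" "\<theta> i < \<theta> j" for i j
    unfolding rank_def by (rule psubset_card_mono) (use that in auto)
  fix i j assume "i \<in> {..<m}" "j \<in> {..<m}" "rank i = rank j"
  then show "i = j" using lt[of i j] lt[of j i] \<theta>_inj[of i j] by force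
qed

lemma rank_surj: assumes "k < m" obtains i where "i < m" "rank i = k"
proof -
  have "rank ` {..<m} = {..<m}" by (rule endo_inj_surj[OF _ _ rank_inj]) (use rank_less in auto)
  then show ?thesis using assms that by (metis imageE lessThan_iff)
qed

text \<open>Near \<open>v i\<close>, the longitude compares with those of the other punctures in the same way as the longitude of \<open>v i\<close> does.\<close>
definition near :: "nat \<Rightarrow> real^3 \<Rightarrow> bool" where
  "near i w \<longleftrightarrow> cc w \<noteq> 0 \<and> \<bar>ang w - \<theta> i\<bar> < pi \<and> (\<forall>j<m. j \<noteq> i --> ang w \<noteq> \<theta> j \<and> (\<theta> j < ang w \<longleftrightarrow> \<theta> j < \<theta> i))"

lemma near_eventually: assumes i: "i < m" obtains \<epsilon> where "\<epsilon> > 0" "\<And>w. dist w (v i) < \<epsilon> ==> near i w"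
proof -
  have nz: "cc (v i) \<noteq> 0" using cc_F[OF vF[OF i]] .
  have lim: "(ang \<longlongrightarrow> \<theta> i) (nhds (v i))" using ang_isCont[OF nz] \<theta>_pos[OF i] by (simp add: tendsto_nhds_iff isCont_def)
  have "eventually (\<lambda>w. ang w \<noteq> \<theta> j \<and> (\<theta> j < ang w \<longleftrightarrow> \<theta> j < \<theta> i)) (nhds (v i))" if "j < m" "j \<noteq> i" for j
  proof (cases "\<theta> j < \<theta> i")
    case True
    from order_tendstoD(1)[OF lim this] show ?thesis by eventually_elim (use True in auto)
  next
    case False
    then have "\<theta> i < \<theta> j" using \<theta>_inj[OF that(1) i] that(2) by force
    from order_tendstoD(2)[OF lim this] show ?thesis by eventually_elim (use False in auto)
  qed
  then have e1: "eventually (\<lambda>w. \<forall>j\<in>{..<m} - {i}. ang w \<noteq> \<theta> j \<and> (\<theta> j < ang w \<longleftrightarrow> \<theta> j < \<theta> i)) (nhds (v i))"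
    by (intro eventually_ball_finite) auto
  have e2: "eventually (\<lambda>w. \<bar>ang w - \<theta> i\<bar> < pi) (nhds (v i))"
    using tendstoD[OF lim pi_gt_zero] by (simp add: dist_real_def)
  have "((\<lambda>w. cc w / cc x) \<longlongrightarrow> cc (v i) / cc x) (nhds (v i))" using cc_isCont[of "v i"] by (simp add: tendsto_nhds_iff isCont_def)
  from tendsto_imp_eventually_ne[OF this, of 0] have e3: "eventually (\<lambda>w. cc w / cc x \<noteq> 0) (nhds (v i))" using nz cx by simp
  have "eventually (near i) (nhds (v i))" using e1 e2 e3 by eventually_elim (auto simp: near_def)
  then show ?thesis using that unfolding eventually_nhds_metric by blast
qed

text \<open>The imaginary part is a positive multiple of the sine of the difference of longitudes.\<close>
lemma near_side: assumes n: "near i z" and i: "i < m"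
  shows "Im (cc z * cnj (cc (v i))) > 0 ==> \<theta> i < ang z" "Im (cc z * cnj (cc (v i))) < 0 ==> ang z < \<theta> i"
proof -
  have nz: "cc (v i) \<noteq> 0" "cc z \<noteq> 0" using cc_F[OF vF[OF i]] n unfolding near_def by auto
  define r where "r = cmod (cc z) * cmod (cc (v i))"
  have r: "r > 0" using nz by (simp add: r_def)
  have xx: "cc x * cnj (cc x) = of_real ((cmod (cc x))\<^sup>2)" by (simp only: complex_norm_square)
  have "cc z * cnj (cc (v i)) = of_real (cmod (cc z) / cmod (cc x)) * cc x * exp (\<i> * of_real (ang z)) * cnj (of_real (cmod (cc (v i)) / cmod (cc x)) * cc x * exp (\<i> * of_real (\<theta> i)))"
    by (simp only: ang_polar[symmetric])
  also have "\<dots> = of_real (cmod (cc z) / cmod (cc x) * (cmod (cc (v i)) / cmod (cc x))) * (cc x * cnj (cc x)) * (exp (\<i> * of_real (ang z)) * exp (- (\<i> * of_real (\<theta> i))))"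
    by (simp add: exp_cnj mult_ac)
  also have "\<dots> = of_real r * exp (\<i> * of_real (ang z - \<theta> i))"
    unfolding xx using cx by (simp add: r_def power2_eq_square exp_add[symmetric] algebra_simps)
  finally have Im: "Im (cc z * cnj (cc (v i))) = r * sin (ang z - \<theta> i)" by (simp add: Im_exp)
  have b: "\<bar>ang z - \<theta> i\<bar> < pi" using n unfolding near_def by blast
  show "\<theta> i < ang z" if "Im (cc z * cnj (cc (v i))) > 0"
  proof (rule ccontr)
    assume "\<not> \<theta> i < ang z"
    then have "sin (\<theta> i - ang z) \<ge> 0" using b by (intro sin_ge_zero) auto
    then have "sin (ang z - \<theta> i) \<le> 0" using sin_minus[of "ang z - \<theta> i"] by simp
    then show False using that r unfolding Im by (simp add: zero_less_mult_iff)
  qed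
  show "ang z < \<theta> i" if "Im (cc z * cnj (cc (v i))) < 0"
  proof (rule ccontr)
    assume "\<not> ang z < \<theta> i"
    then have "sin (ang z - \<theta> i) \<ge> 0" using b by (intro sin_ge_zero) auto
    then show False using that r unfolding Im by (simp add: mult_less_0_iff)
  qed
qed

definition east :: "nat \<Rightarrow> real^3" where "east i = pt (\<i> * sgn (cc (v i))) 0"
definition north :: "nat \<Rightarrow> real^3" where "north i = pt (- of_real (ht (v i)) * sgn (cc (v i))) (cmod (cc (v i)))"

text \<open>The circle of angular radius \<open>\<eta>\<close> about the puncture, starting in the east; for \<open>\<psi>\<close> between \<open>0\<close> and \<open>pi\<close> it runs through the north.\<close>
definition circ :: "nat \<Rightarrow> real \<Rightarrow> real \<Rightarrow> real^3" where
  "circ i \<eta> \<psi> = cos \<eta> *\<^sub>R v i + sin \<eta> *\<^sub>R (cos \<psi> *\<^sub>R east i + sin \<psi> *\<^sub>R north i)"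

lemma v_sq: "i < m ==> (cmod (cc (v i)))\<^sup>2 + (ht (v i))\<^sup>2 = 1" using norm_coords[of "v i"] vs[of i] by simp

lemma sgn_cnj: fixes c :: complex assumes "c \<noteq> 0" shows "sgn c * cnj c = of_real (cmod c)" "c * cnj (sgn c) = of_real (cmod c)" "sgn c * cnj (sgn c) = 1"
proof -
  have e: "c * cnj c = of_real (cmod c) * of_real (cmod c)" using complex_norm_square[of c] by (simp add: power2_eq_square)
  show "sgn c * cnj c = of_real (cmod c)" "c * cnj (sgn c) = of_real (cmod c)" "sgn c * cnj (sgn c) = 1"
    using assms e by (simp_all add: sgn_eq)
qed

lemma frame_v: assumes i: "i < m"
  shows "norm (east i) = 1" "norm (north i) = 1" "east i \<bullet> north i = 0" "east i \<bullet> v i = 0" "north i \<bullet> v i = 0"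
proof -
  have nz: "cc (v i) \<noteq> 0" using cc_F[OF vF[OF i]] .
  note s = sgn_cnj[OF nz]
  have "east i \<bullet> east i = 1" "north i \<bullet> north i = 1"
    unfolding inner_coords east_def north_def using s v_sq[OF i] by (simp_all add: mult_ac power2_eq_square)
  then show "norm (east i) = 1" "norm (north i) = 1" by (simp_all add: norm_eq_1)
  show "east i \<bullet> north i = 0" "east i \<bullet> v i = 0" "north i \<bullet> v i = 0"
    unfolding inner_coords east_def north_def using s by (simp_all add: mult_ac)
qed

lemma circ_norm: assumes i: "i < m" shows "norm (circ i \<eta> \<psi>) = 1" "norm (cos \<psi> *\<^sub>R east i + sin \<psi> *\<^sub>R north i) = 1"
  "(cos \<psi> *\<^sub>R east i + sin \<psi> *\<^sub>R north i) \<bullet> v i = 0"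
proof -
  note f = frame_v[OF i]
  have f': "east i \<bullet> east i = 1" "north i \<bullet> north i = 1" "v i \<bullet> v i = 1" using f vs[OF i] by (simp_all add: norm_eq_1)
  define y where "y = cos \<psi> *\<^sub>R east i + sin \<psi> *\<^sub>R north i"
  have yy: "y \<bullet> y = 1" unfolding y_def using f f' sin_cos_squared_add3[of \<psi>] by (simp add: inner_add_left inner_add_right inner_commute[of "north i" "east i"])
  have yv: "y \<bullet> v i = 0" unfolding y_def using f by (simp add: inner_add_left)
  then have "v i \<bullet> y = 0" by (simp add: inner_commute)
  then have "circ i \<eta> \<psi> \<bullet> circ i \<eta> \<psi> = 1" unfolding circ_def y_def[symmetric] using yy yv f' sin_cos_squared_add3[of \<eta>] by (simp add: inner_add_left inner_add_right)
  then show "norm (circ i \<eta> \<psi>) = 1" by (simp add: norm_eq_1)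
  show "norm (cos \<psi> *\<^sub>R east i + sin \<psi> *\<^sub>R north i) = 1" "(cos \<psi> *\<^sub>R east i + sin \<psi> *\<^sub>R north i) \<bullet> v i = 0"
    using yy yv unfolding y_def by (simp_all add: norm_eq_1)
qed

lemma circ_inner: "i < m ==> circ i \<eta> \<psi> \<bullet> v i = cos \<eta>"
  using circ_norm(3)[of i \<psi>] vs[of i] unfolding circ_def inner_add_left[of "cos \<eta> *\<^sub>R v i"] by (simp add: norm_eq_1)

lemma circ_dist: assumes "i < m" shows "dist (circ i \<eta> \<psi>) (v i) \<le> \<bar>cos \<eta> - 1\<bar> + \<bar>sin \<eta>\<bar>"
proof -
  have "circ i \<eta> \<psi> - v i = (cos \<eta> - 1) *\<^sub>R v i + sin \<eta> *\<^sub>R (cos \<psi> *\<^sub>R east i + sin \<psi> *\<^sub>R north i)"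
    unfolding circ_def by (simp add: algebra_simps)
  then show ?thesis using norm_triangle_ineq[of "(cos \<eta> - 1) *\<^sub>R v i"] circ_norm(2)[OF assms, of \<psi>] vs[OF assms] unfolding dist_norm by (metis mult.right_neutral norm_scaleR)
qed

lemma circ_cc: assumes i: "i < m"
  shows "cc (circ i \<eta> \<psi>) * cnj (cc (v i)) =
     of_real (cmod (cc (v i))) * Complex (cos \<eta> * cmod (cc (v i)) - sin \<eta> * sin \<psi> * ht (v i)) (sin \<eta> * cos \<psi>)"
    "ht (circ i \<eta> \<psi>) = cos \<eta> * ht (v i) + sin \<eta> * sin \<psi> * cmod (cc (v i))"
proof -
  have nz: "cc (v i) \<noteq> 0" using cc_F[OF vF[OF i]] .
  have e: "cc (v i) = of_real (cmod (cc (v i))) * sgn (cc (v i))" using nz by (simp add: sgn_eq)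
  define C where "C = Complex (cos \<eta> * cmod (cc (v i)) - sin \<eta> * sin \<psi> * ht (v i)) (sin \<eta> * cos \<psi>)"
  have "cc (circ i \<eta> \<psi>) = sgn (cc (v i)) * C"
    unfolding C_def circ_def east_def north_def Complex_eq by (simp, subst (1) e) (simp add: algebra_simps)
  then have "cc (circ i \<eta> \<psi>) * cnj (cc (v i)) = (sgn (cc (v i)) * cnj (cc (v i))) * C" by (simp only: mult_ac)
  then show "cc (circ i \<eta> \<psi>) * cnj (cc (v i)) =
     of_real (cmod (cc (v i))) * Complex (cos \<eta> * cmod (cc (v i)) - sin \<eta> * sin \<psi> * ht (v i)) (sin \<eta> * cos \<psi>)"
    unfolding sgn_cnj(1)[OF nz] C_def .
  show "ht (circ i \<eta> \<psi>) = cos \<eta> * ht (v i) + sin \<eta> * sin \<psi> * cmod (cc (v i))"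
    unfolding circ_def east_def north_def by simp
qed

text \<open>The circle meets the meridian of its centre only in its northernmost and southernmost points, which are above and below the puncture.\<close>
lemma circ_side:
  assumes i: "i < m" and n: "near i (circ i \<eta> \<psi>)" and \<eta>: "0 < sin \<eta>" and \<sigma>: "\<sigma> = 1 \<or> \<sigma> = - 1" "\<sigma> * sin \<psi> \<ge> 0"
  shows "circ i \<eta> \<psi> \<in> side \<sigma>"
proof -
  define z where "z = circ i \<eta> \<psi>"
  define \<rho> where "\<rho> = cmod (cc (v i))"
  define t where "t = ht (v i)"
  have nz: "cc (v i) \<noteq> 0" using cc_F[OF vF[OF i]] .
  then have \<rho>: "\<rho> > 0" by (simp add: \<rho>_def)
  have nj: "\<not> ray z (v j)" if "j < m" "j \<noteq> i" for j
    using n ray_ang[OF _ cc_F[OF vF[OF that(1)]], of z] that unfolding near_def z_def by auto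
  have "\<not> cut \<sigma> i z"
  proof
    assume c: "cut \<sigma> i z"
    note C = circ_cc[OF i, of \<eta> \<psi>, folded z_def \<rho>_def t_def]
    have "Im (cc z * cnj (cc (v i))) = 0" using c unfolding cut_def ray_def by blast
    then have "\<rho> * (sin \<eta> * cos \<psi>) = 0" unfolding C(1) by simp
    then have "cos \<psi> = 0" using \<rho> \<eta> by simp
    then have "\<bar>sin \<psi>\<bar> = 1" using sin_cos_squared_add3[of \<psi>] by (simp add: abs_square_eq_1 power2_eq_square[symmetric])
    then have s: "sin \<psi> = \<sigma>" using \<sigma> by auto
    have cz: "cc z * cnj (cc (v i)) = of_real (\<rho> * (cos \<eta> * \<rho> - sin \<eta> * \<sigma> * t))" unfolding C(1) s \<open>cos \<psi> = 0\<close> by (simp add: complex_eq_iff)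
    have "Re (cc z * cnj (cc (v i))) \<ge> 0" using c unfolding cut_def ray_def by blast
    then have pos: "\<rho> * (cos \<eta> * \<rho> - sin \<eta> * \<sigma> * t) \<ge> 0" unfolding cz by simp
    have "cmod (cc z) * \<rho> = \<bar>\<rho> * (cos \<eta> * \<rho> - sin \<eta> * \<sigma> * t)\<bar>" using arg_cong[OF cz, of cmod] unfolding \<rho>_def norm_mult complex_mod_cnj norm_of_real by simp
    then have "cmod (cc z) = cos \<eta> * \<rho> - sin \<eta> * \<sigma> * t" using pos \<rho> by simp
    then have "\<sigma> * (cos \<eta> * t + sin \<eta> * \<sigma> * \<rho>) * \<rho> \<le> \<sigma> * t * (cos \<eta> * \<rho> - sin \<eta> * \<sigma> * t)" using c C(2) s unfolding cut_def \<rho>_def t_def by simp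
    then have "\<sigma> * \<sigma> * (sin \<eta> * (\<rho>\<^sup>2 + t\<^sup>2)) \<le> 0" by (simp add: algebra_simps power2_eq_square)
    moreover have "\<rho>\<^sup>2 + t\<^sup>2 = 1" using v_sq[OF i] unfolding \<rho>_def t_def .
    ultimately show False using \<sigma>(1) \<eta> by auto
  qed
  then have "\<not> cut \<sigma> j z" if "j < m" for j using nj that unfolding cut_def by (cases "j = i") auto
  then show ?thesis using circ_norm(1)[OF i] unfolding side_def cone_def z_def by simp
qed

text \<open>East of the meridian of \<open>v i\<close> the puncture itself is counted, west of it it is not.\<close>
lemma circ_sector: assumes i: "i < m" and n: "near i (circ i \<eta> \<psi>)" and \<eta>: "0 < sin \<eta>"
  shows "cos \<psi> > 0 ==> sector (circ i \<eta> \<psi>) = Suc (rank i) mod m \<and> circ i \<eta> \<psi> \<in> side 1 \<inter> side (- 1)"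
    "cos \<psi> < 0 ==> sector (circ i \<eta> \<psi>) = rank i \<and> circ i \<eta> \<psi> \<in> side 1 \<inter> side (- 1)"
proof -
  define z where "z = circ i \<eta> \<psi>"
  note n = n[folded z_def]
  have \<rho>: "cmod (cc (v i)) > 0" using cc_F[OF vF[OF i]] by simp
  have Im: "Im (cc z * cnj (cc (v i))) = cmod (cc (v i)) * (sin \<eta> * cos \<psi>)" unfolding z_def circ_cc(1)[OF i] by simp
  have nj: "\<theta> j < ang z \<longleftrightarrow> \<theta> j < \<theta> i" "ang z \<noteq> \<theta> j" if "j < m" "j \<noteq> i" for j using n that unfolding near_def by auto
  have S: "z \<in> side 1 \<inter> side (- 1)" if "ang z \<noteq> \<theta> i"
  proof -
    have "\<forall>j<m. ang z \<noteq> \<theta> j" using nj(2) that by metis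
    then show ?thesis using sides_inter[of z] circ_norm(1)[OF i, of \<eta> \<psi>] n unfolding z_def near_def by blast
  qed
  show "sector (circ i \<eta> \<psi>) = Suc (rank i) mod m \<and> circ i \<eta> \<psi> \<in> side 1 \<inter> side (- 1)" if "cos \<psi> > 0"
  proof -
    have "0 < Im (cc z * cnj (cc (v i)))" unfolding Im using \<rho> \<eta> that by simp
    from near_side(1)[OF n i this] have gt: "\<theta> i < ang z" .
    have "{j \<in> {..<m}. \<theta> j < ang z} = insert i {j \<in> {..<m}. \<theta> j < \<theta> i}" using gt nj(1) i by auto
    then show ?thesis using S gt unfolding z_def[symmetric] sector_def rank_def by simp
  qed
  show "sector (circ i \<eta> \<psi>) = rank i \<and> circ i \<eta> \<psi> \<in> side 1 \<inter> side (- 1)" if "cos \<psi> < 0"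
  proof -
    have "Im (cc z * cnj (cc (v i))) < 0" unfolding Im using \<rho> \<eta> that by (simp add: mult_less_0_iff)
    from near_side(2)[OF n i this] have lt: "ang z < \<theta> i" .
    have "{j \<in> {..<m}. \<theta> j < ang z} = {j \<in> {..<m}. \<theta> j < \<theta> i}" using lt nj(1) by fastforce
    then show ?thesis using S lt rank_less[OF i] unfolding z_def[symmetric] sector_def rank_def by simp
  qed
qed

lemma circ_radius: assumes i: "i < m"
  obtains \<eta> where "0 < \<eta>" "\<eta> < pi" "\<And>j. j < m ==> j \<noteq> i ==> v j \<bullet> v i < cos \<eta>" "\<And>\<psi>. near i (circ i \<eta> \<psi>)"
proof -
  obtain \<epsilon> where \<epsilon>: "\<epsilon> > 0" "\<And>w. dist w (v i) < \<epsilon> ==> near i w" using near_eventually[OF i] by blast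
  have "((\<lambda>\<eta>. \<bar>cos \<eta> - 1\<bar> + \<bar>sin \<eta>\<bar>) \<longlongrightarrow> \<bar>cos 0 - 1\<bar> + \<bar>sin 0\<bar>) (at_right (0::real))" by (intro tendsto_intros)
  from order_tendstoD(2)[OF this, of \<epsilon>] have e1: "eventually (\<lambda>\<eta>. \<bar>cos \<eta> - 1\<bar> + \<bar>sin \<eta>\<bar> < \<epsilon>) (at_right 0)" using \<epsilon>(1) by simp
  have c: "((\<lambda>\<eta>. cos \<eta>) \<longlongrightarrow> cos 0) (at_right (0::real))" by (intro tendsto_intros)
  have "eventually (\<lambda>\<eta>. v j \<bullet> v i < cos \<eta>) (at_right 0)" if "j < m" "j \<noteq> i" for j
  proof -
    have "v j \<noteq> v i" using inj that i unfolding inj_on_def by auto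
    moreover have "(norm (v j - v i))\<^sup>2 = 2 - 2 * (v j \<bullet> v i)"
      using vs[OF that(1)] vs[OF i] by (simp add: power2_norm_eq_inner inner_diff_left inner_diff_right inner_commute[of "v i" "v j"] norm_eq_1)
    ultimately have "v j \<bullet> v i \<noteq> 1" by auto
    moreover have "v j \<bullet> v i \<le> 1" using norm_cauchy_schwarz[of "v j" "v i"] vs[OF that(1)] vs[OF i] by simp
    ultimately show ?thesis using order_tendstoD(1)[OF c, of "v j \<bullet> v i"] by simp
  qed
  then have e2: "eventually (\<lambda>\<eta>. \<forall>j\<in>{..<m} - {i}. v j \<bullet> v i < cos \<eta>) (at_right 0)" by (intro eventually_ball_finite) auto
  have e3: "eventually (\<lambda>\<eta>. \<eta> \<in> {0<..<pi}) (at_right (0::real))" by (rule eventually_at_right_real) simp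
  have "eventually (\<lambda>\<eta>. (\<bar>cos \<eta> - 1\<bar> + \<bar>sin \<eta>\<bar> < \<epsilon>) \<and> (\<forall>j\<in>{..<m} - {i}. v j \<bullet> v i < cos \<eta>) \<and> \<eta> \<in> {0<..<pi}) (at_right (0::real))"
    using e1 e2 e3 by eventually_elim blast
  from eventually_happens[OF this] obtain \<eta> where \<eta>: "\<bar>cos \<eta> - 1\<bar> + \<bar>sin \<eta>\<bar> < \<epsilon>" "\<forall>j\<in>{..<m} - {i}. v j \<bullet> v i < cos \<eta>" "\<eta> \<in> {0<..<pi}" by auto
  show ?thesis
  proof (rule that[of \<eta>])
    show "near i (circ i \<eta> \<psi>)" for \<psi> by (rule \<epsilon>(2)) (use circ_dist[OF i, of \<eta> \<psi>] \<eta>(1) in simp)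
  qed (use \<eta> in auto)
qed

end

section \<open>The peripheral classes\<close>

lemma homotopic_loops_reverse:
  assumes "homotopic_loops S p r" shows "homotopic_loops S (reversepath p) (reversepath r)"
proof -
  define C where "C = (\<lambda>f g h. continuous_on ({0..1::real} \<times> {0..1::real}) h \<and> h \<in> ({0..1} \<times> {0..1}) \<rightarrow> S \<and>
    (\<forall>t\<in>{0..1}. h (0, t) = f t) \<and> (\<forall>t\<in>{0..1}. h (1, t) = g t) \<and>
    (\<forall>t\<in>{0..1}. pathfinish (h \<circ> Pair t) = pathstart (h \<circ> Pair t)))"
  have iff: "homotopic_loops S f g \<longleftrightarrow> (\<exists>h. C f g h)" for f g unfolding homotopic_loops C_def ..
  obtain h where h: "C p r h" using assms unfolding iff by (elim exE)
  have "C (reversepath p) (reversepath r) (\<lambda>z. h (fst z, 1 - snd z))"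
    unfolding C_def
  proof (intro conjI ballI)
    show "continuous_on ({0..1} \<times> {0..1}) (\<lambda>z. h (fst z, 1 - snd z))"
      by (rule continuous_on_compose2[of "{0..1} \<times> {0..1}" h]) (use h in \<open>auto simp: C_def intro!: continuous_intros\<close>)
    show "(\<lambda>z. h (fst z, 1 - snd z)) \<in> ({0..1} \<times> {0..1}) \<rightarrow> S" using h unfolding C_def by (auto simp: Pi_iff)
    fix t :: real assume t: "t \<in> {0..1}"
    show "h (fst (0, t), 1 - snd (0, t)) = reversepath p t" "h (fst (1, t), 1 - snd (1, t)) = reversepath r t"
      using h t unfolding C_def reversepath_def by auto
    show "pathfinish ((\<lambda>z. h (fst z, 1 - snd z)) \<circ> Pair t) = pathstart ((\<lambda>z. h (fst z, 1 - snd z)) \<circ> Pair t)"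
      using h t unfolding C_def pathstart_def pathfinish_def by auto
  qed
  then show ?thesis unfolding iff by (rule exI[of "C (reversepath p) (reversepath r)"])
qed

context sphere_frame
begin

abbreviation S where "S \<equiv> punctured_sphere m v"

lemma S_sphere: "S \<subseteq> sphere 0 1" by (auto simp: punctured_sphere_def)

lemma side_S: "side 1 \<subseteq> S" "side (- 1) \<subseteq> S" using sides_union by auto

lemma sector_witness: assumes "j < m" shows "\<exists>z. z \<in> side 1 \<inter> side (- 1) \<and> sector z = j"
proof -
  obtain i where i: "i < m" "rank i = j" using rank_surj[OF assms] by blast
  obtain \<eta> where \<eta>: "0 < \<eta>" "\<eta> < pi" "\<And>\<psi>. near i (circ i \<eta> \<psi>)" using circ_radius[OF i(1)] by metis
  show ?thesis using circ_sector(2)[OF i(1) \<eta>(3), of pi] sin_gt_zero[OF \<eta>(1,2)] i(2) by auto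
qed

sublocale cov: uv_cover S "side 1" "side (- 1)" x sector m
proof
  show "S = side 1 \<union> side (- 1)" by (rule sides_union)
  show "openin (top_of_set S) (side 1)" "openin (top_of_set S) (side (- 1))"
    using openin_subset_trans[OF side_open _ S_sphere] side_S by auto
  show "simply_connected (side 1)" "simply_connected (side (- 1))" by (simp_all add: side_simply_connected)
  have "x \<in> side 1 \<inter> side (- 1)" using sides_inter[of x] xs cx ang_x \<theta>_pos by force
  then show "x \<in> side 1" "x \<in> side (- 1)" by auto
  have e: "{i \<in> {..<m}. \<theta> i < 0} = {}" using \<theta>_pos by force
  show "sector x = 0" unfolding sector_def ang_x e by simp
  show "sector z < m" for z using m unfolding sector_def by simp
  show "\<exists>W. openin (top_of_set S) W \<and> z \<in> W \<and> (\<forall>z'\<in>W. sector z' = sector z)" if z: "z \<in> side 1 \<inter> side (- 1)" for z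
  proof -
    have "eventually (\<lambda>w. sector w = sector z) (nhds z)" using sector_local sides_inter[of z] z by blast
    then obtain T where T: "open T" "z \<in> T" "\<forall>w\<in>T. sector w = sector z" unfolding eventually_nhds by blast
    show ?thesis
    proof (intro exI conjI)
      show "openin (top_of_set S) (S \<inter> T)" by (rule openin_open_Int[OF T(1)])
      show "z \<in> S \<inter> T" using T(2) side_S(1) z by (intro IntI) (rule subsetD, assumption, rule IntD1)
      show "\<forall>z'\<in>S \<inter> T. sector z' = sector z" using T(3) by (intro ballI) (erule bspec, rule IntD2)
    qed
  qed
  show "path_connected {z \<in> side 1 \<inter> side (- 1). sector z = j}" if "j < m" for j by (rule sector_connected[OF that])
  show "\<exists>z. z \<in> side 1 \<inter> side (- 1) \<and> sector z = j" if "j < m" for j by (rule sector_witness[OF that])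
qed

text \<open>The angular radii that are admitted for small loops around \<open>v i\<close>.\<close>
definition cap :: "nat \<Rightarrow> real \<Rightarrow> bool" where
  "cap i \<eta> \<longleftrightarrow> 0 < \<eta> \<and> \<eta> < pi \<and> (\<forall>j<m. j \<noteq> i --> v j \<bullet> v i < cos \<eta>)"

lemma circ_cont:
  fixes A :: "'z::t2_space set"
  shows "continuous_on A f ==> continuous_on A g ==> continuous_on A (\<lambda>t. circ i (f t) (g t))"
  unfolding circ_def by (intro continuous_intros)

lemma circ_period: "circ i \<eta> (\<psi> + 2 * pi) = circ i \<eta> \<psi>" "circ i \<eta> (\<psi> - 2 * pi) = circ i \<eta> \<psi>"
  by (simp_all add: circ_def cos_diff sin_diff)

text \<open>A small circle traversed from the east runs through the northern side to the west and returns through the southern side, so \<open>loop_around\<close> computes its class.\<close>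
lemma canonical_loop:
  assumes i: "i < m"
  obtains \<eta> l where "cap i \<eta>"
    "l \<in> loops_at S x" "homotopic_loops S l (\<lambda>t. circ i \<eta> (2 * pi * t))" "path_class S l = cov.d (rank i)"
proof -
  obtain \<eta> where \<eta>: "0 < \<eta>" "\<eta> < pi" "\<And>j. j < m ==> j \<noteq> i ==> v j \<bullet> v i < cos \<eta>" "\<And>\<psi>. near i (circ i \<eta> \<psi>)"
    using circ_radius[OF i] by metis
  have s: "sin \<eta> > 0" using sin_gt_zero \<eta> by blast
  define p where "p = (\<lambda>t. circ i \<eta> (pi * t))"
  define r where "r = (\<lambda>t. circ i \<eta> (pi * t + pi))"
  define z0 z1 where "z0 = circ i \<eta> 0" and "z1 = circ i \<eta> pi"
  have z0: "sector z0 = Suc (rank i) mod m" "z0 \<in> side 1 \<inter> side (- 1)" using circ_sector(1)[OF i \<eta>(4) s, of 0] unfolding z0_def by auto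
  have z1: "sector z1 = rank i" "z1 \<in> side 1 \<inter> side (- 1)" using circ_sector(2)[OF i \<eta>(4) s, of pi] unfolding z1_def by auto
  have p: "path_from_to (side 1) z0 z1 p"
    unfolding path_from_to_def p_def z0_def z1_def
  proof (intro conjI)
    show "path (\<lambda>t. circ i \<eta> (pi * t))" unfolding path_def by (intro circ_cont continuous_intros)
    show "path_image (\<lambda>t. circ i \<eta> (pi * t)) \<subseteq> side 1" unfolding path_image_def
    proof (rule image_subsetI)
      fix t :: real assume "t \<in> {0..1}"
      then have "0 \<le> pi * t" "pi * t \<le> pi" by (auto simp: mult_left_le)
      from sin_ge_zero[OF this] show "circ i \<eta> (pi * t) \<in> side 1" by (intro circ_side[OF i \<eta>(4) s]) auto
    qed
  qed (simp_all add: pathstart_def pathfinish_def)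
  have r: "path_from_to (side (- 1)) z1 z0 r"
    unfolding path_from_to_def r_def z0_def z1_def
  proof (intro conjI)
    show "path (\<lambda>t. circ i \<eta> (pi * t + pi))" unfolding path_def by (intro circ_cont continuous_intros)
    show "path_image (\<lambda>t. circ i \<eta> (pi * t + pi)) \<subseteq> side (- 1)" unfolding path_image_def
    proof (rule image_subsetI)
      fix t :: real assume "t \<in> {0..1}"
      then have "0 \<le> pi * t" "pi * t \<le> pi" by (auto simp: mult_left_le)
      from sin_ge_zero[OF this] show "circ i \<eta> (pi * t + pi) \<in> side (- 1)" by (intro circ_side[OF i \<eta>(4) s]) auto
    qed
  qed (use circ_period(1)[of i \<eta> 0] in \<open>simp_all add: pathstart_def pathfinish_def\<close>)
  have "p +++ r = (\<lambda>t. circ i \<eta> (2 * pi * t))"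
    by (rule ext) (auto simp: joinpaths_def p_def r_def algebra_simps)
  moreover obtain l where "l \<in> loops_at S x" "homotopic_loops S l (p +++ r)" "path_class S l = pmult S (cov.crossing z1) (pinv S (cov.crossing z0))"
    using cov.loop_around[of z0 z1 p r] z0 z1 p r by blast
  moreover have "cov.crossing z1 = cov.q (rank i)" "cov.crossing z0 = cov.q (Suc (rank i) mod m)"
    using cov.crossing_eq_q z0 z1 by metis+
  moreover have "cap i \<eta>" using \<eta>(1,2,3) unfolding cap_def by blast
  ultimately show ?thesis using that[of \<eta> l] unfolding cov.d_def by simp
qed

text \<open>Two orthonormal frames of the tangent plane differ by a rotation, possibly after a reflection.\<close>
lemma small_loop_form:
  assumes i: "i < m" and sl: "small_loop m v i \<delta>"
  obtains \<kappa> \<alpha> \<epsilon> where "cap i \<kappa>" "\<epsilon> = 1 \<or> \<epsilon> = - 1"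
    "\<delta> = (\<lambda>t. circ i \<kappa> (\<alpha> + \<epsilon> * (2 * pi * t)))"
proof -
  obtain a b \<kappa> where ab: "norm a = 1" "norm b = 1" "a \<bullet> b = 0" "a \<bullet> v i = 0" "b \<bullet> v i = 0"
    and \<kappa>: "0 < \<kappa>" "\<kappa> < pi" "\<forall>j<m. j \<noteq> i --> v j \<bullet> v i < cos \<kappa>"
    and \<delta>: "\<delta> = (\<lambda>t. cos \<kappa> *\<^sub>R v i + sin \<kappa> *\<^sub>R (cos (2 * pi * t) *\<^sub>R a + sin (2 * pi * t) *\<^sub>R b))"
    using sl unfolding small_loop_def by (elim exE conjE) (rule that)
  note f = frame_v[OF i]
  have f': "east i \<bullet> east i = 1" "north i \<bullet> north i = 1" "north i \<bullet> east i = 0" using f by (simp_all add: norm_eq_1 inner_commute)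
  note ex = frame_expand[OF f(1,2) vs[OF i] f(3,4,5)]
  define A B C D where "A = a \<bullet> east i" and "B = a \<bullet> north i" and "C = b \<bullet> east i" and "D = b \<bullet> north i"
  have a: "a = A *\<^sub>R east i + B *\<^sub>R north i" using ex[of a] ab(4) by (simp add: A_def B_def)
  have b: "b = C *\<^sub>R east i + D *\<^sub>R north i" using ex[of b] ab(5) by (simp add: C_def D_def)
  have in1: "(p *\<^sub>R east i + q *\<^sub>R north i) \<bullet> (p' *\<^sub>R east i + q' *\<^sub>R north i) = p * p' + q * q'" for p q p' q'
    using f' f(3) by (simp add: inner_add_left inner_add_right)
  have e: "A * A + B * B = 1" "C * C + D * D = 1" "A * C + B * D = 0"
    using in1[of A B A B] in1[of C D C D] in1[of A B C D] a b ab(1,2,3) by (simp_all add: norm_eq_1)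
  define \<epsilon> where "\<epsilon> = A * D - B * C"
  have "\<epsilon> * \<epsilon> = (A * A + B * B) * (C * C + D * D) - (A * C + B * D) * (A * C + B * D)" unfolding \<epsilon>_def by (simp add: algebra_simps)
  then have "\<epsilon> * \<epsilon> = 1" unfolding e by simp
  then have \<epsilon>: "\<epsilon> = 1 \<or> \<epsilon> = - 1" by (simp add: square_eq_1_iff)
  \<comment> \<open>the second row of an orthogonal matrix with determinant \<open>\<epsilon>\<close> is determined by the first\<close>
  have "- \<epsilon> * B = C * (B * B) - D * (A * B)" unfolding \<epsilon>_def by (simp add: algebra_simps)
  also have "\<dots> = C * (A * A + B * B) - A * (A * C + B * D)" by (simp add: algebra_simps)
  finally have C: "C = - \<epsilon> * B" unfolding e by simp
  have "\<epsilon> * A = D * (A * A + B * B) - B * (A * C + B * D)" unfolding \<epsilon>_def by (simp add: algebra_simps)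
  then have D: "D = \<epsilon> * A" unfolding e by simp
  obtain \<alpha> where \<alpha>: "A = cos \<alpha>" "B = sin \<alpha>" using sincos_total_2pi[of A B] e(1) by (metis power2_eq_square)
  show ?thesis
  proof (rule that[OF _ \<epsilon>])
    show "cap i \<kappa>" unfolding cap_def using \<kappa> by (intro conjI)
    show "\<delta> = (\<lambda>t. circ i \<kappa> (\<alpha> + \<epsilon> * (2 * pi * t)))"
    proof
      fix t
      define u where "u = 2 * pi * t"
      have "cos u *\<^sub>R a + sin u *\<^sub>R b = (cos u * A + sin u * C) *\<^sub>R east i + (cos u * B + sin u * D) *\<^sub>R north i"
        unfolding a b by (simp add: scaleR_add_right scaleR_add_left)
      also have "cos u * A + sin u * C = cos (\<alpha> + \<epsilon> * u)" using \<epsilon> unfolding C \<alpha> by (auto simp: cos_add cos_diff)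
      also have "cos u * B + sin u * D = sin (\<alpha> + \<epsilon> * u)" using \<epsilon> unfolding D \<alpha> by (auto simp: sin_add sin_diff)
      finally show "\<delta> t = circ i \<kappa> (\<alpha> + \<epsilon> * (2 * pi * t))" unfolding \<delta> circ_def u_def by simp
    qed
  qed
qed

lemma circ_S:
  assumes i: "i < m" and cap: "cap i \<eta>" shows "circ i \<eta> \<psi> \<in> S"
proof -
  note \<eta> = cap[unfolded cap_def, THEN conjunct1] cap[unfolded cap_def, THEN conjunct2, THEN conjunct1]
    cap[unfolded cap_def, THEN conjunct2, THEN conjunct2, rule_format]
  have "circ i \<eta> \<psi> \<noteq> v j" if "j < m" for j
  proof
    assume e: "circ i \<eta> \<psi> = v j"
    have c: "v j \<bullet> v i = cos \<eta>" using circ_inner[OF i, of \<eta> \<psi>] unfolding e .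
    show False
    proof (cases "j = i")
      case True
      have "cos \<eta> < cos 0" by (rule cos_monotone_0_pi) (use \<eta> in auto)
      then show False using c True vs[OF i] by (simp add: norm_eq_1)
    qed (use c \<eta>(3)[OF that] in simp)
  qed
  then show ?thesis using circ_norm(1)[OF i] unfolding punctured_sphere_def by auto
qed

text \<open>Change the radius and the starting angle linearly; the intermediate radii are between the two given ones.\<close>
lemma circles_homotopic:
  assumes i: "i < m" and \<kappa>: "cap i \<kappa>" and \<eta>: "cap i \<eta>" and \<epsilon>: "\<epsilon> = 1 \<or> \<epsilon> = - 1"
  shows "homotopic_loops S (\<lambda>t. circ i \<kappa> (\<alpha> + \<epsilon> * (2 * pi * t))) (\<lambda>t. circ i \<eta> (\<epsilon> * (2 * pi * t)))"
proof -
  define h where "h = (\<lambda>z::real \<times> real. circ i ((1 - fst z) * \<kappa> + fst z * \<eta>) ((1 - fst z) * \<alpha> + \<epsilon> * (2 * pi * snd z)))"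
  show ?thesis unfolding homotopic_loops
  proof (intro exI[of _ h] conjI ballI)
    show "continuous_on ({0..1} \<times> {0..1}) h" unfolding h_def by (intro circ_cont continuous_intros)
    show "h \<in> {0..1} \<times> {0..1} \<rightarrow> S"
    proof
      fix z :: "real \<times> real" assume "z \<in> {0..1} \<times> {0..1}"
      then have s: "0 \<le> fst z" "fst z \<le> 1" by auto
      define \<beta> where "\<beta> = (1 - fst z) * \<kappa> + fst z * \<eta>"
      have "(1 - fst z) * min \<kappa> \<eta> + fst z * min \<kappa> \<eta> \<le> \<beta>" "\<beta> \<le> (1 - fst z) * max \<kappa> \<eta> + fst z * max \<kappa> \<eta>"
        unfolding \<beta>_def using s by (intro add_mono mult_left_mono; simp)+
      then have b: "min \<kappa> \<eta> \<le> \<beta>" "\<beta> \<le> max \<kappa> \<eta>" by (simp_all add: algebra_simps)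
      then have pos: "0 < \<beta>" "\<beta> < pi" using \<kappa> \<eta> unfolding cap_def by auto
      have "cos (max \<kappa> \<eta>) \<le> cos \<beta>" by (rule cos_monotone_0_pi_le) (use pos b \<kappa> \<eta> in \<open>auto simp: cap_def\<close>)
      moreover have "v j \<bullet> v i < cos (max \<kappa> \<eta>)" if "j < m" "j \<noteq> i" for j
        using \<kappa> \<eta> that unfolding cap_def max_def by auto
      ultimately have "v j \<bullet> v i < cos \<beta>" if "j < m" "j \<noteq> i" for j using that by (meson order_less_le_trans)
      then have "cap i \<beta>" unfolding cap_def using pos by blast
      then show "h z \<in> S" unfolding h_def \<beta>_def[symmetric] by (rule circ_S[OF i])
    qed
    show "pathfinish (h \<circ> Pair t) = pathstart (h \<circ> Pair t)" for t
      using \<epsilon> circ_period unfolding h_def pathstart_def pathfinish_def by auto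
  qed (simp_all add: h_def)
qed

lemma loops_same_trace:
  assumes \<rho>: "\<rho> \<in> rep_space cov.G" and p: "p \<in> loops_at S x" and l: "l \<in> loops_at S x" and h: "homotopic_loops S p l"
  shows "trace (\<rho> (path_class S p)) = trace (\<rho> (path_class S l))"
proof -
  have pl: "path_from_to S x x p" "path_from_to S x x l" using p l unfolding loops_at_def path_from_to_def by auto
  obtain c where c: "path_from_to S x x c" "homotopic_paths S p (c +++ l +++ reversepath c)"
    using homotopic_loops_imp_conjugate[OF h] pl unfolding path_from_to_def by auto
  note r = path_from_to_reverse[OF c(1)]
  note car = HomI[of S x x, folded fundamental_group_simps(1)]
  have mult: "\<rho> (path_class S (f +++ g)) = \<rho> (path_class S f) ** \<rho> (path_class S g)" if "path_from_to S x x f" "path_from_to S x x g" for f g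
    using rep_spaceD(2)[OF \<rho> car[OF that(1)] car[OF that(2)]] unfolding fundamental_group_simps pmult_class[OF that] .
  have xS: "x \<in> S" using cov.x(1) side_S by auto
  have inv: "path_class S (reversepath c) = inv\<^bsub>cov.G\<^esub> (path_class S c)"
    using fundamental_group_inv[OF xS HomI[OF c(1)]] pinv_class[OF c(1)] by simp
  have "\<rho> (path_class S p) = \<rho> (path_class S c) ** (\<rho> (path_class S l) ** adj (\<rho> (path_class S c)))"
    unfolding path_class_eqI[OF c(2)] mult[OF c(1) path_from_to_join[OF pl(2) r]] mult[OF pl(2) r] inv
      representation_inv[OF cov.grp \<rho> car[OF c(1)]] ..
  then show ?thesis using trace_conj[OF rep_spaceD(1)[OF \<rho> car[OF c(1)]], of "\<rho> (path_class S l)"] by (simp add: matrix_mul_assoc)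
qed

text \<open>Conjugate elements and inverse elements of \<open>SL\<^sub>2\<close> have the same trace.\<close>
lemma peripheral_trace:
  assumes \<rho>: "\<rho> \<in> rep_space cov.G" and i: "i < m" and P: "P \<in> peripheral m v x i"
  shows "trace (\<rho> P) = trace (\<rho> (cov.d (rank i)))"
proof -
  obtain p \<delta> where p: "P = path_class S p" "p \<in> loops_at S x" "small_loop m v i \<delta>" "homotopic_loops S p \<delta>"
    using P unfolding peripheral_def by blast
  obtain \<kappa> \<alpha> \<epsilon> where \<kappa>: "cap i \<kappa>" and \<epsilon>: "\<epsilon> = 1 \<or> \<epsilon> = - 1"
    and \<delta>: "\<delta> = (\<lambda>t. circ i \<kappa> (\<alpha> + \<epsilon> * (2 * pi * t)))" by (rule small_loop_form[OF i p(3)]) (rule that)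
  obtain \<eta> l where \<eta>: "cap i \<eta>"
    and l: "l \<in> loops_at S x" "homotopic_loops S l (\<lambda>t. circ i \<eta> (2 * pi * t))" "path_class S l = cov.d (rank i)" by (rule canonical_loop[OF i]) (rule that)
  have h: "homotopic_loops S p (\<lambda>t. circ i \<eta> (\<epsilon> * (2 * pi * t)))"
    using homotopic_loops_trans[OF p(4)[unfolded \<delta>] circles_homotopic[OF i \<kappa> \<eta> \<epsilon>]] .
  show ?thesis
  proof (cases "\<epsilon> = 1")
    case True
    then have "homotopic_loops S p l" using h homotopic_loops_trans[OF h] homotopic_loops_sym[OF l(2)] by simp
    from loops_same_trace[OF \<rho> p(2) l(1) this] show ?thesis unfolding p(1) l(3) .
  next
    case False
    then have e: "\<epsilon> = - 1" using \<epsilon> by simp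
    have "reversepath (\<lambda>t. circ i \<eta> (2 * pi * t)) = (\<lambda>t. circ i \<eta> (\<epsilon> * (2 * pi * t)))"
    proof
      fix t
      have "circ i \<eta> (2 * pi * (1 - t)) = circ i \<eta> (\<epsilon> * (2 * pi * t) + 2 * pi)" unfolding e by (simp add: algebra_simps)
      then show "reversepath (\<lambda>t. circ i \<eta> (2 * pi * t)) t = circ i \<eta> (\<epsilon> * (2 * pi * t))" unfolding reversepath_def circ_period(1) .
    qed
    then have "homotopic_loops S (reversepath l) (\<lambda>t. circ i \<eta> (\<epsilon> * (2 * pi * t)))" using homotopic_loops_reverse[OF l(2)] by simp
    then have hr: "homotopic_loops S p (reversepath l)" using h homotopic_loops_trans homotopic_loops_sym by blast
    have lf: "path_from_to S x x l" using l(1) unfolding loops_at_def path_from_to_def by auto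
    have rl: "reversepath l \<in> loops_at S x" using path_from_to_reverse[OF lf] unfolding loops_at_def path_from_to_def by auto
    have xS: "x \<in> S" using cov.x(1) side_S by auto
    have "path_class S (reversepath l) = inv\<^bsub>cov.G\<^esub> (path_class S l)"
      using fundamental_group_inv[OF xS HomI[OF lf]] pinv_class[OF lf] by simp
    moreover have "path_class S l \<in> carrier cov.G" using HomI[OF lf] by (simp add: fundamental_group_simps)
    ultimately have "trace (\<rho> (path_class S (reversepath l))) = trace (\<rho> (path_class S l))"
      using representation_inv[OF cov.grp \<rho>] by simp
    then show ?thesis using loops_same_trace[OF \<rho> p(2) rl hr] unfolding p(1) l(3) by simp
  qed
qed

lemma d_peripheral: assumes i: "i < m" shows "cov.d (rank i) \<in> peripheral m v x i"
proof -
  obtain \<eta> l where \<eta>: "cap i \<eta>"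
    and l: "l \<in> loops_at S x" "homotopic_loops S l (\<lambda>t. circ i \<eta> (2 * pi * t))" "path_class S l = cov.d (rank i)" by (rule canonical_loop[OF i]) (rule that)
  have "small_loop m v i (\<lambda>t. circ i \<eta> (2 * pi * t))"
    unfolding small_loop_def by (intro exI[of _ "east i"] exI[of _ "north i"] exI[of _ \<eta>] conjI)
      (use frame_v[OF i] \<eta> in \<open>auto simp: circ_def cap_def\<close>)
  then show ?thesis unfolding peripheral_def using l by blast
qed

end

text \<open>Finitely many planes do not cover space.\<close>
lemma generic_axis:
  fixes F :: "(real^3) set" assumes "finite F"
  obtains N where "norm N = 1" "\<And>p r. p \<in> F ==> r \<in> F ==> N \<notin> span {p, r}"
proof -
  have "negligible (span {p, r})" for p r :: "real^3"
  proof (rule negligible_lowdim)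
    have "dim (span {p, r}) \<le> card {p, r}" using dim_le_card[of "span {p, r}" "{p, r}"] by simp
    also have "\<dots> \<le> 2" by (simp add: card_insert_if)
    finally show "dim (span {p, r}) < DIM(real^3)" by simp
  qed
  then have "negligible (\<Union>((\<lambda>(p, r). span {p, r}) ` (F \<times> F)) \<union> {0})"
    using assms by (intro negligible_Un negligible_Union) auto
  then have "\<Union>((\<lambda>(p, r). span {p, r}) ` (F \<times> F)) \<union> {0} \<noteq> UNIV" using non_negligible_UNIV by metis
  then obtain y where y: "y \<notin> \<Union>((\<lambda>(p, r). span {p, r}) ` (F \<times> F))" "y \<noteq> 0" by blast
  have "(1 / norm y) *\<^sub>R y \<notin> span {p, r}" if "p \<in> F" "r \<in> F" for p r
  proof
    assume "(1 / norm y) *\<^sub>R y \<in> span {p, r}"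
    then have "norm y *\<^sub>R ((1 / norm y) *\<^sub>R y) \<in> span {p, r}" by (rule span_scale)
    then have "y \<in> span {p, r}" using y(2) by simp
    then show False using y(1) that by auto
  qed
  then show ?thesis using that[of "(1 / norm y) *\<^sub>R y"] y(2) by simp
qed

theorem proposition4p5:
  fixes m :: nat and v :: "nat \<Rightarrow> real^3" and x :: "real^3" and w :: "nat \<Rightarrow> complex"
  defines "G \<equiv> fundamental_group (punctured_sphere m v) x"
  assumes punctures: "inj_on v {..<m}" "v ` {..<m} \<subseteq> sphere 0 1"
    and negative_euler: "euler_characteristic 0 m < 0"
    and basepoint: "x \<in> punctured_sphere m v"
    and weights: "\<forall>i<m. w i \<in> UNIV - {2, -2}"
    and point: "\<tau> \<in> sliced_character_variety m v x w"
    and irreducible: "\<exists>\<rho>\<in>rep_space G. irreducible_rep G \<rho> \<and> \<tau> = character G \<rho>"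
  shows "smooth_point (invariant_ring G) (constant_functions (rep_space G))
           (sliced_character_variety m v x w) \<tau>"
proof -
  have m3: "m \<ge> 3" using negative_euler unfolding euler_characteristic_def by simp
  obtain N where N: "norm N = 1" "\<And>p r. p \<in> insert x (v ` {..<m}) ==> r \<in> insert x (v ` {..<m}) ==> N \<notin> span {p, r}"
    using generic_axis[of "insert x (v ` {..<m})"] by auto
  obtain E1 E2 where E: "norm E1 = 1" "norm E2 = 1" "E1 \<bullet> E2 = 0" "E1 \<bullet> N = 0" "E2 \<bullet> N = 0"
    using orthonormal_frame[OF N(1)] by blast
  interpret fr: sphere_frame m v x N E1 E2
  proof
    show "m > 0" using m3 by simp
    show "inj_on v {..<m}" by (rule punctures)
    show "norm (v i) = 1" if "i < m" for i using punctures(2) that by auto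
    show "norm x = 1" using basepoint unfolding punctured_sphere_def by auto
    show "x \<noteq> v i" if "i < m" for i using basepoint that unfolding punctured_sphere_def by auto
  qed (use N E basepoint in \<open>auto simp: punctured_sphere_def\<close>)
  define puncture where "puncture = inv_into {..<m} fr.rank"
  have rank: "puncture k < m" "fr.rank (puncture k) = k" if k: "k < m" for k
  proof -
    have "k \<in> fr.rank ` {..<m}" using fr.rank_surj[OF k] by (metis imageI lessThan_iff)
    then show "puncture k < m" "fr.rank (puncture k) = k" unfolding puncture_def using inv_into_into[of k fr.rank "{..<m}"] f_inv_into_f[of k fr.rank "{..<m}"] by auto
  qed
  have puncture_rank: "puncture (fr.rank i) = i" if "i < m" for i
    unfolding puncture_def by (rule inv_into_f_f[OF fr.rank_inj]) (use that in simp)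
  have grp: "group G" unfolding G_def by (rule fr.cov.grp)
  interpret R: free_reps G "m - 1" fr.cov.d "\<lambda>k. w (puncture k)" "w (puncture (m - 1))"
  proof (rule free_reps.intro)
    show "group G" by (rule grp)
    show "2 \<le> m - 1" using m3 by simp
    show "fr.cov.d k \<in> carrier G" if "k < m - 1" for k unfolding G_def using fr.cov.d_carrier that by simp
    show "carrier G = generate G (fr.cov.d ` {..<m - 1})" unfolding G_def by (rule fr.cov.d_generate)
    show "\<exists>\<rho>\<in>rep_space G. \<forall>k<m - 1. \<rho> (fr.cov.d k) = A k" if "\<And>k. k < m - 1 ==> det (A k) = 1" for A
      unfolding G_def by (rule fr.cov.d_free[OF that])
    show "w (puncture k) \<noteq> 2 \<and> w (puncture k) \<noteq> - 2" if "k < m - 1" for k using weights rank(1)[of k] that by auto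
    show "w (puncture (m - 1)) \<noteq> 2" "w (puncture (m - 1)) \<noteq> - 2" using weights rank(1)[of "m - 1"] m3 by auto
  qed
  have X: "\<rho> \<in> R.X \<longleftrightarrow> \<rho> \<in> rep_space G \<and> (\<forall>k<m. trace (\<rho> (fr.cov.d k)) = w (puncture k))" for \<rho>
  proof -
    have "(\<forall>k<m. P k) \<longleftrightarrow> (\<forall>k<m - 1. P k) \<and> P (m - 1)" for P
      using m3 by (metis One_nat_def Suc_diff_Suc diff_less diff_zero less_Suc_eq less_trans zero_less_one numeral_3_eq_3 Suc_le_eq zero_less_Suc order_less_le_trans)
    note split = this[of "\<lambda>k. trace (\<rho> (fr.cov.d k)) = w (puncture k)"]
    show ?thesis unfolding R.X_def split using fr.cov.d_last_trace[of \<rho>] unfolding G_def by auto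
  qed
  have slice: "\<rho> \<in> R.X \<longleftrightarrow> \<rho> \<in> rep_space G \<and> (\<forall>i<m. \<forall>d\<in>peripheral m v x i. trace (\<rho> d) = w i)" for \<rho>
  proof
    assume r: "\<rho> \<in> R.X"
    then have rs: "\<rho> \<in> rep_space G" and t: "\<And>k. k < m ==> trace (\<rho> (fr.cov.d k)) = w (puncture k)" unfolding X by auto
    have "trace (\<rho> d) = w i" if "i < m" "d \<in> peripheral m v x i" for i d
      using fr.peripheral_trace[OF rs[unfolded G_def] that] t[OF fr.rank_less[OF that(1)]] puncture_rank[OF that(1)] by simp
    then show "\<rho> \<in> rep_space G \<and> (\<forall>i<m. \<forall>d\<in>peripheral m v x i. trace (\<rho> d) = w i)" using rs by blast
  next
    assume r: "\<rho> \<in> rep_space G \<and> (\<forall>i<m. \<forall>d\<in>peripheral m v x i. trace (\<rho> d) = w i)"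
    have "trace (\<rho> (fr.cov.d k)) = w (puncture k)" if "k < m" for k
      using fr.d_peripheral[OF rank(1)[OF that]] r rank[OF that] by auto
    then show "\<rho> \<in> R.X" unfolding X using r by blast
  qed
  have variety: "sliced_character_variety m v x w = character G ` R.X"
    unfolding sliced_character_variety_def Let_def G_def[symmetric] character_variety_def max_spec_def
    using slice character_maximal[OF grp] by auto
  obtain \<rho> where \<rho>: "\<rho> \<in> rep_space G" "irreducible_rep G \<rho>" "\<tau> = character G \<rho>" using irreducible by blast
  obtain \<rho>1 where \<rho>1: "\<rho>1 \<in> R.X" "\<tau> = character G \<rho>1" using point unfolding variety by blast
  have "trace (\<rho> (fr.cov.d k)) = w (puncture k)" if k: "k < m" for k
  proof -
    define f where "f = (\<lambda>\<rho> :: (real \<Rightarrow> real^3) set \<Rightarrow> mtx. trace (\<rho> (fr.cov.d k)) + (- w (puncture k)))"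
    \<comment> \<open>the trace condition is the vanishing of an invariant function, so it depends only on the character\<close>
    have dk: "fr.cov.d k \<in> carrier G" unfolding G_def by (rule fr.cov.d_carrier[OF k])
    have "invariant_fun G f" unfolding f_def
      by (rule invariant_add[OF invariant_trace[OF equivariant_apply[OF dk]] invariant_const])
    from invariant_restrict[OF grp this] have c: "restrict f (rep_space G) \<in> carrier (invariant_ring G)" .
    have "f \<rho>1 = 0" using \<rho>1(1) k unfolding X f_def by simp
    then have "restrict f (rep_space G) \<in> character G \<rho>1" using c \<rho>1(1) unfolding X character_def by simp
    then have "restrict f (rep_space G) \<in> character G \<rho>" using \<rho>(3) \<rho>1(2) by simp
    then show ?thesis using \<rho>(1) unfolding character_def f_def by simp
  qed
  then have "\<rho> \<in> R.X" unfolding X using \<rho>(1) by blast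
  from R.smooth_irreducible[OF this \<rho>(2)] show ?thesis unfolding variety \<rho>(3) .
qed

end
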